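(* Suppose that $r\in\mathbb N_0$, $1\le p\le\infty$, $\alpha,\beta\in J_p$ are such that $r/2+\alpha\ge0$ and $r/2+\beta\ge0$, and $f\in L_p^{\alpha,\beta}$. If $$\sum_{n=1}^\infty r n^{r-1}E_n(f)_{\alpha,\beta,p}<+\infty$$ (if $r=0$ this condition is vacuous), then $f\in\mathbb B_p^r(w_{\alpha,\beta})$, and for all $k\in\mathbb N$ and $N\in\mathbb N$, $$\omega_{k,r}^{\varphi}(f^{(r)},t)_{\alpha,\beta,p}\le c\sum_{n>\max\{N,1/t\}} r n^{r-1}E_n(f)_{\alpha,\beta,p}+c\,t^k\sum_{N\le n\le\max\{N,1/t\}} n^{k+r-1}E_n(f)_{\alpha,\beta,p}+c(N)\,t^kE_{k+r}(f)_{\alpha,\beta,p},\quad t>0.$$ In particular, if $N\le k+r$, then $$\omega_{k,r}^{\varphi}(f^{(r)},t)_{\alpha,\beta,p}\le c\sum_{n>\max\{N,1/t\}} r n^{r-1}E_n(f)_{\alpha,\beta,p}+c\,t^k\sum_{N\le n\le\max\{N,1/t\}} n^{k+r-1}E_n(f)_{\alpha,\beta,p},\quad t>0.$$ Here the sums are over integers $n$, the constants $c$ depend only on $k,r,p,\alpha,\beta$, and $c(N)$ depends only on $k,r,p,\alpha,\beta$ and $N$.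
   Context: $J_p=(-1/p,\infty)$ if $0<p<\infty$ and $J_\infty=[0,\infty)$. Jacobi weight: $w_{\alpha,\beta}(x)=(1-x)^\alpha(1+x)^\beta$. $\varphi(x)=\sqrt{1-x^2}$. $\|\cdot\|_p$ is the usual $L_p$ norm on $[-1,1]$ (essential supremum if $p=\infty$). $L_p^{\alpha,\beta}=\{f:\|w_{\alpha,\beta}f\|_p<\infty\}$ (functions on $[-1,1]$, identified if equal a.e.). $\mathbb P_n$ is the set of algebraic polynomials of degree not more than $n-1$, and $E_n(f)_{\alpha,\beta,p}=\inf_{p_n\in\mathbb P_n}\|w_{\alpha,\beta}(f-p_n)\|_p$ (also written $E_n(f)_{w_{\alpha,\beta},p}$). $\mathbb B_p^0(w_{\alpha,\beta})=L_p^{\alpha,\beta}$ and, for $r\ge1$, $\mathbb B_p^r(w_{\alpha,\beta})=\{f: f^{(r-1)}\in AC_{loc}(-1,1)\text{ and }\varphi^rf^{(r)}\in L_p^{\alpha,\beta}\}$, where $AC_{loc}(-1,1)$ is the set of functions locally absolutely continuous in $(-1,1)$. A function in $\mathbb B_p^r(w_{\alpha,\beta})$ is not distinguished from functions equal to it a.e. (so "$f\in\mathbb B_p^r(w_{\alpha,\beta})$" means that $f$ coincides a.e. with such a function). Symmetric difference: $\Delta_h^k(g,x)=\sum_{i=0}^k\binom ki(-1)^{k-i}g(x-\frac{kh}2+ih)$ if $[x-\frac{kh}2,x+\frac{kh}2]\subseteq[-1,1]$, and $\Delta_h^k(g,x)=0$ otherwise. $\mathcal W_\delta^{\xi,\zeta}(x)=(1-x-\delta\varphi(x)/2)^\xi(1+x-\delta\varphi(x)/2)^\zeta$.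 Modulus: for $k\in\mathbb N$, $r\in\mathbb N_0$, $f\in\mathbb B_p^r(w_{\alpha,\beta})$ and $t>0$, $$\omega_{k,r}^{\varphi}(f^{(r)},t)_{\alpha,\beta,p}=\sup_{0\le h\le t}\big\|\mathcal W_{kh}^{r/2+\alpha,r/2+\beta}(\cdot)\,\Delta_{h\varphi(\cdot)}^k(f^{(r)},\cdot)\big\|_p,$$ where the expression under the norm is understood to be $0$ at points $x$ where $\Delta^k_{h\varphi(x)}(f^{(r)},x)$ is set to $0$ because $[x-\frac{kh\varphi(x)}{2},x+\frac{kh\varphi(x)}{2}]\not\subseteq[-1,1]$. *)

theory Defs
  imports
    "HOL-Analysis.Analysis"
    "HOL-Computational_Algebra.Polynomial"
    "HOL-Probability.Essential_Supremum"
begin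

text \<open>
  Exponents \<open>p\<close> range over \<^typ>\<open>ennreal\<close>. Functions on [-1,1] are total functions on the reals
  whose values outside [-1,1] are never used, up to null sets. Norms, errors of approximation and
  moduli take values in \<^typ>\<open>ennreal\<close>, so that an inequality with finite right-hand side
  includes the assertion that the left-hand side is finite.
\<close>

definition J :: "ennreal \<Rightarrow> real set" where
  "J p = (if p = \<infinity> then {0..} else {- 1 / enn2real p <..})"

definition jacobi_weight :: "real \<Rightarrow> real \<Rightarrow> real \<Rightarrow> real" where
  "jacobi_weight \<alpha> \<beta> x = (1 - x) powr \<alpha> * (1 + x) powr \<beta>"

definition \<phi> :: "real \<Rightarrow> real" where
  "\<phi> x = sqrt (1 - x\<^sup>2)"

definition Lp_norm :: "ennreal \<Rightarrow> (real \<Rightarrow> real) \<Rightarrow> ennreal" where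
  "Lp_norm p f =
    (if p = \<infinity> then esssup (lebesgue_on {-1..1}) (\<lambda>x. ennreal \<bar>f x\<bar>)
     else let I = (\<integral>\<^sup>+ x. ennreal (\<bar>f x\<bar> powr enn2real p) \<partial>lebesgue_on {-1..1})
          in if I = \<infinity> then \<infinity> else ennreal (enn2real I powr (1 / enn2real p)))"

definition Lp_space :: "ennreal \<Rightarrow> real \<Rightarrow> real \<Rightarrow> (real \<Rightarrow> real) set" where
  "Lp_space p \<alpha> \<beta> =
    {f \<in> borel_measurable (lebesgue_on {-1..1}). Lp_norm p (\<lambda>x. jacobi_weight \<alpha> \<beta> x * f x) < \<infinity>}"

text \<open>
  The infimum is over polynomials of degree at most \<open>n - 1\<close>. Since the zero polynomial has
  \<^const>\<open>degree\<close> 0, the bound is written as below; for \<open>n = 0\<close> only the zero polynomial remains.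
\<close>

definition best_approx :: "nat \<Rightarrow> (real \<Rightarrow> real) \<Rightarrow> real \<Rightarrow> real \<Rightarrow> ennreal \<Rightarrow> ennreal" where
  "best_approx n f \<alpha> \<beta> p =
    (INF q \<in> {q :: real poly. q = 0 \<or> degree q < n}.
       Lp_norm p (\<lambda>x. jacobi_weight \<alpha> \<beta> x * (f x - poly q x)))"

definition abs_cont_on :: "real \<Rightarrow> real \<Rightarrow> (real \<Rightarrow> real) \<Rightarrow> bool" where
  "abs_cont_on a b g \<longleftrightarrow>
    (\<forall>\<epsilon>>0. \<exists>\<delta>>0. \<forall>S :: (real \<times> real) set.
       finite S \<longrightarrow>
       (\<forall>(u, v) \<in> S. a \<le> u \<and> u < v \<and> v \<le> b) \<longrightarrow>
       disjoint_family_on (\<lambda>(u, v). {u<..<v}) S \<longrightarrow>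
       (\<Sum>(u, v)\<in>S. v - u) < \<delta> \<longrightarrow>
       (\<Sum>(u, v)\<in>S. \<bar>g v - g u\<bar>) < \<epsilon>)"

definition AC_loc :: "(real \<Rightarrow> real) \<Rightarrow> bool" where
  "AC_loc g \<longleftrightarrow> (\<forall>a b. -1 < a \<longrightarrow> a < b \<longrightarrow> b < 1 \<longrightarrow> abs_cont_on a b g)"

text \<open>
  Members of \<open>B_strict\<close> have pointwise derivatives up to order \<open>r - 1\<close> in (-1,1); their \<open>r\<close>-th
  derivative exists almost everywhere there because the previous one is locally absolutely
  continuous. The value of \<^const>\<open>deriv\<close> at the remaining points is irrelevant.
\<close>

definition B_strict :: "nat \<Rightarrow> ennreal \<Rightarrow> real \<Rightarrow> real \<Rightarrow> (real \<Rightarrow> real) set" where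
  "B_strict r p \<alpha> \<beta> =
    (if r = 0 then Lp_space p \<alpha> \<beta>
     else {g. (\<forall>j < r - 1. \<forall>x \<in> {-1<..<1}. (deriv ^^ j) g field_differentiable (at x)) \<and>
              AC_loc ((deriv ^^ (r - 1)) g) \<and>
              (\<lambda>x. \<phi> x ^ r * (deriv ^^ r) g x) \<in> Lp_space p \<alpha> \<beta>})"

text \<open>
  Functions equal almost everywhere are not distinguished. The \<open>r\<close>-th derivative of \<open>f\<close> is
  \<open>(deriv ^^ r) g\<close> for any representative \<open>g\<close>; it is determined up to a null set.
\<close>

definition B_reps :: "nat \<Rightarrow> ennreal \<Rightarrow> real \<Rightarrow> real \<Rightarrow> (real \<Rightarrow> real) \<Rightarrow> (real \<Rightarrow> real) set" where
  "B_reps r p \<alpha> \<beta> f = {g \<in> B_strict r p \<alpha> \<beta>. AE x in lebesgue_on {-1..1}. g x = f x}"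

definition B_space :: "nat \<Rightarrow> ennreal \<Rightarrow> real \<Rightarrow> real \<Rightarrow> (real \<Rightarrow> real) set" where
  "B_space r p \<alpha> \<beta> = {f. B_reps r p \<alpha> \<beta> f \<noteq> {}}"

definition sym_diff :: "nat \<Rightarrow> real \<Rightarrow> (real \<Rightarrow> real) \<Rightarrow> real \<Rightarrow> real" where
  "sym_diff k h g x =
    (if {x - real k * h / 2 .. x + real k * h / 2} \<subseteq> {-1..1}
     then \<Sum>i\<le>k. real (k choose i) * (-1) ^ (k - i) * g (x - real k * h / 2 + real i * h)
     else 0)"

definition \<W> :: "real \<Rightarrow> real \<Rightarrow> real \<Rightarrow> real \<Rightarrow> real" where
  "\<W> \<delta> \<xi> \<zeta> x = (1 - x - \<delta> * \<phi> x / 2) powr \<xi> * (1 + x - \<delta> * \<phi> x / 2) powr \<zeta>"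

text \<open>
  The argument \<open>F\<close> stands for the \<open>r\<close>-th derivative. Where the weight would have a negative base,
  the difference, and hence the product, is 0.
\<close>

definition modulus ::
  "nat \<Rightarrow> nat \<Rightarrow> (real \<Rightarrow> real) \<Rightarrow> real \<Rightarrow> real \<Rightarrow> real \<Rightarrow> ennreal \<Rightarrow> ennreal" where
  "modulus k r F t \<alpha> \<beta> p =
    (SUP h \<in> {0..t}.
       Lp_norm p (\<lambda>x. \<W> (real k * h) (real r / 2 + \<alpha>) (real r / 2 + \<beta>) x
                        * sym_diff k (h * \<phi> x) F x))"

end

theory Submission
  imports Defs "HOL-Complex_Analysis.Complex_Analysis"
begin

text \<open>
  Let \<open>P\<close> be a polynomial of degree less than \<open>n\<close>. Lifting \<open>P\<close> to the unit circle by
  \<open>x = (\<zeta> + 1/\<zeta>)/2\<close> and interpolating at roots of unity, with a power of a Dirichlet kernel as a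
  localizing factor, bounds \<open>|P|\<close> on the complex disc with centre \<open>x\<close> and radius a small multiple of
  \<open>\<phi>(x)/n\<close> by a rapidly decaying sum of values of \<open>|P|\<close> at the nodes. Averaging over rotations of the
  nodes shows that the supremum of \<open>|P|\<close> over these discs is bounded in the weighted norm by \<open>P\<close>
  itself. Cauchy's estimates on the discs then give the weighted Bernstein inequality and control the
  symmetric differences of \<open>P\<^sup>(\<^sup>r\<^sup>)\<close> for small steps. For arbitrary functions the substitution
  \<open>x \<mapsto> x + s \<phi>(x)\<close> bounds the modulus by the weighted norm of \<open>\<phi>\<^sup>r f\<^sup>(\<^sup>r\<^sup>)\<close>.

  A dyadic chain of near-best approximants telescopes to \<open>f\<close>. By Bernstein's inequality the
  \<open>r\<close>-th derivatives converge in the weighted norm, and the maximal function permits differentiating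
  the last step of the limit almost everywhere. The modulus is estimated by splitting \<open>f\<close> at the
  member of the chain whose degree is about \<open>1/t\<close>.
\<close>

section \<open>The weighted norms\<close>

text \<open>The obstacle is that \<alpha> and \<beta> may be negative, so that the weight is
  unbounded at the endpoints, where the step h \<phi>(x) degenerates too. \<open>J p\<close> is
  exactly the range in which the weight itself lies in L_p, and this is all that the local maximal
  estimate uses. The conditions on r/2 + \<alpha> and r/2 + \<beta> enter through differences only:
  with nonnegative exponents the shrunken weight \<open>\<W>\<close> is at most the Jacobi weight at
  every node of the difference.

  The other point is how the constants depend on N. The degrees of the chain are N 2^i, and each
  dyadic term is charged to the block of integers just below it, at a price independent of N. Only
  the term at N itself has no such block. The k-th difference of an r-th derivative annihilates
  degrees below k + r; hence the first polynomial of the chain, of degree below N, may be replaced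
  by its difference from one of degree below k + r. If N \<le> k + r nothing remains of it, and
  otherwise E_(k+r)(f) measures what is left, which is the origin of c(N).\<close>

lemma convex_on_powr_nonneg:
  assumes "q \<ge> (1::real)"
  shows "convex_on {0..} (\<lambda>x. x powr q)"
proof (rule convex_onI)
  fix t x y :: real
  assume t: "0 < t" "t < 1" and xy: "x \<in> {0..}" "y \<in> {0..}"
  \<comment> \<open>If one of the two points is 0, convexity reduces to s^q \<le> s for 0 < s <
    1.\<close>
  have tq: "s powr q * z \<le> s * z" if "0 < s" "s < 1" "z \<ge> 0" for s z :: real
  proof -
    have "s powr q \<le> s powr 1"
      using that assms by (intro powr_mono') auto
    then show ?thesis using that by (simp add: mult_right_mono)
  qed
  consider "x = 0" | "y = 0" | "x > 0" "y > 0" using xy by force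
  then show "((1 - t) *\<^sub>R x + t *\<^sub>R y) powr q \<le> (1 - t) * x powr q + t * y powr q"
  proof cases
    case 1
    then show ?thesis using t xy tq[of t "y powr q"] by (simp add: powr_mult)
  next
    case 2
    then show ?thesis using t xy tq[of "1 - t" "x powr q"] by (simp add: powr_mult)
  next
    case 3
    then show ?thesis
      using convex_onD[OF powr_convex[OF assms], of t x y] t by simp
  qed
qed simp

text \<open>Jensen's inequality for x^q with the weights l i / (sum of l), multiplied out. Leaving
  the weights unnormalized suits both uses: norms as weights in Minkowski's inequality, and
  interpolation coefficients of which only the sum is controlled.\<close>

lemma sum_powr_le_weighted:
  fixes l y :: "'a \<Rightarrow> real"
  assumes "q \<ge> 1" and "finite S" and l: "\<And>i. i \<in> S \<Longrightarrow> l i \<ge> 0" and y: "\<And>i. i \<in> S \<Longrightarrow> y i \<ge> 0"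
  shows "(\<Sum>i\<in>S. l i * y i) powr q \<le> (\<Sum>i\<in>S. l i) powr (q - 1) * (\<Sum>i\<in>S. l i * y i powr q)"
proof (cases "(\<Sum>i\<in>S. l i) = 0")
  case True
  then have "\<forall>i\<in>S. l i = 0"
    using l assms(2) by (simp add: sum_nonneg_eq_0_iff)
  then show ?thesis by simp
next
  case False
  define \<Lambda> where "\<Lambda> = (\<Sum>i\<in>S. l i)"
  have \<Lambda>: "\<Lambda> > 0" using False l unfolding \<Lambda>_def by (simp add: order_less_le sum_nonneg)
  have "S \<noteq> {}" using False by auto
  have "(\<Sum>i\<in>S. (l i / \<Lambda>) *\<^sub>R y i) powr q \<le> (\<Sum>i\<in>S. (l i / \<Lambda>) * y i powr q)"
  proof (rule convex_on_sum[OF \<open>finite S\<close> \<open>S \<noteq> {}\<close> convex_on_powr_nonneg[OF assms(1)]])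
    show "(\<Sum>i\<in>S. l i / \<Lambda>) = 1"
      using \<Lambda> by (simp add: sum_divide_distrib[symmetric] \<Lambda>_def)
  qed (use l y \<Lambda> in auto)
  moreover have "(\<Sum>i\<in>S. (l i / \<Lambda>) *\<^sub>R y i) = (\<Sum>i\<in>S. l i * y i) / \<Lambda>"
    by (simp add: sum_divide_distrib)
  moreover have "(\<Sum>i\<in>S. (l i / \<Lambda>) * y i powr q) = (\<Sum>i\<in>S. l i * y i powr q) / \<Lambda>"
    by (simp add: sum_divide_distrib)
  ultimately have "((\<Sum>i\<in>S. l i * y i) / \<Lambda>) powr q \<le> (\<Sum>i\<in>S. l i * y i powr q) / \<Lambda>" by simp
  then have "(\<Sum>i\<in>S. l i * y i) powr q / \<Lambda> powr q \<le> (\<Sum>i\<in>S. l i * y i powr q) / \<Lambda>"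
    using \<Lambda> l y by (subst (asm) powr_divide) (auto intro!: sum_nonneg)
  then have "(\<Sum>i\<in>S. l i * y i) powr q \<le> (\<Lambda> powr q / \<Lambda>) * (\<Sum>i\<in>S. l i * y i powr q)"
    using \<Lambda> by (simp add: field_simps)
  moreover have "\<Lambda> powr q / \<Lambda> = \<Lambda> powr (q - 1)"
    using \<Lambda> by (simp add: powr_diff)
  ultimately show ?thesis unfolding \<Lambda>_def[symmetric] by simp
qed

section \<open>The L_p norms on [-1,1] and Minkowski's inequality for countable sums\<close>

abbreviation leb1 :: "real measure" where
  "leb1 \<equiv> lebesgue_on {-1..1}"

lemma enn2real_exponent_ge_1:
  assumes "1 \<le> p" "p \<noteq> (\<infinity>::ennreal)"
  shows "1 \<le> enn2real p"
  by (metis assms enn2real_1 enn2real_mono infinity_ennreal_def top.not_eq_extremum)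

text \<open>Taking q-th powers turns a norm bound into a bound for an integral, to which Fubini's
  theorem and substitution apply. The infinite integral is treated apart because
  \<open>Lp_norm\<close> is defined by cases there.\<close>

lemma Lp_norm_le_iff:
  assumes "1 \<le> p" "p \<noteq> \<infinity>" "C \<ge> 0"
  shows "Lp_norm p f \<le> ennreal C \<longleftrightarrow>
    (\<integral>\<^sup>+ x. ennreal (\<bar>f x\<bar> powr enn2real p) \<partial>leb1) \<le> ennreal (C powr enn2real p)"
proof -
  define q where "q = enn2real p"
  define I where "I = (\<integral>\<^sup>+ x. ennreal (\<bar>f x\<bar> powr q) \<partial>leb1)"
  have q: "q \<ge> 1" unfolding q_def by (rule enn2real_exponent_ge_1[OF assms(1,2)])
  show ?thesis
  proof (cases "I = \<infinity>")
    case True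
    then show ?thesis
      using assms by (simp add: Lp_norm_def I_def[symmetric] q_def[symmetric] top_unique)
  next
    case False
    then obtain i where i: "I = ennreal i" "i \<ge> 0" by (cases I) auto
    have "i powr (1 / q) \<le> C \<longleftrightarrow> i \<le> C powr q"
    proof
      assume "i powr (1 / q) \<le> C"
      then have "(i powr (1 / q)) powr q \<le> C powr q"
        using q by (intro powr_mono2) auto
      then show "i \<le> C powr q" using q i by (simp add: powr_powr)
    next
      assume "i \<le> C powr q"
      then have "i powr (1/q) \<le> (C powr q) powr (1/q)"
        using q i by (intro powr_mono2) auto
      then show "i powr (1 / q) \<le> C" using q assms by (simp add: powr_powr)
    qed
    moreover have "Lp_norm p f = ennreal (i powr (1/q))"
      using assms(2) False i by (simp add: Lp_norm_def I_def[symmetric] q_def[symmetric])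
    ultimately show ?thesis
      using assms i unfolding I_def[symmetric] q_def[symmetric] by simp
  qed
qed

lemma Lp_norm_mono_AE:
  assumes "1 \<le> p" and f: "f \<in> borel_measurable leb1"
    and le: "AE x in leb1. \<bar>f x\<bar> \<le> \<bar>g x\<bar>"
  shows "Lp_norm p f \<le> Lp_norm p g"
proof (cases "p = \<infinity>")
  case True
  have "esssup leb1 (\<lambda>x. ennreal \<bar>f x\<bar>) \<le> esssup leb1 (\<lambda>x. ennreal \<bar>g x\<bar>)"
    using f le by (intro esssup_AE_mono) (auto elim!: eventually_mono)
  then show ?thesis by (simp add: Lp_norm_def True)
next
  case False
  show ?thesis
  proof (cases "Lp_norm p g")
    case (real C)
    have "(\<integral>\<^sup>+ x. ennreal (\<bar>f x\<bar> powr enn2real p) \<partial>leb1) \<le> (\<integral>\<^sup>+ x. ennreal (\<bar>g x\<bar> powr enn2real p) \<partial>leb1)"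
      using le by (intro nn_integral_mono_AE)
        (auto elim!: eventually_mono intro!: ennreal_leI powr_mono2)
    also have "\<dots> \<le> ennreal (C powr enn2real p)"
      using real Lp_norm_le_iff[OF assms(1) False, of C g] by simp
    finally show ?thesis
      using real Lp_norm_le_iff[OF assms(1) False, of C f] by simp
  qed simp
qed

lemma Lp_norm_cong_AE:
  assumes "1 \<le> p" "f \<in> borel_measurable leb1" "g \<in> borel_measurable leb1"
    and "AE x in leb1. f x = g x"
  shows "Lp_norm p f = Lp_norm p g"
  using assms by (intro antisym Lp_norm_mono_AE) (auto elim!: eventually_mono)

lemma Lp_norm_infinity_le:
  assumes "f \<in> borel_measurable leb1" "AE x in leb1. \<bar>f x\<bar> \<le> C"
  shows "Lp_norm \<infinity> f \<le> ennreal C"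
  using assms by (auto simp: Lp_norm_def intro!: esssup_I elim!: eventually_mono ennreal_leI)

lemma Lp_norm_infinity_AE:
  "AE x in leb1. ennreal \<bar>f x\<bar> \<le> Lp_norm \<infinity> f"
  using esssup_AE[of "\<lambda>x. ennreal \<bar>f x\<bar>" leb1] by (simp add: Lp_norm_def)

text \<open>Every z below y^q lies below some (U n)^q, because its q-th root lies below y. Arguing
  from below admits an infinite supremum.\<close>

lemma ennreal_powr_le_SUP:
  fixes y :: real and U :: "nat \<Rightarrow> real"
  assumes q: "q \<ge> 1" and y: "y \<ge> 0" and U: "\<And>n. U n \<ge> 0"
    and le: "ennreal y \<le> (SUP n. ennreal (U n))"
  shows "ennreal (y powr q) \<le> (SUP n. ennreal (U n powr q))"
proof (rule dense_le)
  fix z assume z: "z < ennreal (y powr q)"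
  then obtain s where s: "z = ennreal s" "s \<ge> 0" by (cases z) auto
  then have sy: "s < y powr q" using z by (simp add: ennreal_less_iff)
  have "s powr (1/q) < (y powr q) powr (1/q)"
    using q s sy by (intro powr_less_mono2) auto
  then have "s powr (1/q) < y" using q y by (simp add: powr_powr)
  then have "ennreal (s powr (1/q)) < (SUP n. ennreal (U n))"
    using le by (metis ennreal_less_iff order_less_le_trans powr_ge_zero)
  then obtain n where "ennreal (s powr (1/q)) < ennreal (U n)" by (auto simp: less_SUP_iff)
  then have "s powr (1/q) < U n" by (simp add: ennreal_less_iff)
  then have "(s powr (1/q)) powr q \<le> U n powr q"
    using q by (intro powr_mono2) auto
  then have "s \<le> U n powr q" using q s by (simp add: powr_powr)
  then show "z \<le> (SUP n. ennreal (U n powr q))"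
    using s by (auto intro!: SUP_upper2[of n])
qed

text \<open>Minkowski's inequality for countably many terms. Domination almost everywhere replaces
  equality, so that no convergence has to be shown before it is applied. For finite p it is Jensen's
  inequality with weights close to the norms, followed by monotone convergence of the partial
  sums.\<close>

lemma Lp_norm_countable_triangle:
  fixes u :: "nat \<Rightarrow> real \<Rightarrow> real"
  assumes p: "1 \<le> p" and f: "f \<in> borel_measurable leb1"
    and u: "\<And>i. u i \<in> borel_measurable leb1"
    and le: "AE x in leb1. ennreal \<bar>f x\<bar> \<le> (\<Sum>i. ennreal \<bar>u i x\<bar>)"
  shows "Lp_norm p f \<le> (\<Sum>i. Lp_norm p (u i))"
proof (cases "p = \<infinity>")
  case True
  have "AE x in leb1. \<forall>i. ennreal \<bar>u i x\<bar> \<le> Lp_norm \<infinity> (u i)"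
    unfolding AE_all_countable by (intro allI Lp_norm_infinity_AE)
  with le have "AE x in leb1. ennreal \<bar>f x\<bar> \<le> (\<Sum>i. Lp_norm \<infinity> (u i))"
  proof eventually_elim
    case (elim x)
    have "(\<Sum>i. ennreal \<bar>u i x\<bar>) \<le> (\<Sum>i. Lp_norm \<infinity> (u i))"
      using elim by (intro suminf_le) auto
    then show ?case using elim(1) order_trans by blast
  qed
  then show ?thesis
    unfolding True using f by (subst Lp_norm_def) (auto intro!: esssup_I)
next
  case False
  define q where "q = enn2real p"
  have q: "q \<ge> 1" unfolding q_def by (rule enn2real_exponent_ge_1[OF p False])
  show ?thesis
  proof (rule ennreal_le_epsilon)
    fix e :: real assume fin: "(\<Sum>i. Lp_norm p (u i)) < top" and e: "0 < e"
    \<comment> \<open>The norms serve as weights and are divided by, but may vanish; adding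
      e/2^(i+1) makes them positive and raises their sum by e only.\<close>
    define a where "a = (\<lambda>i. enn2real (Lp_norm p (u i)) + e * (1/2)^(Suc i))"
    have "Lp_norm p (u i) < top" for i
      using fin by (metis ennreal_suminf_lessD infinity_ennreal_def)
    then have aL: "Lp_norm p (u i) \<le> ennreal (a i)" for i
    proof -
      have "Lp_norm p (u i) = ennreal (enn2real (Lp_norm p (u i)))"
        using \<open>Lp_norm p (u i) < top\<close> by simp
      also have "\<dots> \<le> ennreal (a i)" using e by (intro ennreal_leI) (simp add: a_def)
      finally show ?thesis .
    qed
    have apos: "a i > 0" for i using e by (auto simp: a_def intro!: add_nonneg_pos)
    have I: "(\<integral>\<^sup>+ x. ennreal (\<bar>u i x\<bar> powr q) \<partial>leb1) \<le> ennreal (a i powr q)" for i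
      using aL[of i] apos[of i] Lp_norm_le_iff[OF p False, of "a i" "u i"] by (simp add: q_def)
    define S where "S = (\<Sum>i. Lp_norm p (u i)) + ennreal e"
    have "(\<Sum>i. ennreal (a i)) \<le> S"
    proof -
      have "ennreal (a i) = Lp_norm p (u i) + ennreal e * ennreal ((1/2)^(Suc i))" for i
        using \<open>\<And>i. Lp_norm p (u i) < top\<close>[of i] e
        unfolding a_def by (subst ennreal_plus) (auto simp: ennreal_mult'[symmetric])
      then have "(\<Sum>i. ennreal (a i)) = (\<Sum>i. Lp_norm p (u i)) + (\<Sum>i. ennreal e * ennreal ((1/2)^(Suc i)))"
        by (simp add: suminf_add[symmetric])
      also have "(\<Sum>i. ennreal e * ennreal ((1/2)^(Suc i))) = ennreal e * ennreal (\<Sum>i. (1/2)^(Suc i))"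
        by (subst ennreal_suminf_cmult, subst suminf_ennreal2) 
           (use power_half_series in \<open>auto simp: sums_iff\<close>)
      also have "(\<Sum>i. (1/2)^(Suc i)) = (1::real)"
        using power_half_series by (simp add: sums_iff)
      finally show ?thesis by (simp add: S_def)
    qed
    have "S < top" using fin by (simp add: S_def)
    then obtain s where s: "S = ennreal s" "s \<ge> 0" by (cases S) auto
    have as: "(\<Sum>i<n. a i) \<le> s" for n
    proof -
      have "ennreal (\<Sum>i<n. a i) = (\<Sum>i<n. ennreal (a i))"
        using apos by (subst sum_ennreal) (auto intro: less_imp_le)
      also have "\<dots> \<le> S" using \<open>(\<Sum>i. ennreal (a i)) \<le> S\<close>
        by (meson order_trans sum_le_suminf summableI finite_lessThan zero_le)
      finally show ?thesis using s by simp
    qed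
    define U where "U = (\<lambda>n x. \<Sum>i<n. \<bar>u i x\<bar>)"
    have U0: "U n x \<ge> 0" for n x by (auto simp: U_def sum_nonneg)
    have IU: "(\<integral>\<^sup>+ x. ennreal (U n x powr q) \<partial>leb1) \<le> ennreal (s powr q)" for n
    proof -
      define A where "A = (\<Sum>i<n. a i)"
      have A0: "A \<ge> 0" using apos unfolding A_def by (intro sum_nonneg) (auto intro: less_imp_le)
      \<comment> \<open>Jensen with the weights a i. Since the integral of |u i|^q is at most (a
        i)^q, the i-th term integrates to at most a i, and the whole to A^(q-1) A = A^q.\<close>
      have "U n x powr q \<le> A powr (q - 1) * (\<Sum>i<n. a i powr (1 - q) * \<bar>u i x\<bar> powr q)" for x
      proof -
        have "U n x powr q = (\<Sum>i<n. a i * (\<bar>u i x\<bar> / a i)) powr q"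
          using apos by (simp add: U_def less_imp_neq[symmetric])
        also have "\<dots> \<le> A powr (q - 1) * (\<Sum>i<n. a i * (\<bar>u i x\<bar> / a i) powr q)"
          unfolding A_def using apos less_imp_le[OF apos] by (intro sum_powr_le_weighted[OF q]) auto
        also have "(\<Sum>i<n. a i * (\<bar>u i x\<bar> / a i) powr q) = (\<Sum>i<n. a i powr (1 - q) * \<bar>u i x\<bar> powr q)"
          using apos less_imp_le[OF apos] by (intro sum.cong) (auto simp: powr_divide powr_diff less_imp_neq[symmetric])
        finally show ?thesis .
      qed
      then have "(\<integral>\<^sup>+ x. ennreal (U n x powr q) \<partial>leb1) \<le>
         (\<integral>\<^sup>+ x. ennreal (A powr (q - 1)) * (\<Sum>i<n. ennreal (a i powr (1 - q)) * ennreal (\<bar>u i x\<bar> powr q)) \<partial>leb1)"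
        by (intro nn_integral_mono) (auto simp: ennreal_mult[symmetric] sum_nonneg intro!: ennreal_leI)
      also have "\<dots> = ennreal (A powr (q - 1)) * (\<Sum>i<n. ennreal (a i powr (1 - q)) * (\<integral>\<^sup>+ x. ennreal (\<bar>u i x\<bar> powr q) \<partial>leb1))"
        using u by (simp add: nn_integral_cmult nn_integral_sum)
      also have "\<dots> \<le> ennreal (A powr (q - 1)) * (\<Sum>i<n. ennreal (a i powr (1 - q)) * ennreal (a i powr q))"
        by (intro mult_left_mono sum_mono I) auto
      also have "(\<Sum>i<n. ennreal (a i powr (1 - q)) * ennreal (a i powr q)) = ennreal A"
        unfolding A_def using apos less_imp_le[OF apos]
        by (subst sum_ennreal[symmetric]) (auto simp: ennreal_mult[symmetric] powr_add[symmetric])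
      also have "ennreal (A powr (q - 1)) * ennreal A = ennreal (A powr q)"
        using A0 q by (cases "A = 0") (auto simp: ennreal_mult[symmetric] powr_diff)
      also have "\<dots> \<le> ennreal (s powr q)"
        using as[of n] A0 q by (intro ennreal_leI powr_mono2) (auto simp: A_def)
      finally show ?thesis .
    qed
    have "(\<integral>\<^sup>+ x. ennreal (\<bar>f x\<bar> powr q) \<partial>leb1) \<le> (\<integral>\<^sup>+ x. (SUP n. ennreal (U n x powr q)) \<partial>leb1)"
    proof (rule nn_integral_mono_AE)
      show "AE x in leb1. ennreal (\<bar>f x\<bar> powr q) \<le> (SUP n. ennreal (U n x powr q))"
        using le
      proof eventually_elim
        case (elim x)
        have "(\<Sum>i. ennreal \<bar>u i x\<bar>) = (SUP n. ennreal (U n x))"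
          by (subst suminf_eq_SUP) (auto simp: U_def sum_ennreal)
        then show ?case
          using elim q by (intro ennreal_powr_le_SUP U0) auto
      qed
    qed
    also have "\<dots> = (SUP n. \<integral>\<^sup>+ x. ennreal (U n x powr q) \<partial>leb1)"
    proof (rule nn_integral_monotone_convergence_SUP)
      show "incseq (\<lambda>n x. ennreal (U n x powr q))"
        using q U0 by (auto simp: incseq_def le_fun_def U_def intro!: ennreal_leI powr_mono2 sum_mono2 sum_nonneg)
      show "(\<lambda>x. ennreal (U n x powr q)) \<in> borel_measurable leb1" for n
        unfolding U_def using u by measurable
    qed
    also have "\<dots> \<le> ennreal (s powr q)" by (intro SUP_least IU)
    finally show "Lp_norm p f \<le> (\<Sum>i. Lp_norm p (u i)) + ennreal e"
      using Lp_norm_le_iff[OF p False s(2), of f] s by (simp add: q_def S_def)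
  qed
qed

lemma Lp_norm_zero: "1 \<le> p \<Longrightarrow> Lp_norm p (\<lambda>x. 0) = 0"
proof (cases "p = \<infinity>")
  case True
  have "Lp_norm \<infinity> (\<lambda>x. 0) \<le> ennreal 0" by (rule Lp_norm_infinity_le) auto
  then show ?thesis by (simp add: True)
qed (simp add: Lp_norm_def)

lemma Lp_norm_sum:
  assumes p: "1 \<le> p" and "finite A" and f: "f \<in> borel_measurable leb1"
    and u: "\<And>i. i \<in> A \<Longrightarrow> u i \<in> borel_measurable leb1"
    and le: "AE x in leb1. \<bar>f x\<bar> \<le> (\<Sum>i\<in>A. \<bar>u i x\<bar>)"
  shows "Lp_norm p f \<le> (\<Sum>i\<in>A. Lp_norm p (u i))"
proof -
  obtain h where h: "bij_betw h {0..<card A} A" using ex_bij_betw_nat_finite[OF \<open>finite A\<close>] by blast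
  define v where "v = (\<lambda>i. if i < card A then u (h i) else (\<lambda>x. 0))"
  have vm: "v i \<in> borel_measurable leb1" for i
    unfolding v_def using u bij_betwE[OF h] by auto
  have hsum: "(\<Sum>i\<in>A. F (u i)) = (\<Sum>i. F (v i))" if "F (\<lambda>x. 0) = 0" for F :: "_ \<Rightarrow> ennreal"
  proof -
    have "(\<Sum>i. F (v i)) = (\<Sum>i\<in>{0..<card A}. F (v i))"
      using that by (intro suminf_finite) (auto simp: v_def)
    also have "\<dots> = (\<Sum>i\<in>{0..<card A}. F (u (h i)))" by (intro sum.cong) (auto simp: v_def)
    also have "\<dots> = (\<Sum>i\<in>A. F (u i))" by (rule sum.reindex_bij_betw[OF h])
    finally show ?thesis by simp
  qed
  have "Lp_norm p f \<le> (\<Sum>i. Lp_norm p (v i))"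
  proof (rule Lp_norm_countable_triangle[OF p f vm])
    show "AE x in leb1. ennreal \<bar>f x\<bar> \<le> (\<Sum>i. ennreal \<bar>v i x\<bar>)"
      using le
    proof eventually_elim
      case (elim x)
      have "ennreal (\<Sum>i\<in>A. \<bar>u i x\<bar>) = (\<Sum>i. ennreal \<bar>v i x\<bar>)"
      proof -
        have "(\<Sum>i\<in>A. ennreal \<bar>u i x\<bar>) = (\<Sum>i. ennreal \<bar>v i x\<bar>)"
          by (rule hsum) simp
        then show ?thesis by (subst (asm) sum_ennreal) auto
      qed
      then show ?case using ennreal_leI[OF elim] by (rule subst)
    qed
  qed
  then show ?thesis using hsum[of "Lp_norm p"] Lp_norm_zero[OF p] by simp
qed

lemma Lp_norm_triangle:
  assumes p: "1 \<le> p" and m: "f \<in> borel_measurable leb1" "g \<in> borel_measurable leb1" "h \<in> borel_measurable leb1"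
    and le: "AE x in leb1. \<bar>f x\<bar> \<le> \<bar>g x\<bar> + \<bar>h x\<bar>"
  shows "Lp_norm p f \<le> Lp_norm p g + Lp_norm p h"
proof -
  have "Lp_norm p f \<le> (\<Sum>i\<in>{True, False}. Lp_norm p ((\<lambda>b. if b then g else h) i))"
    using m le by (intro Lp_norm_sum[OF p]) auto
  then show ?thesis by simp
qed

lemma Lp_norm_cmult_le:
  assumes p: "1 \<le> p" and f: "f \<in> borel_measurable leb1" and g: "g \<in> borel_measurable leb1" and c: "c \<ge> 0"
    and le: "AE x in leb1. \<bar>f x\<bar> \<le> c * \<bar>g x\<bar>"
  shows "Lp_norm p f \<le> ennreal c * Lp_norm p g"
proof (cases "c = 0")
  case True
  then have "Lp_norm p f \<le> Lp_norm p (\<lambda>x. 0)" using le by (intro Lp_norm_mono_AE[OF p f]) auto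
  then show ?thesis using Lp_norm_zero[OF p] by simp
next
  case False
  then have c: "c > 0" using c by simp
  show ?thesis
  proof (cases "Lp_norm p g")
    case (real C)
    show ?thesis
    proof (cases "p = \<infinity>")
      case True
      have "AE x in leb1. ennreal \<bar>g x\<bar> \<le> ennreal C"
        using Lp_norm_infinity_AE[of g] real by (simp add: True)
      with le have "AE x in leb1. \<bar>f x\<bar> \<le> c * C"
      proof eventually_elim
        case (elim x)
        then have "\<bar>g x\<bar> \<le> C" using real by (simp add: ennreal_le_iff)
        then have "c * \<bar>g x\<bar> \<le> c * C" using c by simp
        then show ?case using elim by linarith
      qed
      then have "Lp_norm \<infinity> f \<le> ennreal (c * C)" by (rule Lp_norm_infinity_le[OF f])
      then show ?thesis using real c by (simp add: True ennreal_mult)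
    next
      case False
      define q where "q = enn2real p"
      have "(\<integral>\<^sup>+ x. ennreal (\<bar>f x\<bar> powr q) \<partial>leb1) \<le> (\<integral>\<^sup>+ x. ennreal (c powr q) * ennreal (\<bar>g x\<bar> powr q) \<partial>leb1)"
      proof (rule nn_integral_mono_AE)
        have q: "q \<ge> 1" unfolding q_def by (rule enn2real_exponent_ge_1[OF p False])
        show "AE x in leb1. ennreal (\<bar>f x\<bar> powr q) \<le> ennreal (c powr q) * ennreal (\<bar>g x\<bar> powr q)"
          using le
        proof eventually_elim
          case (elim x)
          then have "\<bar>f x\<bar> powr q \<le> (c * \<bar>g x\<bar>) powr q" using q by (intro powr_mono2) auto
          also have "\<dots> = c powr q * \<bar>g x\<bar> powr q" using c by (intro powr_mult)
          finally show ?case by (metis ennreal_leI ennreal_mult' powr_ge_zero)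
        qed
      qed
      also have "\<dots> = ennreal (c powr q) * (\<integral>\<^sup>+ x. ennreal (\<bar>g x\<bar> powr q) \<partial>leb1)"
        using g by (intro nn_integral_cmult) measurable
      also have "\<dots> \<le> ennreal (c powr q) * ennreal (C powr q)"
        using real Lp_norm_le_iff[OF p False, of C g] by (intro mult_left_mono) (auto simp: q_def)
      also have "\<dots> = ennreal ((c * C) powr q)"
        using real c by (simp add: ennreal_mult[symmetric] powr_mult)
      finally have "Lp_norm p f \<le> ennreal (c * C)"
        using Lp_norm_le_iff[OF p False, of "c * C" f] real c by (simp add: q_def)
      then show ?thesis using real c by (simp add: ennreal_mult)
    qed
  next
    case top
    then show ?thesis using c by (simp add: ennreal_mult_top)
  qed
qed

section \<open>Localized interpolation at roots of unity\<close>

text \<open>Jordan's inequality: a concave function lies above its chord.\<close>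

lemma sin_ge_two_over_pi:
  assumes "0 \<le> x" "x \<le> pi / 2"
  shows "2 * x / pi \<le> sin x"
proof -
  have "concave_on {0..pi/2} sin"
  proof (rule f''_le0_imp_concave)
    show "DERIV sin x :> cos x" "DERIV cos x :> - sin x" for x :: real
      by (auto intro!: derivative_eq_intros)
    show "- sin x \<le> 0" if "x \<in> {0..pi/2}" for x :: real
      using that by (auto intro!: sin_ge_zero)
  qed simp
  from concave_onD_Icc'[OF this, of x] assms show ?thesis by (simp add: field_simps)
qed

lemma one_minus_cos: "1 - cos x = 2 * (sin (x / 2))\<^sup>2" for x :: real
  using cos_double_sin[of "x / 2"] by simp

lemma cmod_cis_diff: "cmod (cis a - cis b) = 2 * \<bar>sin ((a - b) / 2)\<bar>"
proof -
  have "(cmod (cis a - cis b))\<^sup>2 = (cos a - cos b)\<^sup>2 + (sin a - sin b)\<^sup>2"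
    by (simp add: cmod_power2)
  also have "\<dots> = 2 - 2 * cos (a - b)"
    using sin_cos_squared_add[of a] sin_cos_squared_add[of b]
    unfolding cos_diff power2_diff by (simp add: algebra_simps)
  also have "\<dots> = (2 * \<bar>sin ((a - b) / 2)\<bar>)\<^sup>2"
    using one_minus_cos[of "a - b"] by (simp add: power_mult_distrib)
  finally show ?thesis by (rule power2_eq_imp_eq) auto
qed

text \<open>\<open>arccos (cos s)\<close> folds the angle s into [0,pi]. As sin \<theta> \<ge> 0 and
  the sine of the folded angle is |sin s|, folding can only increase cos (\<theta> - s), that is,
  shorten the chord; Jordan's inequality then compares chord and arc. The constant 2 comes from pi <
  4.\<close>

lemma arccos_dist_le_cmod_cis_diff:
  assumes "0 \<le> \<theta>" "\<theta> \<le> pi"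
  shows "\<bar>\<theta> - arccos (cos s)\<bar> \<le> 2 * cmod (cis \<theta> - cis s)"
proof -
  define u where "u = arccos (cos s)"
  have u: "0 \<le> u" "u \<le> pi" "cos u = cos s" unfolding u_def by (auto intro: arccos_lbound arccos_ubound)
  have sinu: "sin u = \<bar>sin s\<bar>"
    using u by (metis abs_of_nonneg sin_ge_zero sin_cos_squared_add power2_abs add_right_cancel abs_ge_zero power2_eq_iff_nonneg)
  have "cos (\<theta> - s) \<le> cos (\<theta> - u)"
    using assms u sinu by (simp add: cos_diff mult_left_mono sin_ge_zero)
  then have "(sin ((\<theta> - u) / 2))\<^sup>2 \<le> (sin ((\<theta> - s) / 2))\<^sup>2"
    using one_minus_cos[of "\<theta> - u"] one_minus_cos[of "\<theta> - s"] by simp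
  then have 1: "\<bar>sin ((\<theta> - u) / 2)\<bar> \<le> \<bar>sin ((\<theta> - s) / 2)\<bar>"
    by (simp add: abs_le_square_iff)
  have "\<bar>\<theta> - u\<bar> / 4 \<le> 2 * (\<bar>\<theta> - u\<bar> / 2) / pi"
    using mult_left_mono[of pi 4 "\<bar>\<theta> - u\<bar>"] pi_less_4 by (simp add: field_simps)
  also have "\<dots> \<le> sin (\<bar>\<theta> - u\<bar> / 2)"
    using assms u by (intro sin_ge_two_over_pi) auto
  also have "\<dots> \<le> \<bar>sin ((\<theta> - u) / 2)\<bar>"
  proof (cases "\<theta> \<ge> u")
    case False
    then have "\<bar>\<theta> - u\<bar> = u - \<theta>" by simp
    then have "\<bar>\<theta> - u\<bar> / 2 = - ((\<theta> - u) / 2)" unfolding minus_divide_left by simp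
    then show ?thesis by (simp only: sin_minus abs_ge_minus_self)
  qed simp
  also note 1
  finally show ?thesis unfolding u_def cmod_cis_diff by simp
qed

section \<open>Discrete Fourier analysis at the m-th roots of unity\<close>

definition unit_root :: "nat \<Rightarrow> nat \<Rightarrow> complex" where
  "unit_root m k = cis (2 * pi * real k / real m)"

lemma norm_unit_root [simp]: "cmod (unit_root m k) = 1"
  by (simp add: unit_root_def)

lemma unit_root_nonzero [simp]: "unit_root m k \<noteq> 0"
  by (metis norm_unit_root norm_zero zero_neq_one)

lemma unit_root_power: "unit_root m k ^ j = unit_root m j ^ k"
  by (simp add: unit_root_def Complex.DeMoivre mult_ac)

text \<open>By \<open>unit_root_power\<close> the sum is geometric; its ratio is an m-th root of
  unity, and equals 1 for i = j only.\<close>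

lemma unit_root_orthogonal:
  assumes "i < m" "j < m"
  shows "(\<Sum>k<m. unit_root m k ^ i * cnj (unit_root m k ^ j)) = (if i = j then of_nat m else 0)"
proof -
  define x where "x = unit_root m i * cnj (unit_root m j)"
  have m: "m > 0" using assms by simp
  have bij: "bij_betw (unit_root m) {..<m} {z. z ^ m = 1}"
    using Complex.bij_betw_roots_unity[OF m] unfolding unit_root_def[abs_def] .
  have "unit_root m i ^ m = 1" "unit_root m j ^ m = 1"
    using bij assms by (auto dest!: bij_betwE)
  then have xm: "x ^ m = 1" by (simp add: x_def power_mult_distrib flip: complex_cnj_power)
  have eq: "(\<Sum>k<m. unit_root m k ^ i * cnj (unit_root m k ^ j)) = (\<Sum>k<m. x ^ k)"
    by (simp add: x_def power_mult_distrib unit_root_power[of m _ i] unit_root_power[of m _ j] complex_cnj_power)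
  have uu: "unit_root m j * cnj (unit_root m j) = 1"
    by (simp only: complex_norm_square[symmetric] norm_unit_root power_one of_real_1)
  show ?thesis
  proof (cases "i = j")
    case True
    then show ?thesis using eq uu by (simp add: x_def)
  next
    case False
    have "x \<noteq> 1"
    proof
      assume "x = 1"
      then have "unit_root m i * (cnj (unit_root m j) * unit_root m j) = unit_root m j"
        by (simp add: x_def mult.assoc[symmetric])
      then have "unit_root m i = unit_root m j" using uu by (simp add: mult.commute)
      then show False using bij assms False by (auto simp: bij_betw_def inj_on_def)
    qed
    then show ?thesis using eq xm False by (simp add: geometric_sum)
  qed
qed

text \<open>Parseval's identity for the discrete Fourier transform. It bounds the sum over the nodes
  of the squared kernel, from which the interpolation coefficients inherit a sum bounded
  independently of the degree.\<close>

lemma unit_root_parseval: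
  assumes "N \<le> m"
  shows "(\<Sum>k<m. (cmod (\<Sum>j<N. a j * unit_root m k ^ j))\<^sup>2) = real m * (\<Sum>j<N. (cmod (a j))\<^sup>2)"
proof -
  have "complex_of_real (\<Sum>k<m. (cmod (\<Sum>j<N. a j * unit_root m k ^ j))\<^sup>2)
      = (\<Sum>k<m. (\<Sum>i<N. a i * unit_root m k ^ i) * cnj (\<Sum>j<N. a j * unit_root m k ^ j))"
    unfolding of_real_sum complex_norm_square ..
  also have "\<dots> = (\<Sum>k<m. \<Sum>i<N. \<Sum>j<N. (a i * cnj (a j)) * (unit_root m k ^ i * cnj (unit_root m k ^ j)))"
    unfolding cnj_sum sum_product by (simp add: mult_ac)
  also have "\<dots> = (\<Sum>i<N. \<Sum>j<N. \<Sum>k<m. (a i * cnj (a j)) * (unit_root m k ^ i * cnj (unit_root m k ^ j)))"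
    by (subst sum.swap, rule sum.cong[OF refl], rule sum.swap)
  also have "\<dots> = (\<Sum>i<N. \<Sum>j<N. (a i * cnj (a j)) * (if i = j then of_nat m else 0))"
    using assms by (intro sum.cong refl, subst sum_distrib_left[symmetric], subst unit_root_orthogonal) auto
  also have "\<dots> = (\<Sum>i<N. of_nat m * (a i * cnj (a i)))"
    by (intro sum.cong refl) (simp add: if_distrib[of "\<lambda>x. _ * x"] sum.delta' mult_ac cong: if_cong)
  also have "\<dots> = complex_of_real (real m * (\<Sum>j<N. (cmod (a j))\<^sup>2))"
    unfolding of_real_mult of_real_sum complex_norm_square by (simp add: sum_distrib_left)
  finally show ?thesis using of_real_eq_iff by blast
qed

text \<open>Discrete Fourier inversion: once q is expanded, orthogonality leaves the terms i = j
  only, each contributing m times the i-th term of q at z. The rotation u is kept free because the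
  estimate is later averaged over it.\<close>

lemma poly_interpolation_unit_roots:
  assumes u: "cmod u = 1" and deg: "degree q < m"
  shows "poly q z = (\<Sum>k<m. poly q (u * unit_root m k) * ((\<Sum>j<m. (z / (u * unit_root m k)) ^ j) / of_nat m))"
proof -
  have u0: "u \<noteq> 0" using u by auto
  have inv: "1 / unit_root m k ^ j = cnj (unit_root m k ^ j)" for k j
  proof -
    have "unit_root m k ^ j * cnj (unit_root m k ^ j) = 1"
      by (simp only: complex_norm_square[symmetric] norm_power norm_unit_root power_one of_real_1)
    then show ?thesis by (simp add: field_simps)
  qed
  have fac: "(z / (u * unit_root m k)) ^ j = (z / u) ^ j * cnj (unit_root m k ^ j)" for k j
    unfolding inv[symmetric] by (simp add: power_divide power_mult_distrib)
  have coeffs: "poly q y = (\<Sum>i<m. coeff q i * y ^ i)" for y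
  proof -
    have "(\<Sum>i<m. coeff q i * y ^ i) = (\<Sum>i\<le>degree q. coeff q i * y ^ i)"
      using deg by (intro sum.mono_neutral_right) (auto intro: coeff_eq_0)
    then show ?thesis by (simp add: poly_altdef)
  qed
  have "(\<Sum>k<m. poly q (u * unit_root m k) * (\<Sum>j<m. (z / (u * unit_root m k)) ^ j)) =
        (\<Sum>k<m. \<Sum>i<m. \<Sum>j<m. (coeff q i * u ^ i * (z / u) ^ j) * (unit_root m k ^ i * cnj (unit_root m k ^ j)))"
    unfolding coeffs sum_product
    by (intro sum.cong refl) (simp only: fac, simp add: power_mult_distrib mult_ac)
  also have "\<dots> = (\<Sum>i<m. \<Sum>j<m. \<Sum>k<m. (coeff q i * u ^ i * (z / u) ^ j) * (unit_root m k ^ i * cnj (unit_root m k ^ j)))"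
    by (subst sum.swap, rule sum.cong[OF refl], rule sum.swap)
  also have "\<dots> = (\<Sum>i<m. \<Sum>j<m. (coeff q i * u ^ i * (z / u) ^ j) * (if i = j then of_nat m else 0))"
    by (intro sum.cong refl, subst sum_distrib_left[symmetric], subst unit_root_orthogonal) auto
  also have "\<dots> = (\<Sum>i<m. of_nat m * (coeff q i * z ^ i))"
  proof (rule sum.cong[OF refl])
    fix i assume "i \<in> {..<m}"
    have "(\<Sum>j<m. (coeff q i * u ^ i * (z / u) ^ j) * (if i = j then of_nat m else 0))
      = (\<Sum>j<m. if j = i then of_nat m * (coeff q i * z ^ i) else 0)"
      using u0 by (intro sum.cong) (auto simp: power_divide)
    then show "(\<Sum>j<m. (coeff q i * u ^ i * (z / u) ^ j) * (if i = j then of_nat m else 0))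
      = of_nat m * (coeff q i * z ^ i)"
      using \<open>i \<in> {..<m}\<close> by (simp add: sum.delta)
  qed
  also have "\<dots> = of_nat m * poly q z" unfolding coeffs by (simp add: sum_distrib_left)
  finally have "(\<Sum>k<m. poly q (u * unit_root m k) * (\<Sum>j<m. (z / (u * unit_root m k)) ^ j)) = of_nat m * poly q z" .
  then show ?thesis using deg by (simp add: sum_divide_distrib[symmetric])
qed

section \<open>The Joukowski map\<close>

text \<open>The factor y^d clears the negative powers of y, since y (y + 1/y) / 2 = (1 + y^2) / 2.
  On the unit circle it has modulus 1, so there |q| takes the values of |R| on [-1,1].\<close>

lemma joukowski_poly_exists:
  fixes R :: "complex poly"
  assumes "degree R \<le> d"
  shows "\<exists>q. degree q \<le> 2 * d \<and> (\<forall>y. y \<noteq> 0 \<longrightarrow> poly q y = y ^ d * poly R ((y + 1 / y) / 2))"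
proof -
  define q where "q = (\<Sum>j\<le>d. smult (coeff R j) ([:1/2, 0, 1/2:] ^ j * monom 1 (d - j)))"
  have "degree q \<le> 2 * d"
    unfolding q_def
  proof (rule degree_sum_le)
    fix j assume "j \<in> {..d}"
    then have j: "j \<le> d" by simp
    have "degree ([:1/2, 0, 1/2::complex:] ^ j) \<le> 2 * j"
      by (rule order_trans[OF degree_power_le]) simp
    then have "degree ([:1/2, 0, 1/2::complex:] ^ j * monom 1 (d - j)) \<le> 2 * j + (d - j)"
      by (intro order_trans[OF degree_mult_le]) (simp add: degree_monom_eq)
    also have "\<dots> \<le> 2 * d" using j by simp
    finally show "degree (smult (coeff R j) ([:1/2, 0, 1/2::complex:] ^ j * monom 1 (d - j))) \<le> 2 * d"
      using degree_smult_le order_trans by blast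
  qed simp
  moreover have "poly q y = y ^ d * poly R ((y + 1 / y) / 2)" if y: "y \<noteq> 0" for y
  proof -
    have "poly R x = (\<Sum>j\<le>d. coeff R j * x ^ j)" for x
      using assms by (subst poly_altdef, intro sum.mono_neutral_left) (auto intro: coeff_eq_0)
    then have "y ^ d * poly R ((y + 1 / y) / 2) = (\<Sum>j\<le>d. y ^ d * (coeff R j * ((y + 1 / y) / 2) ^ j))"
      by (simp add: sum_distrib_left)
    also have "\<dots> = poly q y"
      unfolding q_def poly_sum
    proof (rule sum.cong[OF refl])
      fix j assume "j \<in> {..d}"
      then have "y ^ d = y ^ (d - j) * y ^ j" by (simp add: power_add[symmetric])
      moreover have "y ^ j * ((y + 1 / y) / 2) ^ j = (1/2 + y * y / 2) ^ j"
      proof -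
        have "y * ((y + 1 / y) / 2) = 1/2 + y * y / 2" using y by (simp add: field_simps)
        then show ?thesis by (simp only: power_mult_distrib[symmetric])
      qed
      ultimately have "y ^ d * ((y + 1 / y) / 2) ^ j = y ^ (d - j) * (1/2 + y * y / 2) ^ j"
        by (simp add: mult.assoc)
      then show "y ^ d * (coeff R j * ((y + 1 / y) / 2) ^ j)
        = poly (smult (coeff R j) ([:1/2, 0, 1/2:] ^ j * monom 1 (d - j))) y"
        by (simp add: poly_monom poly_power mult_ac)
    qed
    finally show ?thesis by simp
  qed
  ultimately show ?thesis by blast
qed

text \<open>The product of the distances from a point of the unit circle to the two Joukowski
  preimages of \<open>z\<close> is twice the distance between the images.\<close>

lemma joukowski_preimage_near:
  assumes \<theta>: "0 < \<theta>" "\<theta> < pi" and \<rho>: "0 < \<rho>"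
    and z: "cmod (z - of_real (cos \<theta>)) \<le> sin \<theta> * \<rho> / 32"
  obtains y where "y \<noteq> 0" "z = (y + 1 / y) / 2" "cmod (y - cis \<theta>) \<le> \<rho>"
proof -
  have sin: "sin \<theta> > 0" using \<theta> by (rule sin_gt_zero)
  have prod: "cmod (cis \<theta> - y) * cmod (cis \<theta> - 1 / y) \<le> sin \<theta> * \<rho> / 16"
    if "y \<noteq> 0" "z = (y + 1 / y) / 2" for y
  proof -
    have "cis \<theta> * cis \<theta> + 1 = cis \<theta> * (2 * of_real (cos \<theta>))"
    proof -
      have "cis \<theta> * (cis \<theta> + cis (-\<theta>)) = cis \<theta> * (2 * of_real (cos \<theta>))"
        by (simp add: complex_eq_iff)
      then show ?thesis by (simp add: distrib_left cis_mult)
    qed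
    moreover have "(cis \<theta> - y) * (cis \<theta> - 1 / y) = (cis \<theta> * cis \<theta> + 1) - cis \<theta> * (y + 1 / y)"
      using that(1) by (simp add: field_simps)
    moreover have "y + 1 / y = 2 * z" using that(2) by (simp add: mult.commute)
    ultimately have "(cis \<theta> - y) * (cis \<theta> - 1 / y) = cis \<theta> * (2 * (of_real (cos \<theta>) - z))"
      by (simp only: right_diff_distrib)
    then have "cmod (cis \<theta> - y) * cmod (cis \<theta> - 1 / y) = 2 * cmod (of_real (cos \<theta>) - z)"
      by (metis (no_types) mult_1 norm_cis norm_mult norm_numeral)
    then show ?thesis using z by (simp add: norm_minus_commute)
  qed
  \<comment> \<open>The two preimages of z are the roots of y^2 - 2 z y + 1, hence inverse to each
    other.\<close>
  define y0 where "y0 = z + csqrt (z\<^sup>2 - 1)"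
  have y0: "y0 * (z - csqrt (z\<^sup>2 - 1)) = 1"
    unfolding y0_def by (simp add: algebra_simps power2_eq_square[symmetric])
  then have ne: "y0 \<noteq> 0" by auto
  have inv: "1 / y0 = z - csqrt (z\<^sup>2 - 1)" using inverse_unique[OF y0] by (simp add: inverse_eq_divide)
  have z0: "z = (y0 + 1 / y0) / 2" unfolding inv by (simp add: y0_def)
  \<comment> \<open>The nearer preimage is taken. From d1^2 \<le> d1 d2 \<le> sin \<theta> \<rho> /
    16 the claim follows at once if sin \<theta> \<le> \<rho>. Otherwise d1 \<le> sin \<theta> / 4,
    so 1/y stays within sin \<theta> of \<open>cis (-\<theta>)\<close>, which is 2 sin \<theta> away
    from \<open>cis \<theta>\<close>; thus d2 \<ge> sin \<theta>, and dividing the product by d2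
    leaves d1 \<le> \<rho> / 16.\<close>
  have main: "cmod (y - cis \<theta>) \<le> \<rho>"
    if y: "y \<noteq> 0" "z = (y + 1 / y) / 2" and le: "cmod (cis \<theta> - y) \<le> cmod (cis \<theta> - 1 / y)" for y
  proof -
    define d1 d2 where "d1 = cmod (cis \<theta> - y)" and "d2 = cmod (cis \<theta> - 1 / y)"
    have d: "d1 * d2 \<le> sin \<theta> * \<rho> / 16" "d1 \<le> d2" "0 \<le> d1"
      using prod[OF y] le by (auto simp: d1_def d2_def)
    have sq: "d1\<^sup>2 \<le> sin \<theta> * \<rho> / 16"
      using d mult_left_mono[OF d(2,3)] unfolding power2_eq_square by linarith
    have "d1 \<le> \<rho>"
    proof (cases "sin \<theta> \<le> \<rho>")
      case True
      then have "sin \<theta> * \<rho> \<le> \<rho> * \<rho>" using \<rho> by (intro mult_right_mono) auto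
      moreover have "0 \<le> \<rho> * \<rho>" by simp
      ultimately have "d1\<^sup>2 \<le> \<rho>\<^sup>2" using sq unfolding power2_eq_square by linarith
      then show ?thesis using \<rho> by (simp add: power2_le_iff_abs_le)
    next
      case False
      then have "sin \<theta> * \<rho> \<le> sin \<theta> * sin \<theta>" using sin by (intro mult_left_mono) auto
      then have "d1\<^sup>2 \<le> (sin \<theta> / 4)\<^sup>2" using sq by (simp add: power2_eq_square)
      then have d14: "d1 \<le> sin \<theta> / 4" using sin by (simp add: power2_le_iff_abs_le)
      then have ny: "cmod y \<ge> 3 / 4"
        using norm_triangle_ineq2[of "cis \<theta>" y] sin_le_one[of \<theta>] d14
        unfolding d1_def norm_cis by linarith
      have "cmod (cis (-\<theta>) - 1 / y) = d1 / cmod y"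
      proof -
        have "cis (-\<theta>) - 1 / y = (y - cis \<theta>) * (cis (-\<theta>) / y)"
          using y(1) by (simp add: field_simps cis_mult)
        then show ?thesis by (simp add: norm_mult norm_divide d1_def norm_minus_commute)
      qed
      also have "\<dots> \<le> d1 / (3/4)" using ny d by (intro divide_left_mono) auto
      also have "\<dots> \<le> sin \<theta>" using d14 sin by simp
      finally have 1: "cmod (cis (-\<theta>) - 1 / y) \<le> sin \<theta>" .
      have "cmod (cis \<theta> - cis (-\<theta>)) = 2 * sin \<theta>"
        using sin by (simp add: cmod_cis_diff)
      moreover have "cmod (cis \<theta> - cis (-\<theta>)) \<le> d2 + cmod (cis (-\<theta>) - 1 / y)"
        unfolding d2_def using norm_triangle_ineq4[of "cis \<theta> - 1/y" "cis (-\<theta>) - 1/y"] by simp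
      ultimately have "sin \<theta> \<le> d2" using 1 by simp
      then have "d1 * sin \<theta> \<le> sin \<theta> * \<rho> / 16" using d(1) mult_left_mono[OF _ d(3), of "sin \<theta>" d2] by linarith
      then have "d1 \<le> \<rho> / 16" using sin by (simp add: mult.commute)
      then show ?thesis using \<rho> by simp
    qed
    then show ?thesis by (simp add: d1_def norm_minus_commute)
  qed
  show thesis
  proof (cases "cmod (cis \<theta> - y0) \<le> cmod (cis \<theta> - 1 / y0)")
    case True
    show thesis by (rule that[OF ne z0 main[OF ne z0 True]])
  next
    case False
    have a: "1 / y0 \<noteq> 0" "z = (1 / y0 + 1 / (1 / y0)) / 2" "cmod (cis \<theta> - 1 / y0) \<le> cmod (cis \<theta> - 1 / (1 / y0))"
      using ne z0 False by auto
    show thesis by (rule that[OF a(1,2) main[OF a]])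
  qed
qed

lemma poly_map_of_real: "poly (map_poly complex_of_real P) (of_real x) = of_real (poly P x)"
  by (induction P) (auto simp: map_poly_pCons)

text \<open>With m = (L + 4) n nodes, the polynomial y^(n-1) P((y + 1/y)/2) can be multiplied by the
  power L + 2 of a kernel G of degree below n and is still reproduced, as 2 (n-1) + (L+2) (n-1) < m.
  Of the factors G, L provide the decay in the angular distance, and the remaining two a sum of
  squares bounded by Parseval's identity. The radius of the disc is such that a preimage of z lies
  within 1/m of \<open>cis \<theta>\<close>, where all powers up to the m-th stay bounded.\<close>

lemma localized_interpolation_bound:
  fixes L :: nat
  shows "\<exists>C>0. \<forall>n\<ge>1. \<forall>P :: real poly. degree P < n \<longrightarrow> (\<forall>\<theta> \<tau> z. 0 < \<theta> \<longrightarrow> \<theta> < pi \<longrightarrow>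
     cmod (z - of_real (cos \<theta>)) \<le> sin \<theta> / (32 * real ((L + 4) * n)) \<longrightarrow>
     (\<exists>a. (\<forall>k. 0 \<le> a k) \<and> (\<Sum>k<(L + 4) * n. a k) \<le> C \<and>
        cmod (poly (map_poly complex_of_real P) z) \<le> (\<Sum>k<(L + 4) * n.
          a k * (\<bar>poly P (cos (\<tau> + 2 * pi * real k / real ((L + 4) * n)))\<bar> /
          (1 + real ((L + 4) * n) * \<bar>\<theta> - arccos (cos (\<tau> + 2 * pi * real k / real ((L + 4) * n)))\<bar>) ^ L))))"
proof -
  \<comment> \<open>\<open>C1\<close> majorizes 3 * 9 + 2 (L + 4) * 20 from \<open>Gdecay\<close>.
    In \<open>C\<close>, the first 81 is 9 for undoing the factor y^(n-1) times 9 for the bound of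
    \<open>g\<close>, and the last factor is the Parseval bound \<open>sumG\<close>.\<close>
  define C1 :: real where "C1 = 2 * (18 + 20 * (real L + 4))"
  define C where "C = 81 * C1 ^ L * (81 * (real L + 4))"
  have C1: "C1 > 0" by (simp add: C1_def add_pos_nonneg)
  then have C: "C > 0" by (simp add: C_def)
  show ?thesis
  proof (intro exI[of _ C] conjI C allI impI)
    fix n :: nat and P :: "real poly" and \<theta> \<tau> :: real and z :: complex
    assume n: "1 \<le> n" and deg: "degree P < n" and \<theta>: "0 < \<theta>" "\<theta> < pi"
      and z: "cmod (z - of_real (cos \<theta>)) \<le> sin \<theta> / (32 * real ((L + 4) * n))"
    define m where "m = (L + 4) * n"
    have m4: "m \<ge> 4" using n unfolding m_def by (metis le_add2 mult_le_mono nat_mult_1_right)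
    have m0: "real m > 0" using m4 by simp
    define t where "t = (\<lambda>k. \<tau> + 2 * pi * real k / real m)"
    obtain y where y: "y \<noteq> 0" "z = (y + 1 / y) / 2" and yc: "cmod (y - cis \<theta>) \<le> 1 / real m"
    proof (rule joukowski_preimage_near[of \<theta> "1 / real m" z])
      show "cmod (z - complex_of_real (cos \<theta>)) \<le> sin \<theta> * (1 / real m) / 32"
        using z unfolding m_def[symmetric] by (simp add: mult.commute)
    qed (use \<theta> m0 in auto)
    have ny: "cmod y \<le> 1 + 1 / real m" "cmod y \<ge> 1 - 1 / real m"
      using norm_triangle_ineq2[of y "cis \<theta>"] norm_triangle_ineq3[of y "cis \<theta>"] yc by auto
    have exp2: "exp 2 \<le> (9::real)"
    proof -
      have "exp 2 = exp (1::real) * exp 1" by (simp flip: exp_add)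
      also have "\<dots> \<le> 3 * 3" using exp_le by (intro mult_mono) auto
      finally show ?thesis by simp
    qed
    \<comment> \<open>Since |y| is within 1/m of 1, both |y| and 1/|y| are at most 1 + 2/m, and
      their powers up to the m-th stay below e^2 \<le> 9.\<close>
    have pow9: "(1 + 2 / real m) ^ j \<le> 9" if "j \<le> m" for j
    proof -
      have "(1 + 2 / real m) ^ j \<le> (1 + 2 / real m) ^ m" using that m0 by (intro power_increasing) auto
      also have "\<dots> \<le> exp 2" using m0 by (intro exp_ge_one_plus_x_over_n_power_n) auto
      finally show ?thesis using exp2 by simp
    qed
    have ypow: "cmod y ^ j \<le> 9" if "j \<le> m" for j
    proof -
      have "cmod y ^ j \<le> (1 + 2 / real m) ^ j"
        using ny m0 by (intro power_mono) (auto simp: field_simps)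
      then show ?thesis using pow9[OF that] by simp
    qed
    have yinv: "1 / cmod y ^ j \<le> 9" if "j \<le> m" for j
    proof -
      have "1 \<le> (1 - 1 / real m) * (1 + 2 / real m)"
        using m4 m0 by (simp add: field_simps)
      also have "\<dots> \<le> cmod y * (1 + 2 / real m)"
        using ny m0 by (intro mult_right_mono) auto
      finally have "1 / cmod y \<le> 1 + 2 / real m" using y(1) by (simp add: field_simps)
      then have "(1 / cmod y) ^ j \<le> (1 + 2 / real m) ^ j" by (intro power_mono) auto
      then show ?thesis using pow9[OF that] by (simp add: power_divide)
    qed
    have "degree (map_poly complex_of_real P) \<le> n - 1"
      using deg by (subst degree_map_poly) auto
    from joukowski_poly_exists[OF this] obtain q where
      "degree q \<le> 2 * (n - 1) \<and> (\<forall>x. x \<noteq> 0 \<longrightarrow> poly q x = x ^ (n - 1) * poly (map_poly complex_of_real P) ((x + 1 / x) / 2))"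
      by (rule exE)
    then have q: "degree q \<le> 2 * (n - 1)" "\<And>x. x \<noteq> 0 \<Longrightarrow> poly q x = x ^ (n - 1) * poly (map_poly complex_of_real P) ((x + 1 / x) / 2)"
      by simp_all
    define u where "u = cis \<tau>"
    have u: "cmod u = 1" by (simp add: u_def)
    define \<zeta> where "\<zeta> = (\<lambda>k. u * unit_root m k)"
    have \<zeta>t: "\<zeta> k = cis (t k)" for k by (simp add: \<zeta>_def u_def unit_root_def cis_mult t_def)
    have n\<zeta>: "cmod (\<zeta> k) = 1" for k by (simp add: \<zeta>t)
    have \<zeta>0: "\<zeta> k \<noteq> 0" for k using n\<zeta>[of k] by auto
    \<comment> \<open>The Dirichlet kernel in x/y, normalized to be 1 at y, so that multiplication
      by its powers leaves the value to be interpolated unchanged.\<close>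
    define G where "G = (\<Sum>j<n. monom (1 / (of_nat n * y ^ j)) j)"
    have G: "poly G x = (\<Sum>j<n. (x / y) ^ j) / of_nat n" for x
      by (simp add: G_def poly_sum poly_monom sum_divide_distrib power_divide mult.commute)
    have Gy: "poly G y = 1" using n y by (simp add: G)
    have "degree G \<le> n - 1" unfolding G_def
      by (rule degree_sum_le) (auto intro: order_trans[OF degree_monom_le])
    then have "degree (q * G ^ (L + 2)) \<le> 2 * (n - 1) + (n - 1) * (L + 2)"
      by (meson add_mono degree_mult_le degree_power_le mult_le_mono1 order_trans q(1))
    also have "\<dots> < m"
    proof -
      have "2 * (n - 1) + (n - 1) * (L + 2) = (n - 1) * (L + 4)" by (cases n) (auto simp: algebra_simps)
      also have "\<dots> < n * (L + 4)" using n by (intro mult_strict_right_mono) auto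
      finally show ?thesis by (simp add: m_def mult.commute)
    qed
    finally have degm: "degree (q * G ^ (L + 2)) < m" .
    define g where "g = (\<lambda>k. (\<Sum>j<m. (y / \<zeta> k) ^ j) / of_nat m)"
    have rep: "poly q y = (\<Sum>k<m. poly q (\<zeta> k) * poly G (\<zeta> k) ^ (L + 2) * g k)"
      using poly_interpolation_unit_roots[OF u degm, of y] by (simp add: Gy \<zeta>_def g_def poly_power)
    have g9: "cmod (g k) \<le> 9" for k
    proof -
      have "cmod (\<Sum>j<m. (y / \<zeta> k) ^ j) \<le> (\<Sum>j<m. 9)"
        by (intro sum_norm_le) (use ypow in \<open>auto simp: norm_power norm_divide n\<zeta>\<close>)
      then show ?thesis using m0 by (simp add: g_def norm_divide field_simps)
    qed
    have G9: "cmod (poly G (\<zeta> k)) \<le> 9" for k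
    proof -
      have nm: "n \<le> m" by (simp add: m_def)
      have "cmod (\<Sum>j<n. (\<zeta> k / y) ^ j) \<le> (\<Sum>j<n. 9)"
        by (intro sum_norm_le) (use yinv nm in \<open>auto simp: norm_power norm_divide n\<zeta> power_divide\<close>)
      then show ?thesis using n by (simp add: G norm_divide field_simps)
    qed
    \<comment> \<open>Summing the geometric series gives |1 - \<zeta>/y| n |G| \<le> 10, and |y -
      \<zeta>| dominates half the folded angular distance up to 1/m. So G decays like the reciprocal
      of that distance measured in units of 1/m.\<close>
    have Gdecay: "cmod (poly G (\<zeta> k)) * (1 + real m * \<bar>\<theta> - arccos (cos (t k))\<bar>) \<le> C1" for k
    proof -
      have "(1 - \<zeta> k / y) * (of_nat n * poly G (\<zeta> k)) = 1 - (\<zeta> k / y) ^ n"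
        using n by (simp add: G one_diff_power_eq)
      then have "cmod (1 - \<zeta> k / y) * (real n * cmod (poly G (\<zeta> k))) = cmod (1 - (\<zeta> k / y) ^ n)"
        by (metis norm_mult norm_of_nat)
      also have "\<dots> \<le> 1 + cmod ((\<zeta> k / y) ^ n)" using norm_triangle_ineq4[of 1 "(\<zeta> k / y) ^ n"] by simp
      also have "cmod ((\<zeta> k / y) ^ n) \<le> 9"
        using yinv[of n] by (simp add: norm_power norm_divide n\<zeta> power_divide m_def)
      finally have 1: "cmod (1 - \<zeta> k / y) * (real n * cmod (poly G (\<zeta> k))) \<le> 10" by simp
      have "1 - \<zeta> k / y = (y - \<zeta> k) / y" using y(1) by (simp add: field_simps)
      then have "cmod (1 - \<zeta> k / y) = cmod (y - \<zeta> k) / cmod y" by (simp add: norm_divide)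
      moreover have "cmod y \<le> 2" using ny m4 by (smt (verit) divide_le_eq_1_pos m0 of_nat_1 of_nat_le_iff one_le_numeral order_trans)
      ultimately have "cmod (y - \<zeta> k) / 2 \<le> cmod (1 - \<zeta> k / y)"
        using y(1) by (simp only:) (intro divide_left_mono, auto)
      then have "cmod (y - \<zeta> k) / 2 * (real n * cmod (poly G (\<zeta> k))) \<le> 10"
        using 1 by (meson mult_right_mono mult_nonneg_nonneg norm_ge_zero of_nat_0_le_iff order_trans)
      then have 2: "real n * cmod (y - \<zeta> k) * cmod (poly G (\<zeta> k)) \<le> 20" by (simp add: mult_ac)
      have "cmod (cis \<theta> - \<zeta> k) \<le> cmod (y - \<zeta> k) + 1 / real m"
        using norm_triangle_ineq4[of "y - \<zeta> k" "y - cis \<theta>"] yc by simp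
      then have "\<bar>\<theta> - arccos (cos (t k))\<bar> \<le> 2 * (cmod (y - \<zeta> k) + 1 / real m)"
        using arccos_dist_le_cmod_cis_diff[of \<theta> "t k"] \<theta> unfolding \<zeta>t by simp
      then have "real m * \<bar>\<theta> - arccos (cos (t k))\<bar> \<le> real m * (2 * (cmod (y - \<zeta> k) + 1 / real m))"
        using m0 by (intro mult_left_mono) auto
      also have "\<dots> = 2 * (real L + 4) * (real n * cmod (y - \<zeta> k)) + 2"
        using m0 by (simp add: distrib_left) (simp add: m_def algebra_simps)
      finally have "1 + real m * \<bar>\<theta> - arccos (cos (t k))\<bar> \<le> 3 + 2 * (real L + 4) * (real n * cmod (y - \<zeta> k))" by simp
      then have "cmod (poly G (\<zeta> k)) * (1 + real m * \<bar>\<theta> - arccos (cos (t k))\<bar>) \<le>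
           cmod (poly G (\<zeta> k)) * (3 + 2 * (real L + 4) * (real n * cmod (y - \<zeta> k)))"
        by (intro mult_left_mono) auto
      also have "\<dots> = 3 * cmod (poly G (\<zeta> k)) + 2 * (real L + 4) * (real n * cmod (y - \<zeta> k) * cmod (poly G (\<zeta> k)))"
        by (simp add: algebra_simps)
      also have "\<dots> \<le> 3 * 9 + 2 * (real L + 4) * 20"
        using 2 G9 by (intro add_mono mult_left_mono) auto
      also have "\<dots> \<le> C1" by (simp add: C1_def)
      finally show ?thesis .
    qed
    have sumG: "(\<Sum>k<m. (cmod (poly G (\<zeta> k)))\<^sup>2) \<le> 81 * (real L + 4)"
    proof -
      have "poly G (\<zeta> k) = (\<Sum>j<n. ((u / y) ^ j / of_nat n) * unit_root m k ^ j)" for k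
        by (simp add: G \<zeta>_def sum_divide_distrib power_mult_distrib power_divide)
      moreover have "n \<le> m" by (simp add: m_def)
      ultimately have "(\<Sum>k<m. (cmod (poly G (\<zeta> k)))\<^sup>2) = real m * (\<Sum>j<n. (cmod ((u / y) ^ j / of_nat n))\<^sup>2)"
        by (simp only: unit_root_parseval)
      also have "\<dots> \<le> real m * (\<Sum>j<n. (9 / real n)\<^sup>2)"
      proof (intro mult_left_mono sum_mono power_mono)
        fix j assume "j \<in> {..<n}"
        then have "j \<le> m" using \<open>n \<le> m\<close> by simp
        then have "(1 / cmod y ^ j) / real n \<le> 9 / real n" by (intro divide_right_mono yinv) auto
        moreover have "cmod ((u / y) ^ j / of_nat n) = (1 / cmod y ^ j) / real n"
          unfolding norm_divide norm_power u norm_of_nat power_divide by simp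
        ultimately show "cmod ((u / y) ^ j / of_nat n) \<le> 9 / real n" by (simp only:)
      qed auto
      also have "\<dots> = 81 * (real L + 4)" using n by (simp add: m_def power2_eq_square field_simps)
      finally show ?thesis .
    qed
    \<comment> \<open>Two factors G remain in the coefficients; the other L have been spent on the
      decay.\<close>
    define a where "a = (\<lambda>k. 81 * C1 ^ L * (cmod (poly G (\<zeta> k)))\<^sup>2)"
    have P\<zeta>: "cmod (poly q (\<zeta> k)) = \<bar>poly P (cos (t k))\<bar>" for k
    proof -
      have "(\<zeta> k + 1 / \<zeta> k) / 2 = of_real (cos (t k))"
      proof -
        have "1 / cis (t k) = cis (- t k)" by (simp add: cis_inverse[symmetric] inverse_eq_divide)
        then show ?thesis unfolding \<zeta>t by (simp add: complex_eq_iff)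
      qed
      then show ?thesis
        using q(2)[OF \<zeta>0] by (simp add: norm_mult norm_power n\<zeta> poly_map_of_real)
    qed
    have "cmod (poly (map_poly complex_of_real P) z) = cmod (poly q y) / cmod y ^ (n - 1)"
      using q(2)[OF y(1)] y(1) unfolding y(2)[symmetric] by (simp add: norm_mult norm_power)
    also have "\<dots> \<le> 9 * cmod (poly q y)"
    proof -
      have "n - 1 \<le> n * (L + 4)" by (simp add: trans_le_add1 algebra_simps)
      then have "n - 1 \<le> m" by (simp add: m_def mult.commute)
      from mult_left_mono[OF yinv[OF this], of "cmod (poly q y)"] show ?thesis by (simp add: mult.commute)
    qed
    also have "\<dots> \<le> 9 * (\<Sum>k<m. cmod (poly q (\<zeta> k) * poly G (\<zeta> k) ^ (L + 2) * g k))"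
      unfolding rep by (intro mult_left_mono norm_sum) auto
    also have "\<dots> \<le> 9 * (\<Sum>k<m. (1/9) * (a k * (\<bar>poly P (cos (t k))\<bar> / (1 + real m * \<bar>\<theta> - arccos (cos (t k))\<bar>) ^ L)))"
    proof (intro mult_left_mono sum_mono)
      fix k
      define D where "D = 1 + real m * \<bar>\<theta> - arccos (cos (t k))\<bar>"
      have D: "D > 0" using m0 by (simp add: D_def add_pos_nonneg)
      have "cmod (poly G (\<zeta> k)) ^ L \<le> (C1 / D) ^ L"
        using Gdecay[of k] D by (intro power_mono) (auto simp: D_def[symmetric] field_simps)
      then have "cmod (poly G (\<zeta> k)) ^ (L + 2) * cmod (g k) \<le> ((C1 / D) ^ L * (cmod (poly G (\<zeta> k)))\<^sup>2) * 9"
        unfolding power_add using g9[of k] C1 D by (intro mult_mono mult_right_mono) auto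
      then have "\<bar>poly P (cos (t k))\<bar> * (cmod (poly G (\<zeta> k)) ^ (L + 2) * cmod (g k)) \<le>
          \<bar>poly P (cos (t k))\<bar> * (((C1 / D) ^ L * (cmod (poly G (\<zeta> k)))\<^sup>2) * 9)"
        by (intro mult_left_mono) auto
      then show "cmod (poly q (\<zeta> k) * poly G (\<zeta> k) ^ (L + 2) * g k) \<le>
        (1/9) * (a k * (\<bar>poly P (cos (t k))\<bar> / (1 + real m * \<bar>\<theta> - arccos (cos (t k))\<bar>) ^ L))"
        by (simp add: a_def D_def[symmetric] norm_mult norm_power P\<zeta> power_divide mult_ac)
    qed auto
    also have "\<dots> = (\<Sum>k<m. a k * (\<bar>poly P (cos (t k))\<bar> / (1 + real m * \<bar>\<theta> - arccos (cos (t k))\<bar>) ^ L))"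
      by (simp add: sum_distrib_left)
    finally have fin: "cmod (poly (map_poly complex_of_real P) z) \<le>
      (\<Sum>k<m. a k * (\<bar>poly P (cos (t k))\<bar> / (1 + real m * \<bar>\<theta> - arccos (cos (t k))\<bar>) ^ L))" .
    have "(\<Sum>k<m. a k) \<le> C"
      using sumG C1 unfolding a_def C_def sum_distrib_left[symmetric] by (intro mult_left_mono) auto
    moreover have "\<forall>k. 0 \<le> a k" using C1 by (simp add: a_def)
    ultimately show "\<exists>a. (\<forall>k. 0 \<le> a k) \<and> (\<Sum>k<(L + 4) * n. a k) \<le> C \<and>
        cmod (poly (map_poly complex_of_real P) z) \<le> (\<Sum>k<(L + 4) * n.
          a k * (\<bar>poly P (cos (\<tau> + 2 * pi * real k / real ((L + 4) * n)))\<bar> /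
          (1 + real ((L + 4) * n) * \<bar>\<theta> - arccos (cos (\<tau> + 2 * pi * real k / real ((L + 4) * n)))\<bar>) ^ L))"
      using fin unfolding t_def m_def by blast
  qed
qed

section \<open>Integrals of Jacobi weights against localized kernels\<close>

lemma nn_integral_inverse_one_plus_square:
  "(\<integral>\<^sup>+u. ennreal (1 / (1 + u\<^sup>2)) \<partial>lborel) \<le> ennreal pi"
proof -
  have pos: "(\<integral>\<^sup>+u. ennreal (1 / (1 + u\<^sup>2)) * indicator {0..} u \<partial>lborel) = ennreal (pi / 2 - arctan 0)"
  proof (rule nn_integral_FTC_atLeast)
    show "DERIV arctan x :> 1 / (1 + x\<^sup>2)" for x :: real
      by (auto intro!: derivative_eq_intros simp: field_simps)
  qed (auto intro!: tendsto_arctan_at_top)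
  have "(\<integral>\<^sup>+u. ennreal (1 / (1 + u\<^sup>2)) \<partial>lborel) \<le>
      (\<integral>\<^sup>+u. ennreal (1 / (1 + u\<^sup>2)) * indicator {0..} u + ennreal (1 / (1 + u\<^sup>2)) * indicator {0..} (0 + (-1) * u) \<partial>lborel)"
    by (intro nn_integral_mono) (auto simp: indicator_def)
  also have "\<dots> = ennreal (pi / 2) + (\<integral>\<^sup>+u. ennreal (1 / (1 + (0 + (-1) * u)\<^sup>2)) * indicator {0..} (0 + (-1) * u) \<partial>lborel)"
    using pos by (subst nn_integral_add) auto
  also have "(\<integral>\<^sup>+u. ennreal (1 / (1 + (0 + (-1) * u)\<^sup>2)) * indicator {0..} (0 + (-1) * u) \<partial>lborel) = ennreal (pi / 2)"
    using nn_integral_real_affine[of "\<lambda>u. ennreal (1 / (1 + u\<^sup>2)) * indicator {0..} u" "-1" 0] pos by simp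
  finally show ?thesis by (simp flip: ennreal_plus)
qed

lemma nn_integral_powr_from_0:
  assumes "0 \<le> a" "a < (1::real)"
  shows "(\<integral>\<^sup>+u. ennreal (u powr (- a)) * indicator {0..1} u \<partial>lborel) = ennreal (1 / (1 - a))"
proof -
  have "((\<lambda>x. x powr (-a)) has_integral (1 powr (-a + 1) / (-a + 1))) {0..1::real}"
    using assms by (intro has_integral_powr_from_0) auto
  from nn_integral_has_integral_lebesgue'[OF _ this] show ?thesis by simp
qed

lemma nn_integral_scaled_powr:
  assumes "0 \<le> a" "a < (1::real)" "c \<noteq> 0"
  shows "ennreal \<bar>c\<bar> * (\<integral>\<^sup>+\<theta>. ennreal ((t + c * \<theta>) powr (- a)) * indicator {0..1} (t + c * \<theta>) \<partial>lborel) = ennreal (1 / (1 - a))"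
  using nn_integral_real_affine[of "\<lambda>u. ennreal (u powr (- a)) * indicator {0..1} u" c t]
    nn_integral_powr_from_0[OF assms(1,2)] assms(3) by simp

text \<open>For u \<ge> 1 the power is at most 1; this separates the singularity at 0 from a bounded
  part.\<close>

lemma powr_minus_split:
  assumes "0 \<le> a" "0 \<le> (u::real)"
  shows "u powr (- a) \<le> 1 + u powr (- a) * indicator {0..1} u"
proof (cases "u \<le> 1")
  case False
  then have "u powr (- a) \<le> u powr 0" using assms by (intro powr_mono) auto
  then show ?thesis using False by simp
qed (use assms in auto)

text \<open>Rescaling by m removes m from every integral. The three bounded summands each cost the
  integral pi of 1/(1 + u^2), since (1 + |u|)^2 \<ge> 1 + u^2, and each singularity costs its
  integral over [0,1].\<close>

lemma nn_integral_scaled_weight: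
  assumes a: "0 \<le> a" "a < (1::real)" and b: "0 \<le> b" "b < 1" and m: "m > 0"
  shows "ennreal m * (\<integral>\<^sup>+\<theta>. ennreal ((1 + (m * \<theta>) powr (- a) + (m * (pi - \<theta>)) powr (- b)) / (1 + m * \<bar>\<theta> - s\<bar>)\<^sup>2)
      * indicator {0<..<pi} \<theta> \<partial>lborel) \<le> ennreal (3 * pi + 1 / (1 - a) + 1 / (1 - b))"
proof -
  define F1 F2 F3 where
    "F1 = (\<lambda>\<theta>. ennreal (1 / (1 + (- m * s + m * \<theta>)\<^sup>2)))" and
    "F2 = (\<lambda>\<theta>. ennreal ((0 + m * \<theta>) powr (- a)) * indicator {0..1} (0 + m * \<theta>))" and
    "F3 = (\<lambda>\<theta>. ennreal ((m * pi + (- m) * \<theta>) powr (- b)) * indicator {0..1} (m * pi + (- m) * \<theta>))"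
  have meas: "F1 \<in> borel_measurable borel" "F2 \<in> borel_measurable borel" "F3 \<in> borel_measurable borel"
    unfolding F1_def F2_def F3_def by measurable
  have pw: "ennreal ((1 + (m * \<theta>) powr (- a) + (m * (pi - \<theta>)) powr (- b)) / (1 + m * \<bar>\<theta> - s\<bar>)\<^sup>2)
      * indicator {0<..<pi} \<theta> \<le> ennreal 3 * F1 \<theta> + F2 \<theta> + F3 \<theta>" for \<theta>
  proof (cases "\<theta> \<in> {0<..<pi}")
    case True
    define N where "N = (1 + m * \<bar>\<theta> - s\<bar>)\<^sup>2"
    have "0 \<le> m * \<bar>\<theta> - s\<bar>" using m by simp
    then have N1: "N \<ge> 1 + (- m * s + m * \<theta>)\<^sup>2" 
    proof -
      have "(- m * s + m * \<theta>)\<^sup>2 = (m * \<bar>\<theta> - s\<bar>)\<^sup>2"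
        using m by (simp add: power_mult_distrib power2_eq_square algebra_simps)
      then show ?thesis using \<open>0 \<le> m * \<bar>\<theta> - s\<bar>\<close> by (simp add: N_def power2_sum)
    qed
    have "0 \<le> (- m * s + m * \<theta>)\<^sup>2" by simp
    then have N: "N \<ge> 1" using N1 by linarith
    define x y where "x = (0 + m * \<theta>) powr (- a) * indicator {0..1} (0 + m * \<theta>)"
      and "y = (m * pi + (- m) * \<theta>) powr (- b) * indicator {0..1} (m * pi + (- m) * \<theta>)"
    have x: "(m * \<theta>) powr (- a) \<le> 1 + x" "x \<ge> 0"
      using powr_minus_split[of a "m * \<theta>"] a m True by (auto simp: x_def)
    have "m * (pi - \<theta>) = m * pi + (- m) * \<theta>" by (simp add: algebra_simps)
    then have y: "(m * (pi - \<theta>)) powr (- b) \<le> 1 + y" "y \<ge> 0"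
      using powr_minus_split[of b "m * (pi - \<theta>)"] b m True by (auto simp: y_def)
    have "(1 + (m * \<theta>) powr (- a) + (m * (pi - \<theta>)) powr (- b)) / N \<le> (3 + x + y) / N"
      using x y N by (intro divide_right_mono) auto
    also have "\<dots> = 3 * (1 / N) + x / N + y / N" by (simp add: add_divide_distrib)
    also have "\<dots> \<le> 3 * (1 / (1 + (- m * s + m * \<theta>)\<^sup>2)) + x / 1 + y / 1"
    proof (intro add_mono mult_left_mono divide_left_mono N1)
      show "0 < N * (1 + (- m * s + m * \<theta>)\<^sup>2)" using N by (intro mult_pos_pos add_pos_nonneg) auto
    qed (use x y N in auto)
    finally have "ennreal ((1 + (m * \<theta>) powr (- a) + (m * (pi - \<theta>)) powr (- b)) / N) \<le>
       ennreal (3 * (1 / (1 + (- m * s + m * \<theta>)\<^sup>2)) + x + y)" by (intro ennreal_leI) simp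
    also have "\<dots> = ennreal 3 * F1 \<theta> + F2 \<theta> + F3 \<theta>"
    proof -
      have "F2 \<theta> = ennreal x" by (simp add: F2_def x_def indicator_def)
      moreover have "F3 \<theta> = ennreal y" by (simp add: F3_def y_def indicator_def)
      moreover have "ennreal 3 * F1 \<theta> = ennreal (3 * (1 / (1 + (- m * s + m * \<theta>)\<^sup>2)))"
        unfolding F1_def by (rule ennreal_mult'[symmetric]) simp
      ultimately show ?thesis using x y by (simp add: ennreal_plus add_nonneg_nonneg del: ennreal_plus[symmetric])
    qed
    finally show ?thesis using True by (simp add: N_def)
  qed simp
  have I1: "ennreal m * (\<integral>\<^sup>+\<theta>. F1 \<theta> \<partial>lborel) \<le> ennreal pi"
    using nn_integral_real_affine[of "\<lambda>u. ennreal (1 / (1 + u\<^sup>2))" m "- m * s"] m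
      nn_integral_inverse_one_plus_square by (simp add: F1_def)
  have I2: "ennreal m * (\<integral>\<^sup>+\<theta>. F2 \<theta> \<partial>lborel) = ennreal (1 / (1 - a))"
    using nn_integral_scaled_powr[OF a, of m 0] m by (simp add: F2_def)
  have I3: "ennreal m * (\<integral>\<^sup>+\<theta>. F3 \<theta> \<partial>lborel) = ennreal (1 / (1 - b))"
    using nn_integral_scaled_powr[OF b, of "-m" "m * pi"] m by (simp add: F3_def)
  have "ennreal m * (\<integral>\<^sup>+\<theta>. ennreal ((1 + (m * \<theta>) powr (- a) + (m * (pi - \<theta>)) powr (- b)) / (1 + m * \<bar>\<theta> - s\<bar>)\<^sup>2)
      * indicator {0<..<pi} \<theta> \<partial>lborel) \<le> ennreal m * (\<integral>\<^sup>+\<theta>. ennreal 3 * F1 \<theta> + F2 \<theta> + F3 \<theta> \<partial>lborel)"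
    by (intro mult_left_mono nn_integral_mono pw) simp
  also have "\<dots> = ennreal 3 * (ennreal m * (\<integral>\<^sup>+\<theta>. F1 \<theta> \<partial>lborel)) + ennreal m * (\<integral>\<^sup>+\<theta>. F2 \<theta> \<partial>lborel)
       + ennreal m * (\<integral>\<^sup>+\<theta>. F3 \<theta> \<partial>lborel)"
    using meas by (simp add: nn_integral_add nn_integral_cmult distrib_left mult.left_commute)
  also have "\<dots> \<le> ennreal 3 * ennreal pi + ennreal (1 / (1 - a)) + ennreal (1 / (1 - b))"
    unfolding I2 I3 by (intro add_mono mult_left_mono I1) auto
  also have "\<dots> = ennreal (3 * pi + 1 / (1 - a) + 1 / (1 - b))"
  proof -
    have "ennreal 3 * ennreal pi = ennreal (3 * pi)" by (rule ennreal_mult'[symmetric]) simp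
    moreover have "1 / (1 - a) \<ge> 0" "1 / (1 - b) \<ge> 0" using a b by auto
    ultimately show ?thesis using pi_gt_zero by (simp only: ennreal_plus add_nonneg_nonneg less_imp_le mult_nonneg_nonneg zero_le_numeral)
  qed
  finally show ?thesis .
qed

section \<open>Comparison of Jacobi weights at two angles\<close>

text \<open>For A \<ge> 0 the reason is \<theta> \<le> s + |\<theta> - s|, where s is at least c/m.
  For A < 0 it is s \<le> \<theta> + |\<theta> - s|, and what blows up as \<theta> tends to 0 is
  collected in the power (m \<theta>)^A.\<close>

lemma powr_ratio_bound:
  fixes A :: real
  assumes c: "c > 0"
  shows "\<exists>C>0. \<forall>m \<theta> s. m > 0 \<longrightarrow> \<theta> > 0 \<longrightarrow> s > 0 \<longrightarrow> c \<le> m * s \<longrightarrow>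
     \<theta> powr A \<le> C * (s powr A * (1 + m * \<bar>\<theta> - s\<bar>) powr \<bar>A\<bar> * (1 + (m * \<theta>) powr (- max 0 (- A))))"
proof (cases "A \<ge> 0")
  case True
  define C where "C = (1 + 1 / c) powr A"
  have C: "C > 0" using c by (simp add: C_def add_pos_pos less_imp_neq[symmetric])
  show ?thesis
  proof (intro exI[of _ C] conjI C allI impI)
    fix m \<theta> s :: real assume *: "m > 0" "\<theta> > 0" "s > 0" "c \<le> m * s"
    have "\<theta> \<le> s + \<bar>\<theta> - s\<bar>" by simp
    also have "\<bar>\<theta> - s\<bar> \<le> s * ((1 / c) * (m * \<bar>\<theta> - s\<bar>))"
    proof -
      have "c * \<bar>\<theta> - s\<bar> \<le> (m * s) * \<bar>\<theta> - s\<bar>" using * by (intro mult_right_mono) auto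
      then show ?thesis using c by (simp add: field_simps)
    qed
    also have "s + s * ((1 / c) * (m * \<bar>\<theta> - s\<bar>)) \<le> s * ((1 + 1 / c) * (1 + m * \<bar>\<theta> - s\<bar>))"
    proof -
      have "1 + (1 / c) * (m * \<bar>\<theta> - s\<bar>) \<le> (1 + 1 / c) * (1 + m * \<bar>\<theta> - s\<bar>)"
        using c * by (simp add: algebra_simps)
      then have "s * (1 + (1 / c) * (m * \<bar>\<theta> - s\<bar>)) \<le> s * ((1 + 1 / c) * (1 + m * \<bar>\<theta> - s\<bar>))"
        using * by (intro mult_left_mono) auto
      then show ?thesis by (simp add: distrib_left)
    qed
    finally have "\<theta> powr A \<le> (s * ((1 + 1 / c) * (1 + m * \<bar>\<theta> - s\<bar>))) powr A"
      using * True by (intro powr_mono2) auto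
    also have "\<dots> = s powr A * (C * (1 + m * \<bar>\<theta> - s\<bar>) powr A)"
      using * c by (simp add: powr_mult C_def)
    also have "\<dots> = C * (s powr A * (1 + m * \<bar>\<theta> - s\<bar>) powr \<bar>A\<bar> * 1)" using True by simp
    also have "\<dots> \<le> C * (s powr A * (1 + m * \<bar>\<theta> - s\<bar>) powr \<bar>A\<bar> * (1 + (m * \<theta>) powr (- max 0 (- A))))"
      using C by (intro mult_left_mono) auto
    finally show "\<theta> powr A \<le> C * (s powr A * (1 + m * \<bar>\<theta> - s\<bar>) powr \<bar>A\<bar> * (1 + (m * \<theta>) powr (- max 0 (- A))))" .
  qed
next
  case False
  define a where "a = - A"
  have a: "a > 0" "\<bar>A\<bar> = a" "max 0 (-A) = a" "A = - a" using False by (auto simp: a_def)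
  define C where "C = 2 powr a"
  have C: "C > 0" by (simp add: C_def)
  show ?thesis
  proof (intro exI[of _ C] conjI C allI impI)
    fix m \<theta> s :: real assume *: "m > 0" "\<theta> > 0" "s > 0" "c \<le> m * s"
    define D where "D = m * \<bar>\<theta> - s\<bar>"
    define v where "v = m * \<theta>"
    have D: "D \<ge> 0" and v: "v > 0" using * by (auto simp: D_def v_def)
    have "s \<le> \<theta> + \<bar>\<theta> - s\<bar>" by simp
    also have "\<bar>\<theta> - s\<bar> = \<theta> * (D * (1 / v))" using * by (simp add: D_def v_def)
    also have "\<theta> + \<theta> * (D * (1 / v)) = \<theta> * (1 + D * (1 / v))" by (simp add: distrib_left)
    also have "\<dots> \<le> \<theta> * ((1 + D) * (1 + 1 / v))"
    proof (intro mult_left_mono)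
      have "0 \<le> 1 / v" using v by simp
      then show "1 + D * (1 / v) \<le> (1 + D) * (1 + 1 / v)" using D unfolding distrib_left distrib_right by linarith
    qed (use * in auto)
    finally have "s powr a \<le> (\<theta> * ((1 + D) * (1 + 1 / v))) powr a"
      using * a by (intro powr_mono2) auto
    also have "\<dots> = \<theta> powr a * ((1 + D) powr a * (1 + 1 / v) powr a)"
      using * D v by (simp add: powr_mult)
    \<comment> \<open>The base is at most 2 for v \<ge> 1 and at most 2/v for v < 1.\<close>
    also have "(1 + 1 / v) powr a \<le> C * (1 + v powr (- a))"
    proof (cases "v \<ge> 1")
      case True
      then have "(1 + 1 / v) powr a \<le> 2 powr a" using a v by (intro powr_mono2) auto
      also have "\<dots> \<le> C * (1 + v powr (- a))" by (simp add: C_def)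
      finally show ?thesis .
    next
      case False
      then have "1 \<le> 1 / v" using v by simp
      then have "(1 + 1 / v) powr a \<le> (2 * (1 / v)) powr a" using a v by (intro powr_mono2) linarith+
      also have "\<dots> = C * v powr (- a)" using v by (simp add: powr_mult C_def powr_divide powr_minus_divide)
      also have "\<dots> \<le> C * (1 + v powr (- a))" by (simp add: C_def)
      finally show ?thesis .
    qed
    then have "\<theta> powr a * ((1 + D) powr a * (1 + 1 / v) powr a) \<le> \<theta> powr a * ((1 + D) powr a * (C * (1 + v powr (- a))))"
      by (intro mult_left_mono) auto
    finally have "s powr a \<le> \<theta> powr a * ((1 + D) powr a * (C * (1 + v powr (- a))))" .
    then have "\<theta> powr (- a) \<le> C * (s powr (- a) * (1 + D) powr a * (1 + v powr (- a)))"
      using * by (simp add: powr_minus divide_simps mult_ac)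
    then show "\<theta> powr A \<le> C * (s powr A * (1 + m * \<bar>\<theta> - s\<bar>) powr \<bar>A\<bar> * (1 + (m * \<theta>) powr (- max 0 (- A))))"
      using a(1) by (simp add: a(4) D_def v_def max_absorb2)
  qed
qed

lemma powr_comparable:
  fixes a b s :: real
  assumes "0 < a" "0 < b"
  shows "\<exists>C>0. \<forall>x y. 0 < y \<longrightarrow> a * y \<le> x \<longrightarrow> x \<le> b * y \<longrightarrow> x powr s \<le> C * y powr s \<and> y powr s \<le> C * x powr s"
proof -
  define C where "C = a powr s + b powr s + a powr (-s) + b powr (-s)"
  have C: "C > 0" using assms by (auto simp: C_def intro!: add_pos_nonneg)
  have le: "x powr t \<le> (a powr t + b powr t) * y powr t" if "0 < y" "a * y \<le> x" "x \<le> b * y" for x y t :: real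
  proof -
    have x: "0 < x" using that assms by (meson mult_pos_pos order_less_le_trans)
    show ?thesis
    proof (cases "t \<ge> 0")
      case True
      then have "x powr t \<le> (b * y) powr t" using that x by (intro powr_mono2) auto
      also have "\<dots> = b powr t * y powr t" using that assms by (simp add: powr_mult)
      also have "\<dots> \<le> (a powr t + b powr t) * y powr t" by (intro mult_right_mono) auto
      finally show ?thesis .
    next
      case False
      then have "x powr t \<le> (a * y) powr t" using that x assms by (intro powr_mono2') auto
      also have "\<dots> = a powr t * y powr t" using that assms by (simp add: powr_mult)
      also have "\<dots> \<le> (a powr t + b powr t) * y powr t" by (intro mult_right_mono) auto
      finally show ?thesis .
    qed
  qed
  show ?thesis
  proof (intro exI[of _ C] conjI C allI impI)
    fix x y :: real assume *: "0 < y" "a * y \<le> x" "x \<le> b * y"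
    have x: "0 < x" using * assms by (meson mult_pos_pos order_less_le_trans)
    have "x powr s \<le> (a powr s + b powr s) * y powr s" by (rule le[OF *])
    also have "\<dots> \<le> C * y powr s" by (intro mult_right_mono) (auto simp: C_def)
    finally show "x powr s \<le> C * y powr s" .
    have "x powr (-s) \<le> (a powr (-s) + b powr (-s)) * y powr (-s)" by (rule le[OF *])
    also have "\<dots> \<le> C * y powr (-s)" by (intro mult_right_mono) (auto simp: C_def)
    finally show "y powr s \<le> C * x powr s"
      using x * by (simp add: powr_minus divide_simps mult_ac)
  qed
qed

lemma one_minus_cos_bounds:
  assumes "0 < \<theta>" "\<theta> < pi"
  shows "(2 / pi\<^sup>2) * \<theta>\<^sup>2 \<le> 1 - cos \<theta>" "1 - cos \<theta> \<le> (1/2) * \<theta>\<^sup>2"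
proof -
  have "\<theta> / pi \<le> sin (\<theta> / 2)" using sin_ge_two_over_pi[of "\<theta> / 2"] assms by simp
  then have "(\<theta> / pi)\<^sup>2 \<le> (sin (\<theta> / 2))\<^sup>2" using assms by (intro power_mono) auto
  then show "(2 / pi\<^sup>2) * \<theta>\<^sup>2 \<le> 1 - cos \<theta>" unfolding one_minus_cos by (simp add: power_divide)
  have "(sin (\<theta> / 2))\<^sup>2 \<le> (\<theta> / 2)\<^sup>2" using assms sin_x_le_x[of "\<theta> / 2"]
    by (intro power_mono) (auto intro!: sin_ge_zero)
  then show "1 - cos \<theta> \<le> (1/2) * \<theta>\<^sup>2" unfolding one_minus_cos by (simp add: power_divide)
qed

lemma one_minus_cos_powr_comparable:
  "\<exists>C>0. \<forall>\<theta>. 0 < \<theta> \<longrightarrow> \<theta> < pi \<longrightarrow> (1 - cos \<theta>) powr a \<le> C * \<theta> powr (2 * a) \<and> \<theta> powr (2 * a) \<le> C * (1 - cos \<theta>) powr a"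
proof -
  obtain C where C: "C > 0" "\<And>x y. 0 < y \<Longrightarrow> (2 / pi\<^sup>2) * y \<le> x \<Longrightarrow> x \<le> (1/2) * y \<Longrightarrow> x powr a \<le> C * y powr a \<and> y powr a \<le> C * x powr a"
    using powr_comparable[of "2 / pi\<^sup>2" "1/2" a] by auto
  have eq: "(\<theta>\<^sup>2) powr a = \<theta> powr (2 * a)" if "\<theta> > 0" for \<theta> :: real
    using that by (metis powr_powr powr_numeral less_imp_le)
  show ?thesis
  proof (intro exI[of _ C] conjI C(1) allI impI)
    fix \<theta> assume *: "0 < \<theta>" "\<theta> < pi"
    have 1: "0 < \<theta>\<^sup>2" using * by simp
    show "(1 - cos \<theta>) powr a \<le> C * \<theta> powr (2 * a)" "\<theta> powr (2 * a) \<le> C * (1 - cos \<theta>) powr a"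
      using C(2)[OF 1 one_minus_cos_bounds[OF *]] unfolding eq[OF *(1)] by auto
  qed
qed

text \<open>In the angle, 1 - cos \<theta> is comparable to \<theta>^2, and 1 + cos \<theta> is the
  same function of pi - \<theta>.\<close>

lemma jacobi_weight_cos_comparable:
  "\<exists>C>0. \<forall>\<theta>. 0 < \<theta> \<longrightarrow> \<theta> < pi \<longrightarrow>
     jacobi_weight a b (cos \<theta>) \<le> C * (\<theta> powr (2 * a) * (pi - \<theta>) powr (2 * b)) \<and>
     \<theta> powr (2 * a) * (pi - \<theta>) powr (2 * b) \<le> C * jacobi_weight a b (cos \<theta>)"
proof -
  obtain C1 where C1: "C1 > 0" "\<And>\<theta>. 0 < \<theta> \<Longrightarrow> \<theta> < pi \<Longrightarrow> (1 - cos \<theta>) powr a \<le> C1 * \<theta> powr (2 * a) \<and> \<theta> powr (2 * a) \<le> C1 * (1 - cos \<theta>) powr a"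
    using one_minus_cos_powr_comparable[of a] by auto
  obtain C2 where C2: "C2 > 0" "\<And>\<theta>. 0 < \<theta> \<Longrightarrow> \<theta> < pi \<Longrightarrow> (1 - cos \<theta>) powr b \<le> C2 * \<theta> powr (2 * b) \<and> \<theta> powr (2 * b) \<le> C2 * (1 - cos \<theta>) powr b"
    using one_minus_cos_powr_comparable[of b] by auto
  show ?thesis
  proof (intro exI[of _ "C1 * C2"] conjI allI impI)
    fix \<theta> assume *: "0 < \<theta>" "\<theta> < pi"
    have e: "1 - cos (pi - \<theta>) = 1 + cos \<theta>" by simp
    have 1: "(1 - cos \<theta>) powr a \<le> C1 * \<theta> powr (2 * a)" "\<theta> powr (2 * a) \<le> C1 * (1 - cos \<theta>) powr a"
      using C1(2)[OF *] by auto
    have 2: "(1 + cos \<theta>) powr b \<le> C2 * (pi - \<theta>) powr (2 * b)" "(pi - \<theta>) powr (2 * b) \<le> C2 * (1 + cos \<theta>) powr b"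
      using C2(2)[of "pi - \<theta>"] * unfolding e by auto
    show "jacobi_weight a b (cos \<theta>) \<le> C1 * C2 * (\<theta> powr (2 * a) * (pi - \<theta>) powr (2 * b))"
      using mult_mono[OF 1(1) 2(1)] C1(1) by (simp add: jacobi_weight_def mult_ac)
    show "\<theta> powr (2 * a) * (pi - \<theta>) powr (2 * b) \<le> C1 * C2 * jacobi_weight a b (cos \<theta>)"
      using mult_mono[OF 1(2) 2(2)] C1(1) by (simp add: jacobi_weight_def mult_ac)
  qed (use C1 C2 in auto)
qed

text \<open>Moves the weight from \<theta> to a node s. The price is a power of 1 + m |\<theta> -
  s|, which the decay of the kernel will pay, together with the singular factors at the two
  ends.\<close>

lemma jacobi_weight_cos_ratio:
  fixes a b :: real
  assumes c: "c > 0"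
  shows "\<exists>C>0. \<forall>m \<theta> s. m \<ge> 1 \<longrightarrow> 0 < \<theta> \<longrightarrow> \<theta> < pi \<longrightarrow> 0 < s \<longrightarrow> s < pi \<longrightarrow> c \<le> m * s \<longrightarrow> c \<le> m * (pi - s) \<longrightarrow>
     jacobi_weight a b (cos \<theta>) \<le> C * (jacobi_weight a b (cos s) * (1 + m * \<bar>\<theta> - s\<bar>) powr (2 * \<bar>a\<bar> + 2 * \<bar>b\<bar>) *
        (1 + (m * \<theta>) powr (- max 0 (- (2 * a))) + (m * (pi - \<theta>)) powr (- max 0 (- (2 * b)))))"
proof -
  obtain K where K: "K > 0" "\<And>\<theta>. 0 < \<theta> \<Longrightarrow> \<theta> < pi \<Longrightarrow>
     jacobi_weight a b (cos \<theta>) \<le> K * (\<theta> powr (2 * a) * (pi - \<theta>) powr (2 * b)) \<and>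
     \<theta> powr (2 * a) * (pi - \<theta>) powr (2 * b) \<le> K * jacobi_weight a b (cos \<theta>)"
    using jacobi_weight_cos_comparable[of a b] by auto
  obtain C1 where C1: "C1 > 0" "\<And>m \<theta> s. m > 0 \<Longrightarrow> \<theta> > 0 \<Longrightarrow> s > 0 \<Longrightarrow> c \<le> m * s \<Longrightarrow>
     \<theta> powr (2*a) \<le> C1 * (s powr (2*a) * (1 + m * \<bar>\<theta> - s\<bar>) powr \<bar>2*a\<bar> * (1 + (m * \<theta>) powr (- max 0 (- (2*a)))))"
    using powr_ratio_bound[OF c, of "2 * a"] by auto
  obtain C2 where C2: "C2 > 0" "\<And>m \<theta> s. m > 0 \<Longrightarrow> \<theta> > 0 \<Longrightarrow> s > 0 \<Longrightarrow> c \<le> m * s \<Longrightarrow>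
     \<theta> powr (2*b) \<le> C2 * (s powr (2*b) * (1 + m * \<bar>\<theta> - s\<bar>) powr \<bar>2*b\<bar> * (1 + (m * \<theta>) powr (- max 0 (- (2*b)))))"
    using powr_ratio_bound[OF c, of "2 * b"] by auto
  define C where "C = K * (C1 * C2) * K * 2"
  have C: "C > 0" using K C1 C2 by (simp add: C_def)
  show ?thesis
  proof (intro exI[of _ C] conjI C allI impI)
    fix m \<theta> s :: real
    assume *: "m \<ge> 1" "0 < \<theta>" "\<theta> < pi" "0 < s" "s < pi" "c \<le> m * s" "c \<le> m * (pi - s)"
    define D x y where "D = 1 + m * \<bar>\<theta> - s\<bar>" and "x = (m * \<theta>) powr (- max 0 (- (2 * a)))"
      and "y = (m * (pi - \<theta>)) powr (- max 0 (- (2 * b)))"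
    have D: "D > 0" using * by (auto simp: D_def intro!: add_pos_nonneg)
    have xy: "x \<ge> 0" "y \<ge> 0" by (auto simp: x_def y_def)
    have 1: "\<theta> powr (2*a) \<le> C1 * (s powr (2*a) * D powr \<bar>2*a\<bar> * (1 + x))"
      using C1(2)[of m \<theta> s] * by (simp add: D_def x_def)
    have "\<bar>(pi - \<theta>) - (pi - s)\<bar> = \<bar>\<theta> - s\<bar>" by simp
    then have 2: "(pi - \<theta>) powr (2*b) \<le> C2 * ((pi - s) powr (2*b) * D powr \<bar>2*b\<bar> * (1 + y))"
      using C2(2)[of m "pi - \<theta>" "pi - s"] * by (simp add: D_def y_def)
    \<comment> \<open>The singular factors can be added instead of multiplied: \<theta> and pi -
      \<theta> are not both below 1, so at least one of x and y is at most 1.\<close>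
    have 3: "(1 + x) * (1 + y) \<le> 2 * (1 + x + y)"
    proof (cases "\<theta> \<ge> 1")
      case True
      have "1 * 1 \<le> m * \<theta>" using True * by (intro mult_mono) auto
      then have "x \<le> 1 powr (- max 0 (- (2 * a)))"
        unfolding x_def by (intro powr_mono2') auto
      then have "x \<le> 1" by simp
      then have "x * y \<le> 1 * y" using xy by (intro mult_right_mono) auto
      then show ?thesis using xy by (simp add: algebra_simps)
    next
      case False
      have "pi > 3" by (rule pi_gt3)
      then have "1 * 1 \<le> m * (pi - \<theta>)" using False * by (intro mult_mono) auto
      then have "y \<le> 1 powr (- max 0 (- (2 * b)))"
        unfolding y_def by (intro powr_mono2') auto
      then have "y \<le> 1" by simp
      then have "x * y \<le> x * 1" using xy by (intro mult_left_mono) auto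
      then show ?thesis using xy by (simp add: algebra_simps)
    qed
    have "jacobi_weight a b (cos \<theta>) \<le> K * (\<theta> powr (2 * a) * (pi - \<theta>) powr (2 * b))" using K * by auto
    also have "\<dots> \<le> K * ((C1 * (s powr (2*a) * D powr \<bar>2*a\<bar> * (1 + x))) * (C2 * ((pi - s) powr (2*b) * D powr \<bar>2*b\<bar> * (1 + y))))"
      using K 1 2 C1 xy by (intro mult_left_mono mult_mono) auto
    also have "\<dots> = K * (C1 * C2) * ((s powr (2*a) * (pi - s) powr (2*b)) * (D powr \<bar>2*a\<bar> * D powr \<bar>2*b\<bar>) * ((1 + x) * (1 + y)))"
      by (simp add: mult_ac)
    also have "D powr \<bar>2*a\<bar> * D powr \<bar>2*b\<bar> = D powr (2 * \<bar>a\<bar> + 2 * \<bar>b\<bar>)" by (simp add: powr_add abs_mult)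
    also have "K * (C1 * C2) * ((s powr (2*a) * (pi - s) powr (2*b)) * D powr (2 * \<bar>a\<bar> + 2 * \<bar>b\<bar>) * ((1 + x) * (1 + y))) \<le>
      K * (C1 * C2) * ((K * jacobi_weight a b (cos s)) * D powr (2 * \<bar>a\<bar> + 2 * \<bar>b\<bar>) * (2 * (1 + x + y)))"
    proof (rule mult_left_mono)
      have X: "s powr (2*a) * (pi - s) powr (2*b) \<le> K * jacobi_weight a b (cos s)" using K * by auto
      have J: "0 \<le> K * jacobi_weight a b (cos s)" using K by (simp add: jacobi_weight_def)
      have "s powr (2*a) * (pi - s) powr (2*b) * D powr (2 * \<bar>a\<bar> + 2 * \<bar>b\<bar>) \<le>
          (K * jacobi_weight a b (cos s)) * D powr (2 * \<bar>a\<bar> + 2 * \<bar>b\<bar>)"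
        by (rule mult_right_mono[OF X]) simp
      then show "(s powr (2*a) * (pi - s) powr (2*b)) * D powr (2 * \<bar>a\<bar> + 2 * \<bar>b\<bar>) * ((1 + x) * (1 + y)) \<le>
        (K * jacobi_weight a b (cos s)) * D powr (2 * \<bar>a\<bar> + 2 * \<bar>b\<bar>) * (2 * (1 + x + y))"
        by (rule mult_mono[OF _ 3]) (use J xy in auto)
      show "0 \<le> K * (C1 * C2)" using K C1 C2 by simp
    qed
    also have "\<dots> = C * (jacobi_weight a b (cos s) * D powr (2 * \<bar>a\<bar> + 2 * \<bar>b\<bar>) * (1 + x + y))"
      by (simp add: C_def mult_ac)
    finally show "jacobi_weight a b (cos \<theta>) \<le> C * (jacobi_weight a b (cos s) * (1 + m * \<bar>\<theta> - s\<bar>) powr (2 * \<bar>a\<bar> + 2 * \<bar>b\<bar>) *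
        (1 + (m * \<theta>) powr (- max 0 (- (2 * a))) + (m * (pi - \<theta>)) powr (- max 0 (- (2 * b)))))"
      by (simp add: D_def x_def y_def)
  qed
qed

text \<open>Of the L powers of decay, 2|a| + 2|b| compensate the growth of the weight away from s,
  and two make the kernel integrable. The exponents must exceed -1/2 because they are doubled in the
  angle, where \<theta>^(2a) has to be integrable.\<close>

lemma nn_integral_jacobi_weight_kernel:
  fixes a b :: real and L :: nat
  assumes c: "c > 0" and a: "a > -1/2" and b: "b > -1/2" and L: "2 * \<bar>a\<bar> + 2 * \<bar>b\<bar> + 2 \<le> real L"
  shows "\<exists>C>0. \<forall>m s. m \<ge> 1 \<longrightarrow> 0 < s \<longrightarrow> s < pi \<longrightarrow> c \<le> m * s \<longrightarrow> c \<le> m * (pi - s) \<longrightarrow>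
     ennreal m * (\<integral>\<^sup>+\<theta>. ennreal (jacobi_weight a b (cos \<theta>) / (1 + m * \<bar>\<theta> - s\<bar>) ^ L) * indicator {0<..<pi} \<theta> \<partial>lborel)
       \<le> ennreal (C * jacobi_weight a b (cos s))"
proof -
  define a' b' where "a' = max 0 (- (2 * a))" and "b' = max 0 (- (2 * b))"
  have a': "0 \<le> a'" "a' < 1" and b': "0 \<le> b'" "b' < 1" using a b by (auto simp: a'_def b'_def)
  obtain K where K: "K > 0" "\<And>m \<theta> s. m \<ge> 1 \<Longrightarrow> 0 < \<theta> \<Longrightarrow> \<theta> < pi \<Longrightarrow> 0 < s \<Longrightarrow> s < pi \<Longrightarrow> c \<le> m * s \<Longrightarrow> c \<le> m * (pi - s) \<Longrightarrow>
     jacobi_weight a b (cos \<theta>) \<le> K * (jacobi_weight a b (cos s) * (1 + m * \<bar>\<theta> - s\<bar>) powr (2 * \<bar>a\<bar> + 2 * \<bar>b\<bar>) *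
        (1 + (m * \<theta>) powr (- a') + (m * (pi - \<theta>)) powr (- b')))"
    using jacobi_weight_cos_ratio[OF c, of a b] unfolding a'_def b'_def by blast
  define I where "I = 3 * pi + 1 / (1 - a') + 1 / (1 - b')"
  have I: "I > 0" using a' b' by (auto simp: I_def intro!: add_pos_pos)
  show ?thesis
  proof (intro exI[of _ "K * I"] conjI allI impI)
    fix m s :: real assume *: "m \<ge> 1" "0 < s" "s < pi" "c \<le> m * s" "c \<le> m * (pi - s)"
    define J where "J = jacobi_weight a b (cos s)"
    have J: "J \<ge> 0" by (simp add: J_def jacobi_weight_def)
    define E where "E = (\<lambda>\<theta>. (1 + (m * \<theta>) powr (- a') + (m * (pi - \<theta>)) powr (- b')) / (1 + m * \<bar>\<theta> - s\<bar>)\<^sup>2)"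
    have E: "E \<in> borel_measurable borel" unfolding E_def by measurable
    have pw: "jacobi_weight a b (cos \<theta>) / (1 + m * \<bar>\<theta> - s\<bar>) ^ L \<le> (K * J) * E \<theta>" if t: "\<theta> \<in> {0<..<pi}" for \<theta>
    proof -
      define D T where "D = 1 + m * \<bar>\<theta> - s\<bar>" and "T = 1 + (m * \<theta>) powr (- a') + (m * (pi - \<theta>)) powr (- b')"
      have D: "D \<ge> 1" using * by (simp add: D_def)
      have T: "T \<ge> 0" by (simp add: T_def add_nonneg_nonneg)
      have "jacobi_weight a b (cos \<theta>) / D ^ L \<le> (K * (J * D powr (2 * \<bar>a\<bar> + 2 * \<bar>b\<bar>) * T)) / D ^ L"
        using K(2)[of m \<theta> s] * t D by (intro divide_right_mono) (auto simp: D_def T_def J_def)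
      also have "\<dots> = (K * J * T) * (D powr (2 * \<bar>a\<bar> + 2 * \<bar>b\<bar>) / D powr real L)"
        using D by (simp add: powr_realpow mult_ac)
      also have "D powr (2 * \<bar>a\<bar> + 2 * \<bar>b\<bar>) / D powr real L = D powr (2 * \<bar>a\<bar> + 2 * \<bar>b\<bar> - real L)"
        by (simp add: powr_diff)
      also have "(K * J * T) * D powr (2 * \<bar>a\<bar> + 2 * \<bar>b\<bar> - real L) \<le> (K * J * T) * D powr (- 2)"
        using K J T D L by (intro mult_left_mono powr_mono) auto
      also have "D powr (-2) = 1 / D\<^sup>2" using D by (simp add: powr_minus_divide powr_numeral)
      finally show ?thesis by (simp add: E_def D_def T_def)
    qed
    have "ennreal m * (\<integral>\<^sup>+\<theta>. ennreal (jacobi_weight a b (cos \<theta>) / (1 + m * \<bar>\<theta> - s\<bar>) ^ L) * indicator {0<..<pi} \<theta> \<partial>lborel)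
      \<le> ennreal m * (\<integral>\<^sup>+\<theta>. ennreal (K * J) * (ennreal (E \<theta>) * indicator {0<..<pi} \<theta>) \<partial>lborel)"
    proof (intro mult_left_mono nn_integral_mono)
      fix \<theta> :: real
      have "ennreal (jacobi_weight a b (cos \<theta>) / (1 + m * \<bar>\<theta> - s\<bar>) ^ L) \<le> ennreal (K * J) * ennreal (E \<theta>)" if "\<theta> \<in> {0<..<pi}"
        using ennreal_leI[OF pw[OF that]] K J by (simp add: ennreal_mult')
      then show "ennreal (jacobi_weight a b (cos \<theta>) / (1 + m * \<bar>\<theta> - s\<bar>) ^ L) * indicator {0<..<pi} \<theta>
        \<le> ennreal (K * J) * (ennreal (E \<theta>) * indicator {0<..<pi} \<theta>)"
        by (cases "\<theta> \<in> {0<..<pi}") auto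
    qed auto
    also have "\<dots> = ennreal (K * J) * (ennreal m * (\<integral>\<^sup>+\<theta>. ennreal (E \<theta>) * indicator {0<..<pi} \<theta> \<partial>lborel))"
      using E by (subst nn_integral_cmult) (auto simp: mult_ac)
    also have "\<dots> \<le> ennreal (K * J) * ennreal I"
      using nn_integral_scaled_weight[OF a' b', of m s] * by (intro mult_left_mono) (auto simp: E_def I_def)
    also have "\<dots> = ennreal (K * I * J)" using K J I by (simp add: ennreal_mult'[symmetric] mult_ac)
    finally show "ennreal m * (\<integral>\<^sup>+\<theta>. ennreal (jacobi_weight a b (cos \<theta>) / (1 + m * \<bar>\<theta> - s\<bar>) ^ L) * indicator {0<..<pi} \<theta> \<partial>lborel)
       \<le> ennreal (K * I * jacobi_weight a b (cos s))" by (simp add: J_def)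
  qed (use K I in auto)
qed

section \<open>The substitution x = cos \<theta>\<close>

text \<open>Reflecting x first allows -cos, which increases on [0,pi], to be substituted; the
  endpoints form a null set.\<close>

lemma nn_integral_cos_substitution:
  fixes f :: "real \<Rightarrow> ennreal"
  assumes f: "f \<in> borel_measurable borel"
  shows "(\<integral>\<^sup>+x. f x * indicator {-1<..<1} x \<partial>lborel) = (\<integral>\<^sup>+\<theta>. f (cos \<theta>) * ennreal (sin \<theta>) * indicator {0<..<pi} \<theta> \<partial>lborel)"
proof -
  have ind: "indicator {-1..1} (- x) = (indicator {-1..1} x :: ennreal)" for x :: real
    by (auto simp: indicator_def)
  have ae: "AE x in lborel. x \<noteq> (a::real)" for a by (rule AE_lborel_singleton)
  have "(\<integral>\<^sup>+x. f x * indicator {-1<..<1} x \<partial>lborel) = (\<integral>\<^sup>+x. f x * indicator {-1..1} x \<partial>lborel)"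
    using ae[of 1] ae[of "-1"] by (intro nn_integral_cong_AE) (auto split: split_indicator elim!: eventually_elim2)
  also have "\<dots> = (\<integral>\<^sup>+x. f (- x) * indicator {-1..1} x \<partial>lborel)"
    using nn_integral_real_affine[of "\<lambda>x. f x * indicator {-1..1} x" "-1" 0] f ind by simp
  also have "\<dots> = (\<integral>\<^sup>+x. f (- x) * indicator {(- cos 0)..(- cos pi)} x \<partial>lborel)" by simp
  also have "\<dots> = (\<integral>\<^sup>+\<theta>. f (- (- cos \<theta>)) * ennreal (sin \<theta>) * indicator {0..pi} \<theta> \<partial>lborel)"
  proof (rule nn_integral_substitution_aux[where g = "\<lambda>x. - cos x" and g' = sin and f = "\<lambda>x. f (- x)"])
    show "(\<lambda>x. f (- x)) \<in> borel_measurable borel" using f by measurable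
    show "((\<lambda>x. - cos x) has_real_derivative sin x) (at x)" for x
      by (auto intro!: derivative_eq_intros)
  qed (auto intro!: continuous_intros sin_ge_zero)
  also have "\<dots> = (\<integral>\<^sup>+\<theta>. f (cos \<theta>) * ennreal (sin \<theta>) * indicator {0<..<pi} \<theta> \<partial>lborel)"
    using ae[of 0] ae[of "pi"] by (intro nn_integral_cong_AE) (auto split: split_indicator elim!: eventually_elim2)
  finally show ?thesis .
qed

text \<open>Absorbs the Jacobian of x = cos \<theta> into the weight, at the cost of 1/2 in each
  exponent.\<close>

lemma sin_eq_jacobi_weight:
  assumes "0 \<le> \<theta>" "\<theta> \<le> pi"
  shows "sin \<theta> = jacobi_weight (1/2) (1/2) (cos \<theta>)"
proof -
  have sq: "(sin \<theta>)\<^sup>2 = (1 - cos \<theta>) * (1 + cos \<theta>)"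
    by (simp add: sin_squared_eq power2_eq_square algebra_simps)
  have nn: "0 \<le> 1 + cos \<theta>" using cos_ge_minus_one[of \<theta>] by linarith
  have "sin \<theta> = sqrt ((1 - cos \<theta>) * (1 + cos \<theta>))"
    using assms sq by (metis real_sqrt_unique sin_ge_zero)
  then show ?thesis by (simp add: jacobi_weight_def powr_half_sqrt real_sqrt_mult nn)
qed

section \<open>The local maximal estimate\<close>

text \<open>Passes from the completed measure on the closed interval to Borel measure on the open
  one, where the weight is finite and positive.\<close>

lemma nn_integral_leb1:
  "(\<integral>\<^sup>+x. f x \<partial>leb1) = (\<integral>\<^sup>+x. f x * indicator {-1<..<1} x \<partial>lborel)"
proof -
  have ae: "AE x in lborel. x \<noteq> (a::real)" for a by (rule AE_lborel_singleton)
  have "(\<integral>\<^sup>+x. f x \<partial>leb1) = (\<integral>\<^sup>+x. f x * indicator {-1..1} x \<partial>lborel)"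
    by (subst nn_integral_restrict_space) (auto simp: nn_integral_completion)
  also have "\<dots> = (\<integral>\<^sup>+x. f x * indicator {-1<..<1} x \<partial>lborel)"
    using ae[of 1] ae[of "-1"] by (intro nn_integral_cong_AE) (auto split: split_indicator elim!: eventually_elim2)
  finally show ?thesis .
qed

lemma AE_leb1_iff: "(AE x in leb1. P x) \<longleftrightarrow> (AE x in lebesgue. x \<in> {-1<..<1} \<longrightarrow> P x)"
proof -
  have ae: "AE x in lebesgue. x \<noteq> (a::real)" for a
    by (rule AE_completion, rule AE_lborel_singleton)
  have "(AE x in leb1. P x) \<longleftrightarrow> (AE x in lebesgue. x \<in> {-1..1} \<longrightarrow> P x)"
    by (rule AE_restrict_space_iff) simp
  also have "\<dots> \<longleftrightarrow> (AE x in lebesgue. x \<in> {-1<..<1} \<longrightarrow> P x)"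
  proof
    assume "AE x in lebesgue. x \<in> {-1<..<1} \<longrightarrow> P x"
    with ae[of 1] ae[of "-1"] show "AE x in lebesgue. x \<in> {-1..1} \<longrightarrow> P x"
      by eventually_elim (auto simp: less_le)
  qed (auto elim!: eventually_mono)
  finally show ?thesis .
qed

lemma AE_leb1I: "(\<And>x. -1 < x \<Longrightarrow> x < 1 \<Longrightarrow> P x) \<Longrightarrow> AE x in leb1. P x"
  unfolding AE_leb1_iff by auto

lemma borel_measurable_leb1I: "f \<in> borel_measurable borel \<Longrightarrow> f \<in> borel_measurable leb1"
  by (intro measurable_restrict_space1 measurable_completion) simp

lemma jacobi_weight_nonneg [simp]: "0 \<le> jacobi_weight a b x"
  by (simp add: jacobi_weight_def)

lemma jacobi_weight_pos: "-1 < x \<Longrightarrow> x < 1 \<Longrightarrow> 0 < jacobi_weight a b x"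
  by (simp add: jacobi_weight_def)

lemma borel_measurable_jacobi_weight [measurable]: "jacobi_weight a b \<in> borel_measurable borel"
  unfolding jacobi_weight_def[abs_def] by measurable

lemma jacobi_weight_powr:
  assumes "-1 \<le> x" "x \<le> 1"
  shows "jacobi_weight a b x powr q = jacobi_weight (q * a) (q * b) x"
  using assms by (simp add: jacobi_weight_def powr_mult powr_powr mult.commute)

lemma jacobi_weight_mult:
  "jacobi_weight a b x * jacobi_weight c d x = jacobi_weight (a + c) (b + d) x"
  by (simp add: jacobi_weight_def powr_add mult_ac)

lemma borel_measurable_poly [measurable]: "poly (P :: real poly) \<in> borel_measurable borel"
  by (intro borel_measurable_continuous_onI continuous_intros)

lemma jacobi_weight_powr_sin:
  assumes "0 < s" "s < pi"
  shows "jacobi_weight \<alpha> \<beta> (cos s) powr q * sin s = jacobi_weight (q * \<alpha> + 1/2) (q * \<beta> + 1/2) (cos s)"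
  using assms sin_eq_jacobi_weight[of s]
  by (simp add: jacobi_weight_powr jacobi_weight_mult)

section \<open>From sums over rotated nodes to integrals over the angle\<close>

text \<open>In units of pi/(4m) the intervals swept by the nodes are [8k+1, 8k+3]. They are pairwise
  disjoint, so that at most one k contributes, and keep a distance of at least 1 from 0, 4m and 8m,
  which stand for the angles 0, pi and 2 pi. On the upper half circle s is its own folding; on the
  lower one the folding is 2 pi - s.\<close>

lemma shifted_nodes_sum_le:
  fixes H :: "real \<Rightarrow> ennreal" and G :: "real \<Rightarrow> ennreal"
  assumes m: "m > (0::nat)"
    and H: "\<And>s. H s = G (arccos (cos s))"
  shows "(\<Sum>k<m. H s * indicator {pi / (4 * real m)..3 * pi / (4 * real m)} (s - 2 * pi * real k / real m))
     \<le> G s * indicator {pi / (4 * real m)..pi - pi / (4 * real m)} s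
     + G (2 * pi - s) * indicator {pi / (4 * real m)..pi - pi / (4 * real m)} (2 * pi - s)"
proof (cases "\<exists>k<m. s - 2 * pi * real k / real m \<in> {pi / (4 * real m)..3 * pi / (4 * real m)}")
  case False
  then have "(\<Sum>k<m. H s * indicator {pi / (4 * real m)..3 * pi / (4 * real m)} (s - 2 * pi * real k / real m)) = 0"
    by (intro sum.neutral) auto
  then show ?thesis by (simp only: zero_le)
next
  case True
  then obtain k where k: "k < m" "s - 2 * pi * real k / real m \<in> {pi / (4 * real m)..3 * pi / (4 * real m)}" by auto
  have m0: "real m > 0" using m by simp
  define x where "x = s * (4 * real m) / pi"
  have s: "s = x * pi / (4 * real m)" using m0 by (simp add: x_def)
  have in_iff: "s - 2 * pi * real j / real m \<in> {pi / (4 * real m)..3 * pi / (4 * real m)} \<longleftrightarrow> x - 8 * real j \<in> {1..3}" for j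
  proof -
    define u where "u = pi / (4 * real m)"
    have u: "u > 0" using m0 by (simp add: u_def)
    have "s - 2 * pi * real j / real m = (x - 8 * real j) * u"
      using m0 by (simp add: s u_def field_simps)
    moreover have "3 * pi / (4 * real m) = 3 * u" "pi / (4 * real m) = 1 * u" by (simp_all add: u_def)
    ultimately show ?thesis unfolding atLeastAtMost_iff using u by (simp only: mult_le_cancel_right_pos)
  qed
  have xk: "x - 8 * real k \<in> {1..3}" using k in_iff by blast
  have uniq: "j = k" if "x - 8 * real j \<in> {1..3}" for j
  proof -
    have "\<bar>8 * real j - 8 * real k\<bar> \<le> 2" using that xk by auto
    then have "\<bar>8 * int j - 8 * int k\<bar> \<le> 2" by linarith
    then show ?thesis by presburger
  qed
  have "(\<Sum>j<m. H s * indicator {pi / (4 * real m)..3 * pi / (4 * real m)} (s - 2 * pi * real j / real m))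
     = (\<Sum>j<m. if j = k then H s else 0)"
  proof (rule sum.cong[OF refl])
    fix j
    have "s - 2 * pi * real j / real m \<in> {pi / (4 * real m)..3 * pi / (4 * real m)} \<longleftrightarrow> j = k"
      using in_iff uniq xk by blast
    then show "H s * indicator {pi / (4 * real m)..3 * pi / (4 * real m)} (s - 2 * pi * real j / real m) = (if j = k then H s else 0)"
      by (simp add: indicator_def del: atLeastAtMost_iff)
  qed
  also have "\<dots> = H s" using k by simp
  finally have eq: "(\<Sum>j<m. H s * indicator {pi / (4 * real m)..3 * pi / (4 * real m)} (s - 2 * pi * real j / real m)) = H s" .
  have pm: "pi / (4 * real m) > 0" using m0 by simp
  have pim: "(4 * real m - 1) * (pi / (4 * real m)) = pi - pi / (4 * real m)"
    "(4 * real m + 1) * (pi / (4 * real m)) = pi + pi / (4 * real m)"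
    "(8 * real m - 1) * (pi / (4 * real m)) = 2 * pi - pi / (4 * real m)"
    using m0 by (simp_all add: field_simps)
  have su: "s = x * (pi / (4 * real m))" by (simp add: s)
  have km: "real k \<le> real m - 1" using k by linarith
  show ?thesis
  proof (cases "2 * k < m")
    case True
    have "x \<le> 4 * real m - 1"
    proof -
      have "2 * k + 1 \<le> m" using True by simp
      then have "2 * real k + 1 \<le> real m" by linarith
      then show ?thesis using xk by simp
    qed
    moreover have "1 \<le> x" using xk by simp
    ultimately have "1 * (pi / (4 * real m)) \<le> s" "s \<le> (4 * real m - 1) * (pi / (4 * real m))"
      unfolding su using pm by (intro mult_right_mono; simp)+
    then have r: "s \<in> {pi / (4 * real m)..pi - pi / (4 * real m)}"
      unfolding pim atLeastAtMost_iff by linarith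
    then have "arccos (cos s) = s" using pm by (intro arccos_cos) auto
    then show ?thesis using r eq H[of s] by simp
  next
    case False
    then have "2 * real k \<ge> real m" by linarith
    then have "x \<ge> 4 * real m + 1" using xk by simp
    moreover have "x \<le> 8 * real m - 1" using xk km by simp
    ultimately have "(4 * real m + 1) * (pi / (4 * real m)) \<le> s" "s \<le> (8 * real m - 1) * (pi / (4 * real m))"
      unfolding su using pm by (intro mult_right_mono; simp)+
    then have r: "2 * pi - s \<in> {pi / (4 * real m)..pi - pi / (4 * real m)}"
      unfolding pim atLeastAtMost_iff by linarith
    then have "arccos (cos (2 * pi - s)) = 2 * pi - s" using pm by (intro arccos_cos) auto
    moreover have "cos (2 * pi - s) = cos s" by (simp add: cos_diff)
    ultimately have "arccos (cos s) = 2 * pi - s" by simp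
    then show ?thesis using r eq H[of s] by simp
  qed
qed

text \<open>Rotating the nodes by all angles in \<open>[\<pi>/(4m), 3\<pi>/(4m)]\<close> turns the sum into an integral and keeps
  the nodes at distance \<open>\<pi>/(4m)\<close> from the angles 0 and \<open>\<pi>\<close>, where the weight may be singular.\<close>

lemma localized_bound_average:
  fixes K :: "real \<Rightarrow> real" and W :: real
  assumes m: "m > (0::nat)" and K: "K \<in> borel_measurable borel" "\<And>s. 0 \<le> K s" and W: "0 \<le> W" and V: "0 \<le> V"
    and le: "\<And>\<tau>. V \<le> W * (\<Sum>k<m. K (arccos (cos (\<tau> + 2 * pi * real k / real m))))"
  shows "ennreal V \<le> ennreal (4 * real m / pi * W) *
     (\<integral>\<^sup>+s. ennreal (K s) * indicator {pi / (4 * real m)..pi - pi / (4 * real m)} s \<partial>lborel)"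
proof -
  have m0: "real m > 0" using m by simp
  define I where "I = {pi / (4 * real m)..3 * pi / (4 * real m)}"
  define A where "A = {pi / (4 * real m)..pi - pi / (4 * real m)}"
  define arc where "arc = (\<lambda>x::real. arccos (cos x))"
  have arc: "arc \<in> borel_measurable borel"
    unfolding arc_def by (intro borel_measurable_continuous_onI continuous_intros) auto
  note [measurable] = arc K(1)
  have [measurable]: "I \<in> sets borel" "A \<in> sets borel" by (auto simp: I_def A_def)
  have Im: "emeasure lborel I = ennreal (pi / (2 * real m))"
  proof -
    have "3 * pi / (4 * real m) - pi / (4 * real m) = pi / (2 * real m)" using m0 by (simp add: field_simps)
    moreover have "pi / (4 * real m) \<le> 3 * pi / (4 * real m)" using m0 by (intro divide_right_mono) auto
    ultimately show ?thesis by (simp add: I_def)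
  qed
  have "ennreal V * ennreal (pi / (2 * real m)) = (\<integral>\<^sup>+\<tau>. ennreal V * indicator I \<tau> \<partial>lborel)"
    by (subst nn_integral_cmult_indicator) (auto simp: Im[symmetric] I_def)
  also have "\<dots> \<le> (\<integral>\<^sup>+\<tau>. ennreal W * (\<Sum>k<m. ennreal (K (arc (2 * pi * real k / real m + 1 * \<tau>))) * indicator I \<tau>) \<partial>lborel)"
  proof (rule nn_integral_mono)
    fix \<tau> :: real
    have "ennreal V \<le> ennreal (W * (\<Sum>k<m. K (arccos (cos (\<tau> + 2 * pi * real k / real m)))))"
      by (rule ennreal_leI[OF le])
    also have "\<dots> = ennreal W * (\<Sum>k<m. ennreal (K (arc (2 * pi * real k / real m + 1 * \<tau>))))"
      using W K by (subst sum_ennreal) (auto simp: ennreal_mult' arc_def add.commute)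
    finally show "ennreal V * indicator I \<tau> \<le> ennreal W * (\<Sum>k<m. ennreal (K (arc (2 * pi * real k / real m + 1 * \<tau>))) * indicator I \<tau>)"
      by (cases "\<tau> \<in> I") auto
  qed
  also have "\<dots> = ennreal W * (\<Sum>k<m. (\<integral>\<^sup>+\<tau>. ennreal (K (arc (2 * pi * real k / real m + 1 * \<tau>))) * indicator I \<tau> \<partial>lborel))"
    by (subst nn_integral_cmult, measurable, subst nn_integral_sum) measurable
  also have "\<dots> = ennreal W * (\<Sum>k<m. (\<integral>\<^sup>+s. ennreal (K (arc s)) * indicator I (s - 2 * pi * real k / real m) \<partial>lborel))"
  proof (intro arg_cong[where f = "\<lambda>x. ennreal W * x"] sum.cong refl)
    fix k
    show "(\<integral>\<^sup>+\<tau>. ennreal (K (arc (2 * pi * real k / real m + 1 * \<tau>))) * indicator I \<tau> \<partial>lborel) =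
      (\<integral>\<^sup>+s. ennreal (K (arc s)) * indicator I (s - 2 * pi * real k / real m) \<partial>lborel)"
      by (subst nn_integral_real_affine[of "\<lambda>s. ennreal (K (arc s)) * indicator I (s - 2 * pi * real k / real m)" 1 "2 * pi * real k / real m"]) simp_all
  qed
  also have "\<dots> = ennreal W * (\<integral>\<^sup>+s. (\<Sum>k<m. ennreal (K (arc s)) * indicator I (s - 2 * pi * real k / real m)) \<partial>lborel)"
    by (subst nn_integral_sum) measurable
  also have "\<dots> \<le> ennreal W * (\<integral>\<^sup>+s. ennreal (K s) * indicator A s + ennreal (K (2 * pi + (-1) * s)) * indicator A (2 * pi + (-1) * s) \<partial>lborel)"
    using shifted_nodes_sum_le[OF m, of "\<lambda>s. ennreal (K (arc s))" "\<lambda>s. ennreal (K s)"]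
    by (intro mult_left_mono nn_integral_mono) (auto simp: I_def A_def arc_def)
  also have "(\<integral>\<^sup>+s. ennreal (K s) * indicator A s + ennreal (K (2 * pi + (-1) * s)) * indicator A (2 * pi + (-1) * s) \<partial>lborel)
      = (\<integral>\<^sup>+s. ennreal (K s) * indicator A s \<partial>lborel) + (\<integral>\<^sup>+s. ennreal (K (2 * pi + (-1) * s)) * indicator A (2 * pi + (-1) * s) \<partial>lborel)"
    by (rule nn_integral_add) measurable
  also have "(\<integral>\<^sup>+s. ennreal (K (2 * pi + (-1) * s)) * indicator A (2 * pi + (-1) * s) \<partial>lborel) = (\<integral>\<^sup>+s. ennreal (K s) * indicator A s \<partial>lborel)"
    using nn_integral_real_affine[of "\<lambda>s. ennreal (K s) * indicator A s" "-1" "2 * pi"] by simp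
  finally have 1: "ennreal V * ennreal (pi / (2 * real m)) \<le> ennreal W * (2 * (\<integral>\<^sup>+s. ennreal (K s) * indicator A s \<partial>lborel))"
    unfolding mult_2 .
  \<comment> \<open>The interval of rotations has length pi/(2m); together with the two half circles
    this makes the factor 4m/pi.\<close>
  have "ennreal V = ennreal (2 * real m / pi) * (ennreal V * ennreal (pi / (2 * real m)))"
  proof -
    have "ennreal (2 * real m / pi) * (ennreal V * ennreal (pi / (2 * real m))) = ennreal (2 * real m / pi * (V * (pi / (2 * real m))))"
      unfolding ennreal_mult'[symmetric, OF V] by (rule ennreal_mult'[symmetric]) simp
    also have "2 * real m / pi * (V * (pi / (2 * real m))) = V" using m0 by simp
    finally show ?thesis by simp
  qed
  also have "\<dots> \<le> ennreal (2 * real m / pi) * (ennreal W * (2 * (\<integral>\<^sup>+s. ennreal (K s) * indicator A s \<partial>lborel)))"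
    by (intro mult_left_mono 1) simp
  also have "\<dots> = (ennreal (2 * real m / pi) * ennreal W * ennreal 2) * (\<integral>\<^sup>+s. ennreal (K s) * indicator A s \<partial>lborel)"
    by (simp only: mult.assoc ennreal_numeral)
  also have "ennreal (2 * real m / pi) * ennreal W * ennreal 2 = ennreal (4 * real m / pi * W)"
  proof -
    have "ennreal (2 * real m / pi) * ennreal W * ennreal 2 = ennreal (2 * real m / pi * W) * ennreal 2"
      by (subst ennreal_mult') auto
    also have "\<dots> = ennreal (2 * real m / pi * W * 2)" by (rule ennreal_mult''[symmetric]) simp
    finally show ?thesis by (simp add: mult_ac)
  qed
  finally show ?thesis by (simp add: A_def)
qed

text \<open>The function v plays the part of the weight times the local maximum of |P|; asking only
  for some z in each disc avoids the measurability of a supremum. The interpolation bound is raised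
  to the power q by Jensen's inequality, averaged over the rotations and integrated over \<theta>.
  After Fubini the weight is integrated against the kernel centred at s, which returns a multiple of
  the weight at s.\<close>

lemma local_max_weighted_norm_finite:
  fixes p :: ennreal and \<alpha> \<beta> :: real
  assumes p: "1 \<le> p" "p \<noteq> \<infinity>" and \<alpha>: "\<alpha> > - 1 / enn2real p" and \<beta>: "\<beta> > - 1 / enn2real p"
  shows "\<exists>\<kappa>>0. \<exists>C>0. \<forall>n\<ge>1. \<forall>P :: real poly. degree P < n \<longrightarrow> (\<forall>v \<in> borel_measurable leb1.
    (\<forall>x. -1 < x \<longrightarrow> x < 1 \<longrightarrow> (\<exists>z. cmod (z - of_real x) \<le> \<phi> x / (\<kappa> * real n) \<and>
        \<bar>v x\<bar> \<le> jacobi_weight \<alpha> \<beta> x * cmod (poly (map_poly complex_of_real P) z))) \<longrightarrow>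
    Lp_norm p v \<le> ennreal C * Lp_norm p (\<lambda>x. jacobi_weight \<alpha> \<beta> x * poly P x))"
proof -
  define q where "q = enn2real p"
  have q: "q \<ge> 1" unfolding q_def by (rule enn2real_exponent_ge_1[OF p])
  \<comment> \<open>The 1/2 is the Jacobian sin \<theta>; thus a > -1/2 says exactly that \<alpha> >
    -1/q.\<close>
  define a b where "a = q * \<alpha> + 1/2" and "b = q * \<beta> + 1/2"
  have ab: "a > -1/2" "b > -1/2" using \<alpha> \<beta> q by (auto simp: a_def b_def q_def[symmetric] field_simps)
  obtain L :: nat where L: "2 * \<bar>a\<bar> + 2 * \<bar>b\<bar> + 2 \<le> real L" using real_arch_simple by blast
  obtain C0 where C0: "C0 > 0" and interp: "\<forall>n\<ge>1. \<forall>P :: real poly. degree P < n \<longrightarrow> (\<forall>\<theta> \<tau> z. 0 < \<theta> \<longrightarrow> \<theta> < pi \<longrightarrow>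
     cmod (z - of_real (cos \<theta>)) \<le> sin \<theta> / (32 * real ((L + 4) * n)) \<longrightarrow>
     (\<exists>a. (\<forall>k. 0 \<le> a k) \<and> (\<Sum>k<(L + 4) * n. a k) \<le> C0 \<and>
        cmod (poly (map_poly complex_of_real P) z) \<le> (\<Sum>k<(L + 4) * n.
          a k * (\<bar>poly P (cos (\<tau> + 2 * pi * real k / real ((L + 4) * n)))\<bar> /
          (1 + real ((L + 4) * n) * \<bar>\<theta> - arccos (cos (\<tau> + 2 * pi * real k / real ((L + 4) * n)))\<bar>) ^ L))))"
    using localized_interpolation_bound[of L] by (elim exE conjE) (rule that)
  \<comment> \<open>The averaged nodes have angles s in [pi/(4m), pi - pi/(4m)]; this is c \<le> m s
    and c \<le> m (pi - s) with c = pi/4.\<close>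
  have "pi / 4 > 0" by simp
  from nn_integral_jacobi_weight_kernel[OF this ab L] obtain C1 where C1: "C1 > 0"
    "\<And>m s. m \<ge> 1 \<Longrightarrow> 0 < s \<Longrightarrow> s < pi \<Longrightarrow> pi / 4 \<le> m * s \<Longrightarrow> pi / 4 \<le> m * (pi - s) \<Longrightarrow>
     ennreal m * (\<integral>\<^sup>+\<theta>. ennreal (jacobi_weight a b (cos \<theta>) / (1 + m * \<bar>\<theta> - s\<bar>) ^ L) * indicator {0<..<pi} \<theta> \<partial>lborel)
       \<le> ennreal (C1 * jacobi_weight a b (cos s))" by blast
  define B where "B = 4 / pi * C0 powr q"
  have B: "B > 0" using C0 by (simp add: B_def)
  define C where "C = (B * C1) powr (1 / q)"
  have C: "C > 0" using B C1 by (simp add: C_def)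
  show ?thesis
  proof (rule exI[of _ "32 * (real L + 4)"], intro conjI, simp add: add_pos_nonneg, rule exI[of _ C], intro conjI C allI impI ballI)
    fix n :: nat and P :: "real poly" and v :: "real \<Rightarrow> real"
    assume n: "1 \<le> n" and deg: "degree P < n" and v: "v \<in> borel_measurable leb1"
      and vz: "\<forall>x. -1 < x \<longrightarrow> x < 1 \<longrightarrow> (\<exists>z. cmod (z - of_real x) \<le> \<phi> x / (32 * (real L + 4) * real n) \<and>
        \<bar>v x\<bar> \<le> jacobi_weight \<alpha> \<beta> x * cmod (poly (map_poly complex_of_real P) z))"
    define m where "m = (L + 4) * n"
    have m1: "m \<ge> 1" using n by (simp add: m_def)
    have m0: "m > 0" "real m \<ge> 1" using m1 by auto
    define A where "A = {pi / (4 * real m)..pi - pi / (4 * real m)}"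
    have Asub: "0 < s" "s < pi" "pi / 4 \<le> real m * s" "pi / 4 \<le> real m * (pi - s)" if "s \<in> A" for s
    proof -
      have pm: "pi / (4 * real m) > 0" using m0 by simp
      show "0 < s" "s < pi" using that pm by (auto simp: A_def)
      have "real m * (pi / (4 * real m)) \<le> real m * s" "real m * (pi / (4 * real m)) \<le> real m * (pi - s)"
        using that by (intro mult_left_mono; simp add: A_def)+
      then show "pi / 4 \<le> real m * s" "pi / 4 \<le> real m * (pi - s)" using m0 by auto
    qed
    define k where "k = (\<lambda>\<theta> s. \<bar>poly P (cos s)\<bar> powr q / (1 + real m * \<bar>\<theta> - s\<bar>) ^ L)"
    have kmeas: "(\<lambda>x. k (f x) (g x)) \<in> borel_measurable M"
      if "f \<in> borel_measurable M" "g \<in> borel_measurable M" for f g and M :: "'z measure"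
    proof -
      have [measurable]: "(\<lambda>s. poly P (cos s)) \<in> borel_measurable borel"
        by (intro borel_measurable_continuous_onI continuous_intros)
      show ?thesis using that unfolding k_def by measurable
    qed
    have k0: "0 \<le> k \<theta> s" for \<theta> s using m0 by (simp add: k_def)
    define F where "F = (\<lambda>\<theta>. \<integral>\<^sup>+s. ennreal (k \<theta> s) * indicator A s \<partial>lborel)"
    have pointwise: "ennreal (\<bar>v (cos \<theta>)\<bar> powr q) \<le> ennreal (B * real m * jacobi_weight \<alpha> \<beta> (cos \<theta>) powr q) * F \<theta>"
      if \<theta>: "0 < \<theta>" "\<theta> < pi" for \<theta>
    proof -
      define w where "w = jacobi_weight \<alpha> \<beta> (cos \<theta>)"
      have cos1: "-1 < cos \<theta>" "cos \<theta> < 1" using \<theta> cos_monotone_0_pi[of 0 \<theta>] cos_monotone_0_pi[of \<theta> pi] by auto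
      have ph: "\<phi> (cos \<theta>) = sin \<theta>" using \<theta> by (simp add: \<phi>_def sin_squared_eq[symmetric] sin_ge_zero)
      obtain z where z: "cmod (z - of_real (cos \<theta>)) \<le> \<phi> (cos \<theta>) / (32 * (real L + 4) * real n)"
        "\<bar>v (cos \<theta>)\<bar> \<le> w * cmod (poly (map_poly complex_of_real P) z)" using vz cos1 unfolding w_def by blast
      have z': "cmod (z - of_real (cos \<theta>)) \<le> sin \<theta> / (32 * real ((L + 4) * n))"
        using z(1) unfolding ph by (simp add: algebra_simps)
      have "\<bar>v (cos \<theta>)\<bar> powr q \<le> (w powr q * C0 powr q) * (\<Sum>j<m. k \<theta> (arccos (cos (\<tau> + 2 * pi * real j / real m))))" for \<tau>
      proof -
        define s where "s = (\<lambda>j. arccos (cos (\<tau> + 2 * pi * real j / real m)))"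
        have coss: "cos (s j) = cos (\<tau> + 2 * pi * real j / real m)" for j by (simp add: s_def)
        define D where "D = (\<lambda>j. 1 + real m * \<bar>\<theta> - s j\<bar>)"
        have D: "D j \<ge> 1" for j by (simp add: D_def)
        have "\<exists>c. (\<forall>j. 0 \<le> c j) \<and> (\<Sum>j<m. c j) \<le> C0 \<and>
          cmod (poly (map_poly complex_of_real P) z) \<le> (\<Sum>j<m. c j * (\<bar>poly P (cos (s j))\<bar> / D j ^ L))"
          using interp[rule_format, OF n deg \<theta> z', of \<tau>] unfolding D_def coss unfolding s_def m_def .
        then obtain c where c: "\<And>j. 0 \<le> c j" "(\<Sum>j<m. c j) \<le> C0"
          "cmod (poly (map_poly complex_of_real P) z) \<le> (\<Sum>j<m. c j * (\<bar>poly P (cos (s j))\<bar> / D j ^ L))"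
          by blast
        have cC: "c j \<le> C0" if "j < m" for j
          using member_le_sum[of j "{..<m}" c] c that by auto
        have "\<bar>v (cos \<theta>)\<bar> powr q \<le> (w * (\<Sum>j<m. c j * (\<bar>poly P (cos (s j))\<bar> / D j ^ L))) powr q"
        proof (rule powr_mono2)
          show "\<bar>v (cos \<theta>)\<bar> \<le> w * (\<Sum>j<m. c j * (\<bar>poly P (cos (s j))\<bar> / D j ^ L))"
            using z(2) mult_left_mono[OF c(3), of w] by (simp add: w_def)
        qed (use q in auto)
        also have "\<dots> = w powr q * (\<Sum>j<m. c j * (\<bar>poly P (cos (s j))\<bar> / D j ^ L)) powr q"
          by (rule powr_mult) 
        also have "\<dots> \<le> w powr q * ((\<Sum>j<m. c j) powr (q - 1) * (\<Sum>j<m. c j * (\<bar>poly P (cos (s j))\<bar> / D j ^ L) powr q))"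
        proof (intro mult_left_mono sum_powr_le_weighted q)
          show "0 \<le> \<bar>poly P (cos (s j))\<bar> / D j ^ L" for j using D[of j] by simp
        qed (use c in auto)
        \<comment> \<open>Each coefficient is at most C0, because the coefficients are nonnegative
          with sum at most C0. As D j \<ge> 1, the decay D^(qL) may be weakened to D^L, for which L
          was chosen.\<close>
        also have "\<dots> \<le> w powr q * (C0 powr (q - 1) * (\<Sum>j<m. C0 * k \<theta> (s j)))"
        proof (intro mult_left_mono mult_mono powr_mono2 sum_mono)
          fix j assume j: "j \<in> {..<m}"
          have "(\<bar>poly P (cos (s j))\<bar> / D j ^ L) powr q = \<bar>poly P (cos (s j))\<bar> powr q / (D j ^ L) powr q"
            by (rule powr_divide)
          also have "\<dots> \<le> \<bar>poly P (cos (s j))\<bar> powr q / (D j ^ L) powr 1"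
            using D[of j] q by (intro divide_left_mono powr_mono mult_pos_pos) (auto simp: less_le_trans[of 0 1])
          also have "\<dots> = k \<theta> (s j)" using D[of j] by (simp add: k_def D_def)
          finally show "(\<bar>poly P (cos (s j))\<bar> / D j ^ L) powr q \<le> k \<theta> (s j)" .
          show "c j \<le> C0" using cC j by auto
        qed (use c C0 k0 q D in \<open>auto intro!: sum_nonneg mult_nonneg_nonneg\<close>)
        also have "\<dots> = (w powr q * (C0 powr (q - 1) * C0)) * (\<Sum>j<m. k \<theta> (s j))"
          by (simp add: sum_distrib_left[symmetric] mult_ac)
        also have "C0 powr (q - 1) * C0 = C0 powr q" using C0 by (simp add: powr_diff)
        finally show ?thesis by (simp add: s_def)
      qed
      note avg = this
      have "ennreal (\<bar>v (cos \<theta>)\<bar> powr q) \<le> ennreal (4 * real m / pi * (w powr q * C0 powr q)) * F \<theta>"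
        unfolding F_def A_def
      proof (rule localized_bound_average[OF m0(1) _ k0 _ _ avg])
        show "k \<theta> \<in> borel_measurable borel" by (rule kmeas) auto
      qed auto
      also have "4 * real m / pi * (w powr q * C0 powr q) = B * real m * w powr q" by (simp add: B_def)
      finally show ?thesis by (simp only: w_def)
    qed
    \<comment> \<open>\<open>F\<close> is a function of the angle, while the substitution needs a
      Borel function of x; the value 0 outside [-1,1] is a placeholder.\<close>
    define arc where "arc = (\<lambda>x::real. if x \<in> {-1..1} then arccos x else 0)"
    have arc: "arc \<in> borel_measurable borel"
      unfolding arc_def by (intro borel_measurable_continuous_on_if) (auto intro!: continuous_intros)
    have arc_cos: "arc (cos \<theta>) = \<theta>" if "0 < \<theta>" "\<theta> < pi" for \<theta> using that by (simp add: arc_def arccos_cos)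
    have cos_arc: "x = cos (arc x)" "0 < arc x" "arc x < pi" if "-1 < x" "x < 1" for x
      using that arccos_lt_bounded[of x] by (auto simp: arc_def)
    have Fm: "F \<in> borel_measurable borel"
      unfolding F_def using kmeas[of fst "borel \<Otimes>\<^sub>M lborel" snd] unfolding A_def
      by (intro lborel.borel_measurable_nn_integral) (auto simp: case_prod_beta')
    have "(\<integral>\<^sup>+x. ennreal (\<bar>v x\<bar> powr q) \<partial>leb1) = (\<integral>\<^sup>+x. ennreal (\<bar>v x\<bar> powr q) * indicator {-1<..<1} x \<partial>lborel)"
      by (rule nn_integral_leb1)
    also have "\<dots> \<le> (\<integral>\<^sup>+x. (ennreal (B * real m * jacobi_weight \<alpha> \<beta> x powr q) * F (arc x)) * indicator {-1<..<1} x \<partial>lborel)"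
    proof (rule nn_integral_mono)
      fix x :: real
      show "ennreal (\<bar>v x\<bar> powr q) * indicator {-1<..<1} x \<le> (ennreal (B * real m * jacobi_weight \<alpha> \<beta> x powr q) * F (arc x)) * indicator {-1<..<1} x"
        using pointwise[of "arc x"] cos_arc[of x] by (auto split: split_indicator)
    qed
    also have "\<dots> = (\<integral>\<^sup>+\<theta>. (ennreal (B * real m * jacobi_weight \<alpha> \<beta> (cos \<theta>) powr q) * F (arc (cos \<theta>))) * ennreal (sin \<theta>) * indicator {0<..<pi} \<theta> \<partial>lborel)"
    proof (rule nn_integral_cos_substitution)
      have [measurable]: "(\<lambda>x. F (arc x)) \<in> borel_measurable borel" by (rule measurable_compose[OF arc Fm])
      show "(\<lambda>x. ennreal (B * real m * jacobi_weight \<alpha> \<beta> x powr q) * F (arc x)) \<in> borel_measurable borel"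
        by measurable
    qed
    also have "\<dots> = (\<integral>\<^sup>+\<theta>. (\<integral>\<^sup>+s. ennreal (B * real m * jacobi_weight a b (cos \<theta>)) * indicator {0<..<pi} \<theta> * (ennreal (k \<theta> s) * indicator A s) \<partial>lborel) \<partial>lborel)"
    proof (rule nn_integral_cong)
      fix \<theta> :: real
      have "(ennreal (B * real m * jacobi_weight \<alpha> \<beta> (cos \<theta>) powr q) * F (arc (cos \<theta>))) * ennreal (sin \<theta>) * indicator {0<..<pi} \<theta>
        = ennreal (B * real m * jacobi_weight a b (cos \<theta>)) * indicator {0<..<pi} \<theta> * F \<theta>"
      proof (cases "\<theta> \<in> {0<..<pi}")
        case True
        then have "ennreal (B * real m * jacobi_weight \<alpha> \<beta> (cos \<theta>) powr q) * ennreal (sin \<theta>) = ennreal (B * real m * jacobi_weight a b (cos \<theta>))"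
          using jacobi_weight_powr_sin[of \<theta> \<alpha> \<beta> q] B
          by (subst ennreal_mult''[symmetric]) (auto simp: sin_ge_zero mult.assoc a_def b_def)
        then show ?thesis using True arc_cos[of \<theta>] by (simp add: mult_ac)
      qed simp
      also have "\<dots> = (\<integral>\<^sup>+s. ennreal (B * real m * jacobi_weight a b (cos \<theta>)) * indicator {0<..<pi} \<theta> * (ennreal (k \<theta> s) * indicator A s) \<partial>lborel)"
        unfolding F_def
      proof (rule nn_integral_cmult[symmetric])
        have [measurable]: "A \<in> sets borel" by (simp add: A_def)
        have [measurable]: "k \<theta> \<in> borel_measurable borel" by (rule kmeas) measurable
        show "(\<lambda>s. ennreal (k \<theta> s) * indicator A s) \<in> borel_measurable lborel" by measurable
      qed
      finally show "(ennreal (B * real m * jacobi_weight \<alpha> \<beta> (cos \<theta>) powr q) * F (arc (cos \<theta>))) * ennreal (sin \<theta>) * indicator {0<..<pi} \<theta> = \<dots>" .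
    qed
    \<comment> \<open>Fubini: for fixed s the inner integral over \<theta> is now the one of
      \<open>nn_integral_jacobi_weight_kernel\<close>.\<close>
    also have "\<dots> = (\<integral>\<^sup>+s. (\<integral>\<^sup>+\<theta>. ennreal (B * real m * jacobi_weight a b (cos \<theta>)) * indicator {0<..<pi} \<theta> * (ennreal (k \<theta> s) * indicator A s) \<partial>lborel) \<partial>lborel)"
    proof (rule lborel_pair.Fubini'[symmetric])
      show "(\<lambda>(\<theta>, s). ennreal (B * real m * jacobi_weight a b (cos \<theta>)) * indicator {0<..<pi} \<theta> * (ennreal (k \<theta> s) * indicator A s)) \<in> borel_measurable (lborel \<Otimes>\<^sub>M lborel)"
      proof -
        have [measurable]: "A \<in> sets borel" by (simp add: A_def)
        have [measurable]: "(\<lambda>x. k (fst x) (snd x)) \<in> borel_measurable (lborel \<Otimes>\<^sub>M lborel)"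
          by (rule kmeas) measurable
        show ?thesis unfolding case_prod_beta' by measurable
      qed
    qed
    also have "\<dots> \<le> (\<integral>\<^sup>+s. (ennreal (B * C1) * ennreal ((jacobi_weight \<alpha> \<beta> (cos s) * \<bar>poly P (cos s)\<bar>) powr q)) * ennreal (sin s) * indicator {0<..<pi} s \<partial>lborel)"
    proof (rule nn_integral_mono)
      fix s :: real
      show "(\<integral>\<^sup>+\<theta>. ennreal (B * real m * jacobi_weight a b (cos \<theta>)) * indicator {0<..<pi} \<theta> * (ennreal (k \<theta> s) * indicator A s) \<partial>lborel)
        \<le> (ennreal (B * C1) * ennreal ((jacobi_weight \<alpha> \<beta> (cos s) * \<bar>poly P (cos s)\<bar>) powr q)) * ennreal (sin s) * indicator {0<..<pi} s"
      proof (cases "s \<in> A")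
        case True
        note s = Asub[OF True]
        define Pq where "Pq = \<bar>poly P (cos s)\<bar> powr q"
        define E where "E = (\<lambda>\<theta>. ennreal (jacobi_weight a b (cos \<theta>) / (1 + real m * \<bar>\<theta> - s\<bar>) ^ L) * indicator {0<..<pi} \<theta>)"
        have Em: "E \<in> borel_measurable borel" unfolding E_def by measurable
        have "ennreal (B * real m * jacobi_weight a b (cos \<theta>)) * indicator {0<..<pi} \<theta> * (ennreal (k \<theta> s) * indicator A s) =
            ennreal (B * Pq) * (ennreal (real m) * E \<theta>)" for \<theta>
        proof (cases "\<theta> \<in> {0<..<pi}")
          case t: True
          have "ennreal (B * real m * jacobi_weight a b (cos \<theta>)) * ennreal (k \<theta> s) = ennreal ((B * real m * jacobi_weight a b (cos \<theta>)) * k \<theta> s)"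
            using k0 by (intro ennreal_mult''[symmetric])
          also have "(B * real m * jacobi_weight a b (cos \<theta>)) * k \<theta> s =
             (B * Pq) * (real m * (jacobi_weight a b (cos \<theta>) / (1 + real m * \<bar>\<theta> - s\<bar>) ^ L))"
            by (simp add: k_def Pq_def)
          also have "ennreal \<dots> = ennreal (B * Pq) * (ennreal (real m) * ennreal (jacobi_weight a b (cos \<theta>) / (1 + real m * \<bar>\<theta> - s\<bar>) ^ L))"
            using B m0 by (subst ennreal_mult', simp add: Pq_def, subst ennreal_mult') auto
          finally show ?thesis using t True by (simp add: E_def)
        qed (simp add: E_def)
        then have "(\<integral>\<^sup>+\<theta>. ennreal (B * real m * jacobi_weight a b (cos \<theta>)) * indicator {0<..<pi} \<theta> * (ennreal (k \<theta> s) * indicator A s) \<partial>lborel)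
          = ennreal (B * Pq) * (ennreal (real m) * (\<integral>\<^sup>+\<theta>. E \<theta> \<partial>lborel))"
          using Em by (simp add: nn_integral_cmult)
        also have "\<dots> \<le> ennreal (B * Pq) * ennreal (C1 * jacobi_weight a b (cos s))"
          using C1(2)[OF m0(2) s] unfolding E_def by (intro mult_left_mono) auto
        also have "\<dots> = ennreal ((B * Pq) * (C1 * jacobi_weight a b (cos s)))"
          using B by (intro ennreal_mult'[symmetric]) (simp add: Pq_def)
        also have "(B * Pq) * (C1 * jacobi_weight a b (cos s)) = ((B * C1) * (jacobi_weight \<alpha> \<beta> (cos s) * \<bar>poly P (cos s)\<bar>) powr q) * sin s"
          using jacobi_weight_powr_sin[OF s(1,2), of \<alpha> \<beta> q] by (simp add: powr_mult Pq_def a_def b_def mult_ac)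
        also have "ennreal \<dots> = (ennreal (B * C1) * ennreal ((jacobi_weight \<alpha> \<beta> (cos s) * \<bar>poly P (cos s)\<bar>) powr q)) * ennreal (sin s)"
          using s B C1(1) by (subst ennreal_mult'', simp add: sin_ge_zero, subst ennreal_mult'') auto
        finally show ?thesis using s by simp
      qed simp
    qed
    also have "\<dots> = (\<integral>\<^sup>+x. ennreal (B * C1) * ennreal ((jacobi_weight \<alpha> \<beta> x * \<bar>poly P x\<bar>) powr q) * indicator {-1<..<1} x \<partial>lborel)"
      by (rule nn_integral_cos_substitution[symmetric]) measurable
    also have "\<dots> = ennreal (B * C1) * (\<integral>\<^sup>+x. ennreal ((jacobi_weight \<alpha> \<beta> x * \<bar>poly P x\<bar>) powr q) * indicator {-1<..<1} x \<partial>lborel)"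
      unfolding mult.assoc by (rule nn_integral_cmult) measurable
    also have "\<dots> = ennreal (B * C1) * (\<integral>\<^sup>+x. ennreal (\<bar>jacobi_weight \<alpha> \<beta> x * poly P x\<bar> powr q) \<partial>leb1)"
      unfolding nn_integral_leb1 by (simp add: abs_mult)
    finally have main: "(\<integral>\<^sup>+x. ennreal (\<bar>v x\<bar> powr q) \<partial>leb1) \<le> ennreal (B * C1) * (\<integral>\<^sup>+x. ennreal (\<bar>jacobi_weight \<alpha> \<beta> x * poly P x\<bar> powr q) \<partial>leb1)" .
    show "Lp_norm p v \<le> ennreal C * Lp_norm p (\<lambda>x. jacobi_weight \<alpha> \<beta> x * poly P x)"
    proof (cases "Lp_norm p (\<lambda>x. jacobi_weight \<alpha> \<beta> x * poly P x)")
      case (real N)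
      then have "(\<integral>\<^sup>+x. ennreal (\<bar>jacobi_weight \<alpha> \<beta> x * poly P x\<bar> powr q) \<partial>leb1) \<le> ennreal (N powr q)"
        using Lp_norm_le_iff[OF p real(1), of "\<lambda>x. jacobi_weight \<alpha> \<beta> x * poly P x"] by (simp add: q_def)
      then have "(\<integral>\<^sup>+x. ennreal (\<bar>v x\<bar> powr q) \<partial>leb1) \<le> ennreal (B * C1) * ennreal (N powr q)"
        using main by (meson mult_left_mono order_trans zero_le)
      also have "\<dots> = ennreal ((C * N) powr q)"
        using B C1 q real(1) by (simp add: C_def powr_mult powr_powr ennreal_mult''[symmetric])
      finally show ?thesis
        using Lp_norm_le_iff[OF p, of "C * N" v] C real by (simp add: q_def ennreal_mult'')
    next
      case top
      then show ?thesis using C by (simp add: ennreal_mult_top)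
    qed
  qed
qed

lemma borel_measurable_leb1_iff:
  fixes f :: "real \<Rightarrow> real"
  shows "f \<in> borel_measurable leb1 \<longleftrightarrow> (\<lambda>x. if x \<in> {-1..1} then f x else 0) \<in> borel_measurable lebesgue"
  by (rule borel_measurable_if[symmetric]) simp

text \<open>Lebesgue measure is complete, so changing values on a null set preserves
  measurability.\<close>

lemma borel_measurable_leb1_AE:
  fixes f g :: "real \<Rightarrow> real"
  assumes f: "f \<in> borel_measurable leb1" and ae: "AE x in leb1. f x = g x"
  shows "g \<in> borel_measurable leb1"
proof -
  have "AE x in lebesgue. x \<in> {-1..1} \<longrightarrow> f x = g x"
    using ae by (subst (asm) AE_restrict_space_iff) auto
  then have "AE x in lebesgue. (if x \<in> {-1..1} then f x else 0) = (if x \<in> {-1..1} then g x else 0)"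
    by (auto elim!: eventually_mono)
  from borel_measurable_AE[OF _ this] f show ?thesis unfolding borel_measurable_leb1_iff by simp
qed

text \<open>Supplies the Borel functions that composition with x + s \<phi>(x) and integration
  against \<open>lborel\<close> require.\<close>

lemma borel_version_leb1:
  fixes f :: "real \<Rightarrow> real"
  assumes f: "f \<in> borel_measurable leb1"
  obtains g where "g \<in> borel_measurable borel" "AE x in leb1. f x = g x"
proof -
  obtain g where g: "g \<in> borel_measurable lborel" "AE x in lborel. (if x \<in> {-1..1} then f x else 0) = g x"
    using completion_ex_borel_measurable_real[OF f[unfolded borel_measurable_leb1_iff]] by blast
  have "AE x in lebesgue. (if x \<in> {-1..1} then f x else 0) = g x"
    by (rule AE_completion[OF g(2)])
  then have "AE x in leb1. f x = g x"
    by (subst AE_restrict_space_iff) (auto elim!: eventually_mono)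
  then show thesis using g(1) that by simp
qed

text \<open>The set where the bound fails is open and null, hence empty.\<close>

lemma continuous_AE_leb1_le:
  fixes f :: "real \<Rightarrow> real"
  assumes f: "continuous_on {-1<..<1} f" and ae: "AE x in leb1. f x \<le> M" and x: "-1 < x" "x < 1"
  shows "f x \<le> M"
proof (rule ccontr)
  assume "\<not> f x \<le> M"
  have "open ({-1<..<1} \<inter> f -` {M<..})"
    using continuous_open_preimage[OF f] by simp
  moreover have "negligible ({-1<..<1} \<inter> f -` {M<..})"
  proof -
    have "AE x in lebesgue. x \<notin> {-1<..<1} \<inter> f -` {M<..}"
      using ae unfolding AE_leb1_iff by eventually_elim auto
    then have "{-1<..<1} \<inter> f -` {M<..} \<in> null_sets lebesgue"
      by (simp add: completion.null_sets_iff_AE)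
    then show ?thesis by (simp add: negligible_iff_null_sets)
  qed
  ultimately have "{-1<..<1} \<inter> f -` {M<..} = {}" using open_not_negligible by blast
  then show False using x \<open>\<not> f x \<le> M\<close> by auto
qed

text \<open>The rotation pi/(2m) is the midpoint of the interval of admissible rotations. In
  \<open>shifted_nodes_sum_le\<close> for the indicator of the complement of the range, a node
  outside the range would make the left side at least 1, while the right side is 0.\<close>

lemma shifted_node_in_range:
  assumes "m > (0::nat)" "k < m"
  shows "arccos (cos (pi / (2 * real m) + 2 * pi * real k / real m)) \<in> {pi / (4 * real m)..pi - pi / (4 * real m)}"
proof (rule ccontr)
  define s where "s = pi / (2 * real m) + 2 * pi * real k / real m"
  define A where "A = {pi / (4 * real m)..pi - pi / (4 * real m)}"
  define G where "G = (\<lambda>u. if u \<in> A then 0 else 1 :: ennreal)"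
  have m0: "real m > 0" using assms by simp
  assume "\<not> ?thesis"
  then have G1: "G (arccos (cos s)) = 1" by (simp add: G_def A_def s_def)
  have "pi / (2 * real m) \<in> {pi / (4 * real m)..3 * pi / (4 * real m)}"
    using m0 by (simp add: field_simps)
  then have one: "indicator {pi / (4 * real m)..3 * pi / (4 * real m)} (s - 2 * pi * real k / real m) = (1 :: ennreal)"
    by (simp add: s_def)
  have "(1::ennreal) = G (arccos (cos s)) * indicator {pi / (4 * real m)..3 * pi / (4 * real m)} (s - 2 * pi * real k / real m)"
    unfolding one G1 by simp
  also have "\<dots> \<le> (\<Sum>j<m. G (arccos (cos s)) * indicator {pi / (4 * real m)..3 * pi / (4 * real m)} (s - 2 * pi * real j / real m))"
    using assms by (intro member_le_sum) auto
  also have "\<dots> \<le> G s * indicator A s + G (2 * pi - s) * indicator A (2 * pi - s)"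
    unfolding A_def by (rule shifted_nodes_sum_le[OF assms(1) refl])
  also have "\<dots> = 0" by (simp add: G_def indicator_def)
  finally show False by simp
qed

text \<open>For the supremum a single rotation suffices: all nodes are then in range, and the weight
  at \<theta> is compared with the weight at each node separately.\<close>

lemma local_max_weighted_norm_infinity:
  fixes \<alpha> \<beta> :: real
  assumes \<alpha>: "\<alpha> \<ge> 0" and \<beta>: "\<beta> \<ge> 0"
  shows "\<exists>\<kappa>>0. \<exists>C>0. \<forall>n\<ge>1. \<forall>P :: real poly. degree P < n \<longrightarrow> (\<forall>v \<in> borel_measurable leb1.
    (\<forall>x. -1 < x \<longrightarrow> x < 1 \<longrightarrow> (\<exists>z. cmod (z - of_real x) \<le> \<phi> x / (\<kappa> * real n) \<and>
        \<bar>v x\<bar> \<le> jacobi_weight \<alpha> \<beta> x * cmod (poly (map_poly complex_of_real P) z))) \<longrightarrow>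
    Lp_norm \<infinity> v \<le> ennreal C * Lp_norm \<infinity> (\<lambda>x. jacobi_weight \<alpha> \<beta> x * poly P x))"
proof -
  obtain L :: nat where L: "2 * \<bar>\<alpha>\<bar> + 2 * \<bar>\<beta>\<bar> \<le> real L" using real_arch_simple by blast
  obtain C0 where C0: "C0 > 0" and interp: "\<forall>n\<ge>1. \<forall>P :: real poly. degree P < n \<longrightarrow> (\<forall>\<theta> \<tau> z. 0 < \<theta> \<longrightarrow> \<theta> < pi \<longrightarrow>
     cmod (z - of_real (cos \<theta>)) \<le> sin \<theta> / (32 * real ((L + 4) * n)) \<longrightarrow>
     (\<exists>a. (\<forall>k. 0 \<le> a k) \<and> (\<Sum>k<(L + 4) * n. a k) \<le> C0 \<and>
        cmod (poly (map_poly complex_of_real P) z) \<le> (\<Sum>k<(L + 4) * n.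
          a k * (\<bar>poly P (cos (\<tau> + 2 * pi * real k / real ((L + 4) * n)))\<bar> /
          (1 + real ((L + 4) * n) * \<bar>\<theta> - arccos (cos (\<tau> + 2 * pi * real k / real ((L + 4) * n)))\<bar>) ^ L))))"
    using localized_interpolation_bound[of L] by (elim exE conjE) (rule that)
  have "pi / 4 > 0" by simp
  from jacobi_weight_cos_ratio[OF this, of \<alpha> \<beta>] obtain C1 where C1: "C1 > 0" and
    ratio: "\<forall>m \<theta> s. m \<ge> 1 \<longrightarrow> 0 < \<theta> \<longrightarrow> \<theta> < pi \<longrightarrow> 0 < s \<longrightarrow> s < pi \<longrightarrow> pi / 4 \<le> m * s \<longrightarrow> pi / 4 \<le> m * (pi - s) \<longrightarrow>
     jacobi_weight \<alpha> \<beta> (cos \<theta>) \<le> C1 * (jacobi_weight \<alpha> \<beta> (cos s) * (1 + m * \<bar>\<theta> - s\<bar>) powr (2 * \<bar>\<alpha>\<bar> + 2 * \<bar>\<beta>\<bar>) *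
        (1 + (m * \<theta>) powr (- max 0 (- (2 * \<alpha>))) + (m * (pi - \<theta>)) powr (- max 0 (- (2 * \<beta>)))))"
    by (elim exE conjE) (rule that)
  define C where "C = 3 * C1 * C0"
  have C: "C > 0" using C0 C1 by (simp add: C_def)
  show ?thesis
  proof (rule exI[of _ "32 * (real L + 4)"], intro conjI, simp add: add_pos_nonneg, rule exI[of _ C], intro conjI C allI impI ballI)
    fix n :: nat and P :: "real poly" and v :: "real \<Rightarrow> real"
    assume n: "1 \<le> n" and deg: "degree P < n" and v: "v \<in> borel_measurable leb1"
      and vz: "\<forall>x. -1 < x \<longrightarrow> x < 1 \<longrightarrow> (\<exists>z. cmod (z - of_real x) \<le> \<phi> x / (32 * (real L + 4) * real n) \<and>
        \<bar>v x\<bar> \<le> jacobi_weight \<alpha> \<beta> x * cmod (poly (map_poly complex_of_real P) z))"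
    define m where "m = (L + 4) * n"
    have m1: "m \<ge> 1" using n by (simp add: m_def)
    have m0: "m > 0" "real m \<ge> 1" using m1 by auto
    show "Lp_norm \<infinity> v \<le> ennreal C * Lp_norm \<infinity> (\<lambda>x. jacobi_weight \<alpha> \<beta> x * poly P x)"
    proof (cases "Lp_norm \<infinity> (\<lambda>x. jacobi_weight \<alpha> \<beta> x * poly P x)")
      case (real M)
      have "AE x in leb1. ennreal \<bar>jacobi_weight \<alpha> \<beta> x * poly P x\<bar> \<le> ennreal M"
        using Lp_norm_infinity_AE[of "\<lambda>x. jacobi_weight \<alpha> \<beta> x * poly P x"] real by simp
      then have aeM: "AE x in leb1. \<bar>jacobi_weight \<alpha> \<beta> x * poly P x\<bar> \<le> M"
        using real(1) by (auto elim!: eventually_mono simp: ennreal_le_iff)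
      \<comment> \<open>The essential bound must hold at every single point, because the nodes form
        a finite set; continuity of the weighted polynomial provides this.\<close>
      have M: "jacobi_weight \<alpha> \<beta> x * \<bar>poly P x\<bar> \<le> M" if "-1 < x" "x < 1" for x
      proof -
        have "continuous_on {-1<..<1} (\<lambda>x. \<bar>jacobi_weight \<alpha> \<beta> x * poly P x\<bar>)"
          unfolding jacobi_weight_def by (intro continuous_intros) auto
        from continuous_AE_leb1_le[OF this aeM that] show ?thesis by (simp add: abs_mult)
      qed
      have pointwise: "\<bar>v (cos \<theta>)\<bar> \<le> C * M" if \<theta>: "0 < \<theta>" "\<theta> < pi" for \<theta>
      proof -
        define w where "w = jacobi_weight \<alpha> \<beta> (cos \<theta>)"
        have cos1: "-1 < cos \<theta>" "cos \<theta> < 1" using \<theta> cos_monotone_0_pi[of 0 \<theta>] cos_monotone_0_pi[of \<theta> pi] by auto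
        have ph: "\<phi> (cos \<theta>) = sin \<theta>" using \<theta> by (simp add: \<phi>_def sin_squared_eq[symmetric] sin_ge_zero)
        obtain z where z: "cmod (z - of_real (cos \<theta>)) \<le> \<phi> (cos \<theta>) / (32 * (real L + 4) * real n)"
          "\<bar>v (cos \<theta>)\<bar> \<le> w * cmod (poly (map_poly complex_of_real P) z)" using vz cos1 unfolding w_def by blast
        have z': "cmod (z - of_real (cos \<theta>)) \<le> sin \<theta> / (32 * real ((L + 4) * n))"
          using z(1) unfolding ph by (simp add: algebra_simps)
        define \<tau> where "\<tau> = pi / (2 * real m)"
        define s where "s = (\<lambda>j. arccos (cos (\<tau> + 2 * pi * real j / real m)))"
        have coss: "cos (s j) = cos (\<tau> + 2 * pi * real j / real m)" for j by (simp add: s_def)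
        define D where "D = (\<lambda>j. 1 + real m * \<bar>\<theta> - s j\<bar>)"
        have D: "D j \<ge> 1" for j by (simp add: D_def)
        have "\<exists>c. (\<forall>j. 0 \<le> c j) \<and> (\<Sum>j<m. c j) \<le> C0 \<and>
          cmod (poly (map_poly complex_of_real P) z) \<le> (\<Sum>j<m. c j * (\<bar>poly P (cos (s j))\<bar> / D j ^ L))"
          using interp[rule_format, OF n deg \<theta> z', of \<tau>] unfolding D_def coss unfolding s_def m_def .
        then obtain c where c: "\<And>j. 0 \<le> c j" "(\<Sum>j<m. c j) \<le> C0"
          "cmod (poly (map_poly complex_of_real P) z) \<le> (\<Sum>j<m. c j * (\<bar>poly P (cos (s j))\<bar> / D j ^ L))"
          by blast
        have "\<bar>v (cos \<theta>)\<bar> \<le> w * (\<Sum>j<m. c j * (\<bar>poly P (cos (s j))\<bar> / D j ^ L))"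
          using z(2) mult_left_mono[OF c(3), of w] by (simp add: w_def)
        also have "\<dots> = (\<Sum>j<m. c j * (w * (\<bar>poly P (cos (s j))\<bar> / D j ^ L)))"
          by (simp add: sum_distrib_left mult_ac)
        also have "\<dots> \<le> (\<Sum>j<m. c j * (3 * C1 * M))"
        proof (intro sum_mono mult_left_mono c)
          fix j assume "j \<in> {..<m}"
          then have "s j \<in> {pi / (4 * real m)..pi - pi / (4 * real m)}"
            using shifted_node_in_range[OF m0(1), of j] by (simp add: s_def \<tau>_def)
          then have sj: "pi / (4 * real m) \<le> s j" "pi / (4 * real m) \<le> pi - s j" by auto
          have pm: "pi / (4 * real m) > 0" using m0 by simp
          have s1: "0 < s j" "s j < pi" using sj pm by linarith+
          have "real m * (pi / (4 * real m)) \<le> real m * s j" "real m * (pi / (4 * real m)) \<le> real m * (pi - s j)"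
            using sj by (intro mult_left_mono; simp)+
          then have s2: "pi / 4 \<le> real m * s j" "pi / 4 \<le> real m * (pi - s j)" using m0 by auto
          have cs: "-1 < cos (s j)" "cos (s j) < 1" using s1 cos_monotone_0_pi[of 0 "s j"] cos_monotone_0_pi[of "s j" pi] by auto
          \<comment> \<open>With nonnegative exponents there is no singularity. Both extra factors
            are 1, which accounts for the constant 3.\<close>
          have x1: "max 0 (- (2 * \<alpha>)) = 0" "max 0 (- (2 * \<beta>)) = 0" using \<alpha> \<beta> by auto
          have x2: "(real m * \<theta>) powr (- 0) = 1" "(real m * (pi - \<theta>)) powr (- 0) = 1" using \<theta> m0 by auto
          have "w \<le> C1 * (jacobi_weight \<alpha> \<beta> (cos (s j)) * D j powr (2 * \<bar>\<alpha>\<bar> + 2 * \<bar>\<beta>\<bar>) * (1 + 1 + 1))"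
            using ratio[rule_format, OF m0(2) \<theta> s1 s2] unfolding x1 x2 by (simp only: w_def D_def)
          also have "\<dots> \<le> C1 * (jacobi_weight \<alpha> \<beta> (cos (s j)) * D j powr (real L) * (1 + 1 + 1))"
            using C1 D[of j] L by (intro mult_left_mono mult_right_mono powr_mono) auto
          also have "D j powr (real L) = D j ^ L" using D[of j] by (simp add: powr_realpow)
          finally have "w \<le> (3 * C1 * jacobi_weight \<alpha> \<beta> (cos (s j))) * D j ^ L" by (simp add: mult_ac)
          then have "w / D j ^ L \<le> 3 * C1 * jacobi_weight \<alpha> \<beta> (cos (s j))"
            using D[of j] by (subst pos_divide_le_eq) auto
          then have "(w / D j ^ L) * \<bar>poly P (cos (s j))\<bar> \<le> (3 * C1 * jacobi_weight \<alpha> \<beta> (cos (s j))) * \<bar>poly P (cos (s j))\<bar>"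
            by (intro mult_right_mono) auto
          also have "\<dots> = 3 * C1 * (jacobi_weight \<alpha> \<beta> (cos (s j)) * \<bar>poly P (cos (s j))\<bar>)" by simp
          also have "\<dots> \<le> 3 * C1 * M" using M[OF cs] C1 by (intro mult_left_mono) auto
          finally show "w * (\<bar>poly P (cos (s j))\<bar> / D j ^ L) \<le> 3 * C1 * M" by simp
        qed
        also have "\<dots> = (\<Sum>j<m. c j) * (3 * C1 * M)" by (simp only: sum_distrib_right)
        also have "\<dots> \<le> C0 * (3 * C1 * M)" using c(2) C1 real(1) by (intro mult_right_mono) auto
        also have "\<dots> = C * M" by (simp add: C_def)
        finally show ?thesis .
      qed
      have "AE x in leb1. \<bar>v x\<bar> \<le> C * M"
      proof (rule AE_leb1I)
        fix x :: real assume x: "-1 < x" "x < 1"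
        then show "\<bar>v x\<bar> \<le> C * M" using pointwise[of "arccos x"] arccos_lt_bounded[of x] by simp
      qed
      from Lp_norm_infinity_le[OF v this] show ?thesis using real C by (simp add: ennreal_mult)
    next
      case top
      then show ?thesis using C by (simp add: ennreal_mult_top)
    qed
  qed
qed

lemma local_max_weighted_norm:
  fixes p :: ennreal and \<alpha> \<beta> :: real
  assumes p: "1 \<le> p" and J: "\<alpha> \<in> J p" "\<beta> \<in> J p"
  shows "\<exists>\<kappa>>0. \<exists>C>0. \<forall>n\<ge>1. \<forall>P :: real poly. degree P < n \<longrightarrow> (\<forall>v \<in> borel_measurable leb1.
    (\<forall>x. -1 < x \<longrightarrow> x < 1 \<longrightarrow> (\<exists>z. cmod (z - of_real x) \<le> \<phi> x / (\<kappa> * real n) \<and>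
        \<bar>v x\<bar> \<le> jacobi_weight \<alpha> \<beta> x * cmod (poly (map_poly complex_of_real P) z))) \<longrightarrow>
    Lp_norm p v \<le> ennreal C * Lp_norm p (\<lambda>x. jacobi_weight \<alpha> \<beta> x * poly P x))"
proof (cases "p = \<infinity>")
  case True
  then show ?thesis using local_max_weighted_norm_infinity[of \<alpha> \<beta>] J by (simp add: J_def)
next
  case False
  then show ?thesis using local_max_weighted_norm_finite[OF p False, of \<alpha> \<beta>] J by (simp add: J_def)
qed

section \<open>Bernstein's inequality\<close>

lemma pderiv_map_poly_of_real:
  "pderiv (map_poly complex_of_real P) = map_poly complex_of_real (pderiv P)"
  by (intro poly_eqI) (simp add: coeff_pderiv coeff_map_poly)

lemma higher_pderiv_map_poly_of_real:
  "(pderiv ^^ j) (map_poly complex_of_real P) = map_poly complex_of_real ((pderiv ^^ j) P)"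
  by (induction j) (auto simp: pderiv_map_poly_of_real)

lemma higher_deriv_poly:
  fixes P :: "'a :: real_normed_field poly"
  shows "(deriv ^^ j) (poly P) = poly ((pderiv ^^ j) P)"
  by (induction j) (auto intro!: ext DERIV_imp_deriv poly_DERIV)

text \<open>Take z where |P| is largest on the disc of radius R. The discs of radius R/2 about the
  points y lie inside it, so one and the same z serves Cauchy's estimate at all these points and for
  all orders; differences need exactly this.\<close>

lemma pderiv_local_bound:
  fixes P :: "real poly"
  assumes R: "R > 0"
  obtains z where "cmod (z - of_real x) \<le> R"
    "\<And>y j. \<bar>y - x\<bar> \<le> R / 2 \<Longrightarrow> \<bar>poly ((pderiv ^^ j) P) y\<bar> \<le> fact j * (2 / R) ^ j * cmod (poly (map_poly complex_of_real P) z)"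
proof -
  define Q where "Q = map_poly complex_of_real P"
  have "continuous_on (cball (complex_of_real x) R) (\<lambda>z. cmod (poly Q z))" by (intro continuous_intros)
  from continuous_attains_sup[OF _ _ this] R obtain z where
    z: "z \<in> cball (complex_of_real x) R" "\<And>u. u \<in> cball (complex_of_real x) R \<Longrightarrow> cmod (poly Q u) \<le> cmod (poly Q z)"
    by auto
  show thesis
  proof
    show "cmod (z - of_real x) \<le> R" using z(1) by (simp add: dist_norm norm_minus_commute)
    fix y j assume y: "\<bar>y - x\<bar> \<le> R / 2"
    have "norm ((deriv ^^ j) (poly Q) (of_real y)) \<le> fact j * cmod (poly Q z) / (R / 2) ^ j"
    proof (rule Cauchy_inequality)
      show "poly Q holomorphic_on ball (complex_of_real y) (R / 2)" by (intro holomorphic_intros)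
      show "continuous_on (cball (complex_of_real y) (R / 2)) (poly Q)" by (intro continuous_intros)
      fix u assume "cmod (complex_of_real y - u) = R / 2"
      then have "dist (complex_of_real x) u \<le> R"
        using y dist_triangle[of "complex_of_real x" u "complex_of_real y"]
        by (simp add: dist_norm norm_minus_commute abs_minus_commute flip: of_real_diff)
      then show "cmod (poly Q u) \<le> cmod (poly Q z)" by (intro z(2)) simp
    qed (use R in simp)
    then show "\<bar>poly ((pderiv ^^ j) P) y\<bar> \<le> fact j * (2 / R) ^ j * cmod (poly (map_poly complex_of_real P) z)"
      unfolding higher_deriv_poly unfolding Q_def higher_pderiv_map_poly_of_real poly_map_of_real
      by (simp add: power_divide field_simps)
  qed
qed

lemma phi_pos: "-1 < x \<Longrightarrow> x < 1 \<Longrightarrow> 0 < \<phi> x"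
  using abs_square_less_1[of x] by (simp add: \<phi>_def)

lemma borel_measurable_phi [measurable]: "\<phi> \<in> borel_measurable borel"
  unfolding \<phi>_def[abs_def] by measurable

lemma jacobi_weight_phi_power:
  assumes "-1 < x" "x < 1"
  shows "jacobi_weight (real r / 2 + \<alpha>) (real r / 2 + \<beta>) x = jacobi_weight \<alpha> \<beta> x * \<phi> x ^ r"
proof -
  have "\<phi> x = (1 - x) powr (1/2) * (1 + x) powr (1/2)"
    using assms by (simp add: \<phi>_def powr_half_sqrt real_sqrt_mult[symmetric] power2_eq_square algebra_simps)
  then have "\<phi> x ^ r = \<phi> x powr real r" using phi_pos[OF assms] by (simp add: powr_realpow)
  also have "\<dots> = (1 - x) powr (real r / 2) * (1 + x) powr (real r / 2)"
    unfolding \<open>\<phi> x = _\<close> using assms by (simp add: powr_mult powr_powr)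
  finally show ?thesis by (simp add: jacobi_weight_def powr_add mult_ac)
qed

text \<open>With R = \<phi>(x) / (\<kappa> n) the loss (2/R)^j in Cauchy's estimate is compensated
  by \<phi>(x)^j, leaving (2 \<kappa> n)^j independent of x. Divided by this number and j!, the
  weighted derivative is an admissible function for the local maximal estimate.\<close>

lemma weighted_bernstein:
  fixes p :: ennreal and \<alpha> \<beta> :: real
  assumes p: "1 \<le> p" and J: "\<alpha> \<in> J p" "\<beta> \<in> J p"
  shows "\<exists>C>0. \<forall>n\<ge>1. \<forall>P :: real poly. degree P < n \<longrightarrow>
    Lp_norm p (\<lambda>x. jacobi_weight \<alpha> \<beta> x * (\<phi> x ^ j * poly ((pderiv ^^ j) P) x))
      \<le> ennreal (C * real n ^ j) * Lp_norm p (\<lambda>x. jacobi_weight \<alpha> \<beta> x * poly P x)"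
proof -
  obtain \<kappa> C where \<kappa>: "\<kappa> > 0" and C: "C > 0" and key: "\<forall>n\<ge>1. \<forall>P :: real poly. degree P < n \<longrightarrow> (\<forall>v \<in> borel_measurable leb1.
    (\<forall>x. -1 < x \<longrightarrow> x < 1 \<longrightarrow> (\<exists>z. cmod (z - of_real x) \<le> \<phi> x / (\<kappa> * real n) \<and>
        \<bar>v x\<bar> \<le> jacobi_weight \<alpha> \<beta> x * cmod (poly (map_poly complex_of_real P) z))) \<longrightarrow>
    Lp_norm p v \<le> ennreal C * Lp_norm p (\<lambda>x. jacobi_weight \<alpha> \<beta> x * poly P x))"
    using local_max_weighted_norm[OF assms] by (elim exE conjE) (rule that)
  define B where "B = fact j * (2 * \<kappa>) ^ j"
  have B: "B > 0" using \<kappa> by (simp add: B_def)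
  show ?thesis
  proof (intro exI[of _ "B * C"] conjI allI impI)
    fix n :: nat and P :: "real poly" assume n: "1 \<le> n" and deg: "degree P < n"
    define b where "b = B * real n ^ j"
    have b: "b > 0" using B n by (simp add: b_def)
    define v where "v = (\<lambda>x. jacobi_weight \<alpha> \<beta> x * (\<phi> x ^ j * poly ((pderiv ^^ j) P) x))"
    have v: "v \<in> borel_measurable leb1" unfolding v_def by (intro borel_measurable_leb1I) measurable
    have v': "(\<lambda>x. v x / b) \<in> borel_measurable leb1" using v by measurable
    have "Lp_norm p (\<lambda>x. v x / b) \<le> ennreal C * Lp_norm p (\<lambda>x. jacobi_weight \<alpha> \<beta> x * poly P x)"
    proof (rule key[rule_format, OF n deg v'])
      fix x :: real assume x: "-1 < x" "x < 1"
      define R where "R = \<phi> x / (\<kappa> * real n)"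
      have R: "R > 0" using phi_pos[OF x] \<kappa> n by (simp add: R_def)
      obtain z where z: "cmod (z - of_real x) \<le> R"
        "\<And>y j. \<bar>y - x\<bar> \<le> R / 2 \<Longrightarrow> \<bar>poly ((pderiv ^^ j) P) y\<bar> \<le> fact j * (2 / R) ^ j * cmod (poly (map_poly complex_of_real P) z)"
        using pderiv_local_bound[OF R, of x P] by metis
      have "\<phi> x ^ j * \<bar>poly ((pderiv ^^ j) P) x\<bar> \<le> \<phi> x ^ j * (fact j * (2 / R) ^ j * cmod (poly (map_poly complex_of_real P) z))"
        using z(2)[of x j] R phi_pos[OF x] by (intro mult_left_mono) auto
      also have "\<dots> = (\<phi> x * (2 / R)) ^ j * fact j * cmod (poly (map_poly complex_of_real P) z)"
        unfolding power_mult_distrib by (simp only: mult_ac)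
      also have "\<phi> x * (2 / R) = 2 * \<kappa> * real n" using phi_pos[OF x] by (simp add: R_def)
      also have "(2 * \<kappa> * real n) ^ j * fact j = b" by (simp add: b_def B_def power_mult_distrib)
      finally have "jacobi_weight \<alpha> \<beta> x * (\<phi> x ^ j * \<bar>poly ((pderiv ^^ j) P) x\<bar>) \<le> jacobi_weight \<alpha> \<beta> x * (b * cmod (poly (map_poly complex_of_real P) z))"
        by (intro mult_left_mono) auto
      then have "\<bar>v x / b\<bar> \<le> jacobi_weight \<alpha> \<beta> x * cmod (poly (map_poly complex_of_real P) z)"
        using b phi_pos[OF x] by (simp add: v_def abs_mult field_simps)
      then show "\<exists>z. cmod (z - of_real x) \<le> \<phi> x / (\<kappa> * real n) \<and> \<bar>v x / b\<bar> \<le> jacobi_weight \<alpha> \<beta> x * cmod (poly (map_poly complex_of_real P) z)"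
        using z(1) unfolding R_def by blast
    qed
    then have "ennreal b * Lp_norm p (\<lambda>x. v x / b) \<le> ennreal b * (ennreal C * Lp_norm p (\<lambda>x. jacobi_weight \<alpha> \<beta> x * poly P x))"
      by (rule mult_left_mono) simp
    moreover have "Lp_norm p v \<le> ennreal b * Lp_norm p (\<lambda>x. v x / b)"
      using b by (intro Lp_norm_cmult_le[OF p v v']) auto
    moreover have "ennreal b * (ennreal C * Lp_norm p (\<lambda>x. jacobi_weight \<alpha> \<beta> x * poly P x)) =
       ennreal (B * C * real n ^ j) * Lp_norm p (\<lambda>x. jacobi_weight \<alpha> \<beta> x * poly P x)"
    proof -
      have e: "B * C * real n ^ j = b * C" by (simp add: b_def)
      have "ennreal (b * C) = ennreal b * ennreal C" using C by (intro ennreal_mult'') simp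
      then show ?thesis unfolding e by (simp only: mult.assoc)
    qed
    ultimately show "Lp_norm p (\<lambda>x. jacobi_weight \<alpha> \<beta> x * (\<phi> x ^ j * poly ((pderiv ^^ j) P) x))
      \<le> ennreal (B * C * real n ^ j) * Lp_norm p (\<lambda>x. jacobi_weight \<alpha> \<beta> x * poly P x)"
      unfolding v_def by order
  qed (use B C in auto)
qed

section \<open>Symmetric differences\<close>

text \<open>Pascal's rule, read as: a difference of order k + 1 is the k-th difference of the first
  difference.\<close>

lemma binomial_difference_Suc:
  fixes a :: "nat \<Rightarrow> real"
  shows "(\<Sum>i\<le>Suc k. real (Suc k choose i) * (-1) ^ (Suc k - i) * a i)
    = (\<Sum>i\<le>k. real (k choose i) * (-1) ^ (k - i) * (a (Suc i) - a i))"
proof -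
  have "(\<Sum>i\<le>Suc k. real (Suc k choose i) * (-1) ^ (Suc k - i) * a i)
      = (-1) ^ Suc k * a 0 + (\<Sum>i\<le>k. real (Suc k choose Suc i) * (-1) ^ (k - i) * a (Suc i))"
    by (subst sum.atMost_Suc_shift) simp
  also have "(\<Sum>i\<le>k. real (Suc k choose Suc i) * (-1) ^ (k - i) * a (Suc i))
     = (\<Sum>i\<le>k. real (k choose i) * (-1) ^ (k - i) * a (Suc i)) + (\<Sum>i\<le>k. real (k choose Suc i) * (-1) ^ (k - i) * a (Suc i))"
    by (simp add: sum.distrib[symmetric] algebra_simps)
  also have "(\<Sum>i\<le>k. real (k choose Suc i) * (-1) ^ (k - i) * a (Suc i)) = (\<Sum>i<k. real (k choose Suc i) * (-1) ^ (k - i) * a (Suc i))"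
    by (intro sum.mono_neutral_right) (auto simp: not_less)
  also have "\<dots> = (\<Sum>i<k. - (real (k choose Suc i) * (-1) ^ (k - Suc i) * a (Suc i)))"
    by (intro sum.cong refl) (simp add: Suc_diff_Suc[symmetric])
  finally have 1: "(\<Sum>i\<le>Suc k. real (Suc k choose i) * (-1) ^ (Suc k - i) * a i)
    = (\<Sum>i\<le>k. real (k choose i) * (-1) ^ (k - i) * a (Suc i)) - ((-1) ^ k * a 0 + (\<Sum>i<k. real (k choose Suc i) * (-1) ^ (k - Suc i) * a (Suc i)))"
    by (simp add: sum_negf)
  have "(\<Sum>i\<le>k. real (k choose i) * (-1) ^ (k - i) * a i) = (-1) ^ k * a 0 + (\<Sum>i<k. real (k choose Suc i) * (-1) ^ (k - Suc i) * a (Suc i))"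
  proof (cases k)
    case (Suc l)
    then show ?thesis by (subst Suc, subst sum.atMost_Suc_shift) (simp add: lessThan_Suc_atMost)
  qed simp
  then show ?thesis using 1 by (simp add: sum_subtractf right_diff_distrib)
qed

text \<open>Induction on k with the increments \<open>G'\<close> in place of G; the mean value
  theorem for the derivative of order k trades the increment for a factor d.\<close>

lemma abs_binomial_difference_le:
  fixes G :: "nat \<Rightarrow> real \<Rightarrow> real"
  assumes G: "\<And>j s. (G j has_real_derivative G (Suc j) s) (at s)" and d: "0 \<le> d"
    and B: "\<And>s. y \<le> s \<Longrightarrow> s \<le> y + real k * d \<Longrightarrow> \<bar>G k s\<bar> \<le> B"
  shows "\<bar>\<Sum>i\<le>k. real (k choose i) * (-1) ^ (k - i) * G 0 (y + real i * d)\<bar> \<le> d ^ k * B"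
  using G B
proof (induction k arbitrary: G B)
  case 0
  then show ?case using "0.prems"(2)[of y] by simp
next
  case (Suc k)
  define G' where "G' = (\<lambda>j s. G j (s + d) - G j s)"
  have "(\<Sum>i\<le>Suc k. real (Suc k choose i) * (-1) ^ (Suc k - i) * G 0 (y + real i * d))
     = (\<Sum>i\<le>k. real (k choose i) * (-1) ^ (k - i) * G' 0 (y + real i * d))"
    unfolding binomial_difference_Suc by (simp add: G'_def algebra_simps)
  also have "\<bar>\<dots>\<bar> \<le> d ^ k * (d * B)"
  proof (rule Suc.IH)
    show "(G' j has_real_derivative G' (Suc j) s) (at s)" for j s
    proof -
      have "((\<lambda>s. G j (s + d)) has_real_derivative G (Suc j) (s + d)) (at s)"
        using DERIV_shift[of "G j" "G (Suc j) (s + d)" s d] Suc.prems(1) by simp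
      then show ?thesis unfolding G'_def by (intro DERIV_diff Suc.prems(1))
    qed
    fix s assume s: "y \<le> s" "s \<le> y + real k * d"
    show "\<bar>G' k s\<bar> \<le> d * B"
    proof (cases "d = 0")
      case False
      then have "s < s + d" using d by simp
      from MVT2[OF this, of "G k" "G (Suc k)"] Suc.prems(1) obtain u where
        u: "s < u" "u < s + d" "G k (s + d) - G k s = d * G (Suc k) u" by auto
      have "\<bar>G (Suc k) u\<bar> \<le> B" using u s by (intro Suc.prems(2)) (auto simp: algebra_simps)
      then show ?thesis using u(3) d by (simp add: G'_def abs_mult mult_left_mono)
    qed (simp add: G'_def)
  qed
  finally show ?case by (simp add: mult_ac)
qed

section \<open>Weighted differences of derivatives of polynomials\<close>

lemma borel_measurable_W [measurable]: "\<W> \<delta> \<xi> \<zeta> \<in> borel_measurable borel"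
  unfolding \<W>_def[abs_def] by measurable

lemma sym_diff_measurable:
  assumes [measurable]: "F \<in> borel_measurable borel"
  shows "(\<lambda>x. sym_diff k (h * \<phi> x) F x) \<in> borel_measurable borel"
  unfolding sym_diff_def atLeastatMost_subset_iff by measurable

text \<open>The two bases of \<open>\<W>\<close> are the distances from the outermost nodes to the
  endpoints, hence at most 1 - y and 1 + y for every y within the reach of the difference.
  Monotonicity of the powers rests on the nonnegative exponents.\<close>

lemma W_le_jacobi_weight:
  assumes d: "\<delta> \<ge> 0" and x: "-1 < x" "x < 1" and \<xi>: "0 \<le> \<xi>" "0 \<le> \<zeta>"
    and dom: "\<delta> * \<phi> x / 2 \<le> 1 - x" "\<delta> * \<phi> x / 2 \<le> 1 + x" and y: "\<bar>y - x\<bar> \<le> \<delta> * \<phi> x / 2"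
    "-1 < y" "y < 1"
  shows "0 \<le> \<W> \<delta> \<xi> \<zeta> x" "\<W> \<delta> \<xi> \<zeta> x \<le> jacobi_weight \<xi> \<zeta> y"
proof -
  have 1: "1 - x - \<delta> * \<phi> x / 2 \<le> 1 - y" "1 + x - \<delta> * \<phi> x / 2 \<le> 1 + y"
    using y(1) by linarith+
  show "\<W> \<delta> \<xi> \<zeta> x \<le> jacobi_weight \<xi> \<zeta> y"
    unfolding \<W>_def jacobi_weight_def using \<xi> dom
    by (intro mult_mono powr_mono2 1) auto
qed (simp add: \<W>_def)

lemma sym_diff_domain:
  assumes "h \<ge> 0" and x: "-1 < x" "x < 1" and i: "{x - real k * (h * \<phi> x) / 2..x + real k * (h * \<phi> x) / 2} \<subseteq> {-1..1}"
  shows "(real k * h) * \<phi> x / 2 \<le> 1 - x" "(real k * h) * \<phi> x / 2 \<le> 1 + x"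
proof -
  have "0 \<le> real k * (h * \<phi> x) / 2" using assms phi_pos[OF x] by simp
  then show "(real k * h) * \<phi> x / 2 \<le> 1 - x" "(real k * h) * \<phi> x / 2 \<le> 1 + x"
    using i by (auto simp: mult.assoc)
qed

text \<open>As long as the whole difference stays within R/2 of x, the derivative of order k + r at
  all its points is controlled by one value |P(z)|, and the powers of \<phi>(x) from the weight and
  from the step cancel those of R.\<close>

lemma modulus_poly_small_step:
  fixes p :: ennreal and \<alpha> \<beta> :: real
  assumes p: "1 \<le> p" and J: "\<alpha> \<in> J p" "\<beta> \<in> J p" and nn: "real r / 2 + \<alpha> \<ge> 0" "real r / 2 + \<beta> \<ge> 0"
  shows "\<exists>\<epsilon>>0. \<exists>C>0. \<forall>n\<ge>1. \<forall>P :: real poly. degree P < n \<longrightarrow> (\<forall>h\<ge>0. h * real n \<le> \<epsilon> \<longrightarrow>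
    Lp_norm p (\<lambda>x. \<W> (real k * h) (real r / 2 + \<alpha>) (real r / 2 + \<beta>) x * sym_diff k (h * \<phi> x) (poly ((pderiv ^^ r) P)) x)
      \<le> ennreal (C * (h ^ k * real n ^ (k + r))) * Lp_norm p (\<lambda>x. jacobi_weight \<alpha> \<beta> x * poly P x))"
proof -
  obtain \<kappa> C where \<kappa>: "\<kappa> > 0" and C: "C > 0" and key: "\<forall>n\<ge>1. \<forall>P :: real poly. degree P < n \<longrightarrow> (\<forall>v \<in> borel_measurable leb1.
    (\<forall>x. -1 < x \<longrightarrow> x < 1 \<longrightarrow> (\<exists>z. cmod (z - of_real x) \<le> \<phi> x / (\<kappa> * real n) \<and>
        \<bar>v x\<bar> \<le> jacobi_weight \<alpha> \<beta> x * cmod (poly (map_poly complex_of_real P) z))) \<longrightarrow>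
    Lp_norm p v \<le> ennreal C * Lp_norm p (\<lambda>x. jacobi_weight \<alpha> \<beta> x * poly P x))"
    using local_max_weighted_norm[OF p J] by (elim exE conjE) (rule that)
  define B where "B = fact (k + r) * (2 * \<kappa>) ^ (k + r)"
  have B: "B > 0" using \<kappa> by (simp add: B_def)
  \<comment> \<open>Ensures k h \<phi>(x) \<le> R, so that all points of the difference are within
    R/2 of x; k + 1 instead of k keeps the denominator positive.\<close>
  define \<epsilon> where "\<epsilon> = 1 / (\<kappa> * (real k + 1))"
  have \<epsilon>: "\<epsilon> > 0" using \<kappa> by (simp add: \<epsilon>_def add_nonneg_pos)
  show ?thesis
  proof (rule exI[of _ \<epsilon>], intro conjI \<epsilon>, intro exI[of _ "B * C"] conjI allI impI)
    fix n :: nat and P :: "real poly" and h :: real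
    assume n: "1 \<le> n" and deg: "degree P < n" and h: "0 \<le> h" "h * real n \<le> \<epsilon>"
    define b where "b = B * (h ^ k * real n ^ (k + r))"
    have b: "b \<ge> 0" using B h by (simp add: b_def)
    define v where "v = (\<lambda>x. \<W> (real k * h) (real r / 2 + \<alpha>) (real r / 2 + \<beta>) x * sym_diff k (h * \<phi> x) (poly ((pderiv ^^ r) P)) x)"
    have v: "v \<in> borel_measurable leb1"
      unfolding v_def by (intro borel_measurable_leb1I borel_measurable_times sym_diff_measurable) measurable
    have hk: "real k * h * (\<kappa> * real n) \<le> 1"
    proof -
      have "real k * h * (\<kappa> * real n) = (real k * \<kappa>) * (h * real n)" by simp
      also have "\<dots> \<le> ((real k + 1) * \<kappa>) * \<epsilon>" using h \<kappa> by (intro mult_mono) auto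
      also have "\<dots> = 1" using \<kappa> by (simp add: \<epsilon>_def field_simps add_nonneg_eq_0_iff)
      finally show ?thesis .
    qed
    have pw: "\<exists>z. cmod (z - of_real x) \<le> \<phi> x / (\<kappa> * real n) \<and> \<bar>v x\<bar> \<le> b * (jacobi_weight \<alpha> \<beta> x * cmod (poly (map_poly complex_of_real P) z))"
      if x: "-1 < x" "x < 1" for x
    proof -
      define R where "R = \<phi> x / (\<kappa> * real n)"
      note ph = phi_pos[OF x]
      have R: "R > 0" using ph \<kappa> n by (simp add: R_def)
      obtain z where z: "cmod (z - of_real x) \<le> R"
        "\<And>y j. \<bar>y - x\<bar> \<le> R / 2 \<Longrightarrow> \<bar>poly ((pderiv ^^ j) P) y\<bar> \<le> fact j * (2 / R) ^ j * cmod (poly (map_poly complex_of_real P) z)"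
        using pderiv_local_bound[OF R, of x P] by metis
      define M where "M = cmod (poly (map_poly complex_of_real P) z)"
      have M: "M \<ge> 0" by (simp add: M_def)
      define d where "d = h * \<phi> x"
      have d: "d \<ge> 0" using h ph by (simp add: d_def)
      have kd: "real k * d \<le> R"
      proof -
        have "real k * d = (real k * h * (\<kappa> * real n)) * R" using \<kappa> n by (simp add: d_def R_def)
        also have "\<dots> \<le> 1 * R" using hk R by (intro mult_right_mono) auto
        finally show ?thesis by simp
      qed
      have "\<bar>v x\<bar> \<le> b * (jacobi_weight \<alpha> \<beta> x * M)"
      proof (cases "{x - real k * (h * \<phi> x) / 2..x + real k * (h * \<phi> x) / 2} \<subseteq> {-1..1}")
        case True
        note dom = sym_diff_domain[OF h(1) x True]
        have W: "0 \<le> \<W> (real k * h) (real r / 2 + \<alpha>) (real r / 2 + \<beta>) x"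
          "\<W> (real k * h) (real r / 2 + \<alpha>) (real r / 2 + \<beta>) x \<le> jacobi_weight \<alpha> \<beta> x * \<phi> x ^ r"
          using W_le_jacobi_weight[OF _ x nn dom, of x] h ph x jacobi_weight_phi_power[OF x, of r \<alpha> \<beta>] by auto
        have "\<bar>sym_diff k d (poly ((pderiv ^^ r) P)) x\<bar> \<le> d ^ k * (fact (k + r) * (2 / R) ^ (k + r) * M)"
        proof -
          have "sym_diff k d (poly ((pderiv ^^ r) P)) x =
            (\<Sum>i\<le>k. real (k choose i) * (-1) ^ (k - i) * poly ((pderiv ^^ (0 + r)) P) (x - real k * d / 2 + real i * d))"
            using True by (simp add: sym_diff_def d_def)
          also have "\<bar>\<dots>\<bar> \<le> d ^ k * (fact (k + r) * (2 / R) ^ (k + r) * M)"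
          proof (rule abs_binomial_difference_le[where G = "\<lambda>j s. poly ((pderiv ^^ (j + r)) P) s"])
            show "((\<lambda>s. poly ((pderiv ^^ (j + r)) P) s) has_real_derivative poly ((pderiv ^^ (Suc j + r)) P) s) (at s)" for j s
              using poly_DERIV[of "(pderiv ^^ (j + r)) P" s] by simp
            fix s assume s: "x - real k * d / 2 \<le> s" "s \<le> x - real k * d / 2 + real k * d"
            then have "\<bar>s - x\<bar> \<le> R / 2" using kd unfolding abs_le_iff by linarith
            from z(2)[OF this, of "k + r"] show "\<bar>poly ((pderiv ^^ (k + r)) P) s\<bar> \<le> fact (k + r) * (2 / R) ^ (k + r) * M"
              by (simp add: M_def)
          qed (use d in auto)
          finally show ?thesis .
        qed
        then have "\<bar>v x\<bar> \<le> (jacobi_weight \<alpha> \<beta> x * \<phi> x ^ r) * (d ^ k * (fact (k + r) * (2 / R) ^ (k + r) * M))"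
          using W ph unfolding v_def abs_mult d_def by (intro mult_mono) auto
        also have "\<dots> = jacobi_weight \<alpha> \<beta> x * (h ^ k * ((\<phi> x * (2 / R)) ^ (k + r)) * fact (k + r)) * M"
          unfolding d_def power_mult_distrib power_add by (simp only: mult_ac)
        also have "\<phi> x * (2 / R) = (2 * \<kappa>) * real n" using ph by (simp add: R_def)
        also have "h ^ k * ((2 * \<kappa>) * real n) ^ (k + r) * fact (k + r) = b"
          unfolding b_def B_def power_mult_distrib by (simp only: mult_ac)
        finally show ?thesis by (simp only: mult_ac)
      next
        case False
        then have "v x = 0" by (simp add: v_def sym_diff_def del: atLeastatMost_subset_iff)
        then show ?thesis using b M by simp
      qed
      then show ?thesis using z(1) unfolding R_def M_def by blast
    qed
    show "Lp_norm p (\<lambda>x. \<W> (real k * h) (real r / 2 + \<alpha>) (real r / 2 + \<beta>) x * sym_diff k (h * \<phi> x) (poly ((pderiv ^^ r) P)) x)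
      \<le> ennreal (B * C * (h ^ k * real n ^ (k + r))) * Lp_norm p (\<lambda>x. jacobi_weight \<alpha> \<beta> x * poly P x)"
    proof -
      \<comment> \<open>For h = 0 and k > 0 the factor b vanishes, and v with it; the quotient is
        then set to 0.\<close>
      define u where "u = (\<lambda>x. if b = 0 then 0 else v x / b)"
      have um: "u \<in> borel_measurable leb1" using v unfolding u_def by (cases "b = 0") auto
      have "Lp_norm p u \<le> ennreal C * Lp_norm p (\<lambda>x. jacobi_weight \<alpha> \<beta> x * poly P x)"
      proof (rule key[rule_format, OF n deg um])
        fix x :: real assume x: "-1 < x" "x < 1"
        obtain z where z: "cmod (z - of_real x) \<le> \<phi> x / (\<kappa> * real n)"
          "\<bar>v x\<bar> \<le> b * (jacobi_weight \<alpha> \<beta> x * cmod (poly (map_poly complex_of_real P) z))" using pw[OF x] by blast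
        have "\<bar>u x\<bar> \<le> jacobi_weight \<alpha> \<beta> x * cmod (poly (map_poly complex_of_real P) z)"
          using z(2) b by (cases "b = 0") (auto simp: u_def pos_divide_le_eq less_le mult.commute)
        then show "\<exists>z. cmod (z - of_real x) \<le> \<phi> x / (\<kappa> * real n) \<and> \<bar>u x\<bar> \<le> jacobi_weight \<alpha> \<beta> x * cmod (poly (map_poly complex_of_real P) z)"
          using z(1) by blast
      qed
      then have "ennreal b * Lp_norm p u \<le> ennreal b * (ennreal C * Lp_norm p (\<lambda>x. jacobi_weight \<alpha> \<beta> x * poly P x))"
        by (rule mult_left_mono) simp
      moreover have "Lp_norm p v \<le> ennreal b * Lp_norm p u"
      proof (rule Lp_norm_cmult_le[OF p v um b], rule AE_leb1I)
        fix x :: real assume x: "-1 < x" "x < 1"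
        show "\<bar>v x\<bar> \<le> b * \<bar>u x\<bar>"
          using pw[OF x] b by (cases "b = 0") (auto simp: u_def)
      qed
      moreover have "ennreal b * (ennreal C * Lp_norm p (\<lambda>x. jacobi_weight \<alpha> \<beta> x * poly P x)) =
         ennreal (B * C * (h ^ k * real n ^ (k + r))) * Lp_norm p (\<lambda>x. jacobi_weight \<alpha> \<beta> x * poly P x)"
      proof -
        have e: "B * C * (h ^ k * real n ^ (k + r)) = b * C" by (simp add: b_def)
        have "ennreal (b * C) = ennreal b * ennreal C" using C by (intro ennreal_mult'') simp
        then show ?thesis unfolding e by (simp only: mult.assoc)
      qed
      ultimately show ?thesis unfolding v_def by order
    qed
  qed (use B C in auto)
qed

section \<open>The change of variables x + s \<phi>(x)\<close>

lemma phi_has_real_derivative: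
  assumes "-1 < x" "x < 1"
  shows "(\<phi> has_real_derivative - x / \<phi> x) (at x)"
proof -
  have "0 < 1 - x\<^sup>2" using assms abs_square_less_1[of x] by simp
  then show ?thesis unfolding \<phi>_def[abs_def]
    by (auto intro!: derivative_eq_intros simp: field_simps)
qed

text \<open>The points of (-1,1) at which a difference of total length 2 a \<phi>(x) is not set to
  0.\<close>

definition shift_domain :: "real \<Rightarrow> real set" where
  "shift_domain a = {x. -1 < x \<and> x < 1 \<and> a * \<phi> x \<le> 1 - x \<and> a * \<phi> x \<le> 1 + x}"

lemma sets_shift_domain [measurable]: "shift_domain a \<in> sets borel"
  unfolding shift_domain_def by measurable

lemma phi_square:
  assumes "-1 < x" "x < 1"
  shows "(\<phi> x)\<^sup>2 = (1 - \<bar>x\<bar>) * (1 + \<bar>x\<bar>)"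
proof -
  have "x\<^sup>2 < 1" using assms by (simp add: abs_square_less_1 abs_less_iff)
  then have "(\<phi> x)\<^sup>2 = 1 - x\<^sup>2" by (simp add: \<phi>_def)
  then show ?thesis by (simp add: algebra_simps power2_eq_square)
qed

text \<open>Both sides of a \<phi>(x) \<le> 1 - |x| are nonnegative and may be squared; then
  \<phi>^2 = (1 - |x|)(1 + |x|) lets 1 - |x| cancel. What remains is linear in |x|, so the domain is
  an interval.\<close>

lemma mem_shift_domain_iff:
  assumes a: "a > 0" and x: "-1 < x" "x < 1"
  shows "x \<in> shift_domain a \<longleftrightarrow> a\<^sup>2 * (1 + \<bar>x\<bar>) \<le> 1 - \<bar>x\<bar>"
proof -
  have "x \<in> shift_domain a \<longleftrightarrow> a * \<phi> x \<le> 1 - \<bar>x\<bar>" using x by (auto simp: shift_domain_def)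
  also have "\<dots> \<longleftrightarrow> (a * \<phi> x)\<^sup>2 \<le> (1 - \<bar>x\<bar>)\<^sup>2"
    using a x phi_pos[OF x] by (subst abs_le_square_iff[symmetric]) auto
  also have "\<dots> \<longleftrightarrow> (1 - \<bar>x\<bar>) * (a\<^sup>2 * (1 + \<bar>x\<bar>)) \<le> (1 - \<bar>x\<bar>) * (1 - \<bar>x\<bar>)"
    unfolding power_mult_distrib phi_square[OF x] by (simp add: power2_eq_square mult_ac)
  also have "\<dots> \<longleftrightarrow> a\<^sup>2 * (1 + \<bar>x\<bar>) \<le> 1 - \<bar>x\<bar>" using x by (intro mult_le_cancel_left_pos) auto
  finally show ?thesis .
qed

text \<open>On the domain of the symmetric difference the substitution \<open>x \<mapsto> x + s \<phi>(x)\<close> has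
  derivative at least 1/2, although \<open>\<phi>'\<close> is unbounded near \<open>\<plusminus>1\<close>.\<close>

lemma shift_derivative_ge_half:
  assumes a: "a > 0" "\<bar>s\<bar> \<le> a" and x: "x \<in> shift_domain a"
  shows "1/2 \<le> 1 - s * x / \<phi> x"
proof -
  have x1: "-1 < x" "x < 1" using x by (auto simp: shift_domain_def)
  have le: "a * \<phi> x \<le> 1 - \<bar>x\<bar>" using x by (auto simp: shift_domain_def)
  note ph = phi_pos[OF x1]
  have "s * x / \<phi> x \<le> a * \<bar>x\<bar> / \<phi> x"
  proof (rule divide_right_mono)
    have "s * x \<le> \<bar>s\<bar> * \<bar>x\<bar>" by (metis abs_ge_self abs_mult)
    also have "\<dots> \<le> a * \<bar>x\<bar>" using a by (intro mult_right_mono) auto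
    finally show "s * x \<le> a * \<bar>x\<bar>" .
  qed (use ph in simp)
  also have "\<dots> \<le> 1/2"
  proof -
    have "2 * (a * \<bar>x\<bar>) * \<phi> x \<le> 2 * \<bar>x\<bar> * (1 - \<bar>x\<bar>)"
      using mult_left_mono[OF le, of "2 * \<bar>x\<bar>"] by (simp add: mult_ac)
    also have "\<dots> \<le> (1 + \<bar>x\<bar>) * (1 - \<bar>x\<bar>)" using x1 by (intro mult_right_mono) auto
    also have "\<dots> = \<phi> x * \<phi> x" using phi_square[OF x1] by (simp add: power2_eq_square mult_ac)
    finally have "2 * (a * \<bar>x\<bar>) \<le> \<phi> x" using ph by (simp add: mult_le_cancel_right)
    then show ?thesis using ph by (simp add: field_simps)
  qed
  finally show ?thesis by simp
qed

text \<open>The factor 2 is the reciprocal of the lower bound 1/2 for the derivative of x + s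
  \<phi>(x). For a \<ge> 1 the domain contains at most the point 0.\<close>

lemma nn_integral_shift_le:
  fixes g :: "real \<Rightarrow> ennreal"
  assumes a: "a > 0" "\<bar>s\<bar> \<le> a" and g [measurable]: "g \<in> borel_measurable borel"
  shows "(\<integral>\<^sup>+x. g (x + s * \<phi> x) * indicator (shift_domain a) x \<partial>lborel)
    \<le> 2 * (\<integral>\<^sup>+x. g x * indicator {-1<..<1} x \<partial>lborel)"
proof (cases "a < 1")
  case False
  have "shift_domain a \<subseteq> {0}"
  proof
    fix x assume x: "x \<in> shift_domain a"
    then have x1: "-1 < x" "x < 1" by (auto simp: shift_domain_def)
    have "1 \<le> a\<^sup>2" using False by (simp add: one_le_power)
    then have "1 * (1 + \<bar>x\<bar>) \<le> a\<^sup>2 * (1 + \<bar>x\<bar>)" by (intro mult_right_mono) auto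
    then show "x \<in> {0}" using x mem_shift_domain_iff[OF a(1) x1] by simp
  qed
  then have "(\<integral>\<^sup>+x. g (x + s * \<phi> x) * indicator (shift_domain a) x \<partial>lborel) = (\<integral>\<^sup>+x. 0 \<partial>(lborel :: real measure))"
    using AE_lborel_singleton[of "0::real"] by (intro nn_integral_cong_AE) (auto elim!: eventually_mono split: split_indicator)
  then show ?thesis by simp
next
  case True
  \<comment> \<open>The solution of a^2 (1 + X) = 1 - X, the right end of the domain.\<close>
  define X where "X = (1 - a\<^sup>2) / (1 + a\<^sup>2)"
  have a2: "a\<^sup>2 < 1" "0 < a\<^sup>2" using a True by (auto simp: power_less_one_iff abs_square_less_1)
  have a3: "0 < 1 + a\<^sup>2" using a2 by linarith
  then have X: "0 < X" "X < 1" using a2 unfolding X_def by (simp_all only: zero_less_divide_iff divide_less_eq_1_pos) auto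
  have dom: "x \<in> shift_domain a \<longleftrightarrow> x \<in> {-X..X}" for x
  proof (cases "-1 < x \<and> x < 1")
    case x: True
    have "a\<^sup>2 * (1 + \<bar>x\<bar>) \<le> 1 - \<bar>x\<bar> \<longleftrightarrow> \<bar>x\<bar> * (1 + a\<^sup>2) \<le> 1 - a\<^sup>2" by (auto simp: algebra_simps)
    also have "\<dots> \<longleftrightarrow> \<bar>x\<bar> \<le> X" using a3 by (simp add: X_def pos_le_divide_eq)
    finally show ?thesis using x mem_shift_domain_iff[OF a(1)] by auto
  next
    case False
    then show ?thesis using X by (auto simp: shift_domain_def)
  qed
  define T where "T = (\<lambda>x. x + s * \<phi> x)"
  have T1: "-1 \<le> T x" "T x \<le> 1" if "x \<in> {-X..X}" for x
  proof -
    have x: "x \<in> shift_domain a" using that dom by blast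
    then have "\<bar>s * \<phi> x\<bar> \<le> a * \<phi> x" using a phi_pos[of x] by (auto simp: shift_domain_def abs_mult intro!: mult_right_mono)
    then show "-1 \<le> T x" "T x \<le> 1" using x by (auto simp: T_def shift_domain_def)
  qed
  have "(\<integral>\<^sup>+x. g (x + s * \<phi> x) * indicator (shift_domain a) x \<partial>lborel)
      \<le> (\<integral>\<^sup>+x. 2 * (g (T x) * ennreal (1 - s * x / \<phi> x) * indicator {-X..X} x) \<partial>lborel)"
  proof (rule nn_integral_mono)
    fix x :: real
    show "g (x + s * \<phi> x) * indicator (shift_domain a) x \<le> 2 * (g (T x) * ennreal (1 - s * x / \<phi> x) * indicator {-X..X} x)"
    proof (cases "x \<in> shift_domain a")
      case True
      have "ennreal 1 \<le> ennreal (2 * (1 - s * x / \<phi> x))"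
      proof (rule ennreal_leI)
        have "1 \<le> 2 * t" if "1/2 \<le> t" for t :: real using that by simp
        then show "1 \<le> 2 * (1 - s * x / \<phi> x)" using shift_derivative_ge_half[OF a True] .
      qed
      also have "\<dots> = 2 * ennreal (1 - s * x / \<phi> x)"
      proof -
        have "0 \<le> 1 - s * x / \<phi> x" using order_trans[OF _ shift_derivative_ge_half[OF a True], of 0] by simp
        from ennreal_mult[OF _ this, of 2] show ?thesis by simp
      qed
      finally have "g (T x) * 1 \<le> g (T x) * (2 * ennreal (1 - s * x / \<phi> x))"
        by (intro mult_left_mono) auto
      then show ?thesis using True dom[of x] by (simp add: T_def mult_ac)
    qed simp
  qed
  also have "\<dots> = 2 * (\<integral>\<^sup>+x. g (T x) * ennreal (1 - s * x / \<phi> x) * indicator {-X..X} x \<partial>lborel)"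
    unfolding T_def by (rule nn_integral_cmult) measurable
  also have "(\<integral>\<^sup>+x. g (T x) * ennreal (1 - s * x / \<phi> x) * indicator {-X..X} x \<partial>lborel)
     = (\<integral>\<^sup>+x. g x * indicator {T (-X)..T X} x \<partial>lborel)"
  proof (rule nn_integral_substitution_aux[symmetric])
    fix x assume "x \<in> {-X..X}"
    then have x: "x \<in> shift_domain a" "-1 < x" "x < 1" using dom X by auto
    show "(T has_real_derivative 1 - s * x / \<phi> x) (at x)"
      unfolding T_def using phi_has_real_derivative[OF x(2,3)]
      by (auto intro!: derivative_eq_intros)
    show "0 \<le> 1 - s * x / \<phi> x" using order_trans[OF _ shift_derivative_ge_half[OF a x(1)], of 0] by simp
  next
    have "\<phi> x \<noteq> 0" if "x \<in> {-X..X}" for x using phi_pos[of x] that X by auto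
    then show "continuous_on {-X..X} (\<lambda>x. 1 - s * x / \<phi> x)"
      unfolding \<phi>_def[abs_def] by (intro continuous_intros) auto
  qed (use X g in auto)
  also have "\<dots> \<le> (\<integral>\<^sup>+x. g x * indicator {-1<..<1} x \<partial>lborel)"
  proof (rule nn_integral_mono_AE)
    show "AE x in lborel. g x * indicator {T (-X)..T X} x \<le> g x * indicator {-1<..<1} x"
      using AE_lborel_singleton[of "1::real"] AE_lborel_singleton[of "-1::real"]
    proof eventually_elim
      case (elim x)
      then show ?case using T1[of X] T1[of "-X"] X by (auto split: split_indicator)
    qed
  qed
  finally show ?thesis by (simp add: mult_left_mono)
qed

text \<open>Applied to a Borel null set, \<open>nn_integral_shift_le\<close> shows that its preimage
  is null. The endpoints are added to the null set, so that almost all shifted points lie in the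
  open interval.\<close>

lemma AE_leb1_shift:
  assumes a: "a > 0" "\<bar>s\<bar> \<le> a" and Q: "AE y in leb1. Q y"
  shows "AE x in leb1. x \<in> shift_domain a \<longrightarrow> -1 < x + s * \<phi> x \<and> x + s * \<phi> x < 1 \<and> Q (x + s * \<phi> x)"
proof -
  have "AE y in lborel. y \<in> {-1<..<1} \<longrightarrow> Q y"
    using Q unfolding AE_leb1_iff AE_completion_iff .
  with AE_lborel_singleton[of "1::real"] AE_lborel_singleton[of "-1::real"]
  have "AE y in lborel. -1 \<le> y \<and> y \<le> 1 \<longrightarrow> -1 < y \<and> y < 1 \<and> Q y"
    by eventually_elim auto
  then obtain N where N: "{y \<in> space lborel. \<not> (-1 \<le> y \<and> y \<le> 1 \<longrightarrow> -1 < y \<and> y < 1 \<and> Q y)} \<subseteq> N"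
    "emeasure lborel N = 0" "N \<in> sets lborel" by (rule AE_E)
  have [measurable]: "N \<in> sets borel" using N(3) by simp
  have "(\<integral>\<^sup>+x. indicator N (x + s * \<phi> x) * indicator (shift_domain a) x \<partial>lborel)
      \<le> 2 * (\<integral>\<^sup>+x. indicator N x * indicator {-1<..<1} x \<partial>lborel)"
    by (rule nn_integral_shift_le[OF a]) measurable
  also have "\<dots> \<le> 2 * (\<integral>\<^sup>+x. indicator N x \<partial>lborel)"
    by (intro mult_left_mono nn_integral_mono) (auto split: split_indicator)
  also have "\<dots> = 0" using N by simp
  finally have "(\<integral>\<^sup>+x. indicator N (x + s * \<phi> x) * indicator (shift_domain a) x \<partial>lborel) = (0::ennreal)" by simp
  then have "AE x in lborel. indicator N (x + s * \<phi> x) * indicator (shift_domain a) x = (0::ennreal)"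
    by (subst (asm) nn_integral_0_iff_AE) measurable
  then have "AE x in lborel. x \<in> {-1<..<1} \<longrightarrow> x \<in> shift_domain a \<longrightarrow> -1 < x + s * \<phi> x \<and> x + s * \<phi> x < 1 \<and> Q (x + s * \<phi> x)"
  proof eventually_elim
    case (elim x)
    show ?case
    proof (intro impI)
      assume x: "x \<in> shift_domain a"
      then have "x + s * \<phi> x \<notin> N" using elim by (simp add: indicator_def split: if_splits)
      moreover have "-1 \<le> x + s * \<phi> x \<and> x + s * \<phi> x \<le> 1"
      proof -
        have "\<bar>s * \<phi> x\<bar> \<le> a * \<phi> x" using a x phi_pos[of x] by (auto simp: shift_domain_def abs_mult intro!: mult_right_mono)
        then show ?thesis using x by (auto simp: shift_domain_def)
      qed
      ultimately show "-1 < x + s * \<phi> x \<and> x + s * \<phi> x < 1 \<and> Q (x + s * \<phi> x)" using N(1) by auto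
    qed
  qed
  then show ?thesis unfolding AE_leb1_iff AE_completion_iff .
qed

text \<open>The substitution costs a factor 2 in the integral of the q-th power; 2 \<le> 2^q turns
  this into a factor 2 in the norm, uniformly in p.\<close>

lemma Lp_norm_shift:
  assumes p: "1 \<le> p" and a: "a > 0" "\<bar>s\<bar> \<le> a" and u: "u \<in> borel_measurable leb1"
  defines "v \<equiv> \<lambda>x. if x \<in> shift_domain a then u (x + s * \<phi> x) else 0"
  shows "v \<in> borel_measurable leb1" "Lp_norm p v \<le> 2 * Lp_norm p u"
proof -
  obtain G where G [measurable]: "G \<in> borel_measurable borel" and uG: "AE x in leb1. u x = G x"
    by (rule borel_version_leb1[OF u])
  define V where "V = (\<lambda>x. if x \<in> shift_domain a then G (x + s * \<phi> x) else 0)"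
  have V: "V \<in> borel_measurable leb1" unfolding V_def by (intro borel_measurable_leb1I) measurable
  have vV: "AE x in leb1. V x = v x"
    using AE_leb1_shift[OF a uG] by eventually_elim (auto simp: V_def v_def)
  show v: "v \<in> borel_measurable leb1" by (rule borel_measurable_leb1_AE[OF V vV])
  show "Lp_norm p v \<le> 2 * Lp_norm p u"
  proof (cases "p = \<infinity>")
    case True
    have "AE x in leb1. ennreal \<bar>v x\<bar> \<le> Lp_norm \<infinity> u"
      using AE_leb1_shift[OF a Lp_norm_infinity_AE[of u]] by eventually_elim (auto simp: v_def)
    then have "Lp_norm \<infinity> v \<le> Lp_norm \<infinity> u"
      unfolding Lp_norm_def[of \<infinity> v] using v by (auto intro!: esssup_I)
    also have "\<dots> \<le> 2 * Lp_norm \<infinity> u" by (simp add: mult_2)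
    finally show ?thesis by (simp add: True)
  next
    case False
    define q where "q = enn2real p"
    have q: "q \<ge> 1" unfolding q_def by (rule enn2real_exponent_ge_1[OF p False])
    show ?thesis
    proof (cases "Lp_norm p u")
      case (real N)
      have "(\<integral>\<^sup>+x. ennreal (\<bar>v x\<bar> powr q) \<partial>leb1) = (\<integral>\<^sup>+x. ennreal (\<bar>V x\<bar> powr q) \<partial>leb1)"
        using vV by (intro nn_integral_cong_AE) (auto elim!: eventually_mono)
      also have "\<dots> \<le> (\<integral>\<^sup>+x. ennreal (\<bar>G (x + s * \<phi> x)\<bar> powr q) * indicator (shift_domain a) x \<partial>lborel)"
        unfolding nn_integral_leb1 by (intro nn_integral_mono) (auto simp: V_def split: split_indicator)
      also have "\<dots> \<le> 2 * (\<integral>\<^sup>+x. ennreal (\<bar>G x\<bar> powr q) * indicator {-1<..<1} x \<partial>lborel)"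
        by (rule nn_integral_shift_le[OF a]) measurable
      also have "(\<integral>\<^sup>+x. ennreal (\<bar>G x\<bar> powr q) * indicator {-1<..<1} x \<partial>lborel) = (\<integral>\<^sup>+x. ennreal (\<bar>u x\<bar> powr q) \<partial>leb1)"
        unfolding nn_integral_leb1[symmetric] using uG by (intro nn_integral_cong_AE) (auto elim!: eventually_mono)
      also have "\<dots> \<le> ennreal (N powr q)"
        using real Lp_norm_le_iff[OF p False, of N u] by (simp add: q_def)
      also have "2 * ennreal (N powr q) = ennreal (2 powr 1 * N powr q)" by (subst ennreal_mult) auto
      also have "\<dots> \<le> ennreal (2 powr q * N powr q)"
        using q by (intro ennreal_leI mult_right_mono powr_mono) auto
      also have "2 powr q * N powr q = (2 * N) powr q" using real by (simp add: powr_mult)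
      finally have "Lp_norm p v \<le> ennreal (2 * N)"
        using Lp_norm_le_iff[OF p False, of "2 * N" v] real by (simp add: q_def mult_left_mono)
      then show ?thesis using real by (simp add: ennreal_mult)
    qed (simp add: ennreal_mult_top)
  qed
qed

text \<open>The coefficients add up to (1 - 1)^k. The step h = 0 occurs in the supremum defining the
  modulus, whereas the shift estimates ask for a positive step.\<close>

lemma sym_diff_zero_step:
  assumes "k \<ge> 1"
  shows "sym_diff k 0 F x = 0"
proof -
  have "(\<Sum>i\<le>k. real (k choose i) * (-1) ^ (k - i)) = (1 + (-1)) ^ k"
    by (subst binomial_ring) simp
  then have "(\<Sum>i\<le>k. real (k choose i) * (-1) ^ (k - i)) = 0" using assms by simp
  then show ?thesis by (simp add: sym_diff_def sum_distrib_right[symmetric])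
qed

text \<open>At each node the shrunken weight is at most the Jacobi weight there, so the i-th term is
  dominated by a shift of the weighted function \<phi>^r F. The constant is 2 for each shift times
  the sum 2^k of the binomial coefficients.\<close>

lemma Lp_norm_weighted_sym_diff:
  fixes F :: "real \<Rightarrow> real"
  assumes p: "1 \<le> p" and k: "k \<ge> 1" and h: "h \<ge> 0" and F: "F \<in> borel_measurable leb1"
    and nn: "real r / 2 + \<alpha> \<ge> 0" "real r / 2 + \<beta> \<ge> 0"
  defines "D \<equiv> \<lambda>x. \<W> (real k * h) (real r / 2 + \<alpha>) (real r / 2 + \<beta>) x * sym_diff k (h * \<phi> x) F x"
  shows "D \<in> borel_measurable leb1"
    and "Lp_norm p D \<le> ennreal (2 ^ (k + 1)) * Lp_norm p (\<lambda>x. jacobi_weight \<alpha> \<beta> x * (\<phi> x ^ r * F x))"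
proof -
  have "D \<in> borel_measurable leb1 \<and>
    Lp_norm p D \<le> ennreal (2 ^ (k + 1)) * Lp_norm p (\<lambda>x. jacobi_weight \<alpha> \<beta> x * (\<phi> x ^ r * F x))"
  proof (cases "h = 0")
    case True
    then have "D = (\<lambda>x. 0)" using k by (simp add: D_def sym_diff_zero_step)
    then show ?thesis using Lp_norm_zero[OF p] by simp
  next
    case False
    then have h: "h > 0" using h by simp
    define a where "a = real k * h / 2"
    have a: "a > 0" using h k by (simp add: a_def)
    define s where "s = (\<lambda>i. (real i - real k / 2) * h)"
    have s: "\<bar>s i\<bar> \<le> a" if "i \<le> k" for i
    proof -
      have "\<bar>real i - real k / 2\<bar> \<le> real k / 2" using of_nat_mono[OF that, where ?'a = real] unfolding abs_le_iff by linarith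
      then have "\<bar>real i - real k / 2\<bar> * h \<le> (real k / 2) * h" using h by (intro mult_right_mono) auto
      then show ?thesis using h by (simp add: s_def a_def abs_mult)
    qed
    define W where "W = \<W> (real k * h) (real r / 2 + \<alpha>) (real r / 2 + \<beta>)"
    have Wm: "W \<in> borel_measurable leb1" unfolding W_def by (intro borel_measurable_leb1I) measurable
    define u where "u = (\<lambda>x. jacobi_weight \<alpha> \<beta> x * (\<phi> x ^ r * F x))"
    have [measurable]: "jacobi_weight \<alpha> \<beta> \<in> borel_measurable leb1" "\<phi> \<in> borel_measurable leb1"
      by (auto intro!: borel_measurable_leb1I)
    have u: "u \<in> borel_measurable leb1" unfolding u_def using F by measurable
    define Fs where "Fs = (\<lambda>i x. if x \<in> shift_domain a then F (x + s i * \<phi> x) else 0)"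
    define us where "us = (\<lambda>i x. if x \<in> shift_domain a then u (x + s i * \<phi> x) else 0)"
    have Fs: "Fs i \<in> borel_measurable leb1" if "i \<le> k" for i
      unfolding Fs_def by (rule Lp_norm_shift(1)[OF p a s[OF that] F])
    have us: "us i \<in> borel_measurable leb1" "Lp_norm p (us i) \<le> 2 * Lp_norm p u" if "i \<le> k" for i
      unfolding us_def using Lp_norm_shift[OF p a s[OF that] u] by auto
    have dom: "{x - real k * (h * \<phi> x) / 2..x + real k * (h * \<phi> x) / 2} \<subseteq> {-1..1} \<longleftrightarrow> x \<in> shift_domain a"
      if x: "-1 < x" "x < 1" for x
    proof -
      have e: "real k * (h * \<phi> x) / 2 = a * \<phi> x" by (simp add: a_def)
      \<comment> \<open>The interval is nonempty, so its inclusion in [-1,1] is not vacuous.\<close>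
      have "a * \<phi> x > 0" using a phi_pos[OF x] by simp
      then show ?thesis unfolding e using x by (auto simp: shift_domain_def)
    qed
    have Deq: "D x = (\<Sum>i\<le>k. real (k choose i) * (-1) ^ (k - i) * (W x * Fs i x))" if x: "-1 < x" "x < 1" for x
    proof (cases "x \<in> shift_domain a")
      case True
      have "x - real k * (h * \<phi> x) / 2 + real i * (h * \<phi> x) = x + s i * \<phi> x" for i
        by (simp add: s_def algebra_simps)
      note node = this
      have "sym_diff k (h * \<phi> x) F x = (\<Sum>i\<le>k. real (k choose i) * (-1) ^ (k - i) * F (x + s i * \<phi> x))"
        using True dom[OF x] unfolding sym_diff_def node by (simp only: if_True)
      then show ?thesis using True
        by (simp add: D_def W_def Fs_def sum_distrib_left mult_ac)
    next
      case False
      then show ?thesis using dom[OF x] by (simp add: D_def sym_diff_def Fs_def del: atLeastatMost_subset_iff)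
    qed
    have Dm: "D \<in> borel_measurable leb1"
    proof (rule borel_measurable_leb1_AE)
      show "(\<lambda>x. \<Sum>i\<le>k. real (k choose i) * (-1) ^ (k - i) * (W x * Fs i x)) \<in> borel_measurable leb1"
        using Wm Fs by (intro borel_measurable_sum borel_measurable_times borel_measurable_const) auto
      show "AE x in leb1. (\<Sum>i\<le>k. real (k choose i) * (-1) ^ (k - i) * (W x * Fs i x)) = D x"
        by (intro AE_leb1I) (simp add: Deq)
    qed
    have "Lp_norm p D \<le> (\<Sum>i\<in>{..k}. Lp_norm p (\<lambda>x. real (k choose i) * us i x))"
    proof (rule Lp_norm_sum[OF p _ Dm])
      show "(\<lambda>x. real (k choose i) * us i x) \<in> borel_measurable leb1" if "i \<in> {..k}" for i
      proof -
        have [measurable]: "us i \<in> borel_measurable leb1" using that by (intro us(1)) simp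
        show ?thesis by measurable
      qed
      have "AE x in leb1. \<forall>i\<in>{..k}. x \<in> shift_domain a \<longrightarrow> -1 < x + s i * \<phi> x \<and> x + s i * \<phi> x < 1 \<and> True"
      proof (rule AE_finite_allI)
        fix i assume "i \<in> {..k}"
        then have "\<bar>s i\<bar> \<le> a" by (intro s) simp
        then show "AE x in leb1. x \<in> shift_domain a \<longrightarrow> -1 < x + s i * \<phi> x \<and> x + s i * \<phi> x < 1 \<and> True"
          by (rule AE_leb1_shift[OF a]) simp
      qed simp
      moreover have "AE x in leb1. -1 < x \<and> x < 1" by (intro AE_leb1I) auto
      ultimately show "AE x in leb1. \<bar>D x\<bar> \<le> (\<Sum>i\<in>{..k}. \<bar>real (k choose i) * us i x\<bar>)"
      proof eventually_elim
        case (elim x)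
        then have x: "-1 < x" "x < 1" by auto
        have "\<bar>D x\<bar> \<le> (\<Sum>i\<le>k. \<bar>real (k choose i) * (-1) ^ (k - i) * (W x * Fs i x)\<bar>)"
          unfolding Deq[OF x] by (rule sum_abs)
        also have "\<dots> \<le> (\<Sum>i\<in>{..k}. \<bar>real (k choose i) * us i x\<bar>)"
        proof (rule sum_mono)
          fix i assume i: "i \<in> {..k}"
          have "\<bar>W x * Fs i x\<bar> \<le> \<bar>us i x\<bar>"
          proof (cases "x \<in> shift_domain a")
            case True
            define y where "y = x + s i * \<phi> x"
            have y: "-1 < y" "y < 1" using elim(1) i True by (auto simp: y_def)
            have da: "(real k * h) * \<phi> x / 2 = a * \<phi> x" by (simp add: a_def)
            have "\<bar>y - x\<bar> = \<bar>s i\<bar> * \<phi> x" using phi_pos[OF x] by (simp add: y_def abs_mult)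
            also have "\<dots> \<le> a * \<phi> x" using s[of i] i phi_pos[OF x] by (intro mult_right_mono) auto
            finally have yx: "\<bar>y - x\<bar> \<le> (real k * h) * \<phi> x / 2" unfolding da .
            have "0 \<le> W x" "W x \<le> jacobi_weight (real r / 2 + \<alpha>) (real r / 2 + \<beta>) y"
              unfolding W_def using True h
              by (intro W_le_jacobi_weight[OF _ x nn _ _ yx y]; simp add: shift_domain_def da)+
            then have "\<bar>W x\<bar> * \<bar>F y\<bar> \<le> (jacobi_weight \<alpha> \<beta> y * \<phi> y ^ r) * \<bar>F y\<bar>"
              unfolding jacobi_weight_phi_power[OF y] by (intro mult_right_mono) auto
            then show ?thesis using True phi_pos[OF y]
              by (simp add: Fs_def us_def u_def y_def[symmetric] abs_mult mult.assoc)
          qed (simp add: Fs_def us_def)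
          then have "real (k choose i) * \<bar>W x * Fs i x\<bar> \<le> real (k choose i) * \<bar>us i x\<bar>"
            by (intro mult_left_mono) auto
          then show "\<bar>real (k choose i) * (-1) ^ (k - i) * (W x * Fs i x)\<bar> \<le> \<bar>real (k choose i) * us i x\<bar>"
            by (simp add: abs_mult power_abs)
        qed
        finally show ?case .
      qed
    qed simp
    also have "\<dots> \<le> (\<Sum>i\<in>{..k}. ennreal (real (k choose i)) * (2 * Lp_norm p u))"
    proof (rule sum_mono)
      fix i assume "i \<in> {..k}"
      then have i: "i \<le> k" by simp
      have "Lp_norm p (\<lambda>x. real (k choose i) * us i x) \<le> ennreal (real (k choose i)) * Lp_norm p (us i)"
        using us(1)[OF i] by (intro Lp_norm_cmult_le[OF p]) (auto simp: abs_mult)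
      also have "\<dots> \<le> ennreal (real (k choose i)) * (2 * Lp_norm p u)"
        by (intro mult_left_mono us(2)[OF i]) simp
      finally show "Lp_norm p (\<lambda>x. real (k choose i) * us i x) \<le> \<dots>" .
    qed
    also have "\<dots> = ennreal (\<Sum>i\<le>k. real (k choose i)) * (2 * Lp_norm p u)"
      unfolding sum_distrib_right[symmetric] by (subst sum_ennreal) auto
    also have "(\<Sum>i\<le>k. real (k choose i)) = 2 ^ k"
      by (metis choose_row_sum of_nat_numeral of_nat_power of_nat_sum)
    also have "ennreal (2 ^ k) * (2 * Lp_norm p u) = ennreal (2 ^ (k + 1)) * Lp_norm p u"
    proof -
      have "ennreal (2 ^ (k + 1)) = ennreal (2 ^ k) * 2" by (simp add: ennreal_mult mult.commute)
      then show ?thesis by (simp only: mult.assoc)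
    qed
    finally show ?thesis using Dm by (simp add: u_def)
  qed
  then show "D \<in> borel_measurable leb1"
    "Lp_norm p D \<le> ennreal (2 ^ (k + 1)) * Lp_norm p (\<lambda>x. jacobi_weight \<alpha> \<beta> x * (\<phi> x ^ r * F x))" by auto
qed

text \<open>Beyond the threshold for h n the difference is bounded by 2^(k+1) times the weighted
  norm of \<phi>^r P^(r), and Bernstein's inequality suffices: as h n exceeds \<epsilon>, the
  missing factor (h n)^k is inserted at the price \<epsilon>^(-k).\<close>

lemma modulus_poly:
  fixes p :: ennreal and \<alpha> \<beta> :: real
  assumes p: "1 \<le> p" and J: "\<alpha> \<in> J p" "\<beta> \<in> J p" and nn: "real r / 2 + \<alpha> \<ge> 0" "real r / 2 + \<beta> \<ge> 0"
    and k: "k \<ge> 1"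
  shows "\<exists>C>0. \<forall>n\<ge>1. \<forall>P :: real poly. degree P < n \<longrightarrow> (\<forall>h\<ge>0.
    Lp_norm p (\<lambda>x. \<W> (real k * h) (real r / 2 + \<alpha>) (real r / 2 + \<beta>) x * sym_diff k (h * \<phi> x) (poly ((pderiv ^^ r) P)) x)
      \<le> ennreal (C * (h ^ k * real n ^ (k + r))) * Lp_norm p (\<lambda>x. jacobi_weight \<alpha> \<beta> x * poly P x))"
proof -
  obtain \<epsilon> C1 where \<epsilon>: "\<epsilon> > 0" and C1: "C1 > 0" and small: "\<forall>n\<ge>1. \<forall>P :: real poly. degree P < n \<longrightarrow> (\<forall>h\<ge>0. h * real n \<le> \<epsilon> \<longrightarrow>
    Lp_norm p (\<lambda>x. \<W> (real k * h) (real r / 2 + \<alpha>) (real r / 2 + \<beta>) x * sym_diff k (h * \<phi> x) (poly ((pderiv ^^ r) P)) x)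
      \<le> ennreal (C1 * (h ^ k * real n ^ (k + r))) * Lp_norm p (\<lambda>x. jacobi_weight \<alpha> \<beta> x * poly P x))"
    using modulus_poly_small_step[OF p J nn, of k] by (elim exE conjE) (rule that)
  obtain C2 where C2: "C2 > 0" and bern: "\<forall>n\<ge>1. \<forall>P :: real poly. degree P < n \<longrightarrow>
    Lp_norm p (\<lambda>x. jacobi_weight \<alpha> \<beta> x * (\<phi> x ^ r * poly ((pderiv ^^ r) P) x))
      \<le> ennreal (C2 * real n ^ r) * Lp_norm p (\<lambda>x. jacobi_weight \<alpha> \<beta> x * poly P x)"
    using weighted_bernstein[OF p J, of r] by (elim exE conjE) (rule that)
  define C3 where "C3 = 2 ^ (k + 1) * C2 * (1 / \<epsilon>) ^ k"
  have C3: "C3 > 0" using C2 \<epsilon> by (simp add: C3_def)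
  show ?thesis
  proof (intro exI[of _ "C1 + C3"] conjI allI impI)
    fix n :: nat and P :: "real poly" and h :: real
    assume n: "1 \<le> n" and deg: "degree P < n" and h: "0 \<le> h"
    define X where "X = Lp_norm p (\<lambda>x. jacobi_weight \<alpha> \<beta> x * poly P x)"
    define Y where "Y = Lp_norm p (\<lambda>x. \<W> (real k * h) (real r / 2 + \<alpha>) (real r / 2 + \<beta>) x * sym_diff k (h * \<phi> x) (poly ((pderiv ^^ r) P)) x)"
    have hn: "0 \<le> h ^ k * real n ^ (k + r)" using h by simp
    have "Y \<le> ennreal ((C1 + C3) * (h ^ k * real n ^ (k + r))) * X"
    proof (cases "h * real n \<le> \<epsilon>")
      case True
      have "Y \<le> ennreal (C1 * (h ^ k * real n ^ (k + r))) * X"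
        unfolding X_def Y_def by (rule small[rule_format, OF n deg h True])
      also have "\<dots> \<le> ennreal ((C1 + C3) * (h ^ k * real n ^ (k + r))) * X"
        using C3 hn by (intro mult_right_mono ennreal_leI) auto
      finally show ?thesis .
    next
      case False
      have "Y \<le> ennreal (2 ^ (k + 1)) * Lp_norm p (\<lambda>x. jacobi_weight \<alpha> \<beta> x * (\<phi> x ^ r * poly ((pderiv ^^ r) P) x))"
        unfolding Y_def by (rule Lp_norm_weighted_sym_diff(2)[OF p k h borel_measurable_leb1I nn]) measurable
      also have "\<dots> \<le> ennreal (2 ^ (k + 1)) * (ennreal (C2 * real n ^ r) * X)"
        unfolding X_def by (intro mult_left_mono bern[rule_format, OF n deg]) simp
      also have "\<dots> = ennreal (2 ^ (k + 1) * (C2 * real n ^ r)) * X"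
        using C2 by (subst ennreal_mult) (auto simp: mult.assoc)
      also have "\<dots> \<le> ennreal ((C1 + C3) * (h ^ k * real n ^ (k + r))) * X"
      proof (intro mult_right_mono ennreal_leI)
        have "1 \<le> (1 / \<epsilon>) * (h * real n)" using False \<epsilon> by (simp add: field_simps)
        then have "1 \<le> ((1 / \<epsilon>) * (h * real n)) ^ k" by (rule one_le_power)
        then have "2 ^ (k + 1) * (C2 * real n ^ r) * 1 \<le> 2 ^ (k + 1) * (C2 * real n ^ r) * ((1 / \<epsilon>) * (h * real n)) ^ k"
          using C2 by (intro mult_left_mono) auto
        also have "\<dots> = C3 * (h ^ k * real n ^ (k + r))"
          unfolding C3_def power_mult_distrib power_add by (simp only: mult_ac)
        also have "\<dots> \<le> (C1 + C3) * (h ^ k * real n ^ (k + r))"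
          using C1 hn by (intro mult_right_mono) auto
        finally show "2 ^ (k + 1) * (C2 * real n ^ r) \<le> (C1 + C3) * (h ^ k * real n ^ (k + r))" by simp
      qed simp
      finally show ?thesis .
    qed
    then show "Lp_norm p (\<lambda>x. \<W> (real k * h) (real r / 2 + \<alpha>) (real r / 2 + \<beta>) x * sym_diff k (h * \<phi> x) (poly ((pderiv ^^ r) P)) x)
      \<le> ennreal ((C1 + C3) * (h ^ k * real n ^ (k + r))) * Lp_norm p (\<lambda>x. jacobi_weight \<alpha> \<beta> x * poly P x)"
      by (simp only: X_def Y_def)
  qed (use C1 C3 in auto)
qed

section \<open>Termwise differentiation almost everywhere\<close>

text \<open>The weak type (1,1) inequality for the centred maximal function, by Vitali's covering
  lemma: the balls enlarged five times have length 10 r, while each ball itself carries mass above 2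
  lam r. Asserting a covering Borel set B leaves the measurability of the exceptional set
  aside.\<close>

lemma hardy_littlewood_maximal_cover:
  fixes R :: "real \<Rightarrow> ennreal"
  assumes R [measurable]: "R \<in> borel_measurable borel" and fin: "(\<integral>\<^sup>+y. R y \<partial>lborel) < \<infinity>" and l: "lam > 0"
  obtains B where "B \<in> sets borel" "emeasure lborel B \<le> ennreal (5 / lam) * (\<integral>\<^sup>+y. R y \<partial>lborel)"
    "\<And>x h. h > 0 \<Longrightarrow> ennreal (lam * (2 * h)) < (\<integral>\<^sup>+y. R y * indicator (cball x h) y \<partial>lborel) \<Longrightarrow> x \<in> B"
proof -
  define \<nu> where "\<nu> = density lborel R"
  have \<nu>: "emeasure \<nu> A = (\<integral>\<^sup>+y. R y * indicator A y \<partial>lborel)" if "A \<in> sets borel" for A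
    unfolding \<nu>_def using that by (subst emeasure_density) auto
  have \<nu>le: "emeasure \<nu> A \<le> (\<integral>\<^sup>+y. R y \<partial>lborel)" for A
  proof -
    have "emeasure \<nu> A \<le> emeasure \<nu> (space \<nu>)" by (rule emeasure_space)
    also have "\<dots> = (\<integral>\<^sup>+y. R y \<partial>lborel)" using \<nu>[of UNIV] by (simp add: \<nu>_def)
    finally show ?thesis .
  qed
  define E where "E = {x. \<exists>h>0. ennreal (lam * (2 * h)) < emeasure \<nu> (cball x h)}"
  have "\<forall>x\<in>E. \<exists>h. 0 < h \<and> ennreal (lam * (2 * h)) < emeasure \<nu> (cball x h)" by (simp add: E_def)
  from bchoice[OF this] obtain r where
    "\<forall>x\<in>E. 0 < r x \<and> ennreal (lam * (2 * r x)) < emeasure \<nu> (cball x (r x))" by (rule exE)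
  then have r: "0 < r x \<and> ennreal (lam * (2 * r x)) < emeasure \<nu> (cball x (r x))" if "x \<in> E" for x
    using that by (rule bspec)
  define I where "I = enn2real (\<integral>\<^sup>+y. R y \<partial>lborel)"
  have I: "(\<integral>\<^sup>+y. R y \<partial>lborel) = ennreal I" "I \<ge> 0" using fin by (auto simp: I_def)
  \<comment> \<open>The finite total mass bounds the radii, as Vitali's lemma demands.\<close>
  have bound: "0 < r x \<and> r x \<le> I / (2 * lam)" if "x \<in> E" for x
  proof -
    have "ennreal (lam * (2 * r x)) \<le> ennreal I"
      using r[OF that] \<nu>le[of "cball x (r x)"] I(1) by (metis less_imp_le order_trans)
    then have "lam * (2 * r x) \<le> I" using I(2) by (simp add: ennreal_le_iff)
    then show ?thesis using r[OF that] l by (simp add: field_simps)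
  qed
  have "E \<subseteq> (\<Union>i\<in>E. cball i (r i))" using bound by fastforce
  from Vitali_covering_lemma_cballs[OF this bound] obtain C where C: "countable C" "C \<subseteq> E"
    "pairwise (\<lambda>i j. disjnt (cball i (r i)) (cball j (r j))) C" "E \<subseteq> (\<Union>i\<in>C. cball i (5 * r i))"
    by blast
  define c where "c = from_nat_into C"
  define N where "N = to_nat_on C ` C"
  have cN: "c n \<in> C" "to_nat_on C (c n) = n" if "n \<in> N" for n
    using that C(1) by (auto simp: N_def c_def)
  \<comment> \<open>Countable additivity asks for a sequence; indices that number no ball receive
    the empty set.\<close>
  define f where "f = (\<lambda>n. if n \<in> N then cball (c n) (r (c n)) else {})"
  define g where "g = (\<lambda>n. if n \<in> N then cball (c n) (5 * r (c n)) else {})"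
  have fs: "f n \<in> sets borel" and gs: "g n \<in> sets borel" for n by (auto simp: f_def g_def)
  have gU: "(\<Union>i\<in>C. cball i (5 * r i)) \<subseteq> (\<Union>n. g n)"
  proof
    fix y assume "y \<in> (\<Union>i\<in>C. cball i (5 * r i))"
    then obtain i where i: "i \<in> C" "y \<in> cball i (5 * r i)" by auto
    then have "to_nat_on C i \<in> N" "c (to_nat_on C i) = i" using C(1) by (auto simp: N_def c_def)
    then have "y \<in> g (to_nat_on C i)" using i(2) by (simp add: g_def)
    then show "y \<in> (\<Union>n. g n)" by blast
  qed
  have dis: "disjoint_family f"
    unfolding disjoint_family_on_def
  proof (intro ballI impI)
    fix m n :: nat assume mn: "m \<noteq> n"
    show "f m \<inter> f n = {}"
    proof (cases "m \<in> N \<and> n \<in> N")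
      case True
      then have "c m \<noteq> c n" using cN mn by metis
      then show ?thesis using C(3) cN True by (auto simp: f_def pairwise_def disjnt_def)
    qed (auto simp: f_def)
  qed
  have "emeasure lborel (\<Union>n. g n) \<le> (\<Sum>n. emeasure lborel (g n))"
    using gs by (intro emeasure_subadditive_countably) auto
  also have "\<dots> \<le> (\<Sum>n. ennreal (5 / lam) * emeasure \<nu> (f n))"
  proof (intro suminf_le)
    fix n
    show "emeasure lborel (g n) \<le> ennreal (5 / lam) * emeasure \<nu> (f n)"
    proof (cases "n \<in> N")
      case True
      then have cE: "c n \<in> E" using cN C(2) by auto
      have "g n = {c n - 5 * r (c n)..c n + 5 * r (c n)}"
        using True by (simp add: g_def cball_eq_atLeastAtMost)
      then have "emeasure lborel (g n) = ennreal (10 * r (c n))" using r[OF cE] by simp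
      also have "\<dots> = ennreal (5 / lam) * ennreal (lam * (2 * r (c n)))"
        using l r[OF cE] by (subst ennreal_mult''[symmetric]) auto
      also have "\<dots> \<le> ennreal (5 / lam) * emeasure \<nu> (f n)"
        using r[OF cE] True by (intro mult_left_mono) (auto simp: f_def less_imp_le)
      finally show ?thesis .
    qed (simp add: g_def)
  qed auto
  also have "\<dots> = ennreal (5 / lam) * (\<Sum>n. emeasure \<nu> (f n))" by simp
  also have "(\<Sum>n. emeasure \<nu> (f n)) = emeasure \<nu> (\<Union>n. f n)"
    using fs dis by (intro suminf_emeasure) (auto simp: \<nu>_def)
  also have "ennreal (5 / lam) * emeasure \<nu> (\<Union>n. f n) \<le> ennreal (5 / lam) * (\<integral>\<^sup>+y. R y \<partial>lborel)"
    by (intro mult_left_mono \<nu>le) simp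
  finally have "emeasure lborel (\<Union>n. g n) \<le> ennreal (5 / lam) * (\<integral>\<^sup>+y. R y \<partial>lborel)" .
  moreover have "x \<in> (\<Union>n. g n)" if "h > 0" "ennreal (lam * (2 * h)) < (\<integral>\<^sup>+y. R y * indicator (cball x h) y \<partial>lborel)" for x h
  proof -
    have "x \<in> E" unfolding E_def using that by (auto simp: \<nu>)
    then show ?thesis using C(4) gU by blast
  qed
  moreover have "(\<Union>n. g n) \<in> sets borel" using gs by auto
  ultimately show thesis by (rule that[rotated])
qed

lemma abs_increment_le_nn_integral:
  fixes U d :: "real \<Rightarrow> real"
  assumes U: "\<And>x. (U has_real_derivative d x) (at x)" and d: "continuous_on UNIV d" and xy: "x \<le> y"
  shows "ennreal \<bar>U y - U x\<bar> \<le> (\<integral>\<^sup>+t. ennreal \<bar>d t\<bar> * indicator {x..y} t \<partial>lborel)"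
proof -
  have dc: "continuous_on {x..y} d" using d continuous_on_subset by blast
  have "(d has_integral (U y - U x)) {x..y}"
    using U xy by (intro fundamental_theorem_of_calculus) (auto intro: has_field_derivative_at_within simp flip: has_real_derivative_iff_has_vector_derivative)
  then have "U y - U x = integral {x..y} d" by (simp add: integral_unique)
  also have "\<bar>\<dots>\<bar> \<le> integral {x..y} (\<lambda>t. \<bar>d t\<bar>)"
    using dc by (intro integral_norm_bound_integral[where f = d, unfolded real_norm_def] integrable_continuous_interval continuous_intros) auto
  finally have "ennreal \<bar>U y - U x\<bar> \<le> ennreal (integral {x..y} (\<lambda>t. \<bar>d t\<bar>))" by (rule ennreal_leI)
  also have "\<dots> = (\<integral>\<^sup>+t. ennreal \<bar>d t\<bar> * indicator {x..y} t \<partial>lborel)"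
  proof (rule nn_integral_has_integral_lebesgue'[symmetric])
    show "((\<lambda>t. \<bar>d t\<bar>) has_integral integral {x..y} (\<lambda>t. \<bar>d t\<bar>)) {x..y}"
      using dc by (intro integrable_integral integrable_continuous_interval continuous_intros)
  qed simp
  finally show ?thesis .
qed

lemma suminf_tail_tendsto_zero_ennreal:
  fixes a :: "nat \<Rightarrow> ennreal"
  assumes "(\<Sum>i. a i) < \<infinity>"
  shows "(\<lambda>m. \<Sum>i. a (i + m)) \<longlonglongrightarrow> 0"
proof -
  define b where "b = (\<lambda>i. enn2real (a i))"
  have "a i < top" for i using assms by (metis ennreal_suminf_lessD infinity_ennreal_def)
  then have a: "a i = ennreal (b i)" "b i \<ge> 0" for i by (auto simp: b_def)
  have b: "summable b"
  proof (rule summable_suminf_not_top[OF a(2)])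
    show "(\<Sum>i. ennreal (b i)) \<noteq> top" using assms by (simp add: a(1)[symmetric])
  qed
  have "(\<lambda>m. \<Sum>i. b (i + m)) \<longlonglongrightarrow> 0"
    using suminf_exist_split2[OF b] .
  then have "(\<lambda>m. ennreal (\<Sum>i. b (i + m))) \<longlonglongrightarrow> ennreal 0" by (rule tendsto_ennrealI)
  moreover have "(\<Sum>i. a (i + m)) = ennreal (\<Sum>i. b (i + m))" for m
    unfolding a(1) using a(2) b by (intro suminf_ennreal2) (auto simp: summable_iff_shift)
  ultimately show ?thesis by simp
qed

text \<open>The intersection of all the sets B m has measure at most c a m for every m, hence
  0.\<close>

lemma AE_lborel_inf_coverI:
  assumes B: "\<And>m::nat. B m \<in> sets borel" and le: "\<And>m. emeasure lborel (B m) \<le> c * a m" and a: "a \<longlonglongrightarrow> (0::ennreal)" and c: "c < \<infinity>"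
  shows "AE x in lborel. \<exists>m. x \<notin> B m"
proof (rule AE_I')
  have "(\<Inter>m. B m) \<in> sets borel" using B by auto
  moreover have "emeasure lborel (\<Inter>m. B m) = 0"
  proof -
    have "(\<lambda>m. c * a m) \<longlonglongrightarrow> c * 0"
      using a c by (intro ennreal_tendsto_cmult) auto
    moreover have "emeasure lborel (\<Inter>m. B m) \<le> c * a m" for m
      using B by (intro order_trans[OF emeasure_mono le[of m]]) auto
    ultimately have "emeasure lborel (\<Inter>m. B m) \<le> c * 0"
      by (intro LIMSEQ_le_const) auto
    then show ?thesis by simp
  qed
  ultimately show "(\<Inter>m. B m) \<in> null_sets lborel" by (auto simp: null_sets_def)
qed auto

text \<open>A substitute for Lebesgue's differentiation theorem that suffices for termwise
  differentiation: the tail of the series is controlled by the maximal function, the head is smooth.\<close>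

lemma AE_termwise_derivative:
  fixes U d :: "nat \<Rightarrow> real \<Rightarrow> real" and H :: "real \<Rightarrow> real"
  assumes U: "\<And>i x. (U i has_real_derivative d i x) (at x)" and d: "\<And>i. continuous_on UNIV (d i)"
    and fin: "(\<Sum>i. \<integral>\<^sup>+t. ennreal \<bar>d i t\<bar> * indicator {a..b} t \<partial>lborel) < \<infinity>"
    and H: "\<And>x y. a \<le> x \<Longrightarrow> x \<le> b \<Longrightarrow> a \<le> y \<Longrightarrow> y \<le> b \<Longrightarrow> (\<lambda>i. U i y - U i x) sums (H y - H x)"
  shows "AE x in lborel. a < x \<and> x < b \<longrightarrow> summable (\<lambda>i. \<bar>d i x\<bar>) \<and> (H has_real_derivative (\<Sum>i. d i x)) (at x)"
proof -
  have dm [measurable]: "d i \<in> borel_measurable borel" for i using d by (rule borel_measurable_continuous_onI)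
  define A where "A = (\<lambda>i. \<integral>\<^sup>+t. ennreal \<bar>d i t\<bar> * indicator {a..b} t \<partial>lborel)"
  \<comment> \<open>R m majorizes the termwise derivative of the m-th tail; the restriction to [a,b]
    makes it integrable over the line.\<close>
  define R where "R = (\<lambda>m x. \<Sum>i. ennreal \<bar>d (i + m) x\<bar> * indicator {a..b} x)"
  have Rm [measurable]: "R m \<in> borel_measurable borel" for m unfolding R_def by measurable
  have IR: "(\<integral>\<^sup>+x. R m x \<partial>lborel) = (\<Sum>i. A (i + m))" for m
    unfolding R_def A_def by (rule nn_integral_suminf) measurable
  have lim: "(\<lambda>m. \<Sum>i. A (i + m)) \<longlonglongrightarrow> 0"
    using fin unfolding A_def by (rule suminf_tail_tendsto_zero_ennreal)
  have Rfin: "(\<integral>\<^sup>+x. R m x \<partial>lborel) < \<infinity>" for m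
  proof -
    have "(\<Sum>i. A (i + m)) \<le> (\<Sum>i. A i)"
      using suminf_offset[OF summableI, of A m] by (simp add: add.commute) 
    then show ?thesis using fin unfolding IR A_def by (rule le_less_trans)
  qed
  \<comment> \<open>For fixed m the points where R m reaches e or its maximal function exceeds e
    have a cover of measure at most (5 + 1)/e times the integral of R m, which tends to 0 as m
    grows. So almost every point escapes for some m.\<close>
  have good: "AE x in lborel. \<exists>m. R m x \<le> ennreal e \<and> (\<forall>h>0. (\<integral>\<^sup>+y. R m y * indicator (cball x h) y \<partial>lborel) \<le> ennreal (e * (2 * h)))"
    if e: "e > 0" for e
  proof -
    have "\<exists>B. B \<in> sets borel \<and> emeasure lborel B \<le> ennreal (5 / e) * (\<integral>\<^sup>+y. R m y \<partial>lborel) \<and>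
      (\<forall>x h. h > 0 \<longrightarrow> ennreal (e * (2 * h)) < (\<integral>\<^sup>+y. R m y * indicator (cball x h) y \<partial>lborel) \<longrightarrow> x \<in> B)" for m
      by (rule hardy_littlewood_maximal_cover[OF Rm Rfin e]) blast
    then obtain B where B: "\<And>m. B m \<in> sets borel" "\<And>m. emeasure lborel (B m) \<le> ennreal (5 / e) * (\<integral>\<^sup>+y. R m y \<partial>lborel)"
      "\<And>m x h. h > 0 \<Longrightarrow> ennreal (e * (2 * h)) < (\<integral>\<^sup>+y. R m y * indicator (cball x h) y \<partial>lborel) \<Longrightarrow> x \<in> B m"
      by metis
    define D where "D = (\<lambda>m. {x. 1 \<le> ennreal (1 / e) * R m x})"
    have D: "D m \<in> sets borel" for m unfolding D_def by measurable
    have "emeasure lborel (B m \<union> D m) \<le> ennreal (6 / e) * (\<Sum>i. A (i + m))" for m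
    proof -
      have "emeasure lborel (D m) \<le> ennreal (1 / e) * (\<integral>\<^sup>+y. R m y \<partial>lborel)"
        using nn_integral_Markov_inequality[of "R m" UNIV lborel "ennreal (1 / e)"] by (simp add: D_def)
      then have "emeasure lborel (B m \<union> D m) \<le> ennreal (5 / e) * (\<integral>\<^sup>+y. R m y \<partial>lborel) + ennreal (1 / e) * (\<integral>\<^sup>+y. R m y \<partial>lborel)"
        using B D by (intro order_trans[OF emeasure_subadditive add_mono]) auto
      also have "\<dots> = (ennreal (5 / e) + ennreal (1 / e)) * (\<integral>\<^sup>+y. R m y \<partial>lborel)" by (simp only: distrib_right)
      also have "ennreal (5 / e) + ennreal (1 / e) = ennreal (6 / e)"
        using e by (subst ennreal_plus[symmetric]) (auto simp: field_simps)
      finally show ?thesis by (simp only: IR)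
    qed
    from AE_lborel_inf_coverI[of "\<lambda>m. B m \<union> D m", OF _ this lim] have "AE x in lborel. \<exists>m. x \<notin> B m \<union> D m"
      using B D by auto
    then show ?thesis
    proof eventually_elim
      case (elim x)
      then obtain m where m: "x \<notin> B m" "x \<notin> D m" by auto
      have "R m x \<le> ennreal e"
      proof (rule ccontr)
        assume "\<not> ?thesis"
        then have "ennreal (1 / e) * ennreal e \<le> ennreal (1 / e) * R m x" by (intro mult_left_mono) auto
        moreover have "ennreal (1 / e) * ennreal e = 1" using e by (subst ennreal_mult''[symmetric]) auto
        ultimately show False using m(2) by (simp add: D_def)
      qed
      moreover have "(\<integral>\<^sup>+y. R m y * indicator (cball x h) y \<partial>lborel) \<le> ennreal (e * (2 * h))" if "h > 0" for h
        using B(3)[OF that] m(1) by (meson not_less)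
      ultimately show ?case by blast
    qed
  qed
  have "AE x in lborel. \<forall>j::nat. \<exists>m. R m x \<le> ennreal (1 / Suc j) \<and> (\<forall>h>0. (\<integral>\<^sup>+y. R m y * indicator (cball x h) y \<partial>lborel) \<le> ennreal (1 / Suc j * (2 * h)))"
    unfolding AE_all_countable by (intro allI good) auto
  moreover have "AE x in lborel. R 0 x \<noteq> \<infinity>"
    using Rfin[of 0] by (intro nn_integral_PInf_AE) auto
  ultimately show ?thesis
  proof eventually_elim
    case (elim x)
    show ?case
    proof (intro impI, elim conjE)
      assume x: "a < x" "x < b"
      have "(\<Sum>i. ennreal \<bar>d i x\<bar>) \<noteq> top" using elim(2) x by (simp add: R_def)
      then have summ: "summable (\<lambda>i. \<bar>d i x\<bar>)" by (intro summable_suminf_not_top) auto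
      have "((\<lambda>h. (H (x + h) - H x) / h) \<longlongrightarrow> (\<Sum>i. d i x)) (at 0)"
      proof (rule LIM_I)
        fix \<epsilon> :: real assume \<epsilon>: "0 < \<epsilon>"
        \<comment> \<open>Four shares of \<epsilon>: two for the difference quotient of the tail, as
          the bound on R m is for the ball of length 2|h|, one for that of the head, and one for the
          tail of the derivatives.\<close>
        obtain j where "1 / real (Suc j) < \<epsilon> / 4" using \<epsilon> nat_approx_posE[of "\<epsilon> / 4"] by auto
        then have j: "1 / Suc j < \<epsilon> / 4" by simp
        define e where "e = 1 / real (Suc j)"
        have e: "e > 0" "e < \<epsilon> / 4" using j by (auto simp: e_def)
        obtain m where m: "R m x \<le> ennreal e" "\<And>h. h > 0 \<Longrightarrow> (\<integral>\<^sup>+y. R m y * indicator (cball x h) y \<partial>lborel) \<le> ennreal (e * (2 * h))"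
          using elim(1) by (auto simp: e_def)
        define S where "S = (\<lambda>y. \<Sum>i<m. U i y)"
        have "(S has_real_derivative (\<Sum>i<m. d i x)) (at x)" unfolding S_def by (intro DERIV_sum U)
        then have "((\<lambda>h. (S (x + h) - S x) / h) \<longlongrightarrow> (\<Sum>i<m. d i x)) (at 0)" unfolding DERIV_def .
        from LIM_D[OF this, of e] e obtain s where s: "s > 0" "\<And>h. h \<noteq> 0 \<Longrightarrow> \<bar>h\<bar> < s \<Longrightarrow> \<bar>(S (x + h) - S x) / h - (\<Sum>i<m. d i x)\<bar> < e"
          by auto
        define s' where "s' = min s (min (x - a) (b - x))"
        have s': "s' > 0" using s x by (simp add: s'_def)
        have tail: "\<bar>\<Sum>i. d (i + m) x\<bar> \<le> e"
        proof -
          have sm: "summable (\<lambda>i. \<bar>d (i + m) x\<bar>)" using summ by (subst summable_iff_shift)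
          have "ennreal (\<Sum>i. \<bar>d (i + m) x\<bar>) = R m x" unfolding R_def using x sm by (subst suminf_ennreal2[symmetric]) auto
          then have "ennreal (\<Sum>i. \<bar>d (i + m) x\<bar>) \<le> ennreal e" using m(1) by (simp only:)
          then have "(\<Sum>i. \<bar>d (i + m) x\<bar>) \<le> e" using e by (subst (asm) ennreal_le_iff) auto
          then show ?thesis using summable_rabs[OF sm] by linarith
        qed
        have split: "(\<Sum>i. d i x) = (\<Sum>i. d (i + m) x) + (\<Sum>i<m. d i x)"
          by (rule suminf_split_initial_segment[OF summable_rabs_cancel[OF summ]])
        show "\<exists>s>0. \<forall>h. h \<noteq> 0 \<and> norm (h - 0) < s \<longrightarrow> norm ((H (x + h) - H x) / h - (\<Sum>i. d i x)) < \<epsilon>"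
        proof (intro exI[of _ s'] conjI s' allI impI, elim conjE)
          fix h :: real assume h: "h \<noteq> 0" "norm (h - 0) < s'"
          have hs: "\<bar>h\<bar> < s" "\<bar>h\<bar> < x - a" "\<bar>h\<bar> < b - x" using h by (auto simp: s'_def)
          have sums: "(\<lambda>i. U i (x + h) - U i x) sums (H (x + h) - H x)" using hs x by (intro H) auto
          have tsums: "(\<lambda>i. U (i + m) (x + h) - U (i + m) x) sums ((H (x + h) - H x) - (S (x + h) - S x))"
            using sums_split_initial_segment[OF sums, of m] by (simp add: S_def sum_subtractf)
          have inc: "ennreal \<bar>U (i + m) (x + h) - U (i + m) x\<bar> \<le> (\<integral>\<^sup>+y. (ennreal \<bar>d (i + m) y\<bar> * indicator {a..b} y) * indicator (cball x \<bar>h\<bar>) y \<partial>lborel)" for i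
          proof -
            have "ennreal \<bar>U (i + m) (x + h) - U (i + m) x\<bar> \<le> (\<integral>\<^sup>+t. ennreal \<bar>d (i + m) t\<bar> * indicator {min x (x + h)..max x (x + h)} t \<partial>lborel)"
              using abs_increment_le_nn_integral[where U = "U (i + m)" and d = "d (i + m)" and x = "min x (x + h)" and y = "max x (x + h)", OF U d]
              by (auto simp: min_def max_def abs_minus_commute split: if_splits)
            also have "\<dots> \<le> (\<integral>\<^sup>+y. (ennreal \<bar>d (i + m) y\<bar> * indicator {a..b} y) * indicator (cball x \<bar>h\<bar>) y \<partial>lborel)"
              using hs x by (intro nn_integral_mono) (auto simp: indicator_def dist_real_def)
            finally show ?thesis .
          qed
          have "(\<Sum>i. ennreal \<bar>U (i + m) (x + h) - U (i + m) x\<bar>) \<le> (\<Sum>i. (\<integral>\<^sup>+y. (ennreal \<bar>d (i + m) y\<bar> * indicator {a..b} y) * indicator (cball x \<bar>h\<bar>) y \<partial>lborel))"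
            by (intro suminf_le inc) auto
          also have "\<dots> = (\<integral>\<^sup>+y. (\<Sum>i. (ennreal \<bar>d (i + m) y\<bar> * indicator {a..b} y) * indicator (cball x \<bar>h\<bar>) y) \<partial>lborel)"
          proof (rule nn_integral_suminf[symmetric])
            have [measurable]: "cball x \<bar>h\<bar> \<in> sets borel" by simp
            show "(\<lambda>y. (ennreal \<bar>d (i + m) y\<bar> * indicator {a..b} y) * indicator (cball x \<bar>h\<bar>) y) \<in> borel_measurable lborel" for i
              by measurable
          qed
          also have "\<dots> = (\<integral>\<^sup>+y. R m y * indicator (cball x \<bar>h\<bar>) y \<partial>lborel)"
            unfolding R_def by simp
          also have "\<dots> \<le> ennreal (e * (2 * \<bar>h\<bar>))" using m(2) h by simp
          finally have le: "(\<Sum>i. ennreal \<bar>U (i + m) (x + h) - U (i + m) x\<bar>) \<le> ennreal (e * (2 * \<bar>h\<bar>))" .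
          then have "(\<Sum>i. ennreal \<bar>U (i + m) (x + h) - U (i + m) x\<bar>) \<noteq> top" by (auto simp: top_unique)
          then have sabs: "summable (\<lambda>i. \<bar>U (i + m) (x + h) - U (i + m) x\<bar>)" by (intro summable_suminf_not_top) auto
          have "(\<Sum>i. \<bar>U (i + m) (x + h) - U (i + m) x\<bar>) \<le> e * (2 * \<bar>h\<bar>)"
            using le sabs e by (subst (asm) suminf_ennreal2) (auto simp: ennreal_le_iff)
          then have tl: "\<bar>(H (x + h) - H x) - (S (x + h) - S x)\<bar> \<le> e * (2 * \<bar>h\<bar>)"
            using summable_rabs[OF sabs] sums_unique[OF tsums] by simp
          have "\<bar>((H (x + h) - H x) - (S (x + h) - S x)) / h\<bar> \<le> 2 * e"
            using tl h by (simp add: field_simps)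
          then have "\<bar>(H (x + h) - H x) / h - (S (x + h) - S x) / h\<bar> \<le> 2 * e" by (simp only: diff_divide_distrib)
          moreover have "\<bar>(S (x + h) - S x) / h - (\<Sum>i<m. d i x)\<bar> < e" using s(2) h hs by simp
          ultimately show "norm ((H (x + h) - H x) / h - (\<Sum>i. d i x)) < \<epsilon>"
            using tail e unfolding split real_norm_def by linarith
        qed
      qed
      then show "summable (\<lambda>i. \<bar>d i x\<bar>) \<and> (H has_real_derivative (\<Sum>i. d i x)) (at x)"
        using summ unfolding DERIV_def by simp
    qed
  qed
qed

section \<open>Limits of polynomials in the weighted norm\<close>

text \<open>Instead of Hoelder's inequality, |y| \<le> M + M^(1-q) |y|^q is used for M > 0; over an
  interval of length 2 it integrates to 2 M + M = 3 M as soon as M bounds the norm. M is let down to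
  the norm at the end, because the norm may be 0.\<close>

lemma nn_integral_abs_le_Lp_norm:
  assumes p: "1 \<le> p" and y: "y \<in> borel_measurable leb1"
  shows "(\<integral>\<^sup>+x. ennreal \<bar>y x\<bar> \<partial>leb1) \<le> 3 * Lp_norm p y"
proof -
  have sp: "(\<integral>\<^sup>+x. c \<partial>leb1) = c * 2" for c
    by (simp add: emeasure_restrict_space)
  show ?thesis
  proof (cases "Lp_norm p y")
    case (real N)
    show ?thesis
    proof (cases "p = \<infinity>")
      case True
      have "(\<integral>\<^sup>+x. ennreal \<bar>y x\<bar> \<partial>leb1) \<le> (\<integral>\<^sup>+x. Lp_norm p y \<partial>leb1)"
        using Lp_norm_infinity_AE[of y] by (intro nn_integral_mono_AE) (simp add: True)
      also have "\<dots> = Lp_norm p y * 2" by (rule sp)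
      also have "\<dots> \<le> Lp_norm p y * 3" by (intro mult_left_mono) auto
      finally show ?thesis by (simp add: mult.commute)
    next
      case False
      define q where "q = enn2real p"
      have q: "q \<ge> 1" unfolding q_def by (rule enn2real_exponent_ge_1[OF p False])
      have bound: "(\<integral>\<^sup>+x. ennreal \<bar>y x\<bar> \<partial>leb1) \<le> ennreal (3 * M)" if M: "M > 0" "N \<le> M" for M
      proof -
        have le: "(\<integral>\<^sup>+x. ennreal (\<bar>y x\<bar> powr q) \<partial>leb1) \<le> ennreal (M powr q)"
          using Lp_norm_le_iff[OF p False, of M y] real M by (simp add: q_def)
        have pw: "\<bar>y x\<bar> \<le> M + M powr (1 - q) * \<bar>y x\<bar> powr q" for x
        proof (cases "\<bar>y x\<bar> \<le> M")
          case False
          then have "M powr (q - 1) \<le> \<bar>y x\<bar> powr (q - 1)" using M q by (intro powr_mono2) auto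
          then have "M powr (1 - q) * M powr (q - 1) * \<bar>y x\<bar> \<le> M powr (1 - q) * \<bar>y x\<bar> powr (q - 1) * \<bar>y x\<bar>"
            by (intro mult_right_mono mult_left_mono) auto
          moreover have "M powr (1 - q) * M powr (q - 1) = 1" using M by (simp flip: powr_add)
          moreover have "\<bar>y x\<bar> powr (q - 1) * \<bar>y x\<bar> = \<bar>y x\<bar> powr q" using False M by (simp add: powr_diff)
          ultimately have "\<bar>y x\<bar> \<le> M powr (1 - q) * \<bar>y x\<bar> powr q" by (simp add: mult.assoc)
          then show ?thesis using M by simp
        qed (auto intro: add_increasing2)
        have "(\<integral>\<^sup>+x. ennreal \<bar>y x\<bar> \<partial>leb1) \<le> (\<integral>\<^sup>+x. ennreal M + ennreal (M powr (1 - q)) * ennreal (\<bar>y x\<bar> powr q) \<partial>leb1)"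
        proof (rule nn_integral_mono)
          fix x
          have "ennreal \<bar>y x\<bar> \<le> ennreal (M + M powr (1 - q) * \<bar>y x\<bar> powr q)" by (rule ennreal_leI[OF pw])
          also have "\<dots> = ennreal M + ennreal (M powr (1 - q)) * ennreal (\<bar>y x\<bar> powr q)"
            using M by (subst ennreal_plus) (auto simp: ennreal_mult)
          finally show "ennreal \<bar>y x\<bar> \<le> \<dots>" .
        qed
        also have "\<dots> = ennreal M * 2 + ennreal (M powr (1 - q)) * (\<integral>\<^sup>+x. ennreal (\<bar>y x\<bar> powr q) \<partial>leb1)"
        proof -
          note [measurable] = y
          have "(\<integral>\<^sup>+x. ennreal M + ennreal (M powr (1 - q)) * ennreal (\<bar>y x\<bar> powr q) \<partial>leb1)
             = (\<integral>\<^sup>+x. ennreal M \<partial>leb1) + (\<integral>\<^sup>+x. ennreal (M powr (1 - q)) * ennreal (\<bar>y x\<bar> powr q) \<partial>leb1)"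
            by (rule nn_integral_add) measurable
          also have "(\<integral>\<^sup>+x. ennreal M \<partial>leb1) = ennreal M * 2" by (rule sp)
          also have "(\<integral>\<^sup>+x. ennreal (M powr (1 - q)) * ennreal (\<bar>y x\<bar> powr q) \<partial>leb1) = ennreal (M powr (1 - q)) * (\<integral>\<^sup>+x. ennreal (\<bar>y x\<bar> powr q) \<partial>leb1)"
            by (rule nn_integral_cmult) measurable
          finally show ?thesis .
        qed
        also have "\<dots> \<le> ennreal M * ennreal 2 + ennreal (M powr (1 - q)) * ennreal (M powr q)"
          using le by (intro add_mono mult_left_mono) auto
        also have "\<dots> = ennreal (M * 2 + M powr (1 - q) * M powr q)"
          using M by (subst ennreal_plus) (auto simp: ennreal_mult)
        also have "M * 2 + M powr (1 - q) * M powr q = 3 * M" using M by (simp flip: powr_add)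
        finally show ?thesis .
      qed
      have "(\<integral>\<^sup>+x. ennreal \<bar>y x\<bar> \<partial>leb1) \<le> ennreal (3 * N)"
      proof (rule ennreal_le_epsilon)
        fix e :: real assume e: "0 < e"
        have "(\<integral>\<^sup>+x. ennreal \<bar>y x\<bar> \<partial>leb1) \<le> ennreal (3 * (N + e / 3))" using real e by (intro bound) auto
        also have "3 * (N + e / 3) = 3 * N + e" by simp
        finally show "(\<integral>\<^sup>+x. ennreal \<bar>y x\<bar> \<partial>leb1) \<le> ennreal (3 * N) + ennreal e" using real e by simp
      qed
      then show ?thesis using real by (simp add: ennreal_mult)
    qed
  qed (simp add: ennreal_mult_top)
qed

text \<open>On a compact subinterval the weight times \<phi>^j has a positive minimum, so the
  weighted norm controls the L_1 norm there.\<close>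

lemma local_integral_le_weighted_Lp_norm:
  assumes p: "1 \<le> p" and c: "0 < c" "c < 1"
  shows "\<exists>K>0. \<forall>v \<in> borel_measurable leb1.
    (\<integral>\<^sup>+x. ennreal \<bar>v x\<bar> * indicator {-c..c} x \<partial>lborel) \<le> ennreal K * Lp_norm p (\<lambda>x. jacobi_weight \<alpha> \<beta> x * (\<phi> x ^ j * v x))"
proof -
  define J where "J = (\<lambda>x. jacobi_weight \<alpha> \<beta> x * \<phi> x ^ j)"
  have "continuous_on {-c..c} J"
    unfolding J_def jacobi_weight_def \<phi>_def[abs_def] using c by (intro continuous_intros) auto
  from continuous_attains_inf[OF _ _ this] c obtain x0 where x0: "x0 \<in> {-c..c}" "\<And>x. x \<in> {-c..c} \<Longrightarrow> J x0 \<le> J x" by auto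
  define d where "d = J x0"
  have d: "d > 0" using x0(1) c phi_pos[of x0] jacobi_weight_pos[of x0 \<alpha> \<beta>] by (simp add: d_def J_def)
  show ?thesis
  proof (intro exI[of _ "3 / d"] conjI ballI)
    fix v :: "real \<Rightarrow> real" assume v: "v \<in> borel_measurable leb1"
    have [measurable]: "jacobi_weight \<alpha> \<beta> \<in> borel_measurable leb1" "\<phi> \<in> borel_measurable leb1"
      by (auto intro!: borel_measurable_leb1I)
    have Jv: "(\<lambda>x. jacobi_weight \<alpha> \<beta> x * (\<phi> x ^ j * v x)) \<in> borel_measurable leb1" using v by measurable
    have "(\<integral>\<^sup>+x. ennreal \<bar>v x\<bar> * indicator {-c..c} x \<partial>lborel) \<le>
      (\<integral>\<^sup>+x. (ennreal (1 / d) * ennreal \<bar>jacobi_weight \<alpha> \<beta> x * (\<phi> x ^ j * v x)\<bar>) * indicator {-1<..<1} x \<partial>lborel)"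
    proof (rule nn_integral_mono)
      fix x :: real
      show "ennreal \<bar>v x\<bar> * indicator {-c..c} x \<le> (ennreal (1 / d) * ennreal \<bar>jacobi_weight \<alpha> \<beta> x * (\<phi> x ^ j * v x)\<bar>) * indicator {-1<..<1} x"
      proof (cases "x \<in> {-c..c}")
        case True
        then have x: "-1 < x" "x < 1" using c by auto
        have "d * \<bar>v x\<bar> \<le> J x * \<bar>v x\<bar>" using x0(2)[OF True] by (intro mult_right_mono) (auto simp: d_def)
        also have "\<dots> = \<bar>jacobi_weight \<alpha> \<beta> x * (\<phi> x ^ j * v x)\<bar>" using phi_pos[OF x] by (simp add: J_def abs_mult)
        finally have "\<bar>v x\<bar> \<le> (1 / d) * \<bar>jacobi_weight \<alpha> \<beta> x * (\<phi> x ^ j * v x)\<bar>" using d by (simp add: field_simps)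
        then have "ennreal \<bar>v x\<bar> \<le> ennreal (1 / d) * ennreal \<bar>jacobi_weight \<alpha> \<beta> x * (\<phi> x ^ j * v x)\<bar>"
          using d by (subst ennreal_mult[symmetric]) (auto intro!: ennreal_leI)
        then show ?thesis using True x by simp
      qed simp
    qed
    also have "\<dots> = (\<integral>\<^sup>+x. ennreal (1 / d) * ennreal \<bar>jacobi_weight \<alpha> \<beta> x * (\<phi> x ^ j * v x)\<bar> \<partial>leb1)"
      by (rule nn_integral_leb1[symmetric])
    also have "\<dots> = ennreal (1 / d) * (\<integral>\<^sup>+x. ennreal \<bar>jacobi_weight \<alpha> \<beta> x * (\<phi> x ^ j * v x)\<bar> \<partial>leb1)"
    proof (rule nn_integral_cmult)
      note [measurable] = v
      show "(\<lambda>x. ennreal \<bar>jacobi_weight \<alpha> \<beta> x * (\<phi> x ^ j * v x)\<bar>) \<in> borel_measurable leb1" by measurable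
    qed
    also have "\<dots> \<le> ennreal (1 / d) * (3 * Lp_norm p (\<lambda>x. jacobi_weight \<alpha> \<beta> x * (\<phi> x ^ j * v x)))"
      by (intro mult_left_mono nn_integral_abs_le_Lp_norm[OF p Jv]) simp
    also have "\<dots> = ennreal (3 / d) * Lp_norm p (\<lambda>x. jacobi_weight \<alpha> \<beta> x * (\<phi> x ^ j * v x))"
    proof -
      have "ennreal (3 / d) = ennreal (1 / d) * 3" using d ennreal_mult[of "1 / d" 3] by simp
      then show ?thesis by (simp only: mult.assoc)
    qed
    finally show "(\<integral>\<^sup>+x. ennreal \<bar>v x\<bar> * indicator {-c..c} x \<partial>lborel) \<le> \<dots>" .
  qed (use d in simp)
qed

text \<open>Averaging |v x| \<le> |v t| + |v x - v t| over t: the L_1 norms of a function and of its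
  derivative bound its supremum. In this way convergence in norm becomes uniform convergence on
  compact subintervals.\<close>

lemma pointwise_le_integral_derivative:
  fixes v d :: "real \<Rightarrow> real"
  assumes v: "\<And>x. (v has_real_derivative d x) (at x)" and d: "continuous_on UNIV d" and c: "c > 0" and x: "x \<in> {-c..c}"
  shows "ennreal \<bar>v x\<bar> * ennreal (2 * c) \<le> (\<integral>\<^sup>+t. ennreal \<bar>v t\<bar> * indicator {-c..c} t \<partial>lborel)
     + (\<integral>\<^sup>+t. ennreal \<bar>d t\<bar> * indicator {-c..c} t \<partial>lborel) * ennreal (2 * c)"
proof -
  have vm [measurable]: "v \<in> borel_measurable borel"
    using v by (intro borel_measurable_continuous_onI continuous_at_imp_continuous_on ballI DERIV_isCont) blast
  define I where "I = (\<integral>\<^sup>+t. ennreal \<bar>d t\<bar> * indicator {-c..c} t \<partial>lborel)"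
  have "ennreal \<bar>v x\<bar> * ennreal (2 * c) = (\<integral>\<^sup>+t. ennreal \<bar>v x\<bar> * indicator {-c..c} t \<partial>lborel)"
    using c by (subst nn_integral_cmult_indicator) auto
  also have "\<dots> \<le> (\<integral>\<^sup>+t. ennreal \<bar>v t\<bar> * indicator {-c..c} t + I * indicator {-c..c} t \<partial>lborel)"
  proof (rule nn_integral_mono)
    fix t :: real
    show "ennreal \<bar>v x\<bar> * indicator {-c..c} t \<le> ennreal \<bar>v t\<bar> * indicator {-c..c} t + I * indicator {-c..c} t"
    proof (cases "t \<in> {-c..c}")
      case True
      have "ennreal \<bar>v x - v t\<bar> \<le> (\<integral>\<^sup>+s. ennreal \<bar>d s\<bar> * indicator {min t x..max t x} s \<partial>lborel)"
        using abs_increment_le_nn_integral[OF v d, of "min t x" "max t x"]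
        by (auto simp: min_def max_def abs_minus_commute split: if_splits)
      also have "\<dots> \<le> I" unfolding I_def using True x by (intro nn_integral_mono) (auto simp: indicator_def)
      finally have 1: "ennreal \<bar>v x - v t\<bar> \<le> I" .
      have "ennreal \<bar>v x\<bar> \<le> ennreal (\<bar>v t\<bar> + \<bar>v x - v t\<bar>)" by (intro ennreal_leI) linarith
      also have "\<dots> = ennreal \<bar>v t\<bar> + ennreal \<bar>v x - v t\<bar>" by (intro ennreal_plus) auto
      also have "\<dots> \<le> ennreal \<bar>v t\<bar> + I" using 1 by (intro add_mono) auto
      finally show ?thesis using True by simp
    qed simp
  qed
  also have "\<dots> = (\<integral>\<^sup>+t. ennreal \<bar>v t\<bar> * indicator {-c..c} t \<partial>lborel) + (\<integral>\<^sup>+t. I * indicator {-c..c} t \<partial>lborel)"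
    by (rule nn_integral_add) measurable
  also have "(\<integral>\<^sup>+t. I * indicator {-c..c} t \<partial>lborel) = I * ennreal (2 * c)"
    using c by (subst nn_integral_cmult_indicator) auto
  finally show ?thesis unfolding I_def .
qed

lemma deriv_cong_open:
  assumes "open S" "x \<in> S" "\<And>y. y \<in> S \<Longrightarrow> f y = g y"
  shows "deriv f x = deriv g x"
  using assms by (intro deriv_cong_ev) (auto simp: eventually_nhds)

lemma higher_deriv_cong_open:
  assumes "open S" "\<And>y. y \<in> S \<Longrightarrow> f y = g y"
  shows "x \<in> S \<Longrightarrow> (deriv ^^ j) f x = (deriv ^^ j) g x"
proof (induction j arbitrary: x)
  case (Suc j)
  have "deriv ((deriv ^^ j) f) x = deriv ((deriv ^^ j) g) x"
    by (rule deriv_cong_open[OF assms(1) Suc.prems Suc.IH])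
  then show ?case by simp
qed (use assms in auto)

lemma higher_pderiv_diff: "(pderiv ^^ j) (p - q) = (pderiv ^^ j) p - (pderiv ^^ j) (q :: real poly)"
  by (induction j arbitrary: p q) (auto simp: pderiv_diff)

lemma poly_telescope:
  fixes Q :: "nat \<Rightarrow> real poly"
  shows "poly ((pderiv ^^ j) (Q m)) x = poly ((pderiv ^^ j) (Q 0)) x + (\<Sum>i<m. poly ((pderiv ^^ j) (Q (Suc i) - Q i)) x)"
  by (induction m) (auto simp: higher_pderiv_diff)

lemma AE_leb1_interval_exhaustion:
  assumes "\<And>c. 0 < c \<Longrightarrow> c < 1 \<Longrightarrow> AE x in lborel. -c < x \<and> x < c \<longrightarrow> P x"
  shows "AE x in leb1. P x"
proof -
  \<comment> \<open>n + 2 keeps the radius 1 - 1/(n + 2) positive at n = 0.\<close>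
  have "AE x in lborel. \<forall>n::nat. - (1 - 1 / real (n + 2)) < x \<and> x < 1 - 1 / real (n + 2) \<longrightarrow> P x"
    unfolding AE_all_countable by (intro allI assms) (auto simp: field_simps)
  then have "AE x in lborel. x \<in> {-1<..<1} \<longrightarrow> P x"
  proof eventually_elim
    case (elim x)
    show ?case
    proof
      assume "x \<in> {-1<..<1}"
      then have "1 - \<bar>x\<bar> > 0" by auto
      then obtain n where "1 / real (Suc n) < 1 - \<bar>x\<bar>" using nat_approx_posE by blast
      moreover have "1 / real (n + 2) \<le> 1 / real (Suc n)" by (intro divide_left_mono) auto
      ultimately have "\<bar>x\<bar> < 1 - 1 / real (n + 2)" by linarith
      then show "P x" using elim by (auto simp: abs_less_iff)
    qed
  qed
  then show ?thesis unfolding AE_leb1_iff AE_completion_iff .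
qed

section \<open>Absolute continuity and derivatives of the limit\<close>

text \<open>Stop at an index m beyond which the integrals add up to less than \<epsilon>/2. The head
  is a polynomial, hence Lipschitz on [-c,c]; over disjoint intervals the increments of the tail add
  up to at most the integral over their union of the absolute derivatives.\<close>

lemma AC_loc_series:
  fixes Q :: "nat \<Rightarrow> real poly"
  assumes fin: "\<And>c. 0 < c \<Longrightarrow> c < 1 \<Longrightarrow>
      (\<Sum>i. \<integral>\<^sup>+t. ennreal \<bar>poly (pderiv (Q (Suc i) - Q i)) t\<bar> * indicator {-c..c} t \<partial>lborel) < \<infinity>"
    and G: "\<And>x. -1 < x \<Longrightarrow> x < 1 \<Longrightarrow> (\<lambda>m. poly (Q m) x) \<longlonglongrightarrow> G x"
  shows "AC_loc G"
  unfolding AC_loc_def abs_cont_on_def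
proof (intro allI impI)
  fix a b \<epsilon> :: real assume ab: "-1 < a" "a < b" "b < 1" and \<epsilon>: "\<epsilon> > 0"
  define c where "c = max (max \<bar>a\<bar> \<bar>b\<bar>) (1/2)"
  have c: "0 < c" "c < 1" "-c \<le> a" "b \<le> c" using ab by (auto simp: c_def)
  define d where "d = (\<lambda>i t. poly (pderiv (Q (Suc i) - Q i)) t)"
  define A where "A = (\<lambda>i. \<integral>\<^sup>+t. ennreal \<bar>d i t\<bar> * indicator {-c..c} t \<partial>lborel)"
  have "(\<lambda>m. \<Sum>i. A (i + m)) \<longlonglongrightarrow> 0"
    using fin[OF c(1,2)] unfolding A_def d_def by (rule suminf_tail_tendsto_zero_ennreal)
  then have "eventually (\<lambda>m. (\<Sum>i. A (i + m)) < ennreal (\<epsilon> / 2)) sequentially"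
    using \<epsilon> by (intro order_tendstoD) auto
  then obtain m where m: "(\<Sum>i. A (i + m)) < ennreal (\<epsilon> / 2)" by (auto simp: eventually_sequentially)
  have "compact ((\<lambda>x. \<bar>poly (pderiv (Q m)) x\<bar>) ` {-c..c})"
    by (intro compact_continuous_image continuous_intros) auto
  then obtain K0 where K0: "\<And>x. x \<in> {-c..c} \<Longrightarrow> \<bar>poly (pderiv (Q m)) x\<bar> \<le> K0"
    by (metis bounded_imp_bdd_above compact_imp_bounded bdd_above_def imageI)
  define K where "K = \<bar>K0\<bar> + 1"
  have K: "K > 0" by (simp add: K_def)
  define R where "R = (\<lambda>t. \<Sum>i. ennreal \<bar>d (i + m) t\<bar>)"
  have Rm [measurable]: "R \<in> borel_measurable borel" unfolding R_def d_def by measurable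
  have inc: "ennreal \<bar>G v - G u\<bar> \<le> ennreal (K * (v - u)) + (\<integral>\<^sup>+t. R t * indicator {u<..<v} t \<partial>lborel)"
    if uv: "a \<le> u" "u < v" "v \<le> b" for u v
  proof -
    have "(\<lambda>n. poly (Q n) v - poly (Q n) u) \<longlonglongrightarrow> G v - G u" using uv ab by (intro tendsto_diff G) auto
    then have "(\<lambda>n. ennreal \<bar>poly (Q n) v - poly (Q n) u\<bar>) \<longlonglongrightarrow> ennreal \<bar>G v - G u\<bar>"
      by (intro tendsto_ennrealI tendsto_rabs)
    moreover have "\<exists>N. \<forall>n\<ge>N. ennreal \<bar>poly (Q n) v - poly (Q n) u\<bar> \<le> ennreal (K * (v - u)) + (\<integral>\<^sup>+t. R t * indicator {u<..<v} t \<partial>lborel)"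
    proof (intro exI[of _ m] allI impI)
      fix n assume n: "m \<le> n"
      have lip: "\<bar>poly (Q m) v - poly (Q m) u\<bar> \<le> K * (v - u)"
      proof -
        obtain z where z: "u < z" "z < v" "poly (Q m) v - poly (Q m) u = (v - u) * poly (pderiv (Q m)) z"
          using poly_MVT[OF uv(2), of "Q m"] by blast
        have "\<bar>poly (pderiv (Q m)) z\<bar> \<le> K" using K0[of z] z uv c by (auto simp: K_def)
        then show ?thesis using z(3) uv by (simp add: abs_mult mult.commute[of K] mult_left_mono)
      qed
      have eq: "poly (Q n) y = poly (Q m) y + (\<Sum>i<n-m. poly (Q (Suc i + m) - Q (i + m)) y)" for y
        using poly_telescope[of 0 "\<lambda>i. Q (i + m)" "n - m" y] n by simp
      have "\<bar>poly (Q n) v - poly (Q n) u\<bar> \<le> K * (v - u) + (\<Sum>i<n-m. \<bar>poly (Q (Suc i + m) - Q (i + m)) v - poly (Q (Suc i + m) - Q (i + m)) u\<bar>)"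
        using lip sum_abs[of "\<lambda>i. poly (Q (Suc i + m) - Q (i + m)) v - poly (Q (Suc i + m) - Q (i + m)) u" "{..<n-m}"]
        unfolding sum_subtractf eq[of u] eq[of v] by linarith
      then have "ennreal \<bar>poly (Q n) v - poly (Q n) u\<bar> \<le> ennreal (K * (v - u) + (\<Sum>i<n-m. \<bar>poly (Q (Suc i + m) - Q (i + m)) v - poly (Q (Suc i + m) - Q (i + m)) u\<bar>))"
        by (rule ennreal_leI)
      also have "\<dots> = ennreal (K * (v - u)) + (\<Sum>i<n-m. ennreal \<bar>poly (Q (Suc i + m) - Q (i + m)) v - poly (Q (Suc i + m) - Q (i + m)) u\<bar>)"
        using K uv by (subst ennreal_plus) (auto intro!: sum_nonneg)
      also have "(\<Sum>i<n-m. ennreal \<bar>poly (Q (Suc i + m) - Q (i + m)) v - poly (Q (Suc i + m) - Q (i + m)) u\<bar>)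
         \<le> (\<Sum>i<n-m. \<integral>\<^sup>+t. ennreal \<bar>d (i + m) t\<bar> * indicator {u..v} t \<partial>lborel)"
      proof (rule sum_mono)
        fix i
        have "continuous_on UNIV (poly (pderiv (Q (Suc i + m) - Q (i + m))))" by (intro continuous_intros)
        from abs_increment_le_nn_integral[OF poly_DERIV this less_imp_le[OF uv(2)]]
        show "ennreal \<bar>poly (Q (Suc i + m) - Q (i + m)) v - poly (Q (Suc i + m) - Q (i + m)) u\<bar>
          \<le> (\<integral>\<^sup>+t. ennreal \<bar>d (i + m) t\<bar> * indicator {u..v} t \<partial>lborel)"
          by (simp only: d_def add_Suc)
      qed
      also have "\<dots> \<le> (\<Sum>i. \<integral>\<^sup>+t. ennreal \<bar>d (i + m) t\<bar> * indicator {u..v} t \<partial>lborel)"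
        by (intro sum_le_suminf) auto
      also have "\<dots> = (\<integral>\<^sup>+t. (\<Sum>i. ennreal \<bar>d (i + m) t\<bar> * indicator {u..v} t) \<partial>lborel)"
        unfolding d_def by (rule nn_integral_suminf[symmetric]) measurable
      also have "\<dots> = (\<integral>\<^sup>+t. R t * indicator {u<..<v} t \<partial>lborel)"
        using AE_lborel_singleton[of u] AE_lborel_singleton[of v]
        by (intro nn_integral_cong_AE) (auto elim!: eventually_elim2 simp: R_def split: split_indicator)
      finally show "ennreal \<bar>poly (Q n) v - poly (Q n) u\<bar> \<le> ennreal (K * (v - u)) + (\<integral>\<^sup>+t. R t * indicator {u<..<v} t \<partial>lborel)"
        by (simp add: add_left_mono)
    qed
    ultimately show ?thesis by (rule LIMSEQ_le_const2)
  qed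
  show "\<exists>\<delta>>0. \<forall>S. finite S \<longrightarrow> (\<forall>(u, v)\<in>S. a \<le> u \<and> u < v \<and> v \<le> b) \<longrightarrow>
      disjoint_family_on (\<lambda>(u, v). {u<..<v}) S \<longrightarrow> (\<Sum>(u, v)\<in>S. v - u) < \<delta> \<longrightarrow> (\<Sum>(u, v)\<in>S. \<bar>G v - G u\<bar>) < \<epsilon>"
  \<comment> \<open>With the Lipschitz constant K the head uses up less than \<epsilon>/2.\<close>
  proof (intro exI[of _ "\<epsilon> / (2 * K)"] conjI allI impI)
    fix S :: "(real \<times> real) set"
    assume S: "finite S" "\<forall>(u, v)\<in>S. a \<le> u \<and> u < v \<and> v \<le> b" "disjoint_family_on (\<lambda>(u, v). {u<..<v}) S"
      and len: "(\<Sum>(u, v)\<in>S. v - u) < \<epsilon> / (2 * K)"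
    have Suv: "a \<le> fst s" "fst s < snd s" "snd s \<le> b" if "s \<in> S" for s using S(2) that by auto
    have "(\<Sum>s\<in>S. ennreal \<bar>G (snd s) - G (fst s)\<bar>) \<le> (\<Sum>s\<in>S. ennreal (K * (snd s - fst s)) + (\<integral>\<^sup>+t. R t * indicator {fst s<..<snd s} t \<partial>lborel))"
      by (intro sum_mono inc Suv)
    also have "\<dots> = (\<Sum>s\<in>S. ennreal (K * (snd s - fst s))) + (\<Sum>s\<in>S. \<integral>\<^sup>+t. R t * indicator {fst s<..<snd s} t \<partial>lborel)"
      by (rule sum.distrib)
    also have "(\<Sum>s\<in>S. ennreal (K * (snd s - fst s))) = ennreal (K * (\<Sum>s\<in>S. snd s - fst s))"
      unfolding sum_distrib_left using K Suv by (intro sum_ennreal) (auto intro: less_imp_le)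
    also have "(\<Sum>s\<in>S. \<integral>\<^sup>+t. R t * indicator {fst s<..<snd s} t \<partial>lborel) = (\<integral>\<^sup>+t. (\<Sum>s\<in>S. R t * indicator {fst s<..<snd s} t) \<partial>lborel)"
      by (rule nn_integral_sum[symmetric]) measurable
    also have "\<dots> \<le> (\<integral>\<^sup>+t. R t * indicator {-c..c} t \<partial>lborel)"
    proof (rule nn_integral_mono)
      fix t :: real
      have "(\<Sum>s\<in>S. R t * indicator {fst s<..<snd s} t) = R t * (\<Sum>s\<in>S. indicator ((\<lambda>(u, v). {u<..<v}) s) t)"
        unfolding sum_distrib_left by (intro sum.cong refl) (auto simp: case_prod_beta')
      also have "(\<Sum>s\<in>S. indicator ((\<lambda>(u, v). {u<..<v}) s) t) = (indicator (\<Union>s\<in>S. (\<lambda>(u, v). {u<..<v}) s) t :: ennreal)"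
        by (rule indicator_UN_disjoint[symmetric, OF S(1,3)])
      also have "R t * \<dots> \<le> R t * indicator {-c..c} t"
      proof (rule mult_left_mono)
        have "(\<Union>s\<in>S. (\<lambda>(u, v). {u<..<v}) s) \<subseteq> {-c..c}" using S(2) c by fastforce
        then show "(indicator (\<Union>s\<in>S. (\<lambda>(u, v). {u<..<v}) s) t :: ennreal) \<le> indicator {-c..c} t"
        proof -
          have "A \<subseteq> B \<Longrightarrow> (indicator A t :: ennreal) \<le> indicator B t" for A B :: "real set"
            by (auto simp: indicator_def)
          then show "(\<Union>s\<in>S. (\<lambda>(u, v). {u<..<v}) s) \<subseteq> {-c..c} \<Longrightarrow> (indicator (\<Union>s\<in>S. (\<lambda>(u, v). {u<..<v}) s) t :: ennreal) \<le> indicator {-c..c} t"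
            by blast
        qed
      qed simp
      finally show "(\<Sum>s\<in>S. R t * indicator {fst s<..<snd s} t) \<le> R t * indicator {-c..c} t" .
    qed
    also have "(\<integral>\<^sup>+t. R t * indicator {-c..c} t \<partial>lborel) = (\<Sum>i. A (i + m))"
    proof -
      have "(\<integral>\<^sup>+t. R t * indicator {-c..c} t \<partial>lborel) = (\<integral>\<^sup>+t. (\<Sum>i. ennreal \<bar>d (i + m) t\<bar> * indicator {-c..c} t) \<partial>lborel)"
        by (simp add: R_def)
      also have "\<dots> = (\<Sum>i. A (i + m))" unfolding A_def d_def by (rule nn_integral_suminf) measurable
      finally show ?thesis .
    qed
    finally have "(\<Sum>s\<in>S. ennreal \<bar>G (snd s) - G (fst s)\<bar>) \<le> ennreal (K * (\<Sum>s\<in>S. snd s - fst s)) + (\<Sum>i. A (i + m))"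
      by (simp add: add_left_mono)
    also have "\<dots> < ennreal (\<epsilon> / 2) + ennreal (\<epsilon> / 2)"
    proof (rule add_strict_mono)
      have "(\<Sum>s\<in>S. snd s - fst s) < \<epsilon> / (2 * K)" using len by (simp add: case_prod_beta')
      then have "K * (\<Sum>s\<in>S. snd s - fst s) < \<epsilon> / 2" using K by (simp add: field_simps)
      moreover have "0 \<le> K * (\<Sum>s\<in>S. snd s - fst s)" using K Suv by (intro mult_nonneg_nonneg sum_nonneg) (auto intro: less_imp_le)
      ultimately show "ennreal (K * (\<Sum>s\<in>S. snd s - fst s)) < ennreal (\<epsilon> / 2)" by (simp add: ennreal_less_iff)
    qed (rule m)
    also have "\<dots> = ennreal \<epsilon>" using \<epsilon> by (subst ennreal_plus[symmetric]) auto
    also have "(\<Sum>s\<in>S. ennreal \<bar>G (snd s) - G (fst s)\<bar>) = ennreal (\<Sum>s\<in>S. \<bar>G (snd s) - G (fst s)\<bar>)" by (rule sum_ennreal) simp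
    finally have "(\<Sum>s\<in>S. \<bar>G (snd s) - G (fst s)\<bar>) < \<epsilon>" by (subst (asm) ennreal_less_iff) (auto intro: sum_nonneg)
    then show "(\<Sum>(u, v)\<in>S. \<bar>G v - G u\<bar>) < \<epsilon>" by (simp add: case_prod_beta')
  qed (use \<epsilon> K in simp)
qed

text \<open>On compact subintervals the weighted norms of the derivatives control their L_1 norms.
  For orders below r the next derivative is controlled as well, so the series converge uniformly and
  may be differentiated. At order r only L_1 control is left, which gives absolute continuity and
  the derivative almost everywhere. Continuity of g is recorded because the comparison with other
  representatives rests on it.\<close>

lemma weighted_limit_in_B:
  fixes p :: ennreal and \<alpha> \<beta> :: real and f :: "real \<Rightarrow> real" and Q :: "nat \<Rightarrow> real poly"
  assumes p: "1 \<le> p" and r: "r \<ge> 1" and f: "f \<in> borel_measurable leb1"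
    and fQ: "(\<Sum>i. Lp_norm p (\<lambda>x. jacobi_weight \<alpha> \<beta> x * (f x - poly (Q i) x))) < \<infinity>"
    and QQ: "\<And>j. j \<le> r \<Longrightarrow> (\<Sum>i. Lp_norm p (\<lambda>x. jacobi_weight \<alpha> \<beta> x * (\<phi> x ^ j * poly ((pderiv ^^ j) (Q (Suc i) - Q i)) x))) < \<infinity>"
  obtains g where "AE x in leb1. g x = f x"
    "\<And>j x. j < r - 1 \<Longrightarrow> x \<in> {-1<..<1} \<Longrightarrow> (deriv ^^ j) g field_differentiable (at x)"
    "AC_loc ((deriv ^^ (r - 1)) g)"
    "\<And>x. x \<in> {-1<..<1} \<Longrightarrow> isCont g x"
    "(deriv ^^ r) g \<in> borel_measurable leb1"
    "\<And>m. Lp_norm p (\<lambda>x. jacobi_weight \<alpha> \<beta> x * (\<phi> x ^ r * ((deriv ^^ r) g x - poly ((pderiv ^^ r) (Q m)) x)))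
       \<le> (\<Sum>i. Lp_norm p (\<lambda>x. jacobi_weight \<alpha> \<beta> x * (\<phi> x ^ r * poly ((pderiv ^^ r) (Q (Suc (i + m)) - Q (i + m))) x)))"
proof -
  define D where "D = (\<lambda>j i x. poly ((pderiv ^^ j) (Q (Suc i) - Q i)) x)"
  define G where "G = (\<lambda>j x. poly ((pderiv ^^ j) (Q 0)) x + (\<Sum>i. D j i x))"
  have Dder: "(D j i has_real_derivative D (Suc j) i x) (at x)" for j i x
    unfolding D_def using poly_DERIV[of "(pderiv ^^ j) (Q (Suc i) - Q i)" x] by simp
  have Dcont: "continuous_on UNIV (D j i)" for j i unfolding D_def by (intro continuous_intros)
  have Dm: "D j i \<in> borel_measurable borel" for j i using Dcont by (rule borel_measurable_continuous_onI)
  define A where "A = (\<lambda>c j i. \<integral>\<^sup>+t. ennreal \<bar>D j i t\<bar> * indicator {-c..c} t \<partial>lborel)"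
  have A: "(\<Sum>i. A c j i) < \<infinity>" if c: "0 < c" "c < 1" and j: "j \<le> r" for c j
  proof -
    obtain K where K: "K > 0" "\<And>v. v \<in> borel_measurable leb1 \<Longrightarrow>
      (\<integral>\<^sup>+x. ennreal \<bar>v x\<bar> * indicator {-c..c} x \<partial>lborel) \<le> ennreal K * Lp_norm p (\<lambda>x. jacobi_weight \<alpha> \<beta> x * (\<phi> x ^ j * v x))"
      using local_integral_le_weighted_Lp_norm[OF p c, of \<alpha> \<beta> j] by (elim exE conjE) (rule that, assumption, blast)
    have "(\<Sum>i. A c j i) \<le> (\<Sum>i. ennreal K * Lp_norm p (\<lambda>x. jacobi_weight \<alpha> \<beta> x * (\<phi> x ^ j * D j i x)))"
      unfolding A_def by (intro suminf_le K(2) borel_measurable_leb1I Dm) auto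
    also have "\<dots> = ennreal K * (\<Sum>i. Lp_norm p (\<lambda>x. jacobi_weight \<alpha> \<beta> x * (\<phi> x ^ j * D j i x)))" by simp
    also have "\<dots> < \<infinity>" using QQ[OF j] unfolding D_def by (simp add: ennreal_mult_less_top)
    finally show ?thesis .
  qed
  \<comment> \<open>The majorants for Weierstrass' test come from the orders j and j + 1 together,
    which is why j < r.\<close>
  have M: "\<exists>M. summable M \<and> (\<forall>i. \<forall>x\<in>{-c..c}. \<bar>D j i x\<bar> \<le> M i)" if c: "0 < c" "c < 1" and j: "j < r" for c j
  proof -
    define a where "a = (\<lambda>j i. enn2real (A c j i))"
    have fin: "(\<Sum>i. A c j i) < \<infinity>" "(\<Sum>i. A c (Suc j) i) < \<infinity>" using A[OF c] j by auto
    have Ai: "A c j i < top" "A c (Suc j) i < top" for i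
      using ennreal_suminf_lessD[OF fin(1)] ennreal_suminf_lessD[OF fin(2)] by auto
    have a: "A c j i = ennreal (a j i)" "A c (Suc j) i = ennreal (a (Suc j) i)" for i using Ai[of i] by (auto simp: a_def)
    have a0: "a j i \<ge> 0" for j i by (simp add: a_def)
    have "summable (a j)" "summable (a (Suc j))"
      using fin unfolding a by (auto intro!: summable_suminf_not_top a0)
    then have "summable (\<lambda>i. a j i / (2 * c) + a (Suc j) i)" by (intro summable_add summable_divide)
    moreover have "\<bar>D j i x\<bar> \<le> a j i / (2 * c) + a (Suc j) i" if x: "x \<in> {-c..c}" for i x
    proof -
      have "ennreal (\<bar>D j i x\<bar> * (2 * c)) = ennreal \<bar>D j i x\<bar> * ennreal (2 * c)" using c by (intro ennreal_mult) auto
      also have "\<dots> \<le> A c j i + A c (Suc j) i * ennreal (2 * c)"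
        unfolding A_def by (rule pointwise_le_integral_derivative[OF Dder Dcont c(1) x])
      also have "\<dots> = ennreal (a j i + a (Suc j) i * (2 * c))"
        unfolding a using a0 c by (simp add: ennreal_mult)
      finally have "\<bar>D j i x\<bar> * (2 * c) \<le> a j i + a (Suc j) i * (2 * c)"
        using a0 c by (subst (asm) ennreal_le_iff) auto
      then show ?thesis using c by (simp add: field_simps)
    qed
    ultimately show ?thesis by blast
  qed
  have inside: "\<exists>c. 0 < c \<and> c < 1 \<and> -c < x \<and> x < c" if "x \<in> {-1<..<1}" for x :: real
  proof -
    have "\<bar>x\<bar> < 1" using that by auto
    then obtain c where c: "\<bar>x\<bar> < c" "c < 1" using dense by blast
    then have "0 < c" "-c < x" "x < c" by linarith+
    then show ?thesis using c(2) by blast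
  qed
  have summ: "summable (\<lambda>i. D j i x)" if "x \<in> {-1<..<1}" "j < r" for j x
  proof -
    obtain c where c: "0 < c" "c < 1" "-c < x" "x < c" using inside[OF \<open>x \<in> {-1<..<1}\<close>] by blast
    obtain M where "summable M" "\<And>i x. x \<in> {-c..c} \<Longrightarrow> \<bar>D j i x\<bar> \<le> M i" using M[OF c(1,2) \<open>j < r\<close>] by (elim exE conjE) (rule that, assumption, blast)
    note M' = this
    show ?thesis
    proof (rule summable_comparison_test'[OF M'(1)])
      fix i :: nat
      show "norm (D j i x) \<le> M i" using M'(2)[of x i] c by simp
    qed
  qed
  have Gder: "(G j has_real_derivative G (Suc j) x) (at x)" if x: "x \<in> {-1<..<1}" and j: "Suc j < r" for j x
  proof -
    obtain c where c: "0 < c" "c < 1" "-c < x" "x < c" using inside[OF x] by blast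
    obtain M where Ms: "summable M" "\<And>i x. x \<in> {-c..c} \<Longrightarrow> \<bar>D (Suc j) i x\<bar> \<le> M i" using M[OF c(1,2) j] by (elim exE conjE) (rule that, assumption, blast)
    have "((\<lambda>x. \<Sum>i. D j i x) has_field_derivative (\<Sum>i. D (Suc j) i x)) (at x)"
    proof (rule has_field_derivative_series'(2)[where S = "{-c..c}" and ?x0.0 = x])
      show "(D j n has_real_derivative D (Suc j) n y) (at y within {-c..c})" for n y
        using Dder by (rule has_field_derivative_at_within)
      show "uniformly_convergent_on {-c..c} (\<lambda>n x. \<Sum>i<n. D (Suc j) i x)"
        using Ms by (intro Weierstrass_m_test'[where M = M]) auto
      show "summable (\<lambda>n. D j n x)" using x j by (intro summ) auto
    qed (use c in auto)
    then show ?thesis unfolding G_def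
      using poly_DERIV[of "(pderiv ^^ j) (Q 0)" x] by (auto intro!: DERIV_add)
  qed
  define g where "g = G 0"
  have gj: "(deriv ^^ j) g x = G j x" if "x \<in> {-1<..<1}" "j < r" for j x
    using that
  proof (induction j arbitrary: x)
    case (Suc j)
    have "deriv ((deriv ^^ j) g) x = deriv (G j) x"
      using Suc by (intro deriv_cong_open[of "{-1<..<1}"]) auto
    also have "\<dots> = G (Suc j) x" by (intro DERIV_imp_deriv Gder) (use Suc.prems in auto)
    finally show ?case by simp
  qed (simp add: g_def)
  have lim: "(\<lambda>m. poly ((pderiv ^^ j) (Q m)) x) \<longlonglongrightarrow> G j x" if "x \<in> {-1<..<1}" "j < r" for j x
  proof -
    have "(\<lambda>m. poly ((pderiv ^^ j) (Q 0)) x + (\<Sum>i<m. D j i x)) \<longlonglongrightarrow> G j x"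
      unfolding G_def using summ[OF that] by (intro tendsto_add tendsto_const summable_LIMSEQ)
    then show ?thesis unfolding D_def poly_telescope[symmetric] .
  qed
  have r1: "r - 1 < r" "Suc (r - 1) = r" using r by auto
  have AC: "AC_loc (G (r - 1))"
  proof (rule AC_loc_series[of "\<lambda>m. (pderiv ^^ (r - 1)) (Q m)"])
    show "(\<lambda>m. poly ((pderiv ^^ (r - 1)) (Q m)) x) \<longlonglongrightarrow> G (r - 1) x" if "-1 < x" "x < 1" for x
      using that r1 by (intro lim) auto
    have e: "pderiv ((pderiv ^^ (r - 1)) (Q (Suc i)) - (pderiv ^^ (r - 1)) (Q i)) = (pderiv ^^ r) (Q (Suc i) - Q i)" for i
      unfolding higher_pderiv_diff[symmetric] using r1(2) by (metis comp_apply funpow.simps(2))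
    show "(\<Sum>i. \<integral>\<^sup>+t. ennreal \<bar>poly (pderiv ((pderiv ^^ (r - 1)) (Q (Suc i)) - (pderiv ^^ (r - 1)) (Q i))) t\<bar> * indicator {-c..c} t \<partial>lborel) < \<infinity>"
      if "0 < c" "c < 1" for c
      using A[OF that, of r] unfolding e A_def D_def by simp
  qed
  have AC': "AC_loc ((deriv ^^ (r - 1)) g)"
    unfolding AC_loc_def
  proof (intro allI impI)
    fix a b :: real assume ab: "-1 < a" "a < b" "b < 1"
    have "abs_cont_on a b (G (r - 1))" using AC ab unfolding AC_loc_def by blast
    moreover have "(\<Sum>(u, v)\<in>S. \<bar>(deriv ^^ (r - 1)) g v - (deriv ^^ (r - 1)) g u\<bar>) = (\<Sum>(u, v)\<in>S. \<bar>G (r - 1) v - G (r - 1) u\<bar>)"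
      if "\<forall>(u, v)\<in>S. a \<le> u \<and> u < v \<and> v \<le> b" for S
      using that ab r1 by (intro sum.cong refl) (auto simp: gj)
    ultimately show "abs_cont_on a b ((deriv ^^ (r - 1)) g)"
      unfolding abs_cont_on_def by (simp cong: imp_cong)
  qed
  have key: "AE x in leb1. summable (\<lambda>i. \<bar>D r i x\<bar>) \<and> (deriv ^^ r) g x = G r x"
  proof -
    have "AE x in leb1. summable (\<lambda>i. \<bar>D r i x\<bar>) \<and> (G (r - 1) has_real_derivative G r x) (at x)"
    proof (rule AE_leb1_interval_exhaustion)
      fix c :: real assume c: "0 < c" "c < 1"
      have "AE x in lborel. -c < x \<and> x < c \<longrightarrow> summable (\<lambda>i. \<bar>D r i x\<bar>) \<and> ((\<lambda>x. \<Sum>i. D (r - 1) i x) has_real_derivative (\<Sum>i. D r i x)) (at x)"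
      proof (rule AE_termwise_derivative)
        show "(D (r - 1) i has_real_derivative D r i x) (at x)" for i x using Dder[of "r - 1" i x] r1 by simp
        show "(\<Sum>i. \<integral>\<^sup>+t. ennreal \<bar>D r i t\<bar> * indicator {-c..c} t \<partial>lborel) < \<infinity>" using A[OF c, of r] by (simp add: A_def)
        show "(\<lambda>i. D (r - 1) i y - D (r - 1) i x) sums ((\<Sum>i. D (r - 1) i y) - (\<Sum>i. D (r - 1) i x))"
          if "-c \<le> x" "x \<le> c" "-c \<le> y" "y \<le> c" for x y
          using that c r1 by (intro sums_diff summable_sums summ) auto
      qed (rule Dcont)
      then show "AE x in lborel. -c < x \<and> x < c \<longrightarrow> summable (\<lambda>i. \<bar>D r i x\<bar>) \<and> (G (r - 1) has_real_derivative G r x) (at x)"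
      proof eventually_elim
        case (elim x)
        have "(poly ((pderiv ^^ (r - 1)) (Q 0)) has_real_derivative poly ((pderiv ^^ r) (Q 0)) x) (at x)"
          using poly_DERIV[of "(pderiv ^^ (r - 1)) (Q 0)" x] r1(2) by (metis comp_apply funpow.simps(2))
        then show ?case using elim unfolding G_def by (auto intro!: DERIV_add)
      qed
    qed
    moreover have "AE x in leb1. x \<in> {-1<..<1}" by (rule AE_leb1I) auto
    ultimately show ?thesis
    proof eventually_elim
      case (elim x)
      have "deriv ((deriv ^^ (r - 1)) g) x = deriv (G (r - 1)) x"
        using elim r1 gj by (intro deriv_cong_open[of "{-1<..<1}"]) auto
      also have "\<dots> = G r x" using elim by (intro DERIV_imp_deriv) auto
      finally show ?case using elim r1(2) by (metis comp_apply funpow.simps(2))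
    qed
  qed
  have Grm: "G r \<in> borel_measurable leb1"
    unfolding G_def using Dm by (intro borel_measurable_leb1I borel_measurable_add borel_measurable_suminf borel_measurable_poly) auto
  have drm: "(deriv ^^ r) g \<in> borel_measurable leb1"
  proof (rule borel_measurable_leb1_AE[OF Grm])
    show "AE x in leb1. G r x = (deriv ^^ r) g x" using key by eventually_elim simp
  qed
  have wm: "jacobi_weight \<alpha> \<beta> \<in> borel_measurable leb1" "\<phi> \<in> borel_measurable leb1"
    by (auto intro!: borel_measurable_leb1I)
  \<comment> \<open>The r-th derivative of g minus its m-th approximant is almost everywhere the
    tail of an absolutely convergent series, so the countable Minkowski inequality applies.\<close>
  have bound: "Lp_norm p (\<lambda>x. jacobi_weight \<alpha> \<beta> x * (\<phi> x ^ r * ((deriv ^^ r) g x - poly ((pderiv ^^ r) (Q m)) x)))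
       \<le> (\<Sum>i. Lp_norm p (\<lambda>x. jacobi_weight \<alpha> \<beta> x * (\<phi> x ^ r * D r (i + m) x)))" for m
  proof (rule Lp_norm_countable_triangle[OF p])
    note [measurable] = wm drm borel_measurable_leb1I[OF Dm] borel_measurable_leb1I[OF borel_measurable_poly]
    show "(\<lambda>x. jacobi_weight \<alpha> \<beta> x * (\<phi> x ^ r * ((deriv ^^ r) g x - poly ((pderiv ^^ r) (Q m)) x))) \<in> borel_measurable leb1"
      by measurable
    show "(\<lambda>x. jacobi_weight \<alpha> \<beta> x * (\<phi> x ^ r * D r (i + m) x)) \<in> borel_measurable leb1" for i by measurable
    show "AE x in leb1. ennreal \<bar>jacobi_weight \<alpha> \<beta> x * (\<phi> x ^ r * ((deriv ^^ r) g x - poly ((pderiv ^^ r) (Q m)) x))\<bar>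
        \<le> (\<Sum>i. ennreal \<bar>jacobi_weight \<alpha> \<beta> x * (\<phi> x ^ r * D r (i + m) x)\<bar>)"
      using key
    proof eventually_elim
      case (elim x)
      define W where "W = \<bar>jacobi_weight \<alpha> \<beta> x * \<phi> x ^ r\<bar>"
      have sa: "summable (\<lambda>i. \<bar>D r i x\<bar>)" using elim by simp
      have sm: "summable (\<lambda>i. \<bar>D r (i + m) x\<bar>)" using sa by (subst summable_iff_shift)
      have "(\<Sum>i. D r i x) = (\<Sum>i. D r (i + m) x) + (\<Sum>i<m. D r i x)"
        by (rule suminf_split_initial_segment[OF summable_rabs_cancel[OF sa]])
      then have "(deriv ^^ r) g x - poly ((pderiv ^^ r) (Q m)) x = (\<Sum>i. D r (i + m) x)"
        using elim poly_telescope[of r Q m x] unfolding G_def D_def by simp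
      then have "\<bar>(deriv ^^ r) g x - poly ((pderiv ^^ r) (Q m)) x\<bar> \<le> (\<Sum>i. \<bar>D r (i + m) x\<bar>)"
        using summable_rabs[OF sm] by simp
      then have "W * \<bar>(deriv ^^ r) g x - poly ((pderiv ^^ r) (Q m)) x\<bar> \<le> W * (\<Sum>i. \<bar>D r (i + m) x\<bar>)"
        by (intro mult_left_mono) (auto simp: W_def)
      also have "\<dots> = (\<Sum>i. W * \<bar>D r (i + m) x\<bar>)" by (rule suminf_mult[OF sm, symmetric])
      finally have "ennreal (W * \<bar>(deriv ^^ r) g x - poly ((pderiv ^^ r) (Q m)) x\<bar>) \<le> ennreal (\<Sum>i. W * \<bar>D r (i + m) x\<bar>)"
        by (rule ennreal_leI)
      also have "\<dots> = (\<Sum>i. ennreal (W * \<bar>D r (i + m) x\<bar>))"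
        by (rule suminf_ennreal2[symmetric]) (auto simp: W_def intro!: summable_mult sm)
      finally show ?case by (simp add: W_def abs_mult mult.assoc)
    qed
  qed
  \<comment> \<open>The errors have a finite sum of norms, hence are summable at almost every point.
    There \<open>poly (Q i) x\<close> tends to f x, and to g x by construction.\<close>
  have gf: "AE x in leb1. g x = f x"
  proof (rule AE_leb1_interval_exhaustion)
    fix c :: real assume c: "0 < c" "c < 1"
    obtain K where K: "K > 0" "\<And>v. v \<in> borel_measurable leb1 \<Longrightarrow>
      (\<integral>\<^sup>+x. ennreal \<bar>v x\<bar> * indicator {-c..c} x \<partial>lborel) \<le> ennreal K * Lp_norm p (\<lambda>x. jacobi_weight \<alpha> \<beta> x * (\<phi> x ^ 0 * v x))"
      using local_integral_le_weighted_Lp_norm[OF p c, of \<alpha> \<beta> 0] by (elim exE conjE) (rule that, assumption, blast)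
    obtain f' where f': "f' \<in> borel_measurable borel" "AE x in leb1. f x = f' x" by (rule borel_version_leb1[OF f])
    note [measurable] = f'(1)
    have fQm: "(\<lambda>x. f x - poly (Q i) x) \<in> borel_measurable leb1" for i
      using f borel_measurable_leb1I[OF borel_measurable_poly, of "Q i"] by measurable
    have ff: "AE x in lborel. x \<in> {-1<..<1} \<longrightarrow> f x = f' x" using f'(2) unfolding AE_leb1_iff AE_completion_iff .
    have e: "(\<integral>\<^sup>+x. ennreal \<bar>f' x - poly (Q i) x\<bar> * indicator {-c..c} x \<partial>lborel) = (\<integral>\<^sup>+x. ennreal \<bar>f x - poly (Q i) x\<bar> * indicator {-c..c} x \<partial>lborel)" for i
      using ff c by (intro nn_integral_cong_AE) (auto elim!: eventually_mono split: split_indicator)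
    have "(\<integral>\<^sup>+x. (\<Sum>i. ennreal \<bar>f' x - poly (Q i) x\<bar> * indicator {-c..c} x) \<partial>lborel)
      = (\<Sum>i. \<integral>\<^sup>+x. ennreal \<bar>f' x - poly (Q i) x\<bar> * indicator {-c..c} x \<partial>lborel)"
      by (rule nn_integral_suminf) measurable
    also have "\<dots> \<le> (\<Sum>i. ennreal K * Lp_norm p (\<lambda>x. jacobi_weight \<alpha> \<beta> x * (\<phi> x ^ 0 * (f x - poly (Q i) x))))"
      unfolding e by (intro suminf_le K(2) fQm) auto
    also have "\<dots> < \<infinity>" using fQ by (simp add: ennreal_mult_less_top)
    finally have "(\<integral>\<^sup>+x. (\<Sum>i. ennreal \<bar>f' x - poly (Q i) x\<bar> * indicator {-c..c} x) \<partial>lborel) \<noteq> \<infinity>" by simp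
    then have "AE x in lborel. (\<Sum>i. ennreal \<bar>f' x - poly (Q i) x\<bar> * indicator {-c..c} x) \<noteq> \<infinity>"
      by (intro nn_integral_PInf_AE) measurable
    with ff show "AE x in lborel. -c < x \<and> x < c \<longrightarrow> g x = f x"
    proof eventually_elim
      case (elim x)
      show ?case
      proof
        assume x: "-c < x \<and> x < c"
        then have "(\<Sum>i. ennreal \<bar>f' x - poly (Q i) x\<bar>) \<noteq> top" using elim by simp
        then have "summable (\<lambda>i. \<bar>f' x - poly (Q i) x\<bar>)" by (intro summable_suminf_not_top) auto
        then have "(\<lambda>i. \<bar>f' x - poly (Q i) x\<bar>) \<longlonglongrightarrow> 0" by (rule summable_LIMSEQ_zero)
        then have "(\<lambda>i. f' x - poly (Q i) x) \<longlonglongrightarrow> 0" by (rule tendsto_rabs_zero_cancel)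
        then have "(\<lambda>i. f' x - (f' x - poly (Q i) x)) \<longlonglongrightarrow> f' x - 0" by (intro tendsto_diff tendsto_const)
        then have "(\<lambda>i. poly (Q i) x) \<longlonglongrightarrow> f' x" by simp
        moreover have "(\<lambda>i. poly (Q i) x) \<longlonglongrightarrow> g x"
        proof -
          have "x \<in> {-1<..<1}" "0 < r" using x c r by auto
          from lim[OF this] show ?thesis by (simp add: g_def)
        qed
        ultimately have "g x = f' x" by (rule LIMSEQ_unique[rotated])
        moreover have "f x = f' x" using elim(1) x c by auto
        ultimately show "g x = f x" by simp
      qed
    qed
  qed
  show thesis
  proof (rule that[OF gf _ AC' _ drm])
    show "(deriv ^^ j) g field_differentiable at x" if "j < r - 1" "x \<in> {-1<..<1}" for j x
    proof -
      have "(G j has_real_derivative G (Suc j) x) (at x)" using that by (intro Gder) auto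
      then have "((deriv ^^ j) g has_real_derivative G (Suc j) x) (at x)"
      proof (rule has_field_derivative_transform_within_open)
        show "open {-1<..<1::real}" by simp
        show "G j y = (deriv ^^ j) g y" if "y \<in> {-1<..<1}" for y using that \<open>j < r - 1\<close> by (intro gj[symmetric]) auto
      qed (use that in auto)
      then show ?thesis by (auto simp: field_differentiable_def)
    qed
    show "isCont g x" if x: "x \<in> {-1<..<1}" for x
    proof -
      obtain c where c: "0 < c" "c < 1" "-c < x" "x < c" using inside[OF x] by blast
      have r0: "0 < r" using r by simp
      obtain M where Ms: "summable M" "\<And>i x. x \<in> {-c..c} \<Longrightarrow> \<bar>D 0 i x\<bar> \<le> M i" using M[OF c(1,2), of 0, OF r0] by (elim exE conjE) (rule that, assumption, blast)
      have ul: "uniform_limit {-c..c} (\<lambda>n x. \<Sum>i<n. D 0 i x) (\<lambda>x. \<Sum>i. D 0 i x) sequentially"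
        using Ms by (intro Weierstrass_m_test) auto
      have "continuous_on {-c..c} (\<lambda>x. \<Sum>i. D 0 i x)"
        by (rule uniform_limit_theorem[OF _ ul]) (auto intro!: always_eventually continuous_on_sum continuous_on_subset[OF Dcont])
      then have "continuous_on {-c..c} g" unfolding g_def G_def by (intro continuous_intros)
      then show ?thesis using c by (intro continuous_on_interior) auto
    qed
    show "Lp_norm p (\<lambda>x. jacobi_weight \<alpha> \<beta> x * (\<phi> x ^ r * ((deriv ^^ r) g x - poly ((pderiv ^^ r) (Q m)) x)))
       \<le> (\<Sum>i. Lp_norm p (\<lambda>x. jacobi_weight \<alpha> \<beta> x * (\<phi> x ^ r * poly ((pderiv ^^ r) (Q (Suc (i + m)) - Q (i + m))) x)))" for m
      using bound[of m] unfolding D_def by (simp only: add_Suc)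
  qed
qed

section \<open>Dyadic chains of near-best approximants\<close>

text \<open>Both sides are suprema of finite sums of nonnegative terms. It replaces the unordered
  sums of the theorem by series over all n.\<close>

lemma infsum_ennreal_eq_suminf:
  fixes a :: "nat \<Rightarrow> ennreal"
  shows "infsum a A = (\<Sum>n. a n * indicator A n)"
proof (rule antisym)
  have SUP: "infsum a A = (SUP F\<in>{F. finite F \<and> F \<subseteq> A}. sum a F)"
    by (rule nonneg_infsum_complete) simp
  show "infsum a A \<le> (\<Sum>n. a n * indicator A n)"
    unfolding SUP
  proof (rule SUP_least)
    fix F assume F: "F \<in> {F. finite F \<and> F \<subseteq> A}"
    then have "sum a F = (\<Sum>n\<in>F. a n * indicator A n)" by (intro sum.cong) auto
    also have "\<dots> \<le> (\<Sum>n. a n * indicator A n)" using F by (intro sum_le_suminf) auto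
    finally show "sum a F \<le> (\<Sum>n. a n * indicator A n)" .
  qed
  show "(\<Sum>n. a n * indicator A n) \<le> infsum a A"
    unfolding suminf_eq_SUP
  proof (rule SUP_least)
    fix n
    have "(\<Sum>i<n. a i * indicator A i) = (\<Sum>i<n. if i \<in> A then a i else 0)"
      by (intro sum.cong) (auto simp: indicator_def)
    also have "\<dots> = sum a ({..<n} \<inter> A)" by (rule sum.inter_restrict[symmetric]) simp
    also have "\<dots> \<le> infsum a A" unfolding SUP by (rule SUP_upper) auto
    finally show "(\<Sum>i<n. a i * indicator A i) \<le> infsum a A" .
  qed
qed

text \<open>A series over all n with an indicator, so that changes of the index set become termwise
  comparisons. The factor r makes it vanish for r = 0, where r - 1 is truncated to 0.\<close>

definition tail_sum :: "nat \<Rightarrow> (nat \<Rightarrow> ennreal) \<Rightarrow> nat set \<Rightarrow> ennreal" where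
  "tail_sum r e A = (\<Sum>n. of_nat (r * n ^ (r - 1)) * e n * indicator A n)"

lemma tail_sum_mono: "A \<subseteq> B \<Longrightarrow> tail_sum r e A \<le> tail_sum r e B"
  unfolding tail_sum_def by (intro suminf_le) (auto simp: indicator_def)

lemma best_approx_antimono:
  assumes "m \<le> n"
  shows "best_approx n f \<alpha> \<beta> p \<le> best_approx m f \<alpha> \<beta> p"
  unfolding best_approx_def using assms by (intro INF_superset_mono) auto

lemma best_approx_finite:
  assumes "f \<in> Lp_space p \<alpha> \<beta>"
  shows "best_approx n f \<alpha> \<beta> p < \<infinity>"
proof -
  have "best_approx n f \<alpha> \<beta> p \<le> Lp_norm p (\<lambda>x. jacobi_weight \<alpha> \<beta> x * (f x - poly 0 x))"
    unfolding best_approx_def by (rule INF_lower) simp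
  also have "\<dots> < \<infinity>" using assms by (simp add: Lp_space_def)
  finally show ?thesis .
qed

text \<open>The strict inequality extracts a polynomial from the infimum; n \<ge> 1 makes the zero
  polynomial meet the degree bound.\<close>

lemma near_best_exists:
  assumes "best_approx n f \<alpha> \<beta> p < e" "n \<ge> 1"
  shows "\<exists>q :: real poly. degree q < n \<and> Lp_norm p (\<lambda>x. jacobi_weight \<alpha> \<beta> x * (f x - poly q x)) \<le> e"
proof -
  obtain q :: "real poly" where q: "q = 0 \<or> degree q < n" "Lp_norm p (\<lambda>x. jacobi_weight \<alpha> \<beta> x * (f x - poly q x)) < e"
    using assms(1) unfolding best_approx_def by (auto simp: INF_less_iff)
  then have "degree q < n" using assms(2) by auto
  then show ?thesis using q(2) by (auto intro: less_imp_le)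
qed

lemma Lp_norm_weighted_poly_diff:
  assumes p: "1 \<le> p" and f: "f \<in> borel_measurable leb1"
  shows "Lp_norm p (\<lambda>x. jacobi_weight \<alpha> \<beta> x * poly (P - Q) x) \<le>
    Lp_norm p (\<lambda>x. jacobi_weight \<alpha> \<beta> x * (f x - poly P x)) + Lp_norm p (\<lambda>x. jacobi_weight \<alpha> \<beta> x * (f x - poly Q x))"
proof (rule Lp_norm_triangle[OF p])
  note [measurable] = f borel_measurable_leb1I[OF borel_measurable_jacobi_weight] borel_measurable_leb1I[OF borel_measurable_poly]
  show "(\<lambda>x. jacobi_weight \<alpha> \<beta> x * poly (P - Q) x) \<in> borel_measurable leb1"
    "(\<lambda>x. jacobi_weight \<alpha> \<beta> x * (f x - poly P x)) \<in> borel_measurable leb1"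
    "(\<lambda>x. jacobi_weight \<alpha> \<beta> x * (f x - poly Q x)) \<in> borel_measurable leb1" by measurable
  show "AE x in leb1. \<bar>jacobi_weight \<alpha> \<beta> x * poly (P - Q) x\<bar> \<le>
    \<bar>jacobi_weight \<alpha> \<beta> x * (f x - poly P x)\<bar> + \<bar>jacobi_weight \<alpha> \<beta> x * (f x - poly Q x)\<bar>"
  proof (intro AE_I2)
    fix x
    have "\<bar>poly P x - poly Q x\<bar> \<le> \<bar>f x - poly P x\<bar> + \<bar>f x - poly Q x\<bar>" by linarith
    then show "\<bar>jacobi_weight \<alpha> \<beta> x * poly (P - Q) x\<bar> \<le>
      \<bar>jacobi_weight \<alpha> \<beta> x * (f x - poly P x)\<bar> + \<bar>jacobi_weight \<alpha> \<beta> x * (f x - poly Q x)\<bar>"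
      by (simp add: abs_mult mult_left_mono distrib_left[symmetric])
  qed
qed

lemma AC_loc_imp_continuous_on:
  assumes "AC_loc g"
  shows "continuous_on {-1<..<1} g"
proof (rule continuous_at_imp_continuous_on, rule ballI)
  fix x :: real assume x: "x \<in> {-1<..<1}"
  obtain a where a: "-1 < a" "a < x" using x dense[of "-1" x] by auto
  obtain b where b: "x < b" "b < 1" using x dense[of x 1] by auto
  have ac: "abs_cont_on a b g" using assms a b unfolding AC_loc_def by auto
  show "isCont g x"
    unfolding continuous_at_eps_delta
  proof (intro allI impI)
    fix \<epsilon> :: real assume "\<epsilon> > 0"
    then obtain \<delta> where \<delta>: "\<delta> > 0" "\<And>S :: (real \<times> real) set. finite S \<Longrightarrow> (\<forall>(u, v)\<in>S. a \<le> u \<and> u < v \<and> v \<le> b) \<Longrightarrow>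
       disjoint_family_on (\<lambda>(u, v). {u<..<v}) S \<Longrightarrow> (\<Sum>(u, v)\<in>S. v - u) < \<delta> \<Longrightarrow> (\<Sum>(u, v)\<in>S. \<bar>g v - g u\<bar>) < \<epsilon>"
      using ac unfolding abs_cont_on_def by meson
    have one: "\<bar>g v - g u\<bar> < \<epsilon>" if "a \<le> u" "u < v" "v \<le> b" "v - u < \<delta>" for u v
      using \<delta>(2)[of "{(u, v)}"] that by (auto simp: disjoint_family_on_def)
    show "\<exists>d>0. \<forall>x'. dist x' x < d \<longrightarrow> dist (g x') (g x) < \<epsilon>"
    proof (intro exI[of _ "min \<delta> (min (x - a) (b - x))"] conjI allI impI)
      fix y assume y: "dist y x < min \<delta> (min (x - a) (b - x))"
      then have yd: "\<bar>y - x\<bar> < \<delta>" "\<bar>y - x\<bar> < x - a" "\<bar>y - x\<bar> < b - x" by (auto simp: dist_real_def)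
      consider "y = x" | "y < x" | "x < y" by linarith
      then show "dist (g y) (g x) < \<epsilon>"
      proof cases
        case 2
        then show ?thesis using one[of y x] yd b by (simp add: dist_real_def abs_minus_commute)
      next
        case 3
        then show ?thesis using one[of x y] yd a by (simp add: dist_real_def)
      qed (use \<open>\<epsilon> > 0\<close> in simp)
    qed (use \<delta> a b in simp)
  qed
qed

text \<open>Two continuous functions equal almost everywhere are equal everywhere. The estimates are
  claimed for every representative, whereas the limit of the chain is a single one; equality on an
  open set carries over to all derivatives.\<close>

lemma B_reps_eq_continuous:
  assumes r: "r \<ge> 1" and g: "g \<in> B_reps r p \<alpha> \<beta> f" and g0: "AE x in leb1. g0 x = f x"
    and g0c: "\<And>x. x \<in> {-1<..<1} \<Longrightarrow> isCont g0 x" and x: "x \<in> {-1<..<1}"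
  shows "g x = g0 x"
proof -
  have gs: "\<And>j x. j < r - 1 \<Longrightarrow> x \<in> {-1<..<1} \<Longrightarrow> (deriv ^^ j) g field_differentiable (at x)" "AC_loc ((deriv ^^ (r - 1)) g)"
    and gf: "AE x in leb1. g x = f x" using g r by (auto simp: B_reps_def B_strict_def)
  have gc: "continuous_on {-1<..<1} g"
  proof (cases "r = 1")
    case True
    then show ?thesis using gs(2) AC_loc_imp_continuous_on[of g] by simp
  next
    case False
    then have "g field_differentiable (at x)" if "x \<in> {-1<..<1}" for x using gs(1)[of 0 x] that r by simp
    then show ?thesis by (intro continuous_at_imp_continuous_on ballI field_differentiable_imp_continuous_at)
  qed
  have "continuous_on {-1<..<1} (\<lambda>x. \<bar>g x - g0 x\<bar>)"
  proof -
    have "continuous_on {-1<..<1} g0" by (intro continuous_at_imp_continuous_on ballI g0c)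
    then show ?thesis using gc by (intro continuous_intros)
  qed
  moreover have "AE x in leb1. \<bar>g x - g0 x\<bar> \<le> 0" using gf g0 by eventually_elim simp
  ultimately have "\<bar>g x - g0 x\<bar> \<le> 0" using x by (intro continuous_AE_leb1_le) auto
  then show ?thesis by simp
qed

section \<open>Comparison of dyadic sums with sums over all integers\<close>

text \<open>The block (m, 2m] has m elements n, each with n^(s-1) \<ge> m^(s-1) and e(n) \<ge>
  e(2m); the factor 2^s is (2m)^s / m^s.\<close>

lemma dyadic_block_bound:
  fixes e :: "nat \<Rightarrow> ennreal"
  assumes e: "\<And>m n. m \<le> n \<Longrightarrow> e n \<le> e m" and s: "s \<ge> 1"
  shows "of_nat ((2 * m) ^ s) * e (2 * m) \<le> 2 ^ s * (\<Sum>n\<in>{m<..2 * m}. of_nat (n ^ (s - 1)) * e n)"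
proof -
  have "of_nat (m ^ s) * e (2 * m) = (\<Sum>n\<in>{m<..2 * m}. of_nat (m ^ (s - 1)) * e (2 * m))"
    using s by (simp add: mult.assoc[symmetric]) (metis One_nat_def Suc_pred' less_eq_Suc_le of_nat_mult power_Suc of_nat_power)
  also have "\<dots> \<le> (\<Sum>n\<in>{m<..2 * m}. of_nat (n ^ (s - 1)) * e n)"
    by (intro sum_mono mult_mono e) (auto intro!: power_mono)
  finally have "2 ^ s * (of_nat (m ^ s) * e (2 * m)) \<le> 2 ^ s * (\<Sum>n\<in>{m<..2 * m}. of_nat (n ^ (s - 1)) * e n)"
    by (intro mult_left_mono) auto
  moreover have "2 ^ s * (of_nat (m ^ s) * e (2 * m)) = of_nat ((2 * m) ^ s) * e (2 * m)"
    by (simp add: power_mult_distrib mult.assoc)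
  ultimately show ?thesis by simp
qed

lemma dyadic_blocks_sum:
  fixes c :: "nat \<Rightarrow> ennreal"
  shows "(\<Sum>i<k. \<Sum>n\<in>{N * 2 ^ (i + i0)<..N * 2 ^ (Suc i + i0)}. c n) = (\<Sum>n\<in>{N * 2 ^ i0<..N * 2 ^ (k + i0)}. c n)"
proof (induction k)
  case (Suc k)
  have le: "N * 2 ^ i0 \<le> N * 2 ^ (k + i0)" "N * 2 ^ (k + i0) \<le> N * 2 ^ (Suc k + i0)"
    by (auto intro!: power_increasing mult_left_mono)
  have "(\<Sum>i<Suc k. \<Sum>n\<in>{N * 2 ^ (i + i0)<..N * 2 ^ (Suc i + i0)}. c n) =
      (\<Sum>n\<in>{N * 2 ^ i0<..N * 2 ^ (k + i0)}. c n) + (\<Sum>n\<in>{N * 2 ^ (k + i0)<..N * 2 ^ (Suc k + i0)}. c n)"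
    using Suc by simp
  also have "\<dots> = (\<Sum>n\<in>{N * 2 ^ i0<..N * 2 ^ (k + i0)} \<union> {N * 2 ^ (k + i0)<..N * 2 ^ (Suc k + i0)}. c n)"
    by (rule sum.union_disjoint[symmetric]) auto
  also have "{N * 2 ^ i0<..N * 2 ^ (k + i0)} \<union> {N * 2 ^ (k + i0)<..N * 2 ^ (Suc k + i0)} = {N * 2 ^ i0<..N * 2 ^ (Suc k + i0)}"
    by (rule ivl_disj_un_two(6)[OF le])
  finally show ?case .
qed simp

text \<open>Each dyadic term is charged to the block below it; the blocks are adjacent and start
  just above N 2^i0. Since r \<ge> 1, the factor r in \<open>tail_sum\<close> only helps.\<close>

lemma dyadic_tail_bound:
  fixes e :: "nat \<Rightarrow> ennreal"
  assumes e: "\<And>m n. m \<le> n \<Longrightarrow> e n \<le> e m" and r: "r \<ge> 1"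
  shows "(\<Sum>i. of_nat ((N * 2 ^ (Suc i + i0)) ^ r) * e (N * 2 ^ (Suc i + i0))) \<le> 2 ^ r * tail_sum r e {n. N * 2 ^ i0 < n}"
  unfolding suminf_eq_SUP
proof (rule SUP_least)
  fix k
  have "(\<Sum>i<k. of_nat ((N * 2 ^ (Suc i + i0)) ^ r) * e (N * 2 ^ (Suc i + i0)))
    \<le> (\<Sum>i<k. 2 ^ r * (\<Sum>n\<in>{N * 2 ^ (i + i0)<..N * 2 ^ (Suc i + i0)}. of_nat (n ^ (r - 1)) * e n))"
  proof (rule sum_mono)
    fix i
    have "N * 2 ^ (Suc i + i0) = 2 * (N * 2 ^ (i + i0))" by simp
    then show "of_nat ((N * 2 ^ (Suc i + i0)) ^ r) * e (N * 2 ^ (Suc i + i0))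
      \<le> 2 ^ r * (\<Sum>n\<in>{N * 2 ^ (i + i0)<..N * 2 ^ (Suc i + i0)}. of_nat (n ^ (r - 1)) * e n)"
      using dyadic_block_bound[of e r "N * 2 ^ (i + i0)", OF e r] by (simp only:)
  qed
  also have "\<dots> = 2 ^ r * (\<Sum>n\<in>{N * 2 ^ i0<..N * 2 ^ (k + i0)}. of_nat (n ^ (r - 1)) * e n)"
    unfolding sum_distrib_left[symmetric] dyadic_blocks_sum ..
  also have "\<dots> \<le> 2 ^ r * tail_sum r e {n. N * 2 ^ i0 < n}"
  proof (rule mult_left_mono)
    have "(\<Sum>n\<in>{N * 2 ^ i0<..N * 2 ^ (k + i0)}. of_nat (n ^ (r - 1)) * e n) \<le>
      (\<Sum>n\<in>{N * 2 ^ i0<..N * 2 ^ (k + i0)}. of_nat (r * n ^ (r - 1)) * e n * indicator {n. N * 2 ^ i0 < n} n)"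
    proof (rule sum_mono)
      fix n assume n: "n \<in> {N * 2 ^ i0<..N * 2 ^ (k + i0)}"
      have "1 * n ^ (r - 1) \<le> r * n ^ (r - 1)" using r by (intro mult_right_mono) auto
      then have "(of_nat (n ^ (r - 1)) :: ennreal) \<le> of_nat (r * n ^ (r - 1))" by (intro of_nat_mono) simp
      then show "of_nat (n ^ (r - 1)) * e n \<le> of_nat (r * n ^ (r - 1)) * e n * indicator {n. N * 2 ^ i0 < n} n"
        using n by (simp add: mult_right_mono del: of_nat_mult of_nat_power)
    qed
    also have "\<dots> \<le> tail_sum r e {n. N * 2 ^ i0 < n}"
      unfolding tail_sum_def by (rule sum_le_suminf) auto
    finally show "(\<Sum>n\<in>{N * 2 ^ i0<..N * 2 ^ (k + i0)}. of_nat (n ^ (r - 1)) * e n) \<le> tail_sum r e {n. N * 2 ^ i0 < n}" .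
  qed simp
  finally show "(\<Sum>i<k. of_nat ((N * 2 ^ (Suc i + i0)) ^ r) * e (N * 2 ^ (Suc i + i0))) \<le> 2 ^ r * tail_sum r e {n. N * 2 ^ i0 < n}" .
qed

text \<open>F stands for the r-th derivative and e for a majorant of the errors. In the last clause
  the tail starts only beyond N 2^(m+1), so that it lies in n > max N (1/t) for the m chosen later;
  the block before it is paid by the single term at N 2^m.\<close>

definition good_chain :: "nat \<Rightarrow> ennreal \<Rightarrow> real \<Rightarrow> real \<Rightarrow> real \<Rightarrow> nat \<Rightarrow> (nat \<Rightarrow> ennreal) \<Rightarrow> (real \<Rightarrow> real) \<Rightarrow> (real \<Rightarrow> real) \<Rightarrow> (nat \<Rightarrow> real poly) \<Rightarrow> bool" where
  "good_chain r p \<alpha> \<beta> C N e f F q \<longleftrightarrow> F \<in> borel_measurable leb1 \<and>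
     (\<forall>i. degree (q i) < N * 2 ^ i \<and> Lp_norm p (\<lambda>x. jacobi_weight \<alpha> \<beta> x * (f x - poly (q i) x)) \<le> e (N * 2 ^ i)) \<and>
     (\<forall>m. Lp_norm p (\<lambda>x. jacobi_weight \<alpha> \<beta> x * (\<phi> x ^ r * (F x - poly ((pderiv ^^ r) (q m)) x)))
        \<le> ennreal C * (of_nat ((N * 2 ^ m) ^ r) * e (N * 2 ^ m) + tail_sum r e {n. N * 2 ^ Suc m < n}))"

lemma good_chain_zero:
  assumes p: "1 \<le> p" and N: "N \<ge> 1" and f: "f \<in> Lp_space p \<alpha> \<beta>" and E: "\<And>n. best_approx n f \<alpha> \<beta> p < e n"
    and g: "g \<in> B_reps 0 p \<alpha> \<beta> f"
  shows "\<exists>q. good_chain 0 p \<alpha> \<beta> 1 N e f g q"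
proof -
  have gf: "AE x in leb1. g x = f x" and gm: "g \<in> borel_measurable leb1"
    using g by (auto simp: B_reps_def B_strict_def Lp_space_def)
  have fm: "f \<in> borel_measurable leb1" using f by (simp add: Lp_space_def)
  have "\<exists>q :: real poly. degree q < N * 2 ^ i \<and> Lp_norm p (\<lambda>x. jacobi_weight \<alpha> \<beta> x * (f x - poly q x)) \<le> e (N * 2 ^ i)" for i
    using N by (intro near_best_exists E) simp
  then obtain q where q: "\<And>i. degree (q i) < N * 2 ^ i \<and> Lp_norm p (\<lambda>x. jacobi_weight \<alpha> \<beta> x * (f x - poly (q i) x)) \<le> e (N * 2 ^ i)"
    by metis
  have "Lp_norm p (\<lambda>x. jacobi_weight \<alpha> \<beta> x * (g x - poly (q m) x)) \<le> e (N * 2 ^ m)" for m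
  proof -
    note [measurable] = fm gm borel_measurable_leb1I[OF borel_measurable_jacobi_weight] borel_measurable_leb1I[OF borel_measurable_poly]
    have "Lp_norm p (\<lambda>x. jacobi_weight \<alpha> \<beta> x * (g x - poly (q m) x)) = Lp_norm p (\<lambda>x. jacobi_weight \<alpha> \<beta> x * (f x - poly (q m) x))"
    proof (rule Lp_norm_cong_AE[OF p])
      show "AE x in leb1. jacobi_weight \<alpha> \<beta> x * (g x - poly (q m) x) = jacobi_weight \<alpha> \<beta> x * (f x - poly (q m) x)"
        using gf by eventually_elim simp
    qed measurable
    then show ?thesis using q[of m] by simp
  qed
  then have "Lp_norm p (\<lambda>x. jacobi_weight \<alpha> \<beta> x * (g x - poly (q m) x)) \<le> e (N * 2 ^ m) + tail_sum 0 e A" for m A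
    by (rule order_trans) simp
  then have "good_chain 0 p \<alpha> \<beta> 1 N e f g q"
    unfolding good_chain_def using gm q by auto
  then show ?thesis by blast
qed

text \<open>Successive approximants differ by a polynomial of degree below N 2^(i+1) and weighted
  norm at most 2 e(N 2^i). Bernstein's inequality bounds the derivatives of the differences, and the
  finite tail sum makes these bounds summable through the dyadic comparison.\<close>

lemma good_chain_pos:
  assumes p: "1 \<le> p" and J: "\<alpha> \<in> J p" "\<beta> \<in> J p" and r: "r \<ge> 1"
  shows "\<exists>C>0. \<forall>N\<ge>1. \<forall>f \<in> Lp_space p \<alpha> \<beta>. \<forall>e. (\<forall>m n. m \<le> n \<longrightarrow> e n \<le> e m) \<longrightarrow>
    (\<forall>n. best_approx n f \<alpha> \<beta> p < e n) \<longrightarrow> (\<forall>n. e n < \<infinity>) \<longrightarrow> tail_sum r e {1..} < \<infinity> \<longrightarrow>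
    B_reps r p \<alpha> \<beta> f \<noteq> {} \<and> (\<forall>g \<in> B_reps r p \<alpha> \<beta> f. \<exists>q. good_chain r p \<alpha> \<beta> C N e f ((deriv ^^ r) g) q)"
proof -
  have "\<forall>j. \<exists>C>0. \<forall>n\<ge>1. \<forall>P :: real poly. degree P < n \<longrightarrow>
    Lp_norm p (\<lambda>x. jacobi_weight \<alpha> \<beta> x * (\<phi> x ^ j * poly ((pderiv ^^ j) P) x))
      \<le> ennreal (C * real n ^ j) * Lp_norm p (\<lambda>x. jacobi_weight \<alpha> \<beta> x * poly P x)"
    using weighted_bernstein[OF p J] by blast
  from choice[OF this] obtain Cb where Cb': "\<forall>j. Cb j > 0 \<and> (\<forall>n\<ge>1. \<forall>P :: real poly. degree P < n \<longrightarrow>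
    Lp_norm p (\<lambda>x. jacobi_weight \<alpha> \<beta> x * (\<phi> x ^ j * poly ((pderiv ^^ j) P) x))
      \<le> ennreal (Cb j * real n ^ j) * Lp_norm p (\<lambda>x. jacobi_weight \<alpha> \<beta> x * poly P x))" by (rule exE)
  then have Cb: "Cb j > 0" for j by blast
  have bern: "Lp_norm p (\<lambda>x. jacobi_weight \<alpha> \<beta> x * (\<phi> x ^ j * poly ((pderiv ^^ j) P) x))
      \<le> ennreal (Cb j * real n ^ j) * Lp_norm p (\<lambda>x. jacobi_weight \<alpha> \<beta> x * poly P x)" if "n \<ge> 1" "degree P < n" for n j P
    using Cb' that by blast
  \<comment> \<open>2^(r+1) stems from the doubled degree (2^r) and the two errors in a difference
    (2); 1 + 2^r collects the terms with indices m and m + 1, which are kept out of the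
    tail.\<close>
  define C where "C = Cb r * 2 ^ (r + 1) * (1 + 2 ^ r)"
  have C: "C > 0" using Cb[of r] by (simp add: C_def add_pos_pos)
  show ?thesis
  proof (rule exI[of _ C], intro conjI C allI impI ballI)
    fix N :: nat and f :: "real \<Rightarrow> real" and e :: "nat \<Rightarrow> ennreal"
    assume N: "1 \<le> N" and f: "f \<in> Lp_space p \<alpha> \<beta>" and e: "\<forall>m n. m \<le> n \<longrightarrow> e n \<le> e m"
      and E: "\<forall>n. best_approx n f \<alpha> \<beta> p < e n" and efin: "\<forall>n. e n < \<infinity>" and ts: "tail_sum r e {1..} < \<infinity>"
    have fm: "f \<in> borel_measurable leb1" and fL: "Lp_norm p (\<lambda>x. jacobi_weight \<alpha> \<beta> x * f x) < \<infinity>"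
      using f by (auto simp: Lp_space_def)
    have emono: "e n \<le> e m" if "m \<le> n" for m n using e that by blast
    have "\<exists>q :: real poly. degree q < N * 2 ^ i \<and> Lp_norm p (\<lambda>x. jacobi_weight \<alpha> \<beta> x * (f x - poly q x)) \<le> e (N * 2 ^ i)" for i
      using N E by (intro near_best_exists) auto
    then obtain q where q: "\<And>i. degree (q i) < N * 2 ^ i \<and> Lp_norm p (\<lambda>x. jacobi_weight \<alpha> \<beta> x * (f x - poly (q i) x)) \<le> e (N * 2 ^ i)"
      by metis
    define en where "en = (\<lambda>i. e (N * 2 ^ i))"
    have u1: "Lp_norm p (\<lambda>x. jacobi_weight \<alpha> \<beta> x * poly (q (Suc i) - q i) x) \<le> 2 * en i" for i
    proof -
      have "Lp_norm p (\<lambda>x. jacobi_weight \<alpha> \<beta> x * poly (q (Suc i) - q i) x) \<le> e (N * 2 ^ Suc i) + e (N * 2 ^ i)"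
        using q[of "Suc i"] q[of i] by (intro order_trans[OF Lp_norm_weighted_poly_diff[OF p fm]] add_mono) auto
      also have "\<dots> \<le> e (N * 2 ^ i) + e (N * 2 ^ i)" by (intro add_mono emono) auto
      finally show ?thesis by (simp add: mult_2 en_def)
    qed
    have u2: "Lp_norm p (\<lambda>x. jacobi_weight \<alpha> \<beta> x * (\<phi> x ^ j * poly ((pderiv ^^ j) (q (Suc i) - q i)) x))
      \<le> ennreal (Cb j * 2 ^ (j + 1)) * (of_nat ((N * 2 ^ i) ^ j) * en i)" for i j
    proof -
      have d: "degree (q (Suc i) - q i) < N * 2 ^ Suc i"
        using q[of i] q[of "Suc i"] N by (intro degree_diff_less) auto
      have "Lp_norm p (\<lambda>x. jacobi_weight \<alpha> \<beta> x * (\<phi> x ^ j * poly ((pderiv ^^ j) (q (Suc i) - q i)) x))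
        \<le> ennreal (Cb j * real (N * 2 ^ Suc i) ^ j) * (2 * en i)"
        using N by (intro order_trans[OF bern[OF _ d]] mult_left_mono u1) auto
      also have "ennreal (Cb j * real (N * 2 ^ Suc i) ^ j) = ennreal (Cb j * 2 ^ j) * of_nat ((N * 2 ^ i) ^ j)"
      proof -
        have "Cb j * real (N * 2 ^ Suc i) ^ j = (Cb j * 2 ^ j) * real ((N * 2 ^ i) ^ j)"
          by (simp add: power_mult_distrib)
        also have "ennreal \<dots> = ennreal (Cb j * 2 ^ j) * ennreal (real ((N * 2 ^ i) ^ j))"
          using Cb[of j] by (intro ennreal_mult) auto
        finally show ?thesis by (simp only: ennreal_of_nat_eq_real_of_nat)
      qed
      also have "ennreal (Cb j * 2 ^ j) * of_nat ((N * 2 ^ i) ^ j) * (2 * en i) = (ennreal (Cb j * 2 ^ j) * 2) * (of_nat ((N * 2 ^ i) ^ j) * en i)"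
        by (simp only: mult_ac)
      also have "ennreal (Cb j * 2 ^ j) * 2 = ennreal (Cb j * 2 ^ (j + 1))"
      proof -
        have "ennreal ((Cb j * 2 ^ j) * 2) = ennreal (Cb j * 2 ^ j) * ennreal 2" by (rule ennreal_mult'') simp
        then show ?thesis by (simp add: mult.assoc mult.commute[of 2])
      qed
      finally show ?thesis .
    qed
    have enfin: "of_nat k * en i < \<infinity>" for k i using efin by (simp add: en_def ennreal_mult_less_top ennreal_of_nat_eq_real_of_nat)
    \<comment> \<open>Lower orders follow from order r, as N 2^i \<ge> 1. The term i = 0 is charged
      to no block and is finite by itself.\<close>
    have sumj: "(\<Sum>i. of_nat ((N * 2 ^ i) ^ j) * en i) < \<infinity>" if j: "j \<le> r" for j
    proof -
      have "(\<Sum>i. of_nat ((N * 2 ^ i) ^ j) * en i) \<le> (\<Sum>i. of_nat ((N * 2 ^ i) ^ r) * en i)"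
        using N j by (intro suminf_le mult_right_mono of_nat_mono power_increasing) auto
      also have "\<dots> = (\<Sum>i<1. of_nat ((N * 2 ^ i) ^ r) * en i) + (\<Sum>i. of_nat ((N * 2 ^ (i + 1)) ^ r) * en (i + 1))"
        by (rule trans[OF suminf_offset[OF summableI] add.commute])
      also have "(\<Sum>i. of_nat ((N * 2 ^ (i + 1)) ^ r) * en (i + 1)) \<le> 2 ^ r * tail_sum r e {n. N * 2 ^ 0 < n}"
        using dyadic_tail_bound[where e = e and N = N and ?i0.0 = 0, OF emono r] by (simp add: en_def)
      also have "\<dots> \<le> 2 ^ r * tail_sum r e {1..}" using N by (intro mult_left_mono tail_sum_mono) auto
      finally have "(\<Sum>i. of_nat ((N * 2 ^ i) ^ j) * en i) \<le> (\<Sum>i<1. of_nat ((N * 2 ^ i) ^ r) * en i) + 2 ^ r * tail_sum r e {1..}"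
        by (simp add: add_left_mono)
      also have "\<dots> < \<infinity>" 
      proof -
        have one: "(\<Sum>i<1. F i) = F 0" for F :: "nat \<Rightarrow> ennreal" by simp
        have "2 ^ r * tail_sum r e {1..} < \<infinity>" using ts by (simp add: ennreal_mult_less_top power_less_top_ennreal)
        then show ?thesis unfolding one using enfin[of "(N * 2 ^ 0) ^ r" 0]
          by (simp only: ennreal_add_less_top infinity_ennreal_def simp_thms)
      qed
      finally show ?thesis .
    qed
    have fq: "(\<Sum>i. Lp_norm p (\<lambda>x. jacobi_weight \<alpha> \<beta> x * (f x - poly (q i) x))) < \<infinity>"
    proof -
      have "(\<Sum>i. Lp_norm p (\<lambda>x. jacobi_weight \<alpha> \<beta> x * (f x - poly (q i) x))) \<le> (\<Sum>i. of_nat ((N * 2 ^ i) ^ 0) * en i)"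
        using q by (intro suminf_le) (auto simp: en_def)
      also have "\<dots> < \<infinity>" by (rule sumj) simp
      finally show ?thesis .
    qed
    have qq: "(\<Sum>i. Lp_norm p (\<lambda>x. jacobi_weight \<alpha> \<beta> x * (\<phi> x ^ j * poly ((pderiv ^^ j) (q (Suc i) - q i)) x))) < \<infinity>" if "j \<le> r" for j
    proof -
      have "(\<Sum>i. Lp_norm p (\<lambda>x. jacobi_weight \<alpha> \<beta> x * (\<phi> x ^ j * poly ((pderiv ^^ j) (q (Suc i) - q i)) x)))
        \<le> (\<Sum>i. ennreal (Cb j * 2 ^ (j + 1)) * (of_nat ((N * 2 ^ i) ^ j) * en i))"
        by (intro suminf_le u2) auto
      also have "\<dots> = ennreal (Cb j * 2 ^ (j + 1)) * (\<Sum>i. of_nat ((N * 2 ^ i) ^ j) * en i)" by simp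
      also have "\<dots> < \<infinity>" using sumj[OF that] by (simp add: ennreal_mult_less_top)
      finally show ?thesis .
    qed
    obtain g0 where g0: "AE x in leb1. g0 x = f x"
      "\<And>j x. j < r - 1 \<Longrightarrow> x \<in> {-1<..<1} \<Longrightarrow> (deriv ^^ j) g0 field_differentiable (at x)"
      "AC_loc ((deriv ^^ (r - 1)) g0)"
      "\<And>x. x \<in> {-1<..<1} \<Longrightarrow> isCont g0 x"
      "(deriv ^^ r) g0 \<in> borel_measurable leb1"
      "\<And>m. Lp_norm p (\<lambda>x. jacobi_weight \<alpha> \<beta> x * (\<phi> x ^ r * ((deriv ^^ r) g0 x - poly ((pderiv ^^ r) (q m)) x)))
         \<le> (\<Sum>i. Lp_norm p (\<lambda>x. jacobi_weight \<alpha> \<beta> x * (\<phi> x ^ r * poly ((pderiv ^^ r) (q (Suc (i + m)) - q (i + m))) x)))"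
      by (rule weighted_limit_in_B[OF p r fm fq qq]) (assumption, rule that, assumption, blast+)
    have tail: "Lp_norm p (\<lambda>x. jacobi_weight \<alpha> \<beta> x * (\<phi> x ^ r * ((deriv ^^ r) g0 x - poly ((pderiv ^^ r) (q m)) x)))
        \<le> ennreal C * (of_nat ((N * 2 ^ m) ^ r) * e (N * 2 ^ m) + tail_sum r e {n. N * 2 ^ Suc m < n})" for m
    proof -
      define a where "a = (\<lambda>i. of_nat ((N * 2 ^ (i + m)) ^ r) * en (i + m))"
      have "Lp_norm p (\<lambda>x. jacobi_weight \<alpha> \<beta> x * (\<phi> x ^ r * ((deriv ^^ r) g0 x - poly ((pderiv ^^ r) (q m)) x)))
        \<le> (\<Sum>i. ennreal (Cb r * 2 ^ (r + 1)) * a i)"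
        unfolding a_def by (rule order_trans[OF g0(6)]) (intro suminf_le u2, auto)
      also have "\<dots> = ennreal (Cb r * 2 ^ (r + 1)) * (\<Sum>i. a i)" by simp
      \<comment> \<open>Two terms are split off, so that the blocks for the rest begin at N
        2^(m+1).\<close>
      also have "(\<Sum>i. a i) = (\<Sum>i<2. a i) + (\<Sum>i. a (i + 2))" by (rule trans[OF suminf_offset[OF summableI] add.commute])
      also have "(\<Sum>i<2. a i) = a 0 + a 1" by (simp add: numeral_2_eq_2)
      also have "(\<Sum>i. a (i + 2)) \<le> 2 ^ r * tail_sum r e {n. N * 2 ^ Suc m < n}"
        using dyadic_tail_bound[where e = e and N = N and ?i0.0 = "Suc m", OF emono r] by (simp add: a_def en_def)
      also have "a 1 \<le> 2 ^ r * a 0"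
      proof -
        have "a 1 \<le> of_nat ((N * 2 ^ (1 + m)) ^ r) * en m"
          unfolding a_def en_def by (intro mult_left_mono emono) auto
        also have "\<dots> = 2 ^ r * a 0" by (simp add: a_def power_mult_distrib mult_ac)
        finally show ?thesis .
      qed
      finally have "Lp_norm p (\<lambda>x. jacobi_weight \<alpha> \<beta> x * (\<phi> x ^ r * ((deriv ^^ r) g0 x - poly ((pderiv ^^ r) (q m)) x)))
        \<le> ennreal (Cb r * 2 ^ (r + 1)) * (a 0 + 2 ^ r * a 0 + 2 ^ r * tail_sum r e {n. N * 2 ^ Suc m < n})"
        by (simp add: mult_left_mono add_mono)
      also have "\<dots> \<le> ennreal (Cb r * 2 ^ (r + 1)) * ((1 + 2 ^ r) * (a 0 + tail_sum r e {n. N * 2 ^ Suc m < n}))"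
        by (intro mult_left_mono) (auto simp: distrib_left distrib_right add_ac intro!: add_mono)
      also have "\<dots> = (ennreal (Cb r * 2 ^ (r + 1)) * (1 + 2 ^ r)) * (a 0 + tail_sum r e {n. N * 2 ^ Suc m < n})"
        by (simp only: mult.assoc)
      also have "ennreal (Cb r * 2 ^ (r + 1)) * (1 + 2 ^ r) = ennreal C"
      proof -
        have "ennreal C = ennreal (Cb r * 2 ^ (r + 1)) * ennreal (1 + 2 ^ r)" unfolding C_def by (rule ennreal_mult'') simp
        also have "ennreal (1 + 2 ^ r) = 1 + 2 ^ r" by (subst ennreal_plus) (auto simp flip: ennreal_power ennreal_numeral)
        finally show ?thesis by simp
      qed
      finally show ?thesis by (simp add: a_def en_def)
    qed
    have "(\<lambda>x. \<phi> x ^ r * (deriv ^^ r) g0 x) \<in> Lp_space p \<alpha> \<beta>"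
      unfolding Lp_space_def
    proof (intro CollectI conjI)
      note [measurable] = g0(5) borel_measurable_leb1I[OF borel_measurable_phi] borel_measurable_leb1I[OF borel_measurable_jacobi_weight] borel_measurable_leb1I[OF borel_measurable_poly]
      show "(\<lambda>x. \<phi> x ^ r * (deriv ^^ r) g0 x) \<in> borel_measurable leb1" by measurable
      have "Lp_norm p (\<lambda>x. jacobi_weight \<alpha> \<beta> x * (\<phi> x ^ r * (deriv ^^ r) g0 x)) \<le>
        Lp_norm p (\<lambda>x. jacobi_weight \<alpha> \<beta> x * (\<phi> x ^ r * ((deriv ^^ r) g0 x - poly ((pderiv ^^ r) (q 0)) x)))
        + Lp_norm p (\<lambda>x. jacobi_weight \<alpha> \<beta> x * (\<phi> x ^ r * poly ((pderiv ^^ r) (q 0)) x))"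
      proof (rule Lp_norm_triangle[OF p])
        show "AE x in leb1. \<bar>jacobi_weight \<alpha> \<beta> x * (\<phi> x ^ r * (deriv ^^ r) g0 x)\<bar>
          \<le> \<bar>jacobi_weight \<alpha> \<beta> x * (\<phi> x ^ r * ((deriv ^^ r) g0 x - poly ((pderiv ^^ r) (q 0)) x))\<bar>
            + \<bar>jacobi_weight \<alpha> \<beta> x * (\<phi> x ^ r * poly ((pderiv ^^ r) (q 0)) x)\<bar>"
        proof (rule AE_I2)
          fix x
          have "jacobi_weight \<alpha> \<beta> x * (\<phi> x ^ r * (deriv ^^ r) g0 x) =
            jacobi_weight \<alpha> \<beta> x * (\<phi> x ^ r * ((deriv ^^ r) g0 x - poly ((pderiv ^^ r) (q 0)) x))
            + jacobi_weight \<alpha> \<beta> x * (\<phi> x ^ r * poly ((pderiv ^^ r) (q 0)) x)" by (simp add: algebra_simps)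
          then show "\<bar>jacobi_weight \<alpha> \<beta> x * (\<phi> x ^ r * (deriv ^^ r) g0 x)\<bar>
            \<le> \<bar>jacobi_weight \<alpha> \<beta> x * (\<phi> x ^ r * ((deriv ^^ r) g0 x - poly ((pderiv ^^ r) (q 0)) x))\<bar>
            + \<bar>jacobi_weight \<alpha> \<beta> x * (\<phi> x ^ r * poly ((pderiv ^^ r) (q 0)) x)\<bar>" using abs_triangle_ineq by metis
        qed
      qed measurable
      also have "\<dots> < \<infinity>"
      proof -
        have "Lp_norm p (\<lambda>x. jacobi_weight \<alpha> \<beta> x * (\<phi> x ^ r * ((deriv ^^ r) g0 x - poly ((pderiv ^^ r) (q 0)) x))) < \<infinity>"
        proof (rule le_less_trans[OF tail[of 0]])
          have mt: "ennreal C * (x + y) < \<infinity>" if "x < \<infinity>" "y < \<infinity>" for x y :: ennreal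
            using that by (simp add: ennreal_mult_less_top)
          have "tail_sum r e {n. N * 2 ^ Suc 0 < n} < \<infinity>" by (rule le_less_trans[OF tail_sum_mono ts]) auto
          moreover have "of_nat ((N * 2 ^ 0) ^ r) * e (N * 2 ^ 0) < \<infinity>" using enfin[of "(N * 2 ^ 0) ^ r" 0] unfolding en_def .
          ultimately show "ennreal C * (of_nat ((N * 2 ^ 0) ^ r) * e (N * 2 ^ 0) + tail_sum r e {n. N * 2 ^ Suc 0 < n}) < \<infinity>"
            by (intro mt)
        qed
        moreover have "Lp_norm p (\<lambda>x. jacobi_weight \<alpha> \<beta> x * (\<phi> x ^ r * poly ((pderiv ^^ r) (q 0)) x)) < \<infinity>"
        proof -
          have "Lp_norm p (\<lambda>x. jacobi_weight \<alpha> \<beta> x * poly (q 0 - 0) x) \<le> e (N * 2 ^ 0) + Lp_norm p (\<lambda>x. jacobi_weight \<alpha> \<beta> x * (f x - poly 0 x))"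
            using q[of 0] by (intro order_trans[OF Lp_norm_weighted_poly_diff[OF p fm]] add_mono) auto
          also have "\<dots> < \<infinity>" using fL efin by simp
          finally have "Lp_norm p (\<lambda>x. jacobi_weight \<alpha> \<beta> x * poly (q 0) x) < \<infinity>" by simp
          moreover have "degree (q 0) < N" using q[of 0] by simp
          ultimately show ?thesis by (intro le_less_trans[OF bern[OF N]]) (auto simp: ennreal_mult_less_top)
        qed
        ultimately show ?thesis by simp
      qed
      finally show "Lp_norm p (\<lambda>x. jacobi_weight \<alpha> \<beta> x * (\<phi> x ^ r * (deriv ^^ r) g0 x)) < \<infinity>" .
    qed
    then have "g0 \<in> B_reps r p \<alpha> \<beta> f"
      using g0 r by (auto simp: B_reps_def B_strict_def)
    then show "B_reps r p \<alpha> \<beta> f \<noteq> {}" by blast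
    fix g assume g: "g \<in> B_reps r p \<alpha> \<beta> f"
    have eq: "(deriv ^^ r) g x = (deriv ^^ r) g0 x" if "x \<in> {-1<..<1}" for x
      using B_reps_eq_continuous[OF r g g0(1) g0(4)] that by (intro higher_deriv_cong_open[of "{-1<..<1}"]) auto
    have ae: "AE x in leb1. (deriv ^^ r) g0 x = (deriv ^^ r) g x" by (rule AE_leb1I) (simp add: eq)
    have gm: "(deriv ^^ r) g \<in> borel_measurable leb1" by (rule borel_measurable_leb1_AE[OF g0(5) ae])
    have "Lp_norm p (\<lambda>x. jacobi_weight \<alpha> \<beta> x * (\<phi> x ^ r * ((deriv ^^ r) g x - poly ((pderiv ^^ r) (q m)) x)))
      = Lp_norm p (\<lambda>x. jacobi_weight \<alpha> \<beta> x * (\<phi> x ^ r * ((deriv ^^ r) g0 x - poly ((pderiv ^^ r) (q m)) x)))" for m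
    proof (rule Lp_norm_cong_AE[OF p])
      note [measurable] = gm g0(5) borel_measurable_leb1I[OF borel_measurable_phi] borel_measurable_leb1I[OF borel_measurable_jacobi_weight] borel_measurable_leb1I[OF borel_measurable_poly]
      show "(\<lambda>x. jacobi_weight \<alpha> \<beta> x * (\<phi> x ^ r * ((deriv ^^ r) g x - poly ((pderiv ^^ r) (q m)) x))) \<in> borel_measurable leb1"
        "(\<lambda>x. jacobi_weight \<alpha> \<beta> x * (\<phi> x ^ r * ((deriv ^^ r) g0 x - poly ((pderiv ^^ r) (q m)) x))) \<in> borel_measurable leb1"
        by measurable
      show "AE x in leb1. jacobi_weight \<alpha> \<beta> x * (\<phi> x ^ r * ((deriv ^^ r) g x - poly ((pderiv ^^ r) (q m)) x)) =
        jacobi_weight \<alpha> \<beta> x * (\<phi> x ^ r * ((deriv ^^ r) g0 x - poly ((pderiv ^^ r) (q m)) x))"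
        using ae by eventually_elim simp
    qed
    then have "good_chain r p \<alpha> \<beta> C N e f ((deriv ^^ r) g) q"
      unfolding good_chain_def using gm q tail by auto
    then show "\<exists>q. good_chain r p \<alpha> \<beta> C N e f ((deriv ^^ r) g) q" by blast
  qed
qed

lemma good_chain_exists:
  assumes p: "1 \<le> p" and J: "\<alpha> \<in> J p" "\<beta> \<in> J p"
  shows "\<exists>C>0. \<forall>N\<ge>1. \<forall>f \<in> Lp_space p \<alpha> \<beta>. \<forall>e. (\<forall>m n. m \<le> n \<longrightarrow> e n \<le> e m) \<longrightarrow>
    (\<forall>n. best_approx n f \<alpha> \<beta> p < e n) \<longrightarrow> (\<forall>n. e n < \<infinity>) \<longrightarrow> tail_sum r e {1..} < \<infinity> \<longrightarrow>
    B_reps r p \<alpha> \<beta> f \<noteq> {} \<and> (\<forall>g \<in> B_reps r p \<alpha> \<beta> f. \<exists>q. good_chain r p \<alpha> \<beta> C N e f ((deriv ^^ r) g) q)"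
proof (cases "r = 0")
  case True
  show ?thesis
    unfolding True
  proof (intro exI[of _ 1] conjI allI impI ballI)
    fix N :: nat and f e assume *: "N \<ge> 1" "f \<in> Lp_space p \<alpha> \<beta>" "\<forall>n. best_approx n f \<alpha> \<beta> p < e n"
    have "f \<in> B_reps 0 p \<alpha> \<beta> f" using *(2) by (simp add: B_reps_def B_strict_def)
    then show "B_reps 0 p \<alpha> \<beta> f \<noteq> {}" by blast
    show "\<exists>q. good_chain 0 p \<alpha> \<beta> 1 N e f ((deriv ^^ 0) g) q" if "g \<in> B_reps 0 p \<alpha> \<beta> f" for g
      using good_chain_zero[OF p *(1,2) _ that] *(3) by simp
  qed simp
next
  case False
  then show ?thesis by (intro good_chain_pos[OF p J]) simp
qed

section \<open>The modulus estimate along a chain\<close>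

lemma higher_pderiv_eq_0:
  fixes P :: "real poly"
  assumes "degree P < n"
  shows "(pderiv ^^ n) P = 0"
  using assms by (intro poly_eqI) (simp add: coeff_higher_pderiv coeff_eq_0)

text \<open>The derivative of order k + r vanishes, so the bound for differences holds with B =
  0.\<close>

lemma sym_diff_low_degree:
  fixes P :: "real poly"
  assumes "degree P < k + r" "d \<ge> 0"
  shows "sym_diff k d (poly ((pderiv ^^ r) P)) x = 0"
proof -
  have "\<bar>\<Sum>i\<le>k. real (k choose i) * (-1) ^ (k - i) * poly ((pderiv ^^ (0 + r)) P) (x - real k * d / 2 + real i * d)\<bar> \<le> d ^ k * 0"
  proof (rule abs_binomial_difference_le[where G = "\<lambda>j s. poly ((pderiv ^^ (j + r)) P) s"])
    show "((\<lambda>s. poly ((pderiv ^^ (j + r)) P) s) has_real_derivative poly ((pderiv ^^ (Suc j + r)) P) s) (at s)" for j s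
      using poly_DERIV[of "(pderiv ^^ (j + r)) P" s] by simp
  qed (use assms higher_pderiv_eq_0[of P "k + r"] in auto)
  then show ?thesis by (simp add: sym_diff_def)
qed

lemma sym_diff_sum:
  assumes "\<And>y. F y = (\<Sum>s\<in>S. G s y)"
  shows "sym_diff k d F x = (\<Sum>s\<in>S. sym_diff k d (G s) x)"
proof (cases "{x - real k * d / 2 .. x + real k * d / 2} \<subseteq> {-1..1}")
  case True
  have "(\<Sum>i\<le>k. real (k choose i) * (-1) ^ (k - i) * F (x - real k * d / 2 + real i * d))
     = (\<Sum>i\<le>k. \<Sum>s\<in>S. real (k choose i) * (-1) ^ (k - i) * G s (x - real k * d / 2 + real i * d))"
    unfolding assms by (simp add: sum_distrib_left)
  also have "\<dots> = (\<Sum>s\<in>S. \<Sum>i\<le>k. real (k choose i) * (-1) ^ (k - i) * G s (x - real k * d / 2 + real i * d))"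
    by (rule sum.swap)
  finally show ?thesis using True unfolding sym_diff_def by (simp only: if_True)
next
  case False
  then show ?thesis unfolding sym_diff_def by (simp only: if_False sum.neutral_const)
qed

text \<open>The constant \<open>c(N)\<close> is realized as \<open>c N\<^sup>k\<^sup>+\<^sup>r\<close>.\<close>

definition inverse_rhs :: "nat \<Rightarrow> nat \<Rightarrow> nat \<Rightarrow> real \<Rightarrow> real \<Rightarrow> (nat \<Rightarrow> ennreal) \<Rightarrow> ennreal" where
  "inverse_rhs k r N c t e =
     ennreal c * tail_sum r e {n. real n > max (real N) (1 / t)}
     + ennreal (c * t ^ k) * (\<Sum>n\<in>{n. N \<le> n \<and> real n \<le> max (real N) (1 / t)}. of_nat (n ^ (k + r - 1)) * e n)
     + (if N \<le> k + r then 0 else ennreal (c * real N ^ (k + r) * t ^ k) * e (k + r))"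

lemma finite_middle_range: "finite {n::nat. N \<le> n \<and> real n \<le> M}"
proof (rule finite_subset)
  show "{n::nat. N \<le> n \<and> real n \<le> M} \<subseteq> {..nat \<lceil>M\<rceil>}" by (auto simp: le_nat_iff) linarith
qed simp

lemma dyadic_index_exists:
  assumes N: "N \<ge> (1::nat)" and M: "real N \<le> M"
  obtains j where "real (N * 2 ^ j) \<le> M" "M < real (N * 2 ^ Suc j)"
proof -
  have "\<exists>j. M < real (N * 2 ^ Suc j)"
  proof -
    obtain j where j: "M < 2 ^ j" using real_arch_pow[of 2 M] by auto
    have "2 ^ j \<le> real (N * 2 ^ Suc j)"
    proof -
      have "(1::real) * 2 ^ j \<le> real N * 2 ^ Suc j" using N by (intro mult_mono) auto
      then show ?thesis by simp
    qed
    then show ?thesis using j by (intro exI[of _ j]) linarith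
  qed
  define j where "j = (LEAST j. M < real (N * 2 ^ Suc j))"
  have j1: "M < real (N * 2 ^ Suc j)" unfolding j_def by (rule LeastI_ex) fact
  have "real (N * 2 ^ j) \<le> M"
  proof (cases j)
    case 0
    then show ?thesis using M by simp
  next
    case (Suc i)
    then have "\<not> M < real (N * 2 ^ Suc i)" using not_less_Least[of i "\<lambda>j. M < real (N * 2 ^ Suc j)"] unfolding j_def by simp
    then show ?thesis using Suc by simp
  qed
  then show thesis using j1 that by blast
qed

text \<open>The index j with N 2^j \<le> max N (1/t) < N 2^(j+1) splits F into the remainder after
  \<open>q j\<close>, the increments of the chain up to j, and the initial polynomial. The remainder
  yields the tail sum and one term of the size of the increments; the increments carry the factor
  t^k by \<open>modulus_poly\<close>; the initial polynomial yields the third term.\<close>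

lemma modulus_term_bound:
  fixes p :: ennreal and \<alpha> \<beta> :: real
  assumes p: "1 \<le> p" and J: "\<alpha> \<in> J p" "\<beta> \<in> J p" and nn: "real r / 2 + \<alpha> \<ge> 0" "real r / 2 + \<beta> \<ge> 0"
    and k: "k \<ge> 1" and Cg: "Cg > 0"
  shows "\<exists>c>0. \<forall>N\<ge>1. \<forall>f \<in> Lp_space p \<alpha> \<beta>. \<forall>e F q. (\<forall>m n. m \<le> n \<longrightarrow> e n \<le> e m) \<longrightarrow>
    (\<forall>n. best_approx n f \<alpha> \<beta> p < e n) \<longrightarrow> good_chain r p \<alpha> \<beta> Cg N e f F q \<longrightarrow> (\<forall>t>0. \<forall>h\<in>{0..t}.
      Lp_norm p (\<lambda>x. \<W> (real k * h) (real r / 2 + \<alpha>) (real r / 2 + \<beta>) x * sym_diff k (h * \<phi> x) F x)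
        \<le> inverse_rhs k r N c t e)"
proof -
  obtain C' where C': "C' > 0" and mp: "\<forall>n\<ge>1. \<forall>P :: real poly. degree P < n \<longrightarrow> (\<forall>h\<ge>0.
    Lp_norm p (\<lambda>x. \<W> (real k * h) (real r / 2 + \<alpha>) (real r / 2 + \<beta>) x * sym_diff k (h * \<phi> x) (poly ((pderiv ^^ r) P)) x)
      \<le> ennreal (C' * (h ^ k * real n ^ (k + r))) * Lp_norm p (\<lambda>x. jacobi_weight \<alpha> \<beta> x * poly P x))"
    using modulus_poly[OF p J nn k] by (elim exE conjE) (rule that)
  \<comment> \<open>c1 bounds the remainder. c2 takes the leading term of the remainder, brought
    under t^k at the price 2^k, and the increments, with 2^(k+r) for the doubled degree and 2 for
    the two errors. c adds what the dyadic comparison and the initial polynomial cost.\<close>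
  define c1 where "c1 = 2 ^ (k + 1) * Cg"
  define c2 where "c2 = c1 * 2 ^ k + C' * 2 ^ (k + r + 1)"
  define c where "c = c1 + c2 * (real (k + r) + 2 ^ (k + r)) + c2 + 2 * C'"
  have c1: "c1 > 0" using Cg by (simp add: c1_def)
  have c2: "c2 > 0" using c1 C' by (simp add: c2_def add_pos_pos)
  have c: "c > 0" using c1 c2 C' unfolding c_def by (intro add_pos_nonneg) auto
  show ?thesis
  proof (rule exI[of _ c], intro conjI c allI impI ballI)
    fix N :: nat and f F :: "real \<Rightarrow> real" and e :: "nat \<Rightarrow> ennreal" and q :: "nat \<Rightarrow> real poly" and t h :: real
    assume N: "1 \<le> N" and f: "f \<in> Lp_space p \<alpha> \<beta>" and e: "\<forall>m n. m \<le> n \<longrightarrow> e n \<le> e m"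
      and E: "\<forall>n. best_approx n f \<alpha> \<beta> p < e n" and gc: "good_chain r p \<alpha> \<beta> Cg N e f F q" and t: "0 < t" and "h \<in> {0..t}"
    then have h: "0 \<le> h" "h \<le> t" by auto
    have fm: "f \<in> borel_measurable leb1" using f by (simp add: Lp_space_def)
    have emono: "e n \<le> e m" if "m \<le> n" for m n using e that by blast
    have Fm: "F \<in> borel_measurable leb1"
      and q: "\<And>i. degree (q i) < N * 2 ^ i" "\<And>i. Lp_norm p (\<lambda>x. jacobi_weight \<alpha> \<beta> x * (f x - poly (q i) x)) \<le> e (N * 2 ^ i)"
      and tail: "\<And>m. Lp_norm p (\<lambda>x. jacobi_weight \<alpha> \<beta> x * (\<phi> x ^ r * (F x - poly ((pderiv ^^ r) (q m)) x)))
        \<le> ennreal Cg * (of_nat ((N * 2 ^ m) ^ r) * e (N * 2 ^ m) + tail_sum r e {n. N * 2 ^ Suc m < n})"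
      using gc unfolding good_chain_def by blast+
    define Y where "Y = (\<lambda>G. Lp_norm p (\<lambda>x. \<W> (real k * h) (real r / 2 + \<alpha>) (real r / 2 + \<beta>) x * sym_diff k (h * \<phi> x) G x))"
    define M where "M = max (real N) (1 / t)"
    obtain j where j: "real (N * 2 ^ j) \<le> M" "M < real (N * 2 ^ Suc j)"
      by (rule dyadic_index_exists[OF N, of M]) (auto simp: M_def)
    define X where "X = (\<lambda>i. of_nat ((N * 2 ^ i) ^ (k + r)) * e (N * 2 ^ i))"
    define T where "T = tail_sum r e {n. real n > M}"
    define S where "S = (\<Sum>n\<in>{n. N \<le> n \<and> real n \<le> M}. of_nat (n ^ (k + r - 1)) * e n)"
    \<comment> \<open>A polynomial that the difference annihilates. If N \<le> k + r it is
      \<open>q 0\<close> itself, and the initial piece \<open>P0\<close> disappears; otherwise it is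
      a near-best one of degree below k + r.\<close>
    obtain Ps where Ps: "degree Ps < k + r" and Psb: "N \<le> k + r \<Longrightarrow> Ps = q 0"
      "\<not> N \<le> k + r \<Longrightarrow> Lp_norm p (\<lambda>x. jacobi_weight \<alpha> \<beta> x * (f x - poly Ps x)) \<le> e (k + r)"
    proof (cases "N \<le> k + r")
      case True
      then show thesis using that[of "q 0"] q(1)[of 0] by simp
    next
      case False
      obtain Q :: "real poly" where "degree Q < k + r" "Lp_norm p (\<lambda>x. jacobi_weight \<alpha> \<beta> x * (f x - poly Q x)) \<le> e (k + r)"
        using near_best_exists[of "k + r" f \<alpha> \<beta> p "e (k + r)"] E k by auto
      then show thesis using that[of Q] False by simp
    qed
    define P0 where "P0 = q 0 - Ps"
    \<comment> \<open>Indices below j are increments, j is the remainder, and j + 1 is the initial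
      piece.\<close>
    define G where "G = (\<lambda>s. if s < j then poly ((pderiv ^^ r) (q (Suc s) - q s))
       else if s = j then (\<lambda>y. F y - poly ((pderiv ^^ r) (q j)) y) else poly ((pderiv ^^ r) P0))"
    have polym: "poly P \<in> borel_measurable leb1" for P :: "real poly" by (intro borel_measurable_leb1I borel_measurable_poly)
    have Gm: "G s \<in> borel_measurable leb1" for s
    proof -
      note [measurable] = Fm polym
      have "(\<lambda>y. F y - poly ((pderiv ^^ r) (q j)) y) \<in> borel_measurable leb1" by measurable
      then show ?thesis unfolding G_def by (auto simp: polym)
    qed
    have Fsplit: "F y = (\<Sum>s\<in>{..<Suc (Suc j)}. G s y) + poly ((pderiv ^^ r) Ps) y" for y
    proof -
      have "(\<Sum>s\<in>{..<Suc (Suc j)}. G s y) = (\<Sum>s<j. G s y) + G j y + G (Suc j) y" by simp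
      also have "(\<Sum>s<j. G s y) = (\<Sum>s<j. poly ((pderiv ^^ r) (q (Suc s) - q s)) y)" by (intro sum.cong) (auto simp: G_def)
      finally show ?thesis using poly_telescope[of r q j y] by (simp add: G_def P0_def higher_pderiv_diff)
    qed
    have Dm: "(\<lambda>x. \<W> (real k * h) (real r / 2 + \<alpha>) (real r / 2 + \<beta>) x * sym_diff k (h * \<phi> x) H x) \<in> borel_measurable leb1"
      if "H \<in> borel_measurable leb1" for H by (rule Lp_norm_weighted_sym_diff(1)[OF p k h(1) that nn])
    have "Y F \<le> (\<Sum>s\<in>{..<Suc (Suc j)}. Y (G s))"
      unfolding Y_def
    proof (rule Lp_norm_sum[OF p _ Dm[OF Fm] Dm[OF Gm]], simp, rule AE_leb1I)
      fix x :: real assume x: "-1 < x" "x < 1"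
      have d: "h * \<phi> x \<ge> 0" using h phi_pos[OF x] by simp
      have "sym_diff k (h * \<phi> x) F x = (\<Sum>s\<in>{True, False}. sym_diff k (h * \<phi> x) ((\<lambda>b. if b then (\<lambda>y. \<Sum>s\<in>{..<Suc (Suc j)}. G s y) else poly ((pderiv ^^ r) Ps)) s) x)"
        by (rule sym_diff_sum) (simp add: Fsplit del: sum.lessThan_Suc)
      also have "\<dots> = sym_diff k (h * \<phi> x) (\<lambda>y. \<Sum>s\<in>{..<Suc (Suc j)}. G s y) x"
        using sym_diff_low_degree[OF Ps d, of x] by simp
      also have "\<dots> = (\<Sum>s\<in>{..<Suc (Suc j)}. sym_diff k (h * \<phi> x) (G s) x)" by (rule sym_diff_sum) simp
      finally have "\<W> (real k * h) (real r / 2 + \<alpha>) (real r / 2 + \<beta>) x * sym_diff k (h * \<phi> x) F x =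
         (\<Sum>s\<in>{..<Suc (Suc j)}. \<W> (real k * h) (real r / 2 + \<alpha>) (real r / 2 + \<beta>) x * sym_diff k (h * \<phi> x) (G s) x)"
        by (simp only: sum_distrib_left)
      then show "\<bar>\<W> (real k * h) (real r / 2 + \<alpha>) (real r / 2 + \<beta>) x * sym_diff k (h * \<phi> x) F x\<bar> \<le>
         (\<Sum>s\<in>{..<Suc (Suc j)}. \<bar>\<W> (real k * h) (real r / 2 + \<alpha>) (real r / 2 + \<beta>) x * sym_diff k (h * \<phi> x) (G s) x\<bar>)"
        by (simp only: sum_abs)
    qed
    also have "\<dots> = (\<Sum>s<j. Y (G s)) + Y (G j) + Y (G (Suc j))" by simp
    finally have split: "Y F \<le> (\<Sum>s<j. Y (G s)) + Y (G j) + Y (G (Suc j))" .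
    have tk: "h ^ k \<le> t ^ k" using h by (intro power_mono) auto
    have A2: "Y (G i) \<le> ennreal (c2 * t ^ k) * X i" if i: "i < j" for i
    proof -
      have d: "degree (q (Suc i) - q i) < N * 2 ^ Suc i"
        using q(1)[of i] q(1)[of "Suc i"] N by (intro degree_diff_less) auto
      have "Lp_norm p (\<lambda>x. jacobi_weight \<alpha> \<beta> x * poly (q (Suc i) - q i) x) \<le> e (N * 2 ^ Suc i) + e (N * 2 ^ i)"
        by (intro order_trans[OF Lp_norm_weighted_poly_diff[OF p fm]] add_mono q)
      also have "\<dots> \<le> e (N * 2 ^ i) + e (N * 2 ^ i)" by (intro add_mono emono) auto
      finally have L: "Lp_norm p (\<lambda>x. jacobi_weight \<alpha> \<beta> x * poly (q (Suc i) - q i) x) \<le> 2 * e (N * 2 ^ i)" by (simp add: mult_2)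
      have n1: "1 \<le> N * 2 ^ Suc i" using N by simp
      have Gi: "G i = poly ((pderiv ^^ r) (q (Suc i) - q i))" using i by (simp only: G_def if_True)
      have "Y (G i) \<le> ennreal (C' * (h ^ k * real (N * 2 ^ Suc i) ^ (k + r))) * Lp_norm p (\<lambda>x. jacobi_weight \<alpha> \<beta> x * poly (q (Suc i) - q i) x)"
        unfolding Y_def Gi by (rule mp[rule_format, OF n1 d h(1)])
      also have "\<dots> \<le> ennreal (C' * (h ^ k * real (N * 2 ^ Suc i) ^ (k + r))) * (2 * e (N * 2 ^ i))"
        by (intro mult_left_mono L) simp
      also have "\<dots> \<le> ennreal (c2 / 2 * t ^ k * real ((N * 2 ^ i) ^ (k + r))) * (2 * e (N * 2 ^ i))"
      proof (intro mult_right_mono ennreal_leI)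
        have "C' * (h ^ k * real (N * 2 ^ Suc i) ^ (k + r)) = (C' * 2 ^ (k + r)) * (h ^ k * real ((N * 2 ^ i) ^ (k + r)))"
          by (simp add: power_mult_distrib)
        also have "\<dots> \<le> (c2 / 2) * (t ^ k * real ((N * 2 ^ i) ^ (k + r)))"
          using tk C' c1 h by (intro mult_mono) (auto simp: c2_def)
        finally show "C' * (h ^ k * real (N * 2 ^ Suc i) ^ (k + r)) \<le> c2 / 2 * t ^ k * real ((N * 2 ^ i) ^ (k + r))" by simp
      qed simp
      also have "ennreal (c2 / 2 * t ^ k * real ((N * 2 ^ i) ^ (k + r))) = ennreal (c2 / 2 * t ^ k) * of_nat ((N * 2 ^ i) ^ (k + r))"
        unfolding ennreal_of_nat_eq_real_of_nat by (rule ennreal_mult'') simp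
      also have "ennreal (c2 / 2 * t ^ k) * of_nat ((N * 2 ^ i) ^ (k + r)) * (2 * e (N * 2 ^ i)) = (ennreal (c2 / 2 * t ^ k) * ennreal 2) * X i"
        by (simp only: X_def mult_ac ennreal_numeral)
      also have "ennreal (c2 / 2 * t ^ k) * ennreal 2 = ennreal (c2 * t ^ k)"
        using ennreal_mult''[of 2 "c2 / 2 * t ^ k"] by simp
      finally show ?thesis .
    qed
    have A1: "Y (G j) \<le> ennreal c1 * T + ennreal (c2 * t ^ k) * X j"
    proof -
      have "Y (G j) \<le> ennreal (2 ^ (k + 1)) * Lp_norm p (\<lambda>x. jacobi_weight \<alpha> \<beta> x * (\<phi> x ^ r * G j x))"
        unfolding Y_def by (rule Lp_norm_weighted_sym_diff(2)[OF p k h(1) Gm nn])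
      also have "\<dots> \<le> ennreal (2 ^ (k + 1)) * (ennreal Cg * (of_nat ((N * 2 ^ j) ^ r) * e (N * 2 ^ j) + tail_sum r e {n. N * 2 ^ Suc j < n}))"
        using tail[of j] by (intro mult_left_mono) (auto simp: G_def)
      also have "\<dots> = ennreal c1 * (of_nat ((N * 2 ^ j) ^ r) * e (N * 2 ^ j) + tail_sum r e {n. N * 2 ^ Suc j < n})"
        unfolding c1_def using Cg by (subst ennreal_mult) (auto simp: mult.assoc)
      also have "\<dots> = ennreal c1 * tail_sum r e {n. N * 2 ^ Suc j < n} + ennreal c1 * (of_nat ((N * 2 ^ j) ^ r) * e (N * 2 ^ j))"
        by (simp only: distrib_left add.commute)
      also have "\<dots> \<le> ennreal c1 * T + ennreal (c2 * t ^ k) * X j"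
      proof (rule add_mono)
        have "{n. N * 2 ^ Suc j < n} \<subseteq> {n. real n > M}"
        proof
          fix n assume "n \<in> {n. N * 2 ^ Suc j < n}"
          then have "real (N * 2 ^ Suc j) < real n" by (simp only: mem_Collect_eq of_nat_less_iff)
          then show "n \<in> {n. real n > M}" using j(2) by simp
        qed
        then show "ennreal c1 * tail_sum r e {n. N * 2 ^ Suc j < n} \<le> ennreal c1 * T"
          unfolding T_def by (intro mult_left_mono tail_sum_mono) auto
        \<comment> \<open>By the choice of j, 2 t N 2^j is at least 1; its k-th power supplies the
          t^k that turns the leading term, of order (N 2^j)^r, into part of the middle sum.\<close>
        have "1 / t < real (N * 2 ^ Suc j)" using j(2) by (simp add: M_def)
        then have "1 \<le> 2 * t * real (N * 2 ^ j)" using t by (simp add: field_simps)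
        then have "1 \<le> (2 * t * real (N * 2 ^ j)) ^ k" by (rule one_le_power)
        then have "c1 * real ((N * 2 ^ j) ^ r) * 1 \<le> c1 * real ((N * 2 ^ j) ^ r) * (2 * t * real (N * 2 ^ j)) ^ k"
          using c1 by (intro mult_left_mono) auto
        also have "\<dots> = (c1 * 2 ^ k) * (t ^ k * real ((N * 2 ^ j) ^ (k + r)))"
          unfolding power_mult_distrib power_add of_nat_mult of_nat_power by (simp only: mult_ac)
        also have "\<dots> \<le> c2 * (t ^ k * real ((N * 2 ^ j) ^ (k + r)))"
          using C' t by (intro mult_right_mono) (auto simp: c2_def)
        finally have "ennreal (c1 * real ((N * 2 ^ j) ^ r)) \<le> ennreal ((c2 * t ^ k) * real ((N * 2 ^ j) ^ (k + r)))"
          by (intro ennreal_leI) (simp add: mult.assoc)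
        then have "(ennreal c1 * of_nat ((N * 2 ^ j) ^ r)) * e (N * 2 ^ j) \<le> (ennreal (c2 * t ^ k) * of_nat ((N * 2 ^ j) ^ (k + r))) * e (N * 2 ^ j)"
          unfolding ennreal_of_nat_eq_real_of_nat by (subst (1 2) ennreal_mult''[symmetric]) (auto intro: mult_right_mono)
        then show "ennreal c1 * (of_nat ((N * 2 ^ j) ^ r) * e (N * 2 ^ j)) \<le> ennreal (c2 * t ^ k) * X j"
          by (simp only: X_def mult.assoc)
      qed
      finally show ?thesis .
    qed
    have A3: "Y (G (Suc j)) \<le> (if N \<le> k + r then 0 else ennreal (2 * C' * real N ^ (k + r) * t ^ k) * e (k + r))"
    proof (cases "N \<le> k + r")
      case True
      then have "P0 = 0" using Psb(1) by (simp add: P0_def)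
      then have "G (Suc j) = (\<lambda>y. 0)" by (simp add: G_def fun_eq_iff)
      then have "Y (G (Suc j)) = Y (\<lambda>y. 0)" by (simp only:)
      also have "\<dots> = 0"
      proof -
        have "sym_diff k d (\<lambda>y. 0) x = 0" for d x by (auto simp: sym_diff_def)
        then show ?thesis by (simp add: Y_def Lp_norm_zero[OF p])
      qed
      finally show ?thesis using True by simp
    next
      case False
      have d: "degree P0 < N" using q(1)[of 0] Ps False unfolding P0_def by (intro degree_diff_less) auto
      have "Lp_norm p (\<lambda>x. jacobi_weight \<alpha> \<beta> x * poly P0 x) \<le> e (N * 2 ^ 0) + e (k + r)"
        unfolding P0_def by (intro order_trans[OF Lp_norm_weighted_poly_diff[OF p fm]] add_mono q Psb(2) False)
      also have "\<dots> \<le> e (k + r) + e (k + r)" using False by (intro add_mono emono) auto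
      finally have L: "Lp_norm p (\<lambda>x. jacobi_weight \<alpha> \<beta> x * poly P0 x) \<le> 2 * e (k + r)" by (simp add: mult_2)
      have "Y (G (Suc j)) \<le> ennreal (C' * (h ^ k * real N ^ (k + r))) * (2 * e (k + r))"
      proof -
        have "G (Suc j) = poly ((pderiv ^^ r) P0)" by (simp add: G_def)
        then have "Y (G (Suc j)) \<le> ennreal (C' * (h ^ k * real N ^ (k + r))) * Lp_norm p (\<lambda>x. jacobi_weight \<alpha> \<beta> x * poly P0 x)"
          unfolding Y_def using mp[rule_format, OF N d h(1)] by simp
        also have "\<dots> \<le> ennreal (C' * (h ^ k * real N ^ (k + r))) * (2 * e (k + r))" by (intro mult_left_mono L) simp
        finally show ?thesis .
      qed
      also have "\<dots> \<le> ennreal (C' * (t ^ k * real N ^ (k + r))) * (2 * e (k + r))"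
        using C' tk by (intro mult_right_mono ennreal_leI mult_left_mono) auto
      also have "\<dots> = (ennreal (C' * (t ^ k * real N ^ (k + r))) * ennreal 2) * e (k + r)" by (simp only: mult.assoc ennreal_numeral)
      also have "ennreal (C' * (t ^ k * real N ^ (k + r))) * ennreal 2 = ennreal (2 * C' * real N ^ (k + r) * t ^ k)"
        by (subst ennreal_mult''[symmetric]) (simp_all add: mult_ac)
      finally show ?thesis using False by simp
    qed
    \<comment> \<open>X i with i \<ge> 1 is charged to the block just below N 2^i, and N 2^j \<le> M
      keeps all these blocks within the middle range. X 0 remains.\<close>
    have Xsum: "(\<Sum>i<j. X i) + X j \<le> X 0 + 2 ^ (k + r) * S"
    proof -
      have "(\<Sum>i<j. X i) + X j = (\<Sum>i<Suc j. X i)" by simp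
      also have "\<dots> = X 0 + (\<Sum>i<j. X (Suc i))" by (rule sum.lessThan_Suc_shift)
      also have "(\<Sum>i<j. X (Suc i)) \<le> (\<Sum>i<j. 2 ^ (k + r) * (\<Sum>n\<in>{N * 2 ^ (i + 0)<..N * 2 ^ (Suc i + 0)}. of_nat (n ^ (k + r - 1)) * e n))"
      proof (rule sum_mono)
        fix i
        have "N * 2 ^ Suc i = 2 * (N * 2 ^ i)" by simp
        then show "X (Suc i) \<le> 2 ^ (k + r) * (\<Sum>n\<in>{N * 2 ^ (i + 0)<..N * 2 ^ (Suc i + 0)}. of_nat (n ^ (k + r - 1)) * e n)"
          using dyadic_block_bound[of e "k + r" "N * 2 ^ i", OF emono] k unfolding X_def add_0_right by (simp only:)
      qed
      also have "\<dots> = 2 ^ (k + r) * (\<Sum>n\<in>{N * 2 ^ 0<..N * 2 ^ (j + 0)}. of_nat (n ^ (k + r - 1)) * e n)"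
        unfolding sum_distrib_left[symmetric] dyadic_blocks_sum ..
      also have "\<dots> \<le> 2 ^ (k + r) * S"
        unfolding S_def
      proof (intro mult_left_mono sum_mono2 finite_middle_range)
        show "{N * 2 ^ 0<..N * 2 ^ (j + 0)} \<subseteq> {n. N \<le> n \<and> real n \<le> M}"
        proof
          fix n assume "n \<in> {N * 2 ^ 0<..N * 2 ^ (j + 0)}"
          then have "N \<le> n" "real n \<le> real (N * 2 ^ j)" unfolding of_nat_le_iff by auto
          then show "n \<in> {n. N \<le> n \<and> real n \<le> M}" using j(1) by simp
        qed
      qed auto
      finally show ?thesis by (simp add: add_left_mono)
    qed
    have NS: "of_nat (N ^ (k + r - 1)) * e N \<le> S"
      unfolding S_def by (rule member_le_sum[of N]) (auto simp: M_def finite_middle_range)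
    \<comment> \<open>No block lies below N. If N \<le> k + r, one factor N is bounded by k + r and
      the rest is the term n = N of the middle sum; otherwise monotonicity of e passes to e(k + r),
      and N^(k+r) goes into the constant.\<close>
    have X0: "X 0 \<le> (if N \<le> k + r then of_nat (k + r) * S else of_nat (N ^ (k + r)) * e (k + r))"
    proof (cases "N \<le> k + r")
      case True
      have NN: "N ^ (k + r) = N * N ^ (k + r - 1)" using k by (metis Suc_diff_1 add_gr_0 less_le_trans power_Suc zero_less_one)
      have "X 0 = of_nat N * (of_nat (N ^ (k + r - 1)) * e N)"
        unfolding X_def power_0 mult_1_right NN of_nat_mult by (simp only: mult.assoc)
      also have "\<dots> \<le> of_nat (k + r) * S" using True NS by (intro mult_mono of_nat_mono) auto
      finally show ?thesis using True by simp
    next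
      case False
      then have "X 0 \<le> of_nat (N ^ (k + r)) * e (k + r)" unfolding X_def by (auto intro!: mult_left_mono emono)
      then show ?thesis using False by simp
    qed
    have "Y F \<le> (\<Sum>s<j. ennreal (c2 * t ^ k) * X s) + (ennreal c1 * T + ennreal (c2 * t ^ k) * X j)
        + (if N \<le> k + r then 0 else ennreal (2 * C' * real N ^ (k + r) * t ^ k) * e (k + r))"
      by (intro order_trans[OF split] add_mono sum_mono A1 A2 A3) auto
    also have "\<dots> = ennreal c1 * T + ennreal (c2 * t ^ k) * ((\<Sum>i<j. X i) + X j)
        + (if N \<le> k + r then 0 else ennreal (2 * C' * real N ^ (k + r) * t ^ k) * e (k + r))"
      by (simp only: sum_distrib_left[symmetric] distrib_left add_ac)
    also have "\<dots> \<le> ennreal c1 * T + ennreal (c2 * t ^ k) * (X 0 + 2 ^ (k + r) * S)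
        + (if N \<le> k + r then 0 else ennreal (2 * C' * real N ^ (k + r) * t ^ k) * e (k + r))"
      by (intro add_mono mult_left_mono Xsum order_refl) auto
    also have "\<dots> \<le> inverse_rhs k r N c t e"
    proof (cases "N \<le> k + r")
      case True
      have "ennreal (c2 * t ^ k) * (X 0 + 2 ^ (k + r) * S) \<le> ennreal (c2 * t ^ k) * (of_nat (k + r) * S + 2 ^ (k + r) * S)"
        using X0 True by (intro mult_left_mono add_mono) auto
      also have "\<dots> = ennreal (c2 * t ^ k) * (of_nat (k + r) + 2 ^ (k + r)) * S" by (simp only: distrib_right mult.assoc)
      also have "of_nat (k + r) + 2 ^ (k + r) = ennreal (real (k + r) + 2 ^ (k + r))"
        by (subst ennreal_plus) (auto simp: ennreal_of_nat_eq_real_of_nat simp flip: ennreal_power ennreal_numeral)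
      also have "ennreal (c2 * t ^ k) * ennreal (real (k + r) + 2 ^ (k + r)) = ennreal ((c2 * t ^ k) * (real (k + r) + 2 ^ (k + r)))"
        by (rule ennreal_mult''[symmetric]) simp
      also have "\<dots> \<le> ennreal (c * t ^ k)"
      proof (rule ennreal_leI)
        have "c2 * (real (k + r) + 2 ^ (k + r)) \<le> c" using c1 c2 C' by (simp add: c_def)
        then have "c2 * (real (k + r) + 2 ^ (k + r)) * t ^ k \<le> c * t ^ k" using t by (intro mult_right_mono) auto
        then show "(c2 * t ^ k) * (real (k + r) + 2 ^ (k + r)) \<le> c * t ^ k" by (simp only: mult_ac)
      qed
      finally have 1: "ennreal (c2 * t ^ k) * (X 0 + 2 ^ (k + r) * S) \<le> ennreal (c * t ^ k) * S"
        by (simp add: mult_right_mono)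
      have 2: "ennreal c1 * T \<le> ennreal c * T" using c2 C' by (intro mult_right_mono ennreal_leI) (auto simp: c_def)
      show ?thesis using True add_mono[OF 2 1] unfolding inverse_rhs_def M_def[symmetric] T_def[symmetric] S_def[symmetric] by simp
    next
      case False
      define Z where "Z = e (k + r)"
      have "ennreal (c2 * t ^ k) * (X 0 + 2 ^ (k + r) * S) \<le> ennreal (c2 * t ^ k) * (of_nat (N ^ (k + r)) * Z + 2 ^ (k + r) * S)"
        using X0 False by (intro mult_left_mono add_mono) (auto simp: Z_def)
      also have "\<dots> = ennreal (c2 * t ^ k) * 2 ^ (k + r) * S + ennreal (c2 * t ^ k) * of_nat (N ^ (k + r)) * Z"
        by (simp only: distrib_left mult.assoc add.commute)
      also have "ennreal (c2 * t ^ k) * 2 ^ (k + r) = ennreal (c2 * t ^ k * 2 ^ (k + r))"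
        by (subst ennreal_mult'') (auto simp flip: ennreal_power ennreal_numeral)
      also have "ennreal (c2 * t ^ k) * of_nat (N ^ (k + r)) = ennreal (c2 * t ^ k * real N ^ (k + r))"
        by (subst ennreal_mult'') (auto simp: ennreal_of_nat_eq_real_of_nat)
      finally have 0: "ennreal (c2 * t ^ k) * (X 0 + 2 ^ (k + r) * S) \<le> ennreal (c2 * t ^ k * 2 ^ (k + r)) * S + ennreal (c2 * t ^ k * real N ^ (k + r)) * Z" .
      have 1: "ennreal (c2 * t ^ k * 2 ^ (k + r)) * S \<le> ennreal (c * t ^ k) * S"
      proof (intro mult_right_mono ennreal_leI)
        have "c2 * 2 ^ (k + r) \<le> c" using c1 c2 C' by (simp add: c_def distrib_left)
        then have "c2 * 2 ^ (k + r) * t ^ k \<le> c * t ^ k" using t by (intro mult_right_mono) auto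
        then show "c2 * t ^ k * 2 ^ (k + r) \<le> c * t ^ k" by (simp only: mult_ac)
      qed simp
      have 2: "ennreal c1 * T \<le> ennreal c * T" using c2 C' by (intro mult_right_mono ennreal_leI) (auto simp: c_def)
      have 3: "ennreal (c2 * t ^ k * real N ^ (k + r)) * Z + ennreal (2 * C' * real N ^ (k + r) * t ^ k) * Z \<le> ennreal (c * real N ^ (k + r) * t ^ k) * Z"
      proof -
        have "ennreal (c2 * t ^ k * real N ^ (k + r)) * Z + ennreal (2 * C' * real N ^ (k + r) * t ^ k) * Z
          = ennreal (c2 * t ^ k * real N ^ (k + r) + 2 * C' * real N ^ (k + r) * t ^ k) * Z"
          using c2 C' t by (subst ennreal_plus) (auto simp: distrib_right)
        also have "\<dots> \<le> ennreal (c * real N ^ (k + r) * t ^ k) * Z"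
        proof (intro mult_right_mono ennreal_leI)
          have "c2 + 2 * C' \<le> c" using c1 c2 by (simp add: c_def)
          then have "(c2 + 2 * C') * (real N ^ (k + r) * t ^ k) \<le> c * (real N ^ (k + r) * t ^ k)" using t by (intro mult_right_mono) auto
          then show "c2 * t ^ k * real N ^ (k + r) + 2 * C' * real N ^ (k + r) * t ^ k \<le> c * real N ^ (k + r) * t ^ k"
            by (simp add: algebra_simps)
        qed simp
        finally show ?thesis .
      qed
      have "ennreal c1 * T + ennreal (c2 * t ^ k) * (X 0 + 2 ^ (k + r) * S) + ennreal (2 * C' * real N ^ (k + r) * t ^ k) * Z
        \<le> ennreal c1 * T + (ennreal (c2 * t ^ k * 2 ^ (k + r)) * S + ennreal (c2 * t ^ k * real N ^ (k + r)) * Z) + ennreal (2 * C' * real N ^ (k + r) * t ^ k) * Z"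
        by (intro add_mono 0 order_refl)
      also have "\<dots> = ennreal c1 * T + ennreal (c2 * t ^ k * 2 ^ (k + r)) * S + (ennreal (c2 * t ^ k * real N ^ (k + r)) * Z + ennreal (2 * C' * real N ^ (k + r) * t ^ k) * Z)"
        by (simp only: add_ac)
      also have "\<dots> \<le> ennreal c * T + ennreal (c * t ^ k) * S + ennreal (c * real N ^ (k + r) * t ^ k) * Z"
        by (intro add_mono 1 2 3)
      finally show ?thesis using False unfolding inverse_rhs_def M_def[symmetric] T_def[symmetric] S_def[symmetric] Z_def by simp
    qed
    finally show "Lp_norm p (\<lambda>x. \<W> (real k * h) (real r / 2 + \<alpha>) (real r / 2 + \<beta>) x * sym_diff k (h * \<phi> x) F x) \<le> inverse_rhs k r N c t e"
      by (simp only: Y_def)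
  qed
qed

section \<open>The inverse theorem\<close>

lemma tail_sum_add_cmult:
  "tail_sum r (\<lambda>n. E n + \<epsilon> * z n) A = tail_sum r E A + \<epsilon> * tail_sum r z A"
proof -
  have "tail_sum r (\<lambda>n. E n + \<epsilon> * z n) A =
     (\<Sum>n. of_nat (r * n ^ (r - 1)) * E n * indicator A n + \<epsilon> * (of_nat (r * n ^ (r - 1)) * z n * indicator A n))"
    unfolding tail_sum_def by (intro suminf_cong) (simp only: distrib_left distrib_right mult_ac)
  also have "\<dots> = tail_sum r E A + \<epsilon> * tail_sum r z A"
    unfolding tail_sum_def ennreal_suminf_cmult[symmetric] by (rule suminf_add[symmetric]) auto
  finally show ?thesis .
qed

text \<open>The bound is linear in the errors; therefore a perturbation costs only \<epsilon> times
  a finite number.\<close>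

lemma inverse_rhs_add_cmult:
  "inverse_rhs k r N c t (\<lambda>n. E n + \<epsilon> * z n) = inverse_rhs k r N c t E + \<epsilon> * inverse_rhs k r N c t z"
proof -
  have "(\<Sum>n\<in>B. of_nat (n ^ (k + r - 1)) * (E n + \<epsilon> * z n)) = (\<Sum>n\<in>B. of_nat (n ^ (k + r - 1)) * E n) + \<epsilon> * (\<Sum>n\<in>B. of_nat (n ^ (k + r - 1)) * z n)" for B
    unfolding sum_distrib_left sum.distrib[symmetric] by (intro sum.cong refl) (simp only: distrib_left distrib_right mult_ac)
  then show ?thesis
    unfolding inverse_rhs_def tail_sum_add_cmult
    by (cases "N \<le> k + r") (simp_all only: if_True if_False distrib_left distrib_right mult_ac add_ac mult_zero_right mult_zero_left add_0_left add_0_right)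
qed

text \<open>Any positive decreasing sequence would do whose products with r n^(r-1) are summable;
  the exponent r + 1 makes these products of order 1/n^2.\<close>

definition perturbation :: "nat \<Rightarrow> nat \<Rightarrow> ennreal" where
  "perturbation r n = ennreal (1 / (real n + 1) ^ (r + 1))"

lemma perturbation_pos: "perturbation r n > 0"
  by (simp add: perturbation_def add_nonneg_pos)

lemma perturbation_antimono: "m \<le> n \<Longrightarrow> perturbation r n \<le> perturbation r m"
  unfolding perturbation_def by (intro ennreal_leI divide_left_mono power_mono mult_pos_pos zero_less_power) auto

lemma tail_sum_perturbation_finite: "tail_sum r (perturbation r) A < \<infinity>"
proof -
  have "tail_sum r (perturbation r) A \<le> (\<Sum>n. ennreal (real r * (1 / (real n + 1)\<^sup>2)))"
    unfolding tail_sum_def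
  proof (intro suminf_le)
    fix n
    have "of_nat (r * n ^ (r - 1)) * perturbation r n = ennreal (real (r * n ^ (r - 1)) * (1 / (real n + 1) ^ (r + 1)))"
      unfolding perturbation_def ennreal_of_nat_eq_real_of_nat by (rule ennreal_mult''[symmetric]) simp
    also have "\<dots> \<le> ennreal (real r * (1 / (real n + 1)\<^sup>2))"
    proof (cases "r = 0")
      case False
      have "real (n ^ (r - 1)) \<le> (real n + 1) ^ (r - 1)" by (simp add: power_mono)
      then have "real (n ^ (r - 1)) * (1 / (real n + 1) ^ (r + 1)) \<le> (real n + 1) ^ (r - 1) * (1 / (real n + 1) ^ (r + 1))"
        by (intro mult_right_mono) auto
      also have "(real n + 1) ^ (r - 1) * (1 / (real n + 1) ^ (r + 1)) = 1 / (real n + 1)\<^sup>2"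
      proof -
        have "(real n + 1) ^ (r + 1) = (real n + 1) ^ (r - 1) * (real n + 1)\<^sup>2"
          using False by (simp flip: power_add)
        then show ?thesis by (simp add: add_nonneg_eq_0_iff)
      qed
      finally have "real r * (real (n ^ (r - 1)) * (1 / (real n + 1) ^ (r + 1))) \<le> real r * (1 / (real n + 1)\<^sup>2)"
        by (rule mult_left_mono) simp
      moreover have "real (r * n ^ (r - 1)) * (1 / (real n + 1) ^ (r + 1)) = real r * (real (n ^ (r - 1)) * (1 / (real n + 1) ^ (r + 1)))"
        by (simp only: of_nat_mult mult.assoc)
      ultimately show ?thesis by (intro ennreal_leI) (simp only:)
    qed simp
    finally show "of_nat (r * n ^ (r - 1)) * perturbation r n * indicator A n \<le> ennreal (real r * (1 / (real n + 1)\<^sup>2))"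
      by (auto simp: indicator_def)
  qed auto
  also have "\<dots> = ennreal (\<Sum>n. real r * (1 / (real n + 1)\<^sup>2))"
  proof (rule suminf_ennreal2)
    have "summable (\<lambda>n. 1 / (real n + 1)\<^sup>2)"
      using inverse_squares_sums by (auto simp: sums_iff add.commute)
    then show "summable (\<lambda>n. real r * (1 / (real n + 1)\<^sup>2))" by (rule summable_mult)
  qed simp
  also have "\<dots> < \<infinity>" by simp
  finally show ?thesis .
qed

lemma inverse_rhs_perturbation_finite: "inverse_rhs k r N c t (perturbation r) < \<infinity>"
proof -
  have "(\<Sum>n\<in>{n. N \<le> n \<and> real n \<le> max (real N) (1 / t)}. of_nat (n ^ (k + r - 1)) * perturbation r n) < \<infinity>"
    using finite_middle_range[of N "max (real N) (1 / t)"]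
    by (simp only: infinity_ennreal_def ennreal_sum_less_top) (auto simp: perturbation_def ennreal_of_nat_eq_real_of_nat ennreal_mult_less_top power_less_top_ennreal)
  moreover have "perturbation r (k + r) < \<infinity>" by (simp add: perturbation_def)
  ultimately show ?thesis unfolding inverse_rhs_def using tail_sum_perturbation_finite[of r "{n. real n > max (real N) (1 / t)}"]
    by (simp add: ennreal_mult_less_top)
qed

text \<open>Polynomials with error strictly below the perturbed error exist trivially, so that the existence
  of best approximants is never needed; \<open>\<epsilon>\<close> tends to 0 at the very end.\<close>

lemma perturbed_errors:
  assumes f: "f \<in> Lp_space p \<alpha> \<beta>" and ts: "tail_sum r (\<lambda>n. best_approx n f \<alpha> \<beta> p) {1..} < \<infinity>" and \<epsilon>: "\<epsilon> > 0"
  defines "e \<equiv> \<lambda>n. best_approx n f \<alpha> \<beta> p + ennreal \<epsilon> * perturbation r n"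
  shows "\<forall>m n. m \<le> n \<longrightarrow> e n \<le> e m" "\<forall>n. best_approx n f \<alpha> \<beta> p < e n" "\<forall>n. e n < \<infinity>" "tail_sum r e {1..} < \<infinity>"
proof -
  show "\<forall>m n. m \<le> n \<longrightarrow> e n \<le> e m"
    unfolding e_def by (intro allI impI add_mono best_approx_antimono mult_left_mono perturbation_antimono) auto
  have fin: "best_approx n f \<alpha> \<beta> p < \<infinity>" for n by (rule best_approx_finite[OF f])
  have pos: "ennreal \<epsilon> * perturbation r n > 0" for n using \<epsilon> perturbation_pos[of r n] by (simp add: ennreal_zero_less_mult_iff)
  show "\<forall>n. best_approx n f \<alpha> \<beta> p < e n"
  proof
    fix n
    show "best_approx n f \<alpha> \<beta> p < e n"
      using fin[of n] pos[of n] unfolding e_def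
      by (metis add.right_neutral ennreal_add_left_cancel_less infinity_ennreal_def less_irrefl)
  qed
  show "\<forall>n. e n < \<infinity>" using fin unfolding e_def by (simp add: perturbation_def ennreal_mult_less_top)
  show "tail_sum r e {1..} < \<infinity>"
    unfolding e_def tail_sum_add_cmult using ts tail_sum_perturbation_finite[of r "{1..}"] by (simp add: ennreal_mult_less_top)
qed

lemma inverse_estimate:
  fixes p :: ennreal and \<alpha> \<beta> :: real
  assumes p: "1 \<le> p" and J: "\<alpha> \<in> J p" "\<beta> \<in> J p" and nn: "real r / 2 + \<alpha> \<ge> 0" "real r / 2 + \<beta> \<ge> 0"
    and k: "k \<ge> 1"
  shows "\<exists>c>0. \<forall>N\<ge>1. \<forall>f \<in> Lp_space p \<alpha> \<beta>. tail_sum r (\<lambda>n. best_approx n f \<alpha> \<beta> p) {1..} < \<infinity> \<longrightarrow>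
    (\<forall>g \<in> B_reps r p \<alpha> \<beta> f. \<forall>t>0. modulus k r ((deriv ^^ r) g) t \<alpha> \<beta> p \<le> inverse_rhs k r N c t (\<lambda>n. best_approx n f \<alpha> \<beta> p))"
proof -
  obtain Cg where Cg: "Cg > 0" and chain: "\<forall>N\<ge>1. \<forall>f \<in> Lp_space p \<alpha> \<beta>. \<forall>e. (\<forall>m n. m \<le> n \<longrightarrow> e n \<le> e m) \<longrightarrow>
    (\<forall>n. best_approx n f \<alpha> \<beta> p < e n) \<longrightarrow> (\<forall>n. e n < \<infinity>) \<longrightarrow> tail_sum r e {1..} < \<infinity> \<longrightarrow>
    B_reps r p \<alpha> \<beta> f \<noteq> {} \<and> (\<forall>g \<in> B_reps r p \<alpha> \<beta> f. \<exists>q. good_chain r p \<alpha> \<beta> Cg N e f ((deriv ^^ r) g) q)"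
    using good_chain_exists[OF p J, of r] by (elim exE conjE) (rule that)
  obtain c where c: "c > 0" and main: "\<forall>N\<ge>1. \<forall>f \<in> Lp_space p \<alpha> \<beta>. \<forall>e F q. (\<forall>m n. m \<le> n \<longrightarrow> e n \<le> e m) \<longrightarrow>
    (\<forall>n. best_approx n f \<alpha> \<beta> p < e n) \<longrightarrow> good_chain r p \<alpha> \<beta> Cg N e f F q \<longrightarrow> (\<forall>t>0. \<forall>h\<in>{0..t}.
      Lp_norm p (\<lambda>x. \<W> (real k * h) (real r / 2 + \<alpha>) (real r / 2 + \<beta>) x * sym_diff k (h * \<phi> x) F x)
        \<le> inverse_rhs k r N c t e)"
    using modulus_term_bound[OF p J nn k Cg] by (elim exE conjE) (rule that)
  show ?thesis
  proof (rule exI[of _ c], intro conjI c allI impI ballI)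
    fix N :: nat and f g :: "real \<Rightarrow> real" and t :: real
    assume N: "1 \<le> N" and f: "f \<in> Lp_space p \<alpha> \<beta>" and ts: "tail_sum r (\<lambda>n. best_approx n f \<alpha> \<beta> p) {1..} < \<infinity>"
      and g: "g \<in> B_reps r p \<alpha> \<beta> f" and t: "0 < t"
    define E where "E = (\<lambda>n. best_approx n f \<alpha> \<beta> p)"
    define Z where "Z = inverse_rhs k r N c t (perturbation r)"
    have Zfin: "Z < \<infinity>" unfolding Z_def by (rule inverse_rhs_perturbation_finite)
    show "modulus k r ((deriv ^^ r) g) t \<alpha> \<beta> p \<le> inverse_rhs k r N c t (\<lambda>n. best_approx n f \<alpha> \<beta> p)"
      unfolding modulus_def E_def[symmetric]
    proof (rule SUP_least, rule ennreal_le_epsilon)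
      fix h \<eta> :: real assume h: "h \<in> {0..t}" and \<eta>: "0 < \<eta>"
      \<comment> \<open>The perturbation costs \<epsilon> Z, which this choice keeps below \<eta>;
        the 1 in the denominator covers Z = 0.\<close>
      define \<epsilon> where "\<epsilon> = \<eta> / (enn2real Z + 1)"
      have \<epsilon>: "\<epsilon> > 0" using \<eta> by (simp add: \<epsilon>_def add_nonneg_pos)
      note pe = perturbed_errors[OF f ts \<epsilon>]
      obtain q where q: "good_chain r p \<alpha> \<beta> Cg N (\<lambda>n. best_approx n f \<alpha> \<beta> p + ennreal \<epsilon> * perturbation r n) f ((deriv ^^ r) g) q"
        using chain[rule_format, OF N f pe[rule_format], THEN conjunct2] g by blast
      have "Lp_norm p (\<lambda>x. \<W> (real k * h) (real r / 2 + \<alpha>) (real r / 2 + \<beta>) x * sym_diff k (h * \<phi> x) ((deriv ^^ r) g) x)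
        \<le> inverse_rhs k r N c t (\<lambda>n. best_approx n f \<alpha> \<beta> p + ennreal \<epsilon> * perturbation r n)"
        by (rule main[rule_format, OF N f pe(1,2)[rule_format] q t h])
      also have "\<dots> = inverse_rhs k r N c t E + ennreal \<epsilon> * Z"
        unfolding E_def Z_def by (rule inverse_rhs_add_cmult)
      also have "ennreal \<epsilon> * Z \<le> ennreal \<eta>"
      proof -
        have "Z = ennreal (enn2real Z)" using Zfin by simp
        then have "ennreal \<epsilon> * Z = ennreal (\<epsilon> * enn2real Z)" using \<epsilon> by (metis ennreal_mult' less_imp_le)
        also have "\<epsilon> * enn2real Z \<le> \<eta>"
        proof -
          have "\<epsilon> * enn2real Z \<le> \<epsilon> * (enn2real Z + 1)" using \<epsilon> by (intro mult_left_mono) auto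
          also have "\<dots> = \<eta>" by (simp add: \<epsilon>_def add_nonneg_eq_0_iff)
          finally show ?thesis .
        qed
        finally show ?thesis by (simp add: ennreal_leI)
      qed
      finally show "Lp_norm p (\<lambda>x. \<W> (real k * h) (real r / 2 + \<alpha>) (real r / 2 + \<beta>) x * sym_diff k (h * \<phi> x) ((deriv ^^ r) g) x)
        \<le> inverse_rhs k r N c t E + ennreal \<eta>" by (simp add: add_left_mono)
    qed
  qed
qed

theorem theorem1p6:
  fixes r :: nat and p :: ennreal and \<alpha> \<beta> :: real
  assumes "1 \<le> p" and "\<alpha> \<in> J p" and "\<beta> \<in> J p"
    and "real r / 2 + \<alpha> \<ge> 0" and "real r / 2 + \<beta> \<ge> 0"
  shows
    "(\<forall>f \<in> Lp_space p \<alpha> \<beta>.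
        (\<Sum>\<^sub>\<infinity>n\<in>{1..}. of_nat (r * n ^ (r - 1)) * best_approx n f \<alpha> \<beta> p) < \<infinity> \<longrightarrow>
        f \<in> B_space r p \<alpha> \<beta>)
     \<and>
     (\<forall>k\<ge>1. \<exists>c::real. c > 0 \<and> (\<forall>N\<ge>1. \<exists>cN::real. cN > 0 \<and>
        (\<forall>f \<in> Lp_space p \<alpha> \<beta>.
          (\<Sum>\<^sub>\<infinity>n\<in>{1..}. of_nat (r * n ^ (r - 1)) * best_approx n f \<alpha> \<beta> p) < \<infinity> \<longrightarrow>
          (\<forall>g \<in> B_reps r p \<alpha> \<beta> f. \<forall>t::real. t > 0 \<longrightarrow>
            modulus k r ((deriv ^^ r) g) t \<alpha> \<beta> p
            \<le> ennreal c * (\<Sum>\<^sub>\<infinity>n\<in>{n::nat. real n > max (real N) (1 / t)}.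
                             of_nat (r * n ^ (r - 1)) * best_approx n f \<alpha> \<beta> p)
              + ennreal (c * t ^ k) * (\<Sum>n\<in>{n::nat. N \<le> n \<and> real n \<le> max (real N) (1 / t)}.
                             of_nat (n ^ (k + r - 1)) * best_approx n f \<alpha> \<beta> p)
              + ennreal (cN * t ^ k) * best_approx (k + r) f \<alpha> \<beta> p))))
     \<and>
     (\<forall>k\<ge>1. \<exists>c::real. c > 0 \<and> (\<forall>N\<ge>1. N \<le> k + r \<longrightarrow>
        (\<forall>f \<in> Lp_space p \<alpha> \<beta>.
          (\<Sum>\<^sub>\<infinity>n\<in>{1..}. of_nat (r * n ^ (r - 1)) * best_approx n f \<alpha> \<beta> p) < \<infinity> \<longrightarrow>
          (\<forall>g \<in> B_reps r p \<alpha> \<beta> f. \<forall>t::real. t > 0 \<longrightarrow>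
            modulus k r ((deriv ^^ r) g) t \<alpha> \<beta> p
            \<le> ennreal c * (\<Sum>\<^sub>\<infinity>n\<in>{n::nat. real n > max (real N) (1 / t)}.
                             of_nat (r * n ^ (r - 1)) * best_approx n f \<alpha> \<beta> p)
              + ennreal (c * t ^ k) * (\<Sum>n\<in>{n::nat. N \<le> n \<and> real n \<le> max (real N) (1 / t)}.
                             of_nat (n ^ (k + r - 1)) * best_approx n f \<alpha> \<beta> p)))))"
proof (intro conjI)
  have tail: "(\<Sum>\<^sub>\<infinity>n\<in>A. of_nat (r * n ^ (r - 1)) * best_approx n f \<alpha> \<beta> p) = tail_sum r (\<lambda>n. best_approx n f \<alpha> \<beta> p) A" for A f
    unfolding tail_sum_def by (rule infsum_ennreal_eq_suminf)
  note est = inverse_estimate[OF assms]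
  show "\<forall>f \<in> Lp_space p \<alpha> \<beta>.
        (\<Sum>\<^sub>\<infinity>n\<in>{1..}. of_nat (r * n ^ (r - 1)) * best_approx n f \<alpha> \<beta> p) < \<infinity> \<longrightarrow>
        f \<in> B_space r p \<alpha> \<beta>"
    unfolding tail
  proof (intro ballI impI)
    fix f assume f: "f \<in> Lp_space p \<alpha> \<beta>" and ts: "tail_sum r (\<lambda>n. best_approx n f \<alpha> \<beta> p) {1..} < \<infinity>"
    obtain Cg where chain: "\<forall>N\<ge>1. \<forall>f \<in> Lp_space p \<alpha> \<beta>. \<forall>e. (\<forall>m n. m \<le> n \<longrightarrow> e n \<le> e m) \<longrightarrow>
      (\<forall>n. best_approx n f \<alpha> \<beta> p < e n) \<longrightarrow> (\<forall>n. e n < \<infinity>) \<longrightarrow> tail_sum r e {1..} < \<infinity> \<longrightarrow>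
      B_reps r p \<alpha> \<beta> f \<noteq> {} \<and> (\<forall>g \<in> B_reps r p \<alpha> \<beta> f. \<exists>q. good_chain r p \<alpha> \<beta> Cg N e f ((deriv ^^ r) g) q)"
      using good_chain_exists[OF assms(1-3), of r] by (elim exE conjE) (rule that)
    \<comment> \<open>Membership asks for one chain only, so N = 1 and \<epsilon> = 1 will
      do.\<close>
    note pe = perturbed_errors[OF f ts zero_less_one]
    have "B_reps r p \<alpha> \<beta> f \<noteq> {}"
      using chain[rule_format, OF order_refl f pe[rule_format], THEN conjunct1] .
    then show "f \<in> B_space r p \<alpha> \<beta>" by (simp add: B_space_def)
  qed
  show "\<forall>k\<ge>1. \<exists>c::real. c > 0 \<and> (\<forall>N\<ge>1. \<exists>cN::real. cN > 0 \<and>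
        (\<forall>f \<in> Lp_space p \<alpha> \<beta>.
          (\<Sum>\<^sub>\<infinity>n\<in>{1..}. of_nat (r * n ^ (r - 1)) * best_approx n f \<alpha> \<beta> p) < \<infinity> \<longrightarrow>
          (\<forall>g \<in> B_reps r p \<alpha> \<beta> f. \<forall>t::real. t > 0 \<longrightarrow>
            modulus k r ((deriv ^^ r) g) t \<alpha> \<beta> p
            \<le> ennreal c * (\<Sum>\<^sub>\<infinity>n\<in>{n::nat. real n > max (real N) (1 / t)}.
                             of_nat (r * n ^ (r - 1)) * best_approx n f \<alpha> \<beta> p)
              + ennreal (c * t ^ k) * (\<Sum>n\<in>{n::nat. N \<le> n \<and> real n \<le> max (real N) (1 / t)}.
                             of_nat (n ^ (k + r - 1)) * best_approx n f \<alpha> \<beta> p)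
              + ennreal (cN * t ^ k) * best_approx (k + r) f \<alpha> \<beta> p)))"
    unfolding tail
  proof (intro allI impI)
    fix k :: nat assume k: "k \<ge> 1"
    obtain c where c: "c > 0" and main: "\<forall>N\<ge>1. \<forall>f \<in> Lp_space p \<alpha> \<beta>. tail_sum r (\<lambda>n. best_approx n f \<alpha> \<beta> p) {1..} < \<infinity> \<longrightarrow>
      (\<forall>g \<in> B_reps r p \<alpha> \<beta> f. \<forall>t>0. modulus k r ((deriv ^^ r) g) t \<alpha> \<beta> p \<le> inverse_rhs k r N c t (\<lambda>n. best_approx n f \<alpha> \<beta> p))"
      using est[OF k] by (elim exE conjE) (rule that)
    show "\<exists>c::real. c > 0 \<and> (\<forall>N\<ge>1. \<exists>cN::real. cN > 0 \<and>
        (\<forall>f \<in> Lp_space p \<alpha> \<beta>.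
          tail_sum r (\<lambda>n. best_approx n f \<alpha> \<beta> p) {1..} < \<infinity> \<longrightarrow>
          (\<forall>g \<in> B_reps r p \<alpha> \<beta> f. \<forall>t::real. t > 0 \<longrightarrow>
            modulus k r ((deriv ^^ r) g) t \<alpha> \<beta> p
            \<le> ennreal c * tail_sum r (\<lambda>n. best_approx n f \<alpha> \<beta> p) {n::nat. real n > max (real N) (1 / t)}
              + ennreal (c * t ^ k) * (\<Sum>n\<in>{n::nat. N \<le> n \<and> real n \<le> max (real N) (1 / t)}.
                             of_nat (n ^ (k + r - 1)) * best_approx n f \<alpha> \<beta> p)
              + ennreal (cN * t ^ k) * best_approx (k + r) f \<alpha> \<beta> p)))"
    proof (rule exI[of _ c], intro conjI c allI impI)
      fix N :: nat assume N: "N \<ge> 1"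
      show "\<exists>cN::real. cN > 0 \<and>
        (\<forall>f \<in> Lp_space p \<alpha> \<beta>.
          tail_sum r (\<lambda>n. best_approx n f \<alpha> \<beta> p) {1..} < \<infinity> \<longrightarrow>
          (\<forall>g \<in> B_reps r p \<alpha> \<beta> f. \<forall>t::real. t > 0 \<longrightarrow>
            modulus k r ((deriv ^^ r) g) t \<alpha> \<beta> p
            \<le> ennreal c * tail_sum r (\<lambda>n. best_approx n f \<alpha> \<beta> p) {n::nat. real n > max (real N) (1 / t)}
              + ennreal (c * t ^ k) * (\<Sum>n\<in>{n::nat. N \<le> n \<and> real n \<le> max (real N) (1 / t)}.
                             of_nat (n ^ (k + r - 1)) * best_approx n f \<alpha> \<beta> p)
              + ennreal (cN * t ^ k) * best_approx (k + r) f \<alpha> \<beta> p))"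
      proof (rule exI[of _ "c * real N ^ (k + r)"], intro conjI ballI allI impI)
        show "c * real N ^ (k + r) > 0" using c N by simp
        fix f g and t :: real assume fg: "f \<in> Lp_space p \<alpha> \<beta>" "tail_sum r (\<lambda>n. best_approx n f \<alpha> \<beta> p) {1..} < \<infinity>" "g \<in> B_reps r p \<alpha> \<beta> f" "t > 0"
        have "modulus k r ((deriv ^^ r) g) t \<alpha> \<beta> p \<le> inverse_rhs k r N c t (\<lambda>n. best_approx n f \<alpha> \<beta> p)"
          by (rule main[rule_format, OF N fg])
        \<comment> \<open>If N \<le> k + r, \<open>inverse_rhs\<close> has no third term, and a
          nonnegative one is added here.\<close>
        also have "\<dots> \<le> ennreal c * tail_sum r (\<lambda>n. best_approx n f \<alpha> \<beta> p) {n::nat. real n > max (real N) (1 / t)}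
              + ennreal (c * t ^ k) * (\<Sum>n\<in>{n::nat. N \<le> n \<and> real n \<le> max (real N) (1 / t)}.
                             of_nat (n ^ (k + r - 1)) * best_approx n f \<alpha> \<beta> p)
              + ennreal (c * real N ^ (k + r) * t ^ k) * best_approx (k + r) f \<alpha> \<beta> p"
          unfolding inverse_rhs_def by (intro add_left_mono) simp
        finally show "modulus k r ((deriv ^^ r) g) t \<alpha> \<beta> p \<le> \<dots>" .
      qed
    qed
  qed
  show "\<forall>k\<ge>1. \<exists>c::real. c > 0 \<and> (\<forall>N\<ge>1. N \<le> k + r \<longrightarrow>
        (\<forall>f \<in> Lp_space p \<alpha> \<beta>.
          (\<Sum>\<^sub>\<infinity>n\<in>{1..}. of_nat (r * n ^ (r - 1)) * best_approx n f \<alpha> \<beta> p) < \<infinity> \<longrightarrow>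
          (\<forall>g \<in> B_reps r p \<alpha> \<beta> f. \<forall>t::real. t > 0 \<longrightarrow>
            modulus k r ((deriv ^^ r) g) t \<alpha> \<beta> p
            \<le> ennreal c * (\<Sum>\<^sub>\<infinity>n\<in>{n::nat. real n > max (real N) (1 / t)}.
                             of_nat (r * n ^ (r - 1)) * best_approx n f \<alpha> \<beta> p)
              + ennreal (c * t ^ k) * (\<Sum>n\<in>{n::nat. N \<le> n \<and> real n \<le> max (real N) (1 / t)}.
                             of_nat (n ^ (k + r - 1)) * best_approx n f \<alpha> \<beta> p))))"
    unfolding tail
  proof (intro allI impI)
    fix k :: nat assume k: "k \<ge> 1"
    obtain c where c: "c > 0" and main: "\<forall>N\<ge>1. \<forall>f \<in> Lp_space p \<alpha> \<beta>. tail_sum r (\<lambda>n. best_approx n f \<alpha> \<beta> p) {1..} < \<infinity> \<longrightarrow>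
      (\<forall>g \<in> B_reps r p \<alpha> \<beta> f. \<forall>t>0. modulus k r ((deriv ^^ r) g) t \<alpha> \<beta> p \<le> inverse_rhs k r N c t (\<lambda>n. best_approx n f \<alpha> \<beta> p))"
      using est[OF k] by (elim exE conjE) (rule that)
    show "\<exists>c::real. c > 0 \<and> (\<forall>N\<ge>1. N \<le> k + r \<longrightarrow>
        (\<forall>f \<in> Lp_space p \<alpha> \<beta>.
          tail_sum r (\<lambda>n. best_approx n f \<alpha> \<beta> p) {1..} < \<infinity> \<longrightarrow>
          (\<forall>g \<in> B_reps r p \<alpha> \<beta> f. \<forall>t::real. t > 0 \<longrightarrow>
            modulus k r ((deriv ^^ r) g) t \<alpha> \<beta> p
            \<le> ennreal c * tail_sum r (\<lambda>n. best_approx n f \<alpha> \<beta> p) {n::nat. real n > max (real N) (1 / t)}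
              + ennreal (c * t ^ k) * (\<Sum>n\<in>{n::nat. N \<le> n \<and> real n \<le> max (real N) (1 / t)}.
                             of_nat (n ^ (k + r - 1)) * best_approx n f \<alpha> \<beta> p))))"
    proof (rule exI[of _ c], intro conjI c allI impI ballI)
      fix N :: nat and f g and t :: real
      assume N: "N \<ge> 1" "N \<le> k + r" and fg: "f \<in> Lp_space p \<alpha> \<beta>" "tail_sum r (\<lambda>n. best_approx n f \<alpha> \<beta> p) {1..} < \<infinity>" "g \<in> B_reps r p \<alpha> \<beta> f" "t > 0"
      show "modulus k r ((deriv ^^ r) g) t \<alpha> \<beta> p
            \<le> ennreal c * tail_sum r (\<lambda>n. best_approx n f \<alpha> \<beta> p) {n::nat. real n > max (real N) (1 / t)}
              + ennreal (c * t ^ k) * (\<Sum>n\<in>{n::nat. N \<le> n \<and> real n \<le> max (real N) (1 / t)}.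
                             of_nat (n ^ (k + r - 1)) * best_approx n f \<alpha> \<beta> p)"
        using main[rule_format, OF N(1) fg] N(2) unfolding inverse_rhs_def by (simp only: if_True add_0_right)
    qed
  qed
qed

end
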